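(* There is an absolute constant $C$ (depending only on the choice of the cutoff $\chi$) such that for every divergence-free vector field $u\in L^2(\mathbb R^3)$ and all integers $-1\le Q_0<Q_1<\infty$, the energy flux through dyadic shells between wavenumbers $\lambda_{Q_0}$ and $\lambda_{Q_1}$ satisfies $$|\Pi_{Q_0Q_1}|\le C(K\ast d^2)^{3/2}(Q_0)+C(K\ast d^2)^{3/2}(Q_1),$$ where $(K\ast d^2)(Q)=\sum_{q\ge-1}K(Q-q)d_q^2$, $d_q=\lambda_q^{1/3}\|\Delta_qu\|_{L^3}$, and $K(q)=\lambda_q^{2/3}$ for $q\le0$, $K(q)=\lambda_q^{-4/3}$ for $q>0$.
   Context: Littlewood-Paley notation. $\lambda_q=2^q$. Fix a nonnegative radial $\chi\in C_0^\infty(B(0,1))$ on $\mathbb R^3$ with $\chi(\xi)=1$ for $|\xi|\le 1/2$, and let $\varphi(\xi)=\chi(\xi/2)-\chi(\xi)$. With $\mathcal F$ the Fourier transform, $\Delta_q u=\mathcal F^{-1}(\varphi(\lambda_q^{-1}\xi)\mathcal F u)$ for $q\ge 0$ and $\Delta_{-1}u=\mathcal F^{-1}(\chi(\xi)\mathcal F u)$. For $-1\le Q_0<Q_1<\infty$ let $S_{Q_0Q_1}=\sum_{Q_0\le q\le Q_1}\Delta_q$. The energy flux through the dyadic shells between scales $Q_0$ and $Q_1$ is $$\Pi_{Q_0Q_1}=\int_{\mathbb R^3}\mathrm{Tr}[S_{Q_0Q_1}(u\otimes u)\cdot\nabla S_{Q_0Q_1}u]\,dx=\int_{\mathbb R^3}\sum_{i,j}S_{Q_0Q_1}(u_iu_j)\,\partial_iS_{Q_0Q_1}u_j\,dx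 .$$ The right-hand side of the estimate is allowed to be $+\infty$. *)

theory Defs
  imports "HOL-Analysis.Analysis"
begin

type_synonym R3 = "real ^ 3"

definition partial :: "3 \<Rightarrow> (R3 \<Rightarrow> 'b::real_normed_vector) \<Rightarrow> R3 \<Rightarrow> 'b" where
  "partial i f x = frechet_derivative f (at x) (axis i 1)"

primrec C_k :: "nat \<Rightarrow> (R3 \<Rightarrow> real) \<Rightarrow> bool" where
  "C_k 0 f \<longleftrightarrow> continuous_on UNIV f"
| "C_k (Suc k) f \<longleftrightarrow> (\<forall>x. f differentiable (at x)) \<and> (\<forall>i. C_k k (partial i f))"

definition smooth_fun :: "(R3 \<Rightarrow> real) \<Rightarrow> bool" where
  "smooth_fun f \<longleftrightarrow> (\<forall>k. C_k k f)"

definition support :: "(R3 \<Rightarrow> real) \<Rightarrow> R3 set" where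
  "support f = closure {x. f x \<noteq> 0}"

definition test_function :: "(R3 \<Rightarrow> real) \<Rightarrow> bool" where
  "test_function f \<longleftrightarrow> smooth_fun f \<and> compact (support f)"

definition L2 :: "(R3 \<Rightarrow> 'b::euclidean_space) \<Rightarrow> bool" where
  "L2 f \<longleftrightarrow> f \<in> borel_measurable lebesgue \<and> integrable lebesgue (\<lambda>x. (norm (f x))\<^sup>2)"

(* The divergence is taken in the sense of distributions: u is only in L2. *)
definition divergence_free :: "(R3 \<Rightarrow> R3) \<Rightarrow> bool" where
  "divergence_free u \<longleftrightarrow>
     (\<forall>\<psi>. test_function \<psi> \<longrightarrow> (LINT x|lebesgue. (\<Sum>i\<in>UNIV. u x $ i * partial i \<psi> x)) = 0)"

definition fourier_L1 :: "(R3 \<Rightarrow> complex) \<Rightarrow> R3 \<Rightarrow> complex" where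
  "fourier_L1 f \<xi> = (LINT x|lebesgue. cis (- (\<xi> \<bullet> x)) * f x)"

(* Plancherel's extension: the Fourier integrals over the balls |x| \<le> R converge to g
   in L2 as R tends to infinity.  This determines g up to a null set. *)
definition is_fourier_L2 :: "(R3 \<Rightarrow> complex) \<Rightarrow> (R3 \<Rightarrow> complex) \<Rightarrow> bool" where
  "is_fourier_L2 f g \<longleftrightarrow> L2 g \<and>
     ((\<lambda>R::real. \<integral>\<^sup>+ \<xi>. ennreal ((cmod (fourier_L1 (\<lambda>x. indicator (cball 0 R) x * f x) \<xi> - g \<xi>))\<^sup>2)
          \<partial>lebesgue) \<longlongrightarrow> 0) at_top"

(* The transform on L1 + L2 is needed only on L1 (for the products u_i u_j) and on L2 (for the
   components u_j); on the intersection the two definitions agree almost everywhere. *)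
definition fourier :: "(R3 \<Rightarrow> complex) \<Rightarrow> R3 \<Rightarrow> complex" where
  "fourier f = (if integrable lebesgue f then fourier_L1 f else (SOME g. is_fourier_L2 f g))"

(* Applied below only to products of a bounded compactly supported symbol with the transform
   of an L1 or L2 function; such products are integrable. *)
definition inverse_fourier :: "(R3 \<Rightarrow> complex) \<Rightarrow> R3 \<Rightarrow> complex" where
  "inverse_fourier g x = (LINT \<xi>|lebesgue. cis (\<xi> \<bullet> x) * g \<xi>) / complex_of_real ((2 * pi) ^ 3)"

definition LP_cutoff :: "(R3 \<Rightarrow> real) \<Rightarrow> bool" where
  "LP_cutoff chi \<longleftrightarrow>
     smooth_fun chi \<and> compact (support chi) \<and> support chi \<subseteq> ball 0 1 \<and>
     (\<forall>\<xi>. 0 \<le> chi \<xi>) \<and>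
     (\<forall>\<xi> \<eta>. norm \<xi> = norm \<eta> \<longrightarrow> chi \<xi> = chi \<eta>) \<and>
     (\<forall>\<xi>. norm \<xi> \<le> 1 / 2 \<longrightarrow> chi \<xi> = 1)"

definition lam :: "int \<Rightarrow> real" where
  "lam q = 2 powr real_of_int q"

definition LP_phi :: "(R3 \<Rightarrow> real) \<Rightarrow> R3 \<Rightarrow> real" where
  "LP_phi chi \<xi> = chi (\<xi> /\<^sub>R 2) - chi \<xi>"

(* Frequencies q < -1 do not occur; the value 0 there is the usual convention. *)
definition LP_symbol :: "(R3 \<Rightarrow> real) \<Rightarrow> int \<Rightarrow> R3 \<Rightarrow> real" where
  "LP_symbol chi q \<xi> =
     (if q \<ge> 0 then LP_phi chi (\<xi> /\<^sub>R lam q) else if q = -1 then chi \<xi> else 0)"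

definition LP_block :: "(R3 \<Rightarrow> real) \<Rightarrow> int \<Rightarrow> (R3 \<Rightarrow> complex) \<Rightarrow> R3 \<Rightarrow> complex" where
  "LP_block chi q f = inverse_fourier (\<lambda>\<xi>. complex_of_real (LP_symbol chi q \<xi>) * fourier f \<xi>)"

definition LP_sum :: "(R3 \<Rightarrow> real) \<Rightarrow> int \<Rightarrow> int \<Rightarrow> (R3 \<Rightarrow> complex) \<Rightarrow> R3 \<Rightarrow> complex" where
  "LP_sum chi Q0 Q1 f x = (\<Sum>q\<in>{Q0..Q1}. LP_block chi q f x)"

definition component :: "(R3 \<Rightarrow> R3) \<Rightarrow> 3 \<Rightarrow> R3 \<Rightarrow> complex" where
  "component u j x = complex_of_real (u x $ j)"

definition LP_block_vec :: "(R3 \<Rightarrow> real) \<Rightarrow> int \<Rightarrow> (R3 \<Rightarrow> R3) \<Rightarrow> R3 \<Rightarrow> complex ^ 3" where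
  "LP_block_vec chi q u x = (\<chi> j. LP_block chi q (component u j) x)"

(* The integrand is real-valued (chi is even and u is real) although it has type complex, and it
   is integrable for u in L2: S(u_i u_j) is in L1, and the derivatives of S u_j are bounded. *)
definition energy_flux :: "(R3 \<Rightarrow> real) \<Rightarrow> (R3 \<Rightarrow> R3) \<Rightarrow> int \<Rightarrow> int \<Rightarrow> complex" where
  "energy_flux chi u Q0 Q1 =
     (LINT x|lebesgue. (\<Sum>i\<in>UNIV. \<Sum>j\<in>UNIV.
        LP_sum chi Q0 Q1 (\<lambda>y. component u i y * component u j y) x *
        partial i (LP_sum chi Q0 Q1 (component u j)) x))"

(* For exponents a > 0. *)
definition ennreal_powr :: "ennreal \<Rightarrow> real \<Rightarrow> ennreal" where
  "ennreal_powr x a = (if x = \<infinity> then \<infinity> else ennreal (enn2real x powr a))"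

definition Lp_norm :: "real \<Rightarrow> (R3 \<Rightarrow> 'b::real_normed_vector) \<Rightarrow> ennreal" where
  "Lp_norm p f = ennreal_powr (\<integral>\<^sup>+ x. ennreal (norm (f x) powr p) \<partial>lebesgue) (1 / p)"

definition d_coeff :: "(R3 \<Rightarrow> real) \<Rightarrow> (R3 \<Rightarrow> R3) \<Rightarrow> int \<Rightarrow> ennreal" where
  "d_coeff chi u q = ennreal (lam q powr (1 / 3)) * Lp_norm 3 (LP_block_vec chi q u)"

definition K_kernel :: "int \<Rightarrow> real" where
  "K_kernel q = (if q \<le> 0 then lam q powr (2 / 3) else lam q powr (- (4 / 3)))"

definition K_conv_d2 :: "(R3 \<Rightarrow> real) \<Rightarrow> (R3 \<Rightarrow> R3) \<Rightarrow> int \<Rightarrow> ennreal" where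
  "K_conv_d2 chi u Q = (\<Sum>\<^sub>\<infinity>q\<in>{-1..}. ennreal (K_kernel (Q - q)) * (d_coeff chi u q)\<^sup>2)"

end

theory Submission
  imports Defs
begin

text \<open>
  Since the symbol of \<open>S\<^bsub>Q\<^sub>0Q\<^sub>1\<^esub>\<close> is a difference of two dilated cutoffs, the larger of which is one on the
  support of the smaller, its square splits into one symbol at scale \<open>\<lambda>\<^bsub>Q\<^sub>1\<^esub>\<close> and one at scale \<open>\<lambda>\<^bsub>Q\<^sub>0\<^esub>\<close>; so the
  flux is a sum of two forms \<open>\<integral> u\<^sub>i u\<^sub>j (\<partial>\<^sub>i G \<star> u\<^sub>j)\<close> with \<open>G\<close> an even Schwartz kernel living at one of these scales.
  Incompressibility turns such a form into the Duchon--Robert integral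
  \<open>1/4 \<integral> \<partial>\<^sub>i G(z) \<integral> |\<delta>\<^sub>z u|\<^sup>2 \<delta>\<^sub>z u\<^sub>i dx dz\<close>, which is controlled by the cubes of the norms of the increments
  \<open>\<delta>\<^sub>z u = u(\<cdot> - z) - u\<close> in L3. These are bounded by \<open>(1 + \<lambda>\<^sub>Q |z|) \<lambda>\<^sub>Q\<close> to the power \<open>-1/3\<close> times the root of \<open>(K \<star> d\<^sup>2)(Q)\<close>,
  once the L3 norm of a sum of blocks is bounded by the l2 sum of the L3 norms of the blocks. The latter
  follows by adding the blocks one at a time: the part of the increase of \<open>\<integral> |T|\<^sup>3\<close> that is linear in the new block is small,
  because the block is oscillating on a finer scale than \<open>|T| T\<close>.
\<close>

subsection \<open>Smooth functions of compact support\<close>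

text \<open>Both exponents of \<open>K_kernel\<close> come from one bound: shifting a block at
  frequency \<lambda>_q by z costs min(1, \<lambda>_q |z|), and at |z| = 1/\<lambda>_Q the square of
  this is K(Q - q) (\<lambda>_q / \<lambda>_Q)^(2/3). So the l2 sum of the shifted blocks is (K *
  d^2)(Q) up to a power of \<lambda>_Q, and these powers cancel: the gradient kernel at scale Q
  contributes \<lambda>_Q, the three increments \<lambda>_Q^(-1). The obstacle is that u is only in
  L2, whereas cubes of its increments must be integrable. If the right-hand side is finite, the
  weights K(Q - q) \<lambda>_q^(2/3), bounded below for q \<ge> -1, make the L3 norms of the blocks
  square summable, which puts u in L3; if it is infinite there is nothing to prove. The passage from
  blocks to u goes through L2 convergence of partial sums, an almost everywhere convergent
  subsequence and Fatou. Fourier inversion is carried with an undetermined factor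
  \<open>mass\<close>: kernels compose up to it, partial sums tend to \<open>mass\<close> times u,
  and it can be divided out because it is nonzero.\<close>

lemma partial_eq:
  assumes "(f has_derivative f') (at x)"
  shows "partial i f x = f' (axis i 1)"
  using frechet_derivative_at[OF assms] by (simp add: partial_def)

lemma C_k_Suc_imp: "C_k (Suc k) f \<Longrightarrow> C_k k f"
proof (induction k arbitrary: f)
  case 0
  then show ?case
    by (auto simp: continuous_on_eq_continuous_within differentiable_imp_continuous_within)
next
  case (Suc k)
  then show ?case by (metis C_k.simps(2))
qed

lemma C_k_add: "C_k k f \<Longrightarrow> C_k k g \<Longrightarrow> C_k k (\<lambda>x. f x + g x)"
proof (induction k arbitrary: f g)
  case 0
  then show ?case by (auto intro!: continuous_intros)
next
  case (Suc k)
  have "partial i (\<lambda>x. f x + g x) = (\<lambda>x. partial i f x + partial i g x)" for i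
  proof
    fix x
    have "(f has_derivative frechet_derivative f (at x)) (at x)"
         "(g has_derivative frechet_derivative g (at x)) (at x)"
      using Suc.prems by (auto simp: frechet_derivative_works)
    from partial_eq[OF has_derivative_add[OF this]]
    show "partial i (\<lambda>x. f x + g x) x = partial i f x + partial i g x"
      by (simp add: partial_def)
  qed
  then show ?case using Suc by (auto intro!: derivative_intros)
qed

lemma partial_mult:
  assumes "f differentiable (at x)" "g differentiable (at x)"
  shows "partial i (\<lambda>x. f x * g x) x = f x * partial i g x + partial i f x * (g x :: real)"
proof -
  have "(f has_derivative frechet_derivative f (at x)) (at x)"
       "(g has_derivative frechet_derivative g (at x)) (at x)"
    using assms by (auto simp: frechet_derivative_works)
  from partial_eq[OF has_derivative_mult[OF this]] show ?thesis
    by (simp add: partial_def)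
qed

lemma C_k_mult: "C_k k f \<Longrightarrow> C_k k g \<Longrightarrow> C_k k (\<lambda>x. f x * g x)"
proof (induction k arbitrary: f g)
  case 0
  then show ?case by (auto intro!: continuous_intros)
next
  case (Suc k)
  have "partial i (\<lambda>x. f x * g x) = (\<lambda>x. f x * partial i g x + partial i f x * g x)" for i
    by (rule ext, rule partial_mult) (use Suc.prems in auto)
  moreover have "C_k k f" "C_k k g" using Suc.prems C_k_Suc_imp by blast+
  ultimately show ?case using Suc by (auto intro!: derivative_intros C_k_add)
qed

lemma partial_const: "partial i (\<lambda>x. c) = (\<lambda>x. 0)"
  by (rule ext, rule partial_eq[THEN trans]) (auto intro!: derivative_eq_intros)

lemma C_k_const: "C_k k (\<lambda>x. c)"
  by (induction k arbitrary: c) (auto simp: partial_const)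

lemma partial_coord: "partial j (\<lambda>x. x $ i) = (\<lambda>x. if i = j then 1 else 0)"
  by (rule ext, rule partial_eq[THEN trans], rule bounded_linear_imp_has_derivative)
     (auto simp: axis_def intro!: bounded_linear_vec_nth)

lemma C_k_coord: "C_k k (\<lambda>x. x $ i)"
proof (cases k)
  case 0
  then show ?thesis by (auto intro!: continuous_intros)
next
  case (Suc n)
  have "(\<lambda>x::R3. x $ i) differentiable (at x)" for x
    by (rule differentiableI, rule bounded_linear_imp_has_derivative) (rule bounded_linear_vec_nth)
  then show ?thesis by (simp add: Suc partial_coord C_k_const)
qed

text \<open>Negative \<open>a\<close> is included because kernels are later differentiated in y
  through x - y.\<close>

lemma partial_affine:
  fixes f :: "R3 \<Rightarrow> real"
  assumes "f differentiable (at (a *\<^sub>R x + b))"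
  shows "(\<lambda>x. f (a *\<^sub>R x + b)) differentiable (at x)"
    and "partial i (\<lambda>x. f (a *\<^sub>R x + b)) x = a * partial i f (a *\<^sub>R x + b)"
proof -
  let ?D = "frechet_derivative f (at (a *\<^sub>R x + b))"
  have D: "(f has_derivative ?D) (at (a *\<^sub>R x + b))"
    using assms by (auto simp: frechet_derivative_works)
  have A: "((\<lambda>x. a *\<^sub>R x + b) has_derivative (\<lambda>h. a *\<^sub>R h)) (at x)"
    by (auto intro!: derivative_eq_intros)
  have *: "((\<lambda>x. f (a *\<^sub>R x + b)) has_derivative (\<lambda>h. ?D (a *\<^sub>R h))) (at x)"
    by (rule has_derivative_compose[OF A D])
  then show "(\<lambda>x. f (a *\<^sub>R x + b)) differentiable (at x)" by (rule differentiableI)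
  have "linear ?D" using D has_derivative_linear by blast
  then show "partial i (\<lambda>x. f (a *\<^sub>R x + b)) x = a * partial i f (a *\<^sub>R x + b)"
    using partial_eq[OF *] by (simp add: partial_def linear_cmul)
qed

lemma C_k_affine: "C_k k f \<Longrightarrow> C_k k (\<lambda>x. f (a *\<^sub>R x + b))"
proof (induction k arbitrary: f)
  case 0
  then show ?case by (auto intro!: continuous_intros continuous_on_compose2[of UNIV f])
next
  case (Suc k)
  have "partial i (\<lambda>x. f (a *\<^sub>R x + b)) = (\<lambda>x. a * partial i f (a *\<^sub>R x + b))" for i
    using Suc.prems by (auto simp: partial_affine)
  then show ?case using Suc by (auto intro!: partial_affine C_k_mult C_k_const)
qed

text \<open>Vanishing outside some ball passes to products, sums and affine substitutions at sight;
  from here on it replaces compactness of the closure in \<open>support\<close>.\<close>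

lemma test_function_iff:
  "test_function f \<longleftrightarrow> smooth_fun f \<and> (\<exists>R. \<forall>x. R < norm x \<longrightarrow> f x = 0)"
proof -
  have "compact (support f) \<longleftrightarrow> bounded {x. f x \<noteq> 0}"
    by (auto simp: support_def compact_eq_bounded_closed intro: bounded_subset[OF _ closure_subset])
  also have "\<dots> \<longleftrightarrow> (\<exists>R. \<forall>x. R < norm x \<longrightarrow> f x = 0)"
    by (auto simp: bounded_iff) (meson linorder_not_le)+
  finally show ?thesis by (simp add: test_function_def)
qed

lemma test_functionD:
  assumes "test_function f"
  obtains R where "R > 0" "\<And>x. R < norm x \<Longrightarrow> f x = 0"
proof -
  from assms obtain R where "\<And>x. R < norm x \<Longrightarrow> f x = 0" by (auto simp: test_function_iff)
  then show ?thesis by (intro that[of "max R 1"]) auto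
qed

lemma test_function_continuous: "test_function f \<Longrightarrow> continuous_on UNIV f"
  unfolding test_function_def smooth_fun_def using C_k.simps(1) by blast

lemma test_function_differentiable: "test_function f \<Longrightarrow> f differentiable (at x)"
  unfolding test_function_def smooth_fun_def using C_k.simps(2) by blast

lemma test_function_add: "test_function f \<Longrightarrow> test_function g \<Longrightarrow> test_function (\<lambda>x. f x + g x)"
  unfolding test_function_iff smooth_fun_def
  by (auto intro: C_k_add) (metis add.right_neutral max_less_iff_conj)

lemma test_function_mult: "test_function f \<Longrightarrow> smooth_fun g \<Longrightarrow> test_function (\<lambda>x. f x * g x)"
  unfolding test_function_iff smooth_fun_def
  by (auto intro: C_k_mult)

lemma test_function_smooth: "test_function f \<Longrightarrow> smooth_fun f"
  by (simp add: test_function_def)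

lemma test_function_cmult: "test_function f \<Longrightarrow> test_function (\<lambda>x. c * f x)"
  using test_function_mult[of f "\<lambda>_. c"] by (simp add: smooth_fun_def C_k_const mult.commute)

lemma test_function_coord: "test_function f \<Longrightarrow> test_function (\<lambda>x. x $ i * f x)"
  using test_function_mult[of f "\<lambda>x. x $ i"] by (simp add: smooth_fun_def C_k_coord mult.commute)

lemma test_function_diff: "test_function f \<Longrightarrow> test_function g \<Longrightarrow> test_function (\<lambda>x. f x - g x)"
  using test_function_add[OF _ test_function_cmult[of g "-1"]] by simp

lemma test_function_affine:
  assumes "test_function f" "a \<noteq> 0"
  shows "test_function (\<lambda>x. f (a *\<^sub>R x + b))"
proof -
  obtain R where R: "R > 0" "\<And>x. R < norm x \<Longrightarrow> f x = 0" using test_functionD[OF assms(1)] by metis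
  have "f (a *\<^sub>R x + b) = 0" if "(R + norm b) / \<bar>a\<bar> < norm x" for x
  proof (rule R(2))
    have "R + norm b < \<bar>a\<bar> * norm x"
      using that \<open>a \<noteq> 0\<close> by (simp add: divide_less_eq mult.commute)
    moreover have "norm (a *\<^sub>R x) \<le> norm (a *\<^sub>R x + b) + norm b"
      by (metis add_diff_cancel norm_triangle_ineq4)
    ultimately show "R < norm (a *\<^sub>R x + b)" by simp
  qed
  then show ?thesis using assms(1) unfolding test_function_iff smooth_fun_def
    by (auto intro: C_k_affine)
qed

lemma test_function_scaleR: "test_function f \<Longrightarrow> a \<noteq> 0 \<Longrightarrow> test_function (\<lambda>x. f (a *\<^sub>R x))"
  using test_function_affine[of f a 0] by simp

lemma partial_eq_0_outside:
  fixes f :: "R3 \<Rightarrow> real"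
  assumes "\<And>x. R < norm x \<Longrightarrow> f x = 0" "R < norm x"
  shows "partial i f x = 0"
proof -
  have "open {x::R3. R < norm x}" by (intro open_Collect_less continuous_intros)
  then have "(f has_derivative (\<lambda>h. 0)) (at x)"
    by (rule has_derivative_transform_within_open[OF has_derivative_const[of 0]]) (use assms in auto)
  from partial_eq[OF this] show ?thesis by simp
qed

lemma test_function_partial:
  assumes "test_function f"
  shows "test_function (partial i f)"
proof -
  obtain R where R: "R > 0" "\<And>x. R < norm x \<Longrightarrow> f x = 0" using test_functionD[OF assms(1)] by metis
  have "partial i f x = 0" if "R < norm x" for x using R(2) that by (rule partial_eq_0_outside)
  moreover have "smooth_fun (partial i f)"
    using assms unfolding test_function_def smooth_fun_def using C_k.simps(2) by blast
  ultimately show ?thesis unfolding test_function_iff by blast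
qed

lemma test_function_bounded:
  assumes "test_function f"
  obtains B where "B > 0" "\<And>x. \<bar>f x\<bar> \<le> B"
proof -
  obtain R where R: "R > 0" "\<And>x. R < norm x \<Longrightarrow> f x = 0" using test_functionD[OF assms(1)] by metis
  have "compact (f ` cball 0 R)"
    by (intro compact_continuous_image continuous_on_subset[OF test_function_continuous[OF assms]]) auto
  then obtain B where B: "\<And>y. y \<in> f ` cball 0 R \<Longrightarrow> norm y \<le> B"
    by (meson compact_imp_bounded bounded_iff)
  have "\<bar>f x\<bar> \<le> max B 1" for x
    using R(2)[of x] B[of "f x"] by (cases "norm x \<le> R") auto
  then show ?thesis by (intro that[of "max B 1"]) auto
qed

lemma test_function_measurable [measurable_dest]: "test_function f \<Longrightarrow> f \<in> borel_measurable borel"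
  by (intro borel_measurable_continuous_onI test_function_continuous)

lemma test_function_integrable:
  assumes "test_function f"
  shows "integrable lborel f"
proof -
  obtain R where R: "R > 0" "\<And>x. R < norm x \<Longrightarrow> f x = 0" using test_functionD[OF assms(1)] by metis
  have "integrable lborel (\<lambda>x. indicator (cball 0 R) x *\<^sub>R f x)"
    by (intro borel_integrable_compact continuous_on_subset[OF test_function_continuous[OF assms]]) auto
  also have "(\<lambda>x. indicator (cball 0 R) x *\<^sub>R f x) = f"
    using R(2) by (auto simp: indicator_def fun_eq_iff)
  finally show ?thesis .
qed

subsection \<open>Decay of Fourier integrals\<close>

lemma nn_integral_affine3:
  fixes f :: "R3 \<Rightarrow> ennreal" and t :: R3
  assumes [measurable]: "f \<in> borel_measurable borel" and c: "c \<noteq> 0"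
  shows "(\<integral>\<^sup>+x. f x \<partial>lborel) = ennreal (\<bar>c\<bar> ^ 3) * (\<integral>\<^sup>+x. f (t + c *\<^sub>R x) \<partial>lborel)"
  by (subst lborel_affine[OF c, of t])
     (simp add: nn_integral_density nn_integral_distr nn_integral_cmult ennreal_power)

lemma integrable_affine3:
  fixes f :: "R3 \<Rightarrow> 'a :: {banach, second_countable_topology}" and t :: R3
  assumes f: "integrable lborel f" and "c \<noteq> 0"
  shows "integrable lborel (\<lambda>x. f (t + c *\<^sub>R x))"
proof -
  have "(\<integral>\<^sup>+x. norm (f x) \<partial>lborel) = ennreal (\<bar>c\<bar> ^ 3) * (\<integral>\<^sup>+x. norm (f (t + c *\<^sub>R x)) \<partial>lborel)"
    using f by (intro nn_integral_affine3[OF _ \<open>c \<noteq> 0\<close>]) auto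
  then show ?thesis
    using f f[THEN borel_measurable_integrable] \<open>c \<noteq> 0\<close> unfolding integrable_iff_bounded
    by (auto simp: ennreal_mult_less_top)
qed

lemma integrable_affine3_iff:
  fixes f :: "R3 \<Rightarrow> 'a :: {banach, second_countable_topology}" and t :: R3
  assumes "c \<noteq> 0"
  shows "integrable lborel (\<lambda>x. f (t + c *\<^sub>R x)) \<longleftrightarrow> integrable lborel f"
  using integrable_affine3[of f c t] assms
    integrable_affine3[of "\<lambda>x. f (t + c *\<^sub>R x)" "1/c" "-(1/c) *\<^sub>R t"]
  by (auto simp: algebra_simps)

lemma integral_affine3:
  fixes f :: "R3 \<Rightarrow> 'a :: {banach, second_countable_topology}" and t :: R3
  assumes c: "c \<noteq> 0" 
  shows "(LINT x|lborel. f x) = \<bar>c\<bar> ^ 3 *\<^sub>R (LINT x|lborel. f (t + c *\<^sub>R x))"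
proof cases
  assume f: "integrable lborel f"
  then have [measurable]: "f \<in> borel_measurable borel" by auto
  show ?thesis
    using c f integrable_affine3[OF f c, of t]
    by (subst lborel_affine[OF c, of t])
       (simp add: integral_density integral_distr ennreal_power)
next
  \<comment> \<open>Without integrability both sides take the default value 0, so the change of
    variables is unconditional.\<close>
  assume "\<not> integrable lborel f" with c show ?thesis
    by (simp add: integrable_affine3_iff not_integrable_integral_eq)
qed

lemma integrable_translate_iff:
  fixes f :: "R3 \<Rightarrow> 'a :: {banach, second_countable_topology}"
  shows "integrable lborel (\<lambda>x. f (x + a)) \<longleftrightarrow> integrable lborel f"
    "integrable lborel (\<lambda>x. f (x - a)) \<longleftrightarrow> integrable lborel f"
    "integrable lborel (\<lambda>x. f (a - x)) \<longleftrightarrow> integrable lborel f"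
    "integrable lborel (\<lambda>x. f (- x)) \<longleftrightarrow> integrable lborel f"
  using integrable_affine3_iff[of 1 f a] integrable_affine3_iff[of 1 f "-a"]
    integrable_affine3_iff[of "-1" f a] integrable_affine3_iff[of "-1" f 0]
  by (auto simp: add.commute)

lemma integral_translate:
  fixes f :: "R3 \<Rightarrow> 'a :: {banach, second_countable_topology}"
  shows "(LINT x|lborel. f (x + a)) = (LINT x|lborel. f x)"
    "(LINT x|lborel. f (x - a)) = (LINT x|lborel. f x)"
    "(LINT x|lborel. f (a - x)) = (LINT x|lborel. f x)"
    "(LINT x|lborel. f (- x)) = (LINT x|lborel. f x)"
  using integral_affine3[of 1 f a] integral_affine3[of 1 f "-a"]
    integral_affine3[of "-1" f a] integral_affine3[of "-1" f 0]
  by (auto simp: add.commute)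

lemma nn_integral_translate:
  fixes f :: "R3 \<Rightarrow> ennreal"
  assumes "f \<in> borel_measurable borel"
  shows "(\<integral>\<^sup>+x. f (x + a) \<partial>lborel) = (\<integral>\<^sup>+x. f x \<partial>lborel)"
    "(\<integral>\<^sup>+x. f (x - a) \<partial>lborel) = (\<integral>\<^sup>+x. f x \<partial>lborel)"
    "(\<integral>\<^sup>+x. f (a - x) \<partial>lborel) = (\<integral>\<^sup>+x. f x \<partial>lborel)"
  using nn_integral_affine3[OF assms, of 1 a] nn_integral_affine3[OF assms, of 1 "-a"]
    nn_integral_affine3[OF assms, of "-1" a]
  by (auto simp: add.commute)

section \<open>Directional derivatives and the vanishing integral of a derivative\<close>

lemma has_real_derivative_line:
  fixes f :: "R3 \<Rightarrow> real"
  assumes "f differentiable (at (x + s *\<^sub>R h))"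
  shows "((\<lambda>s. f (x + s *\<^sub>R h)) has_real_derivative (\<Sum>i\<in>UNIV. h $ i * partial i f (x + s *\<^sub>R h))) (at s)"
proof -
  let ?D = "frechet_derivative f (at (x + s *\<^sub>R h))"
  have D: "(f has_derivative ?D) (at (x + s *\<^sub>R h))"
    using assms by (auto simp: frechet_derivative_works)
  have A: "((\<lambda>s. x + s *\<^sub>R h) has_derivative (\<lambda>t. t *\<^sub>R h)) (at s)"
    by (auto intro!: derivative_eq_intros)
  have l: "linear ?D" using D has_derivative_linear by blast
  have "?D h = ?D (\<Sum>i\<in>UNIV. h $ i *\<^sub>R axis i 1)"
    using basis_expansion[of h] by (simp add: scalar_mult_eq_scaleR)
  also have "\<dots> = (\<Sum>i\<in>UNIV. h $ i * partial i f (x + s *\<^sub>R h))"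
    by (simp add: linear_sum[OF l] linear_cmul[OF l] partial_def)
  finally show ?thesis
    using has_derivative_compose[OF A D] l by (simp add: has_field_derivative_def linear_cmul mult_commute_abs)
qed

lemma has_real_derivative_partial:
  fixes g :: "R3 \<Rightarrow> real"
  assumes "g differentiable (at (x + s *\<^sub>R axis i 1))"
  shows "((\<lambda>s. g (x + s *\<^sub>R axis i 1)) has_real_derivative partial i g (x + s *\<^sub>R axis i 1)) (at s)"
proof -
  have "(\<Sum>j\<in>UNIV. axis i (1::real) $ j * partial j g (x + s *\<^sub>R axis i 1)) = partial i g (x + s *\<^sub>R axis i 1)"
    by (simp add: axis_def if_distrib[of "\<lambda>c. c * _"] cong: if_cong)
  then show ?thesis using has_real_derivative_line[OF assms] by simp
qed

text \<open>The integral of a difference quotient of g vanishes by translation invariance, and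
  dominated convergence carries this to the derivative. The dominating function is a constant on a
  slightly larger ball.\<close>

lemma integral_partial_eq_0:
  fixes g :: "R3 \<Rightarrow> real"
  assumes diff: "\<And>x. g differentiable (at x)" and cont: "continuous_on UNIV (partial i g)"
    and R: "\<And>x. R < norm x \<Longrightarrow> g x = 0" "R > 0"
  shows "(LINT x|lborel. partial i g x) = 0"
proof -
  let ?e = "axis i 1 :: R3"
  have cg: "continuous_on UNIV g"
    using diff by (auto simp: continuous_on_eq_continuous_within differentiable_imp_continuous_within)
  then have [measurable]: "g \<in> borel_measurable borel" by (rule borel_measurable_continuous_onI)
  have [measurable]: "partial i g \<in> borel_measurable borel"
    by (rule borel_measurable_continuous_onI[OF cont])
  have "compact (partial i g ` cball 0 (R + 1))"
    by (intro compact_continuous_image continuous_on_subset[OF cont]) auto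
  then obtain B where B: "\<And>y. y \<in> partial i g ` cball 0 (R+1) \<Longrightarrow> norm y \<le> B"
    by (meson compact_imp_bounded bounded_iff)
  have "integrable lborel (\<lambda>x. indicator (cball 0 R) x *\<^sub>R g x)"
    by (intro borel_integrable_compact continuous_on_subset[OF cg]) auto
  also have "(\<lambda>x. indicator (cball 0 R) x *\<^sub>R g x) = g"
    using R by (auto simp: indicator_def fun_eq_iff)
  finally have gi: "integrable lborel g" .
  define s where "s t x = (g (x + t *\<^sub>R ?e) - g x) / t" for t x
  \<comment> \<open>The shift of the index by two keeps every step strictly below 1, so all
    translated supports stay inside the ball of radius R + 1.\<close>
  define t where "t n = inverse (real (Suc (Suc n)))" for n
  have t: "t n > 0" "t n < 1" for n by (auto simp: t_def inverse_less_1_iff)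
  have tl: "filterlim t (at 0) sequentially"
  proof -
    have "t \<longlonglongrightarrow> 0" unfolding t_def by (rule LIMSEQ_Suc[OF LIMSEQ_inverse_real_of_nat])
    moreover have "t n \<noteq> 0" for n using t(1)[of n] by simp
    ultimately show ?thesis by (simp add: filterlim_at)
  qed
  have "B \<ge> 0" using B[of "partial i g 0"] R(2) by fastforce
  have zero: "partial i g x = 0" if "R < norm x" for x using R(1) that by (rule partial_eq_0_outside)
  have Bp: "\<bar>partial i g x\<bar> \<le> B" for x
    using B[of "partial i g x"] zero[of x] \<open>B \<ge> 0\<close> by (cases "norm x \<le> R") auto
  have bd: "\<bar>s (t n) x\<bar> \<le> B * indicator (cball 0 (R + 1)) x" for n x
  proof (cases "norm x \<le> R + 1")
    case True
    obtain z where "0 < z" "z < t n" and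
      z: "g (x + t n *\<^sub>R ?e) - g (x + 0 *\<^sub>R ?e) = (t n - 0) * partial i g (x + z *\<^sub>R ?e)"
      using MVT2[OF t(1)[of n], of "\<lambda>s. g (x + s *\<^sub>R ?e)" "\<lambda>s. partial i g (x + s *\<^sub>R ?e)"]
        has_real_derivative_partial[OF diff] by blast
    then have "s (t n) x = partial i g (x + z *\<^sub>R ?e)" using t[of n] by (simp add: s_def)
    then show ?thesis using True Bp by simp
  next
    case False
    have "norm x \<le> norm (x + t n *\<^sub>R ?e) + norm (t n *\<^sub>R ?e)"
      by (metis add_diff_cancel norm_triangle_ineq4)
    then have "R < norm (x + t n *\<^sub>R ?e)" using False t[of n] by simp
    then show ?thesis using False R by (simp add: s_def)
  qed
  have "(\<lambda>n. LINT x|lborel. s (t n) x) \<longlonglongrightarrow> (LINT x|lborel. partial i g x)"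
  proof (rule integral_dominated_convergence[where w="\<lambda>x. B * indicator (cball 0 (R + 1)) x"])
    show "AE x in lborel. (\<lambda>n. s (t n) x) \<longlonglongrightarrow> partial i g x"
    proof (rule AE_I2)
      fix x
      have "((\<lambda>h. (g (x + h *\<^sub>R ?e) - g x) / h) \<longlongrightarrow> partial i g x) (at 0)"
        using has_real_derivative_partial[OF diff, where x=x and s=0 and i=i] by (simp add: DERIV_def)
      from filterlim_compose[OF this tl]
      show "(\<lambda>n. s (t n) x) \<longlonglongrightarrow> partial i g x" by (simp add: s_def)
    qed
    show "integrable lborel (\<lambda>x. B * indicator (cball 0 (R + 1)) x)"
      by (intro integrable_mult_right integrable_real_indicator)
        (auto simp: emeasure_cball top.not_eq_extremum[symmetric] R less_imp_le)
  qed (use bd in \<open>auto simp: s_def\<close>)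
  moreover have "(LINT x|lborel. s (t n) x) = 0" for n
    using gi by (simp add: s_def integral_translate integrable_translate_iff)
  ultimately show ?thesis by (simp add: LIMSEQ_const_iff)
qed

text \<open>With \<open>sink\<close>, the real and imaginary part of the inverse transform of a real
  symbol. Only this part survives for even symbols, so all multipliers of the flux become real
  convolutions.\<close>

definition cosk :: "(R3 \<Rightarrow> real) \<Rightarrow> R3 \<Rightarrow> real" where
  "cosk \<rho> x = (LINT \<xi>|lborel. \<rho> \<xi> * cos (\<xi> \<bullet> x)) / (2 * pi) ^ 3"

definition sink :: "(R3 \<Rightarrow> real) \<Rightarrow> R3 \<Rightarrow> real" where
  "sink \<rho> x = (LINT \<xi>|lborel. \<rho> \<xi> * sin (\<xi> \<bullet> x)) / (2 * pi) ^ 3"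

lemma integrable_mult_bounded:
  fixes f g :: "'a \<Rightarrow> 'b :: {banach, second_countable_topology, real_normed_div_algebra}"
  assumes "integrable M f" "g \<in> borel_measurable M" "\<And>x. norm (g x) \<le> B"
  shows "integrable M (\<lambda>x. f x * g x)" "integrable M (\<lambda>x. g x * f x)"
proof -
  note [measurable] = assms(2) borel_measurable_integrable[OF assms(1)]
  have le: "norm (f x) * norm (g x) \<le> norm (B * norm (f x))" for x
  proof -
    have "norm (f x) * norm (g x) \<le> B * norm (f x)"
      using mult_left_mono[OF assms(3)[of x] norm_ge_zero[of "f x"]] by (simp add: mult.commute)
    then show ?thesis by simp
  qed
  have i: "integrable M (\<lambda>x. B * norm (f x))" using assms(1) by simp
  show "integrable M (\<lambda>x. f x * g x)"
    by (rule Bochner_Integration.integrable_bound[OF i], measurable)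
      (intro AE_I2, subst norm_mult, rule le)
  show "integrable M (\<lambda>x. g x * f x)"
    by (rule Bochner_Integration.integrable_bound[OF i], measurable)
      (intro AE_I2, subst norm_mult, subst mult.commute, rule le)
qed

lemma test_function_trig_integrable:
  assumes "test_function \<rho>"
  shows "integrable lborel (\<lambda>\<xi>. \<rho> \<xi> * cos (\<xi> \<bullet> x))" "integrable lborel (\<lambda>\<xi>. \<rho> \<xi> * sin (\<xi> \<bullet> x))"
  by (rule integrable_mult_bounded(1)[OF test_function_integrable[OF assms], where B=1]; simp)+

lemma partial_trig:
  "partial i (\<lambda>\<xi>. cos (\<xi> \<bullet> x)) \<xi> = - (x $ i) * sin (\<xi> \<bullet> x)"
  "partial i (\<lambda>\<xi>. sin (\<xi> \<bullet> x)) \<xi> = x $ i * cos (\<xi> \<bullet> x)"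
  "(\<lambda>\<xi>. cos (\<xi> \<bullet> x)) differentiable (at \<xi>)" "(\<lambda>\<xi>. sin (\<xi> \<bullet> x)) differentiable (at \<xi>)"
proof -
  have 1: "((\<lambda>\<xi>. cos (\<xi> \<bullet> x)) has_derivative (\<lambda>h. - (h \<bullet> x) * sin (\<xi> \<bullet> x))) (at \<xi>)"
    and 2: "((\<lambda>\<xi>. sin (\<xi> \<bullet> x)) has_derivative (\<lambda>h. (h \<bullet> x) * cos (\<xi> \<bullet> x))) (at \<xi>)"
    by (auto intro!: derivative_eq_intros simp: mult.commute)
  show "partial i (\<lambda>\<xi>. cos (\<xi> \<bullet> x)) \<xi> = - (x $ i) * sin (\<xi> \<bullet> x)"
    "partial i (\<lambda>\<xi>. sin (\<xi> \<bullet> x)) \<xi> = x $ i * cos (\<xi> \<bullet> x)"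
    using partial_eq[OF 1] partial_eq[OF 2] by (auto simp: inner_axis' )
  show "(\<lambda>\<xi>. cos (\<xi> \<bullet> x)) differentiable (at \<xi>)" "(\<lambda>\<xi>. sin (\<xi> \<bullet> x)) differentiable (at \<xi>)"
    using 1 2 differentiableI by blast+
qed

text \<open>Integration by parts on the frequency side: the integrals of the derivatives of \<rho>
  cos and \<rho> sin vanish. A factor x_i on a kernel is thus traded for a derivative of the symbol,
  which is again a test function.\<close>

lemma cosk_partial:
  assumes "test_function \<rho>"
  shows "cosk (partial i \<rho>) x = x $ i * sink \<rho> x" "sink (partial i \<rho>) x = - (x $ i) * cosk \<rho> x"
proof -
  obtain R where R: "R > 0" "\<And>x. R < norm x \<Longrightarrow> \<rho> x = 0" using test_functionD[OF assms(1)] by metis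
  note d = test_function_differentiable[OF assms] 
  note cont = test_function_continuous[OF assms] test_function_continuous[OF test_function_partial[OF assms]]
  note int = test_function_trig_integrable[OF test_function_partial[OF assms]] test_function_trig_integrable[OF assms]
  have 1: "partial i (\<lambda>\<xi>. \<rho> \<xi> * cos (\<xi> \<bullet> x)) = (\<lambda>\<xi>. partial i \<rho> \<xi> * cos (\<xi> \<bullet> x) - x $ i * (\<rho> \<xi> * sin (\<xi> \<bullet> x)))"
    by (rule ext) (simp add: partial_mult[OF d partial_trig(3)] partial_trig)
  have 2: "partial i (\<lambda>\<xi>. \<rho> \<xi> * sin (\<xi> \<bullet> x)) = (\<lambda>\<xi>. partial i \<rho> \<xi> * sin (\<xi> \<bullet> x) + x $ i * (\<rho> \<xi> * cos (\<xi> \<bullet> x)))"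
    by (rule ext) (simp add: partial_mult[OF d partial_trig(4)] partial_trig)
  have "(LINT \<xi>|lborel. partial i (\<lambda>\<xi>. \<rho> \<xi> * cos (\<xi> \<bullet> x)) \<xi>) = 0"
    using R by (intro integral_partial_eq_0[where R=R])
      (auto simp: 1 intro!: continuous_intros cont d partial_trig differentiable_mult)
  then show "cosk (partial i \<rho>) x = x $ i * sink \<rho> x"
    using int unfolding 1 by (simp add: cosk_def sink_def)
  have "(LINT \<xi>|lborel. partial i (\<lambda>\<xi>. \<rho> \<xi> * sin (\<xi> \<bullet> x)) \<xi>) = 0"
    using R by (intro integral_partial_eq_0[where R=R])
      (auto simp: 2 intro!: continuous_intros cont d partial_trig differentiable_mult)
  then show "sink (partial i \<rho>) x = - (x $ i) * cosk \<rho> x"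
    using int unfolding 2 by (simp add: cosk_def sink_def) (simp add: field_simps)
qed

text \<open>Induction on the power with arbitrary symbol; both kernels are bounded together because
  every integration by parts interchanges them.\<close>

lemma trig_kernel_power_bound:
  assumes "test_function \<rho>"
  shows "\<exists>B\<ge>0. \<forall>x. \<bar>x $ i\<bar> ^ n * \<bar>cosk \<rho> x\<bar> \<le> B \<and> \<bar>x $ i\<bar> ^ n * \<bar>sink \<rho> x\<bar> \<le> B"
  using assms
proof (induction n arbitrary: \<rho>)
  case 0
  let ?B = "LINT \<xi>|lborel. \<bar>\<rho> \<xi>\<bar>"
  note i = test_function_integrable[OF 0]
  have p: "1 \<le> (2 * pi) ^ 3" using pi_gt3 by (intro one_le_power) linarith
  have div: "\<bar>a / (2 * pi) ^ 3\<bar> \<le> B" if "\<bar>a\<bar> \<le> B" for a B :: real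
  proof -
    have "\<bar>a / (2 * pi) ^ 3\<bar> = \<bar>a\<bar> / (2 * pi) ^ 3"
      using p unfolding abs_divide by (subst (2) abs_of_nonneg) (auto simp del: power_mult_distrib)
    also have "\<dots> \<le> B / 1" using that p by (intro frac_le) auto
    finally show ?thesis by simp
  qed
  have "\<bar>cosk \<rho> x\<bar> \<le> ?B \<and> \<bar>sink \<rho> x\<bar> \<le> ?B" for x
    unfolding cosk_def sink_def
    by (intro conjI div integral_abs_bound[THEN order_trans] integral_mono integrable_abs
        test_function_trig_integrable[OF 0] i) (auto simp: abs_mult mult_left_le)
  moreover have "?B \<ge> 0" by simp
  ultimately show ?case by (intro exI[of _ ?B]) auto
next
  case (Suc n)
  from Suc.IH[OF test_function_partial[OF Suc.prems, of i]] obtain B where "B \<ge> 0" and 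
    B: "\<And>x. \<bar>x $ i\<bar> ^ n * \<bar>x $ i * sink \<rho> x\<bar> \<le> B" "\<And>x. \<bar>x $ i\<bar> ^ n * \<bar>x $ i * cosk \<rho> x\<bar> \<le> B"
    by (auto simp: cosk_partial[OF Suc.prems])
  then show ?case by (intro exI[of _ B]) (auto simp: abs_mult mult_ac)
qed

lemma one_plus_norm_power_le:
  fixes x :: R3
  shows "(1 + norm x) ^ n \<le> 4 ^ n * (1 + (\<Sum>i\<in>UNIV. \<bar>x $ i\<bar> ^ n))"
proof -
  define m where "m = Max (insert 1 (range (\<lambda>i. \<bar>x $ i\<bar>)))"
  have m: "1 \<le> m" "\<And>i. \<bar>x $ i\<bar> \<le> m" and mem: "m \<in> insert 1 (range (\<lambda>i. \<bar>x $ i\<bar>))"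
    unfolding m_def by (rule Max_ge Max_in; simp)+
  have "norm x \<le> (\<Sum>i\<in>UNIV. \<bar>x $ i\<bar>)" by (rule norm_le_l1_cart)
  also have "\<dots> \<le> (\<Sum>i\<in>(UNIV::3 set). m)" using m by (intro sum_mono) auto
  \<comment> \<open>The 4 counts the summand 1 and the three coordinates, each at most m.\<close>
  finally have "1 + norm x \<le> 4 * m" using m by simp
  then have "(1 + norm x) ^ n \<le> 4 ^ n * m ^ n"
    by (metis add_nonneg_nonneg norm_ge_zero power_mono power_mult_distrib zero_le_one)
  also have "m ^ n \<le> 1 + (\<Sum>i\<in>UNIV. \<bar>x $ i\<bar> ^ n)"
  proof (cases "m = 1")
    case False
    then obtain i where "m = \<bar>x $ i\<bar>" using mem by auto
    then have "m ^ n \<le> (\<Sum>i\<in>UNIV. \<bar>x $ i\<bar> ^ n)"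
      by (metis (no_types, lifting) UNIV_I abs_ge_zero finite member_le_sum zero_le_power)
    then show ?thesis by simp
  qed (simp add: sum_nonneg)
  finally show ?thesis by simp
qed

text \<open>Exponent 0 will give boundedness of the kernels, exponent 5 their integrability, and
  larger exponents the weighted moments needed for the flux.\<close>

lemma trig_kernel_decay:
  assumes "test_function \<rho>"
  shows "\<exists>C\<ge>0. \<forall>x. \<bar>cosk \<rho> x\<bar> \<le> C / (1 + norm x) ^ n \<and> \<bar>sink \<rho> x\<bar> \<le> C / (1 + norm x) ^ n"
proof -
  obtain B0 where B0: "B0 \<ge> 0" "\<And>x. \<bar>cosk \<rho> x\<bar> \<le> B0" "\<And>x. \<bar>sink \<rho> x\<bar> \<le> B0"
    using trig_kernel_power_bound[OF assms, of undefined 0] by auto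
  have "\<exists>B. \<forall>i. B i \<ge> 0 \<and> (\<forall>x. \<bar>x $ i\<bar> ^ n * \<bar>cosk \<rho> x\<bar> \<le> B i \<and> \<bar>x $ i\<bar> ^ n * \<bar>sink \<rho> x\<bar> \<le> B i)"
    by (rule choice) (use trig_kernel_power_bound[OF assms] in blast)
  then obtain B where B: "\<And>i. B i \<ge> 0" "\<And>i x. \<bar>x $ i\<bar> ^ n * \<bar>cosk \<rho> x\<bar> \<le> B i"
    "\<And>i x. \<bar>x $ i\<bar> ^ n * \<bar>sink \<rho> x\<bar> \<le> B i" by blast
  define C where "C = 4 ^ n * (B0 + (\<Sum>i\<in>UNIV. B i))"
  have *: "\<bar>v\<bar> \<le> C / (1 + norm x) ^ n" if "\<bar>v\<bar> \<le> B0" "\<And>i. \<bar>x $ i\<bar> ^ n * \<bar>v\<bar> \<le> B i" for v and x :: R3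
  proof -
    have "\<bar>v\<bar> * (1 + norm x) ^ n \<le> \<bar>v\<bar> * (4 ^ n * (1 + (\<Sum>i\<in>UNIV. \<bar>x $ i\<bar> ^ n)))"
      by (intro mult_left_mono one_plus_norm_power_le) auto
    also have "\<dots> = 4 ^ n * (\<bar>v\<bar> + (\<Sum>i\<in>UNIV. \<bar>x $ i\<bar> ^ n * \<bar>v\<bar>))"
      by (simp add: algebra_simps sum_distrib_left sum_distrib_right)
    also have "\<dots> \<le> C" unfolding C_def using that by (intro mult_left_mono add_mono sum_mono) auto
    finally show ?thesis by (simp add: pos_le_divide_eq add_pos_nonneg)
  qed
  have "C \<ge> 0" unfolding C_def using B0 B by (auto intro!: mult_nonneg_nonneg add_nonneg_nonneg sum_nonneg)
  then show ?thesis using * B B0 by blast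
qed

subsection \<open>Fourier inversion up to a constant\<close>

lemma suminf_ennreal_less_top:
  assumes "summable f" "\<And>i. 0 \<le> f i"
  shows "(\<Sum>i. ennreal (f i)) < \<infinity>"
  using suminf_ennreal2[OF assms(2,1)] by (simp add: ennreal_less_top)

text \<open>Where the norm has integer part m, the integrand is at most (m + 1)^(-n), and the ball
  of radius m + 1 has volume of order (m + 1)^3; so n \<ge> 5 leaves the summable series of inverse
  squares.\<close>

lemma integrable_decay:
  assumes "n \<ge> 5"
  shows "integrable lborel (\<lambda>x::R3. 1 / (1 + norm x) ^ n)"
proof (rule integrableI_nonneg)
  let ?v = "unit_ball_vol (real DIM(R3))"
  have [measurable]: "cball 0 r \<in> sets (borel :: R3 measure)" for r by simp
  have "(\<integral>\<^sup>+(x::R3). ennreal (1 / (1 + norm x) ^ n) \<partial>lborel)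
      \<le> (\<integral>\<^sup>+(x::R3). (\<Sum>m. ennreal (1 / (real m + 1) ^ n) * indicator (cball 0 (real m + 1)) x) \<partial>lborel)"
  proof (rule nn_integral_mono)
    fix x :: R3
    define m where "m = nat \<lfloor>norm x\<rfloor>"
    have m: "real m \<le> norm x" "norm x \<le> real m + 1" by (auto simp: m_def)
    have "ennreal (1 / (1 + norm x) ^ n) \<le> ennreal (1 / (real m + 1) ^ n) * indicator (cball 0 (real m + 1)) x"
      using m by (auto intro!: ennreal_leI divide_left_mono power_mono mult_pos_pos add_nonneg_pos)
    also have "\<dots> \<le> (\<Sum>m. ennreal (1 / (real m + 1) ^ n) * indicator (cball 0 (real m + 1)) x)"
    proof -
      have "F m \<le> suminf F" for F :: "nat \<Rightarrow> ennreal"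
        using sum_le_suminf[of F "{m}"] by simp
      then show ?thesis .
    qed
    finally show "ennreal (1 / (1 + norm x) ^ n) \<le> \<dots>" .
  qed
  also have "\<dots> = (\<Sum>m. ennreal (1 / (real m + 1) ^ n) * emeasure lborel (cball (0::R3) (real m + 1)))"
    by (subst nn_integral_suminf) (auto simp: nn_integral_cmult_indicator)
  also have "\<dots> = (\<Sum>m. ennreal (1 / (real m + 1) ^ n * (?v * (real m + 1) ^ 3)))"
    by (intro suminf_cong, subst emeasure_cball) (auto simp: ennreal_mult[symmetric] simp del: ennreal_mult)
  also have "\<dots> \<le> (\<Sum>m. ennreal (?v * (1 / (real (Suc m)) ^ 2)))"
  proof (intro suminf_le ennreal_leI summableI allI)
    fix m
    let ?a = "real m + 1"
    have "1 / ?a ^ n * (?v * ?a ^ 3) = ?v * (?a ^ 3 / ?a ^ n)" by simp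
    also have "\<dots> \<le> ?v * (?a ^ 3 / ?a ^ 5)"
      using assms by (intro mult_left_mono divide_left_mono power_increasing) auto
    also have "?a ^ 3 / ?a ^ 5 = 1 / ?a ^ 2"
    proof -
      have "a ^ 3 / a ^ 5 = 1 / a ^ 2" if "a > 0" for a :: real
        using that by (simp add: field_simps power_numeral_reduce)
      then show ?thesis by simp
    qed
    finally show "1 / ?a ^ n * (?v * ?a ^ 3) \<le> ?v * (1 / (real (Suc m)) ^ 2)" by (simp add: add.commute)
  qed
  also have "\<dots> < \<infinity>"
  proof (rule suminf_ennreal_less_top)
    show "summable (\<lambda>m. ?v * (1 / (real (Suc m)) ^ 2))"
      using summable_Suc_iff[THEN iffD2, OF inverse_power_summable[of 2, where 'a=real]]
      by (intro summable_mult) (simp add: inverse_eq_divide)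
    show "0 \<le> ?v * (1 / (real (Suc m)) ^ 2)" for m by (intro mult_nonneg_nonneg) auto
  qed
  finally show "(\<integral>\<^sup>+(x::R3). ennreal (1 / (1 + norm x) ^ n) \<partial>lborel) < \<infinity>" .
qed auto

lemma integrable_pairI:
  fixes f :: "R3 \<Rightarrow> R3 \<Rightarrow> 'b :: {banach, second_countable_topology}"
  assumes [measurable]: "(\<lambda>(x, y). f x y) \<in> borel_measurable (lborel \<Otimes>\<^sub>M lborel)"
    and "(\<integral>\<^sup>+x. \<integral>\<^sup>+y. ennreal (norm (f x y)) \<partial>lborel \<partial>lborel) < \<infinity>"
  shows "integrable (lborel \<Otimes>\<^sub>M lborel) (\<lambda>(x, y). f x y)"
proof (rule integrableI_bounded)
  have "(\<integral>\<^sup>+p. ennreal (norm (case p of (x, y) \<Rightarrow> f x y)) \<partial>(lborel \<Otimes>\<^sub>M lborel)) =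
    (\<integral>\<^sup>+x. \<integral>\<^sup>+y. ennreal (norm (f x y)) \<partial>lborel \<partial>lborel)"
    by (subst lborel.nn_integral_fst[symmetric]) auto
  then show "(\<integral>\<^sup>+p. ennreal (norm (case p of (x, y) \<Rightarrow> f x y)) \<partial>(lborel \<Otimes>\<^sub>M lborel)) < \<infinity>"
    using assms(2) by simp
qed measurable

lemma integral_swap:
  fixes f :: "R3 \<Rightarrow> R3 \<Rightarrow> 'b :: {banach, second_countable_topology}"
  assumes "(\<lambda>(x, y). f x y) \<in> borel_measurable (lborel \<Otimes>\<^sub>M lborel)"
    and "(\<integral>\<^sup>+x. \<integral>\<^sup>+y. ennreal (norm (f x y)) \<partial>lborel \<partial>lborel) < \<infinity>"
  shows "(LINT x|lborel. LINT y|lborel. f x y) = (LINT y|lborel. LINT x|lborel. f x y)"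
  using lborel_pair.Fubini_integral[OF integrable_pairI[OF assms]] by simp

text \<open>The bounded factor stands for the oscillation \<open>cis\<close> of a Fourier integral;
  f and g alone make the double integral absolutely convergent.\<close>

lemma integral_swap_bounded:
  fixes f g :: "R3 \<Rightarrow> 'b :: {banach, second_countable_topology, real_normed_field}" and b :: "R3 \<Rightarrow> R3 \<Rightarrow> 'b"
  assumes f: "integrable lborel f" and g: "integrable lborel g"
    and [measurable]: "(\<lambda>(x, y). b x y) \<in> borel_measurable (lborel \<Otimes>\<^sub>M lborel)"
    and b: "\<And>x y. norm (b x y) \<le> B"
  shows "(LINT x|lborel. f x * (LINT y|lborel. g y * b x y)) = (LINT y|lborel. g y * (LINT x|lborel. f x * b x y))"
proof -
  note [measurable] = borel_measurable_integrable[OF f] borel_measurable_integrable[OF g]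
  have "(\<integral>\<^sup>+x. \<integral>\<^sup>+y. ennreal (norm (f x * g y * b x y)) \<partial>lborel \<partial>lborel)
    \<le> (\<integral>\<^sup>+x. \<integral>\<^sup>+y. ennreal (norm (f x)) * (ennreal (norm (g y)) * ennreal B) \<partial>lborel \<partial>lborel)"
    using order_trans[OF norm_ge_zero b]
    by (intro nn_integral_mono)
      (auto simp: norm_mult ennreal_mult[symmetric] mult.assoc intro!: ennreal_leI mult_left_mono b)
  also have "\<dots> = (\<integral>\<^sup>+x. ennreal (norm (f x)) \<partial>lborel) * ((\<integral>\<^sup>+y. ennreal (norm (g y)) \<partial>lborel) * ennreal B)"
    by (simp add: nn_integral_cmult nn_integral_multc)
  also have "\<dots> < \<infinity>"
    using f g by (simp add: nn_integral_eq_integral ennreal_mult_less_top)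
  finally have fin: "(\<integral>\<^sup>+x. \<integral>\<^sup>+y. ennreal (norm (f x * g y * b x y)) \<partial>lborel \<partial>lborel) < \<infinity>" .
  have "(LINT x|lborel. LINT y|lborel. f x * g y * b x y) = (LINT y|lborel. LINT x|lborel. f x * g y * b x y)"
    by (rule integral_swap[OF _ fin]) measurable
  moreover have "(LINT y|lborel. f x * g y * b x y) = f x * (LINT y|lborel. g y * b x y)" for x
    by (simp add: mult.assoc)
  moreover have "(LINT x|lborel. f x * g y * b x y) = g y * (LINT x|lborel. f x * b x y)" for y
    by (simp add: mult.assoc mult.left_commute[of _ "g y"])
  ultimately show ?thesis by simp
qed

text \<open>The definitions integrate over the completion \<open>lebesgue\<close>, whereas the
  Fubini arguments live on products of \<open>lborel\<close>; for Borel functions the two are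
  interchangeable.\<close>

lemma integral_lebesgue:
  fixes f :: "R3 \<Rightarrow> 'b :: {banach, second_countable_topology}"
  assumes "f \<in> borel_measurable borel"
  shows "(LINT x|lebesgue. f x) = (LINT x|lborel. f x)" "integrable lebesgue f \<longleftrightarrow> integrable lborel f"
  using assms by (auto simp: integral_completion integrable_completion)

section \<open>Fourier integrals of integrable Borel functions\<close>

lemma measurable_cis [measurable]:
  "f \<in> borel_measurable M \<Longrightarrow> (\<lambda>x. cis (f x)) \<in> borel_measurable M"
  by (rule measurable_compose[OF _ borel_measurable_continuous_onI]) (auto intro!: continuous_intros)

lemma fourier_lborel:
  assumes [measurable]: "f \<in> borel_measurable borel"
  shows "fourier_L1 f \<xi> = (LINT x|lborel. cis (- (\<xi> \<bullet> x)) * f x)"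
    "inverse_fourier f x = (LINT \<xi>|lborel. cis (\<xi> \<bullet> x) * f \<xi>) / complex_of_real ((2 * pi) ^ 3)"
proof -
  have "(\<lambda>x. cis (- (\<xi> \<bullet> x)) * f x) \<in> borel_measurable borel" "(\<lambda>\<xi>. cis (\<xi> \<bullet> x) * f \<xi>) \<in> borel_measurable borel"
    by measurable
  note * = this[THEN integral_lebesgue(1)]
  show "fourier_L1 f \<xi> = (LINT x|lborel. cis (- (\<xi> \<bullet> x)) * f x)"
    "inverse_fourier f x = (LINT \<xi>|lborel. cis (\<xi> \<bullet> x) * f \<xi>) / complex_of_real ((2 * pi) ^ 3)"
    unfolding fourier_L1_def inverse_fourier_def by (simp_all only: *)
qed

lemma measurable_fourier_L1 [measurable]:
  assumes [measurable]: "f \<in> borel_measurable borel"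
  shows "fourier_L1 f \<in> borel_measurable borel" "inverse_fourier f \<in> borel_measurable borel"
proof -
  have "(\<lambda>\<xi>. LINT x|lborel. cis (- (\<xi> \<bullet> x)) * f x) \<in> borel_measurable borel"
    "(\<lambda>x. (LINT \<xi>|lborel. cis (\<xi> \<bullet> x) * f \<xi>) / complex_of_real ((2 * pi) ^ 3)) \<in> borel_measurable borel"
    by measurable
  moreover have "fourier_L1 f = (\<lambda>\<xi>. LINT x|lborel. cis (- (\<xi> \<bullet> x)) * f x)"
    "inverse_fourier f = (\<lambda>x. (LINT \<xi>|lborel. cis (\<xi> \<bullet> x) * f \<xi>) / complex_of_real ((2 * pi) ^ 3))"
    by (rule ext, rule fourier_lborel, measurable)+
  ultimately show "fourier_L1 f \<in> borel_measurable borel" "inverse_fourier f \<in> borel_measurable borel"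
    by simp_all
qed

lemma norm_fourier_L1_le:
  assumes "integrable lborel f"
  shows "norm (fourier_L1 f \<xi>) \<le> (LINT x|lborel. norm (f x))"
proof -
  have [measurable]: "f \<in> borel_measurable borel" using assms by auto
  have "norm (fourier_L1 f \<xi>) \<le> (LINT x|lborel. norm (cis (- (\<xi> \<bullet> x)) * f x))"
    unfolding fourier_lborel[OF \<open>f \<in> borel_measurable borel\<close>] by (rule integral_norm_bound)
  then show ?thesis by (simp add: norm_mult)
qed

text \<open>Fubini: the transform of f is opened under the frequency integral, and the two phases
  combine to x - y.\<close>

lemma inverse_fourier_mult_L1:
  assumes \<rho>: "integrable lborel \<rho>" and f: "integrable lborel f"
  shows "inverse_fourier (\<lambda>\<xi>. \<rho> \<xi> * fourier_L1 f \<xi>) x = (LINT y|lborel. inverse_fourier \<rho> (x - y) * f y)"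
proof -
  have [measurable]: "\<rho> \<in> borel_measurable borel" "f \<in> borel_measurable borel" using assms by auto
  let ?p = "complex_of_real ((2 * pi) ^ 3)"
  have "(LINT \<xi>|lborel. cis (\<xi> \<bullet> x) * (\<rho> \<xi> * fourier_L1 f \<xi>)) =
     (LINT \<xi>|lborel. \<rho> \<xi> * (LINT y|lborel. f y * cis (\<xi> \<bullet> (x - y))))"
    unfolding fourier_lborel[OF \<open>f \<in> borel_measurable borel\<close>]
  proof (intro Bochner_Integration.integral_cong refl)
    fix \<xi>
    have c: "cis (\<xi> \<bullet> x) * cis (- (\<xi> \<bullet> y)) = cis (\<xi> \<bullet> (x - y))" for y
      by (simp add: cis_mult inner_diff_right)
    have "cis (\<xi> \<bullet> x) * (LINT y|lborel. cis (- (\<xi> \<bullet> y)) * f y) = (LINT y|lborel. cis (\<xi> \<bullet> x) * (cis (- (\<xi> \<bullet> y)) * f y))"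
      by simp
    also have "\<dots> = (LINT y|lborel. f y * cis (\<xi> \<bullet> (x - y)))"
      by (intro Bochner_Integration.integral_cong refl) (simp add: c[symmetric])
    finally show "cis (\<xi> \<bullet> x) * (\<rho> \<xi> * (LINT y|lborel. cis (- (\<xi> \<bullet> y)) * f y)) =
       \<rho> \<xi> * (LINT y|lborel. f y * cis (\<xi> \<bullet> (x - y)))" by (simp add: mult.left_commute)
  qed
  also have "\<dots> = (LINT y|lborel. f y * (LINT \<xi>|lborel. \<rho> \<xi> * cis (\<xi> \<bullet> (x - y))))"
    by (rule integral_swap_bounded[OF \<rho> f, where B=1]) (auto simp: split_beta')
  also have "\<dots> = (LINT y|lborel. (inverse_fourier \<rho> (x - y) * f y) * ?p)"
    unfolding fourier_lborel[OF \<open>\<rho> \<in> borel_measurable borel\<close>]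
    by (intro Bochner_Integration.integral_cong refl) (simp add: mult.commute)
  finally show ?thesis
    by (subst fourier_lborel(2)) (auto simp del: of_real_power of_real_mult)
qed

lemma inverse_fourier_test_function:
  assumes "test_function \<rho>"
  shows "inverse_fourier (\<lambda>\<xi>. complex_of_real (\<rho> \<xi>)) x = Complex (cosk \<rho> x) (sink \<rho> x)"
proof -
  have [measurable]: "\<rho> \<in> borel_measurable borel" using assms by (rule test_function_measurable)
  have i: "integrable lborel (\<lambda>\<xi>. cis (\<xi> \<bullet> x) * complex_of_real (\<rho> \<xi>))"
    using integrable_mult_bounded(2)[of lborel "\<lambda>\<xi>. complex_of_real (\<rho> \<xi>)" "\<lambda>\<xi>. cis (\<xi> \<bullet> x)" 1]
      test_function_integrable[OF assms] by simp
  have "(LINT \<xi>|lborel. cis (\<xi> \<bullet> x) * complex_of_real (\<rho> \<xi>)) =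
    Complex (LINT \<xi>|lborel. \<rho> \<xi> * cos (\<xi> \<bullet> x)) (LINT \<xi>|lborel. \<rho> \<xi> * sin (\<xi> \<bullet> x))"
    using integral_Re[OF i] integral_Im[OF i] by (intro complex_eqI) (auto simp: mult.commute)
  then show ?thesis
    by (subst fourier_lborel(2))
       (auto simp: cosk_def sink_def complex_eq_iff Re_divide_of_real Im_divide_of_real simp del: of_real_power of_real_mult)
qed


text \<open>By Fourier inversion this is the value of \<rho> at 0. It is kept as an undetermined
  factor, and the inversion formula below is stated relative to it.\<close>

definition kernel_mass :: "(R3 \<Rightarrow> real) \<Rightarrow> complex" where
  "kernel_mass \<rho> = (LINT x|lborel. inverse_fourier (\<lambda>\<xi>. complex_of_real (\<rho> \<xi>)) x)"

lemma integrable_trig_kernel: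
  assumes "test_function \<rho>"
  shows "integrable lborel (cosk \<rho>)" "integrable lborel (sink \<rho>)"
    "integrable lborel (inverse_fourier (\<lambda>\<xi>. complex_of_real (\<rho> \<xi>)))"
    "cosk \<rho> \<in> borel_measurable borel" "sink \<rho> \<in> borel_measurable borel"
proof -
  have [measurable]: "\<rho> \<in> borel_measurable borel" using assms by (rule test_function_measurable)
  have [measurable]: "inverse_fourier (\<lambda>\<xi>. complex_of_real (\<rho> \<xi>)) \<in> borel_measurable borel"
    by measurable
  have c: "cosk \<rho> = (\<lambda>x. Re (inverse_fourier (\<lambda>\<xi>. complex_of_real (\<rho> \<xi>)) x))"
    and s: "sink \<rho> = (\<lambda>x. Im (inverse_fourier (\<lambda>\<xi>. complex_of_real (\<rho> \<xi>)) x))"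
    using inverse_fourier_test_function[OF assms] by auto
  show [measurable]: "cosk \<rho> \<in> borel_measurable borel" "sink \<rho> \<in> borel_measurable borel"
    unfolding c s by measurable
  obtain C where C: "C \<ge> 0" "\<And>x. \<bar>cosk \<rho> x\<bar> \<le> C / (1 + norm x) ^ 5" "\<And>x. \<bar>sink \<rho> x\<bar> \<le> C / (1 + norm x) ^ 5"
    using trig_kernel_decay[OF assms] by blast
  have i: "integrable lborel (\<lambda>x::R3. C / (1 + norm x) ^ 5)"
    using integrable_mult_right[OF integrable_decay[of 5], of C] by simp
  show 1: "integrable lborel (cosk \<rho>)" "integrable lborel (sink \<rho>)"
    by (rule Bochner_Integration.integrable_bound[OF i]; use C in \<open>auto intro!: AE_I2 order_trans[OF C(2)] order_trans[OF C(3)]\<close>)+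
  have "inverse_fourier (\<lambda>\<xi>. complex_of_real (\<rho> \<xi>)) = (\<lambda>x. complex_of_real (cosk \<rho> x) + \<i> * complex_of_real (sink \<rho> x))"
    using inverse_fourier_test_function[OF assms] by (auto simp: complex_eq_iff)
  then show "integrable lborel (inverse_fourier (\<lambda>\<xi>. complex_of_real (\<rho> \<xi>)))"
    using 1 by simp
qed

text \<open>The kernel of a fixed cutoff serves as an approximate identity, so no explicitly known
  transform (such as that of a Gaussian) is needed; the price is an unspecified constant.\<close>

lemma fourier_inverse_fourier:
  assumes \<rho>: "test_function \<rho>" and chi: "test_function chi" "chi 0 = 1"
  shows "fourier_L1 (inverse_fourier (\<lambda>\<xi>. complex_of_real (\<rho> \<xi>))) \<xi>\<^sub>0 = kernel_mass chi * complex_of_real (\<rho> \<xi>\<^sub>0)"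
proof -
  let ?k = "inverse_fourier (\<lambda>\<xi>. complex_of_real (\<rho> \<xi>))"
  let ?g = "inverse_fourier (\<lambda>\<xi>. complex_of_real (chi \<xi>))"
  let ?p = "complex_of_real ((2 * pi) ^ 3)"
  note [measurable] = test_function_measurable[OF \<rho>] test_function_measurable[OF chi(1)]
  note ik = integrable_trig_kernel(3)[OF \<rho>] and ig = integrable_trig_kernel(3)[OF chi(1)]
  obtain B where B: "\<And>x. \<bar>chi x\<bar> \<le> B" using test_function_bounded[OF chi(1)] by metis
  obtain B' where B': "\<And>x. \<bar>\<rho> x\<bar> \<le> B'" using test_function_bounded[OF \<rho>] by metis
  define e where "e n = inverse (real (Suc n))" for n
  have e: "e n > 0" for n by (simp add: e_def)
  have elim: "e \<longlonglongrightarrow> 0" unfolding e_def by (rule LIMSEQ_inverse_real_of_nat)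
  \<comment> \<open>The limit of \<open>J\<close> is computed twice: letting the dilated cutoff tend
    to 1 gives the transform at \<open>\<xi>\<^sub>0\<close>, while exchanging the integrals turns
    the cutoff into a kernel that concentrates at \<open>\<xi>\<^sub>0\<close>.\<close>
  define J where "J n = (LINT x|lborel. ?k x * (cis (- (\<xi>\<^sub>0 \<bullet> x)) * complex_of_real (chi (e n *\<^sub>R x))))" for n
  have "J \<longlonglongrightarrow> (LINT x|lborel. ?k x * cis (- (\<xi>\<^sub>0 \<bullet> x)))"
    unfolding J_def
  proof (rule integral_dominated_convergence[where w="\<lambda>x. norm (?k x) * B"])
    show "integrable lborel (\<lambda>x. norm (?k x) * B)" using ik by simp
    show "AE x in lborel. (\<lambda>n. ?k x * (cis (- (\<xi>\<^sub>0 \<bullet> x)) * complex_of_real (chi (e n *\<^sub>R x)))) \<longlonglongrightarrow> ?k x * cis (- (\<xi>\<^sub>0 \<bullet> x))"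
    proof (rule AE_I2)
      fix x
      have "(\<lambda>n. chi (e n *\<^sub>R x)) \<longlonglongrightarrow> chi 0"
        using test_function_continuous[OF chi(1)] tendsto_scaleR[OF elim tendsto_const[of x]]
        by (intro continuous_on_tendsto_compose[of UNIV chi]) auto
      then have "(\<lambda>n. ?k x * (cis (- (\<xi>\<^sub>0 \<bullet> x)) * complex_of_real (chi (e n *\<^sub>R x)))) \<longlonglongrightarrow> ?k x * (cis (- (\<xi>\<^sub>0 \<bullet> x)) * complex_of_real 1)"
        by (intro tendsto_intros) (simp add: chi)
      then show "(\<lambda>n. ?k x * (cis (- (\<xi>\<^sub>0 \<bullet> x)) * complex_of_real (chi (e n *\<^sub>R x)))) \<longlonglongrightarrow> ?k x * cis (- (\<xi>\<^sub>0 \<bullet> x))"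
        by simp
    qed
  qed (auto simp: norm_mult intro!: mult_left_mono B)
  also have "(LINT x|lborel. ?k x * cis (- (\<xi>\<^sub>0 \<bullet> x))) = fourier_L1 ?k \<xi>\<^sub>0"
    using fourier_lborel(1)[of ?k] by (simp add: mult.commute)
  finally have lim1: "J \<longlonglongrightarrow> fourier_L1 ?k \<xi>\<^sub>0" .
  have J: "J n = (LINT y|lborel. ?g y * complex_of_real (\<rho> (\<xi>\<^sub>0 + e n *\<^sub>R y)))" for n
  proof -
    let ?c = "\<lambda>x. complex_of_real (chi (e n *\<^sub>R x))"
    have ic: "integrable lborel ?c"
      using test_function_integrable[OF test_function_scaleR[OF chi(1)]] e[of n] by simp
    have "J n * ?p = (LINT x|lborel. (cis (- (\<xi>\<^sub>0 \<bullet> x)) * ?c x) * (LINT \<xi>|lborel. complex_of_real (\<rho> \<xi>) * cis (\<xi> \<bullet> x)))"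
      unfolding J_def
      by (subst integral_mult_left_zero[symmetric], intro Bochner_Integration.integral_cong refl, subst fourier_lborel(2))
        (auto simp: mult_ac simp del: of_real_power of_real_mult)
    also have "\<dots> = (LINT \<xi>|lborel. complex_of_real (\<rho> \<xi>) * (LINT x|lborel. (cis (- (\<xi>\<^sub>0 \<bullet> x)) * ?c x) * cis (\<xi> \<bullet> x)))"
    proof (rule integral_swap_bounded[where B=1])
      show "integrable lborel (\<lambda>x. cis (- (\<xi>\<^sub>0 \<bullet> x)) * ?c x)"
        by (rule integrable_mult_bounded(2)[OF ic, where B=1]) auto
      show "integrable lborel (\<lambda>\<xi>. complex_of_real (\<rho> \<xi>))" using test_function_integrable[OF \<rho>] by simp
    qed (auto simp: split_beta')
    also have "\<dots> = (LINT \<xi>|lborel. complex_of_real (\<rho> \<xi>) * (?p * of_real (1 / e n ^ 3) * ?g ((1 / e n) *\<^sub>R (\<xi> - \<xi>\<^sub>0))))"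
    proof (intro Bochner_Integration.integral_cong refl arg_cong2[where f="(*)"])
      fix \<xi>
      have "(LINT x|lborel. cis (- (\<xi>\<^sub>0 \<bullet> x)) * ?c x * cis (\<xi> \<bullet> x)) = (LINT x|lborel. cis ((\<xi> - \<xi>\<^sub>0) \<bullet> x) * ?c x)"
      proof (intro Bochner_Integration.integral_cong refl)
        fix x
        have "cis (- (\<xi>\<^sub>0 \<bullet> x)) * cis (\<xi> \<bullet> x) = cis ((\<xi> - \<xi>\<^sub>0) \<bullet> x)"
          by (simp add: cis_mult inner_diff_left)
        then show "cis (- (\<xi>\<^sub>0 \<bullet> x)) * ?c x * cis (\<xi> \<bullet> x) = cis ((\<xi> - \<xi>\<^sub>0) \<bullet> x) * ?c x"
          by (simp add: mult.commute mult.left_commute)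
      qed
      also have "\<dots> = of_real (1 / e n ^ 3) * (LINT x|lborel. cis (x \<bullet> ((1 / e n) *\<^sub>R (\<xi> - \<xi>\<^sub>0))) * complex_of_real (chi x))"
        using e[of n] integral_affine3[of "1 / e n" "\<lambda>x. cis ((\<xi> - \<xi>\<^sub>0) \<bullet> x) * ?c x" 0]
        by (simp add: scaleR_conv_of_real[where 'a=complex] power_divide inner_commute)
      also have "\<dots> = of_real (1 / e n ^ 3) * (?p * ?g ((1 / e n) *\<^sub>R (\<xi> - \<xi>\<^sub>0)))"
        by (subst fourier_lborel(2)) (auto simp del: of_real_power of_real_mult)
      finally show "(LINT x|lborel. cis (- (\<xi>\<^sub>0 \<bullet> x)) * ?c x * cis (\<xi> \<bullet> x)) = ?p * of_real (1 / e n ^ 3) * ?g ((1 / e n) *\<^sub>R (\<xi> - \<xi>\<^sub>0))"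
        by (simp only: mult_ac)
    qed
    also have "\<dots> = (LINT \<xi>|lborel. of_real (1 / e n ^ 3) * (complex_of_real (\<rho> \<xi>) * ?g ((1 / e n) *\<^sub>R (\<xi> - \<xi>\<^sub>0))) * ?p)"
      by (simp only: mult_ac)
    also have "\<dots> = of_real (1 / e n ^ 3) * (LINT \<xi>|lborel. complex_of_real (\<rho> \<xi>) * ?g ((1 / e n) *\<^sub>R (\<xi> - \<xi>\<^sub>0))) * ?p"
      by (simp only: integral_mult_left_zero integral_mult_right_zero)
    \<comment> \<open>The substitution centred at \<open>\<xi>\<^sub>0\<close> brings out the cube
      of \<open>e n\<close>, which cancels the inverse cube from the dilated cutoff.\<close>
    also have "(LINT \<xi>|lborel. complex_of_real (\<rho> \<xi>) * ?g ((1 / e n) *\<^sub>R (\<xi> - \<xi>\<^sub>0))) =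
       of_real (e n ^ 3) * (LINT y|lborel. ?g y * complex_of_real (\<rho> (\<xi>\<^sub>0 + e n *\<^sub>R y)))"
      using e[of n] integral_affine3[of "e n" "\<lambda>\<xi>. complex_of_real (\<rho> \<xi>) * ?g ((1 / e n) *\<^sub>R (\<xi> - \<xi>\<^sub>0))" "\<xi>\<^sub>0"]
      by (simp add: scaleR_conv_of_real[where 'a=complex] mult.commute)
    finally show ?thesis using e[of n] by simp
  qed
  have "J \<longlonglongrightarrow> (LINT y|lborel. ?g y * complex_of_real (\<rho> \<xi>\<^sub>0))"
    unfolding J
  proof (rule integral_dominated_convergence[where w="\<lambda>x. norm (?g x) * B'"])
    show "integrable lborel (\<lambda>x. norm (?g x) * B')" using ig by simp
    show "AE x in lborel. (\<lambda>n. ?g x * complex_of_real (\<rho> (\<xi>\<^sub>0 + e n *\<^sub>R x))) \<longlonglongrightarrow> ?g x * complex_of_real (\<rho> \<xi>\<^sub>0)"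
    proof (rule AE_I2)
      fix x
      have "(\<lambda>n. \<xi>\<^sub>0 + e n *\<^sub>R x) \<longlonglongrightarrow> \<xi>\<^sub>0 + 0 *\<^sub>R x" by (intro tendsto_intros elim)
      then have "(\<lambda>n. \<rho> (\<xi>\<^sub>0 + e n *\<^sub>R x)) \<longlonglongrightarrow> \<rho> \<xi>\<^sub>0"
        using test_function_continuous[OF \<rho>]
        by (intro continuous_on_tendsto_compose[of UNIV \<rho>]) auto
      then show "(\<lambda>n. ?g x * complex_of_real (\<rho> (\<xi>\<^sub>0 + e n *\<^sub>R x))) \<longlonglongrightarrow> ?g x * complex_of_real (\<rho> \<xi>\<^sub>0)"
        by (intro tendsto_intros)
    qed
  qed (auto simp: norm_mult intro!: mult_left_mono B')
  then have "J \<longlonglongrightarrow> kernel_mass chi * complex_of_real (\<rho> \<xi>\<^sub>0)"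
    by (simp add: kernel_mass_def)
  with lim1 show ?thesis by (rule LIMSEQ_unique)
qed

section \<open>Differentiation under the Fourier integral\<close>

lemma norm_cis_minus_linear_le: "norm (cis t - 1 - \<i> * of_real t) \<le> t\<^sup>2"
proof -
  have "\<bar>sin t - t\<bar> \<le> t\<^sup>2 / 2"
    using Maclaurin_sin_bound[of t 2] by (simp add: numeral_2_eq_2 sin_coeff_def)
  moreover have "\<bar>cos t - 1\<bar> \<le> t\<^sup>2 / 2"
  proof -
    have "\<bar>sin (t/2)\<bar> \<le> \<bar>t/2\<bar>" by (rule abs_sin_x_le_abs_x)
    then have "(sin (t/2))\<^sup>2 \<le> (t/2)\<^sup>2" using abs_le_square_iff by blast
    then show ?thesis using cos_double_sin[of "t/2"] by (simp add: power_divide)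
  qed
  moreover have "norm (cis t - 1 - \<i> * of_real t) \<le> \<bar>cos t - 1\<bar> + \<bar>sin t - t\<bar>"
    using cmod_le[of "cis t - 1 - \<i> * of_real t"] by simp
  ultimately show ?thesis by linarith
qed

lemma norm_integral_le:
  fixes f :: "'a \<Rightarrow> 'b :: {banach, second_countable_topology}"
  assumes "integrable M f" "integrable M g" "\<And>x. norm (f x) \<le> g x"
  shows "norm (integral\<^sup>L M f) \<le> integral\<^sup>L M g"
  by (rule order_trans[OF integral_norm_bound]) (intro integral_mono integrable_norm assms)

lemma borel_measurable_lebesgueI:
  fixes f :: "R3 \<Rightarrow> 'b :: real_normed_vector"
  shows "f \<in> borel_measurable borel \<Longrightarrow> f \<in> borel_measurable lebesgue"
  by (rule measurable_completion) simp

text \<open>M will contain an L2 transform, which is only Lebesgue measurable, so nothing but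
  integrability and bounded support is assumed of it. Since |\<xi>| \<le> A on this support, the
  derivative is dominated, and the remainder is at most A^2 |h|^2 times the L1 norm of M.\<close>

lemma has_derivative_fourier_integral:
  fixes M :: "R3 \<Rightarrow> complex"
  assumes M: "integrable lebesgue M" and R: "\<And>\<xi>. R < norm \<xi> \<Longrightarrow> M \<xi> = 0"
  shows "((\<lambda>x. LINT \<xi>|lebesgue. cis (\<xi> \<bullet> x) * M \<xi>) has_derivative
     (\<lambda>h. LINT \<xi>|lebesgue. \<i> * of_real (\<xi> \<bullet> h) * (cis (\<xi> \<bullet> x) * M \<xi>))) (at x)"
proof -
  have [measurable]: "M \<in> borel_measurable lebesgue" using M by auto
  have [measurable]: "(\<lambda>\<xi>::R3. cis (\<xi> \<bullet> y)) \<in> borel_measurable lebesgue" "(\<lambda>\<xi>::R3. \<xi> \<bullet> y) \<in> borel_measurable lebesgue" for y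
    by (rule borel_measurable_lebesgueI, measurable)+
  define A where "A = max R 0"
  have A: "norm \<xi> \<le> A" if "M \<xi> \<noteq> 0" for \<xi> using R[of \<xi>] that by (force simp: A_def)
  have A0: "A \<ge> 0" by (simp add: A_def)
  have ic: "integrable lebesgue (\<lambda>\<xi>. cis (\<xi> \<bullet> y) * M \<xi>)" for y
    by (rule integrable_mult_bounded(2)[OF M, where B=1]) auto
  have bh: "norm (\<i> * of_real (\<xi> \<bullet> h) * (cis (\<xi> \<bullet> x) * M \<xi>)) \<le> A * norm h * norm (M \<xi>)" for \<xi> h
  proof (cases "M \<xi> = 0")
    case False
    have "\<bar>\<xi> \<bullet> h\<bar> \<le> norm \<xi> * norm h" by (rule Cauchy_Schwarz_ineq2)
    also have "\<dots> \<le> A * norm h" using A[OF False] by (intro mult_right_mono) auto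
    finally show ?thesis by (simp add: norm_mult mult_right_mono)
  qed simp
  have iM: "integrable lebesgue (\<lambda>\<xi>. c * norm (M \<xi>))" for c :: real using M by simp
  have ih: "integrable lebesgue (\<lambda>\<xi>. \<i> * of_real (\<xi> \<bullet> h) * (cis (\<xi> \<bullet> x) * M \<xi>))" for h
  proof (rule Bochner_Integration.integrable_bound[OF iM[of "A * norm h"]])
    show "AE \<xi> in lebesgue. norm (\<i> * of_real (\<xi> \<bullet> h) * (cis (\<xi> \<bullet> x) * M \<xi>)) \<le> norm (A * norm h * norm (M \<xi>))"
      using bh A0 by (auto simp: abs_mult)
  qed measurable
  let ?D = "\<lambda>h. LINT \<xi>|lebesgue. \<i> * of_real (\<xi> \<bullet> h) * (cis (\<xi> \<bullet> x) * M \<xi>)"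
  let ?I = "LINT \<xi>|lebesgue. norm (M \<xi>)"
  have "bounded_linear ?D"
  proof (rule bounded_linear_intro[where K="A * ?I"])
    show "?D (a + b) = ?D a + ?D b" for a b
      using ih by (simp add: inner_add_right distrib_right distrib_left flip: Bochner_Integration.integral_add)
    show "?D (r *\<^sub>R a) = r *\<^sub>R ?D a" for r a
      by (simp add: mult_ac scaleR_conv_of_real[where 'a=complex] flip: integral_mult_right_zero)
    show "norm (?D a) \<le> norm a * (A * ?I)" for a
    proof -
      have "norm (?D a) \<le> (LINT \<xi>|lebesgue. A * norm a * norm (M \<xi>))"
        by (rule norm_integral_le[OF ih iM bh])
      then show ?thesis by (simp add: mult_ac)
    qed
  qed
  moreover have "((\<lambda>h. norm ((LINT \<xi>|lebesgue. cis (\<xi> \<bullet> (x + h)) * M \<xi>) - (LINT \<xi>|lebesgue. cis (\<xi> \<bullet> x) * M \<xi>) - ?D h) / norm h) \<longlongrightarrow> 0) (at 0)"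
  proof (rule Lim_null_comparison)
    show "\<forall>\<^sub>F h in at 0. norm (norm ((LINT \<xi>|lebesgue. cis (\<xi> \<bullet> (x + h)) * M \<xi>) - (LINT \<xi>|lebesgue. cis (\<xi> \<bullet> x) * M \<xi>) - ?D h) / norm h)
       \<le> A\<^sup>2 * ?I * norm h"
    proof (rule eventually_at_topological[THEN iffD2], intro exI[of _ UNIV] conjI ballI impI)
      fix h :: R3 assume "h \<noteq> 0"
      let ?r = "\<lambda>\<xi>. cis (\<xi> \<bullet> (x + h)) * M \<xi> - cis (\<xi> \<bullet> x) * M \<xi> - \<i> * of_real (\<xi> \<bullet> h) * (cis (\<xi> \<bullet> x) * M \<xi>)"
      have r: "norm (?r \<xi>) \<le> A\<^sup>2 * (norm h)\<^sup>2 * norm (M \<xi>)" for \<xi>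
      proof (cases "M \<xi> = 0")
        case False
        have "?r \<xi> = (cis (\<xi> \<bullet> h) - 1 - \<i> * of_real (\<xi> \<bullet> h)) * (cis (\<xi> \<bullet> x) * M \<xi>)"
          by (simp add: inner_add_right cis_mult[symmetric] algebra_simps)
        then have "norm (?r \<xi>) = norm (cis (\<xi> \<bullet> h) - 1 - \<i> * of_real (\<xi> \<bullet> h)) * norm (M \<xi>)"
          by (simp add: norm_mult)
        also have "\<dots> \<le> (\<xi> \<bullet> h)\<^sup>2 * norm (M \<xi>)"
          by (intro mult_right_mono norm_cis_minus_linear_le) auto
        also have "\<dots> \<le> (A * norm h)\<^sup>2 * norm (M \<xi>)"
        proof (intro mult_right_mono)
          have "\<bar>\<xi> \<bullet> h\<bar> \<le> norm \<xi> * norm h" by (rule Cauchy_Schwarz_ineq2)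
          also have "\<dots> \<le> A * norm h" using A[OF False] by (intro mult_right_mono) auto
          finally show "(\<xi> \<bullet> h)\<^sup>2 \<le> (A * norm h)\<^sup>2" by (metis abs_ge_zero power2_abs power_mono)
        qed auto
        finally show ?thesis by (simp add: power_mult_distrib)
      qed simp
      have "(LINT \<xi>|lebesgue. cis (\<xi> \<bullet> (x + h)) * M \<xi>) - (LINT \<xi>|lebesgue. cis (\<xi> \<bullet> x) * M \<xi>) - ?D h = (LINT \<xi>|lebesgue. ?r \<xi>)"
        using ic ih by simp
      moreover have "norm (LINT \<xi>|lebesgue. ?r \<xi>) \<le> (LINT \<xi>|lebesgue. A\<^sup>2 * (norm h)\<^sup>2 * norm (M \<xi>))"
        using ic ih by (intro norm_integral_le[OF _ iM r]) auto
      ultimately show "norm (norm ((LINT \<xi>|lebesgue. cis (\<xi> \<bullet> (x + h)) * M \<xi>) - (LINT \<xi>|lebesgue. cis (\<xi> \<bullet> x) * M \<xi>) - ?D h) / norm h)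
       \<le> A\<^sup>2 * ?I * norm h"
        using \<open>h \<noteq> 0\<close> by (simp add: divide_le_eq power2_eq_square mult_ac)
    qed auto
    show "((\<lambda>h. A\<^sup>2 * ?I * norm h) \<longlongrightarrow> 0) (at 0)"
      by (rule tendsto_eq_intros refl)+ simp
  qed
  ultimately show ?thesis by (simp add: has_derivative_at)
qed

lemma has_derivative_inverse_fourier:
  fixes M :: "R3 \<Rightarrow> complex"
  assumes M: "integrable lebesgue M" and R: "\<And>\<xi>. R < norm \<xi> \<Longrightarrow> M \<xi> = 0"
  shows "inverse_fourier M differentiable (at x)"
    "partial i (inverse_fourier M) x = \<i> * inverse_fourier (\<lambda>\<xi>. of_real (\<xi> $ i) * M \<xi>) x"
proof -
  let ?p = "complex_of_real ((2 * pi) ^ 3)"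
  have *: "(inverse_fourier M has_derivative
     (\<lambda>h. (LINT \<xi>|lebesgue. \<i> * of_real (\<xi> \<bullet> h) * (cis (\<xi> \<bullet> x) * M \<xi>)) / ?p)) (at x)"
    unfolding inverse_fourier_def[abs_def]
    using bounded_linear.has_derivative[OF bounded_linear_divide has_derivative_fourier_integral[OF M R]] by simp
  then show "inverse_fourier M differentiable (at x)" by (rule differentiableI)
  have "(LINT \<xi>|lebesgue. \<i> * of_real (\<xi> \<bullet> axis i 1) * (cis (\<xi> \<bullet> x) * M \<xi>)) =
    \<i> * (LINT \<xi>|lebesgue. cis (\<xi> \<bullet> x) * (of_real (\<xi> $ i) * M \<xi>))"
    unfolding integral_mult_right_zero[symmetric] by (simp add: inner_axis mult_ac)
  then show "partial i (inverse_fourier M) x = \<i> * inverse_fourier (\<lambda>\<xi>. of_real (\<xi> $ i) * M \<xi>) x"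
    unfolding partial_eq[OF *] by (simp add: inverse_fourier_def)
qed

lemma partial_Re_Im:
  assumes "f differentiable (at x)"
  shows "(\<lambda>x. Re (f x)) differentiable (at x)" "(\<lambda>x. Im (f x)) differentiable (at x)"
    "partial i (\<lambda>x. Re (f x)) x = Re (partial i f x)" "partial i (\<lambda>x. Im (f x)) x = Im (partial i f x)"
proof -
  have d: "(f has_derivative frechet_derivative f (at x)) (at x)"
    using assms by (auto simp: frechet_derivative_works)
  note 1 = bounded_linear.has_derivative[OF bounded_linear_Re d]
  note 2 = bounded_linear.has_derivative[OF bounded_linear_Im d]
  show "(\<lambda>x. Re (f x)) differentiable (at x)" "(\<lambda>x. Im (f x)) differentiable (at x)"
    using 1 2 differentiableI by blast+
  show "partial i (\<lambda>x. Re (f x)) x = Re (partial i f x)" "partial i (\<lambda>x. Im (f x)) x = Im (partial i f x)"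
    using partial_eq[OF 1] partial_eq[OF 2] by (auto simp: partial_def)
qed

text \<open>Differentiating a kernel multiplies its symbol by i \<xi>_i, which again leaves a test
  function up to the factor i; iterating this gives smoothness.\<close>

lemma partial_trig_kernel:
  assumes "test_function \<rho>"
  shows "cosk \<rho> differentiable (at x)" "sink \<rho> differentiable (at x)"
    "partial i (cosk \<rho>) x = - sink (\<lambda>\<xi>. \<xi> $ i * \<rho> \<xi>) x"
    "partial i (sink \<rho>) x = cosk (\<lambda>\<xi>. \<xi> $ i * \<rho> \<xi>) x"
proof -
  let ?k = "inverse_fourier (\<lambda>\<xi>. complex_of_real (\<rho> \<xi>))"
  obtain R where R: "R > 0" "\<And>x. R < norm x \<Longrightarrow> \<rho> x = 0" using test_functionD[OF assms(1)] by metis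
  have "integrable lebesgue (\<lambda>\<xi>. complex_of_real (\<rho> \<xi>))"
    using integrable_completion[of \<rho> lborel] test_function_integrable[OF assms] test_function_measurable[OF assms]
    by simp
  note d = has_derivative_inverse_fourier[OF this, where R=R and x=x]
  have d1: "?k differentiable (at x)" using d R by simp
  have d2: "partial i ?k x = \<i> * Complex (cosk (\<lambda>\<xi>. \<xi> $ i * \<rho> \<xi>) x) (sink (\<lambda>\<xi>. \<xi> $ i * \<rho> \<xi>) x)"
    using d(2) R inverse_fourier_test_function[OF test_function_coord[OF assms, of i], of x] by simp
  have c: "cosk \<rho> = (\<lambda>x. Re (?k x))" and s: "sink \<rho> = (\<lambda>x. Im (?k x))"
    using inverse_fourier_test_function[OF assms] by auto
  show "cosk \<rho> differentiable (at x)" "sink \<rho> differentiable (at x)"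
    unfolding c s by (intro partial_Re_Im d1)+
  show "partial i (cosk \<rho>) x = - sink (\<lambda>\<xi>. \<xi> $ i * \<rho> \<xi>) x"
    "partial i (sink \<rho>) x = cosk (\<lambda>\<xi>. \<xi> $ i * \<rho> \<xi>) x"
    using partial_Re_Im(3,4)[OF d1, of i] d2 unfolding c[symmetric] s[symmetric] by simp_all
qed

lemma C_k_uminus: "C_k k f \<Longrightarrow> C_k k (\<lambda>x. - f x)"
  using C_k_mult[of k "\<lambda>_. -1" f] by (simp add: C_k_const)

lemma smooth_trig_kernel:
  assumes "test_function \<rho>"
  shows "smooth_fun (cosk \<rho>)" "smooth_fun (sink \<rho>)"
proof -
  have "C_k k (cosk \<rho>) \<and> C_k k (sink \<rho>)" for k
    using assms
  proof (induction k arbitrary: \<rho>)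
    case 0
    then show ?case using partial_trig_kernel(1,2)[OF 0]
      by (auto simp: continuous_on_eq_continuous_within differentiable_imp_continuous_within)
  next
    case (Suc k)
    have "partial i (cosk \<rho>) = (\<lambda>x. - sink (\<lambda>\<xi>. \<xi> $ i * \<rho> \<xi>) x)" "partial i (sink \<rho>) = cosk (\<lambda>\<xi>. \<xi> $ i * \<rho> \<xi>)" for i
      using partial_trig_kernel(3,4)[OF Suc.prems] by auto
    then show ?case
      using Suc.IH[OF test_function_coord[OF Suc.prems]] partial_trig_kernel(1,2)[OF Suc.prems]
      by (auto intro: C_k_uminus)
  qed
  then show "smooth_fun (cosk \<rho>)" "smooth_fun (sink \<rho>)" by (auto simp: smooth_fun_def)
qed

text \<open>The set where f differs from 0 is open and null, and a nonempty open set is not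
  negligible.\<close>

lemma AE_zero_continuous:
  fixes f :: "R3 \<Rightarrow> real"
  assumes ae: "AE x in lborel. f x = 0" and f: "continuous_on UNIV f"
  shows "f x = 0"
proof -
  have "open {x. f x \<noteq> 0}"
    by (intro open_Collect_neq f continuous_intros)
  moreover have "negligible {x. f x \<noteq> 0}"
    using AE_completion[OF ae] by (simp add: AE_iff_null_sets negligible_iff_null_sets null_sets_completionI borel_open \<open>open _\<close>)
  ultimately have "{x. f x \<noteq> 0} = {}" using open_not_negligible by blast
  then show ?thesis by auto
qed

section \<open>Parity and dilation of kernels\<close>

lemma trig_kernel_minus: "cosk \<rho> (- x) = cosk \<rho> x" "sink \<rho> (- x) = - sink \<rho> x"
  by (simp_all add: cosk_def sink_def)

lemma trig_kernel_parity:
  assumes "\<And>\<xi>. \<rho> (- \<xi>) = \<rho> \<xi>"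
  shows "sink \<rho> x = 0" "cosk (\<lambda>\<xi>. \<xi> $ i * \<rho> \<xi>) x = 0"
proof -
  have z: "a = 0" if "a = - a" for a :: real using that by simp
  have "(LINT \<xi>|lborel. \<rho> \<xi> * sin (\<xi> \<bullet> x)) = (LINT \<xi>|lborel. \<rho> (- \<xi>) * sin (- \<xi> \<bullet> x))"
    by (rule integral_translate(4)[symmetric])
  also have "\<dots> = - (LINT \<xi>|lborel. \<rho> \<xi> * sin (\<xi> \<bullet> x))" by (simp add: assms)
  finally show "sink \<rho> x = 0" unfolding sink_def using z by simp
  have "(LINT \<xi>|lborel. \<xi> $ i * \<rho> \<xi> * cos (\<xi> \<bullet> x)) = (LINT \<xi>|lborel. (- \<xi>) $ i * \<rho> (- \<xi>) * cos (- \<xi> \<bullet> x))"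
    by (rule integral_translate(4)[symmetric])
  also have "\<dots> = - (LINT \<xi>|lborel. \<xi> $ i * \<rho> \<xi> * cos (\<xi> \<bullet> x))" by (simp add: assms)
  finally show "cosk (\<lambda>\<xi>. \<xi> $ i * \<rho> \<xi>) x = 0" unfolding cosk_def using z by simp
qed

text \<open>The cube of l is the Jacobian of the frequency variable; the extra factor \<xi>_i of a
  gradient kernel supplies the fourth power.\<close>

lemma trig_kernel_scale:
  assumes "l > 0"
  shows "cosk (\<lambda>\<xi>. \<rho> (\<xi> /\<^sub>R l)) x = l ^ 3 * cosk \<rho> (l *\<^sub>R x)"
    "sink (\<lambda>\<xi>. \<rho> (\<xi> /\<^sub>R l)) x = l ^ 3 * sink \<rho> (l *\<^sub>R x)"
    "sink (\<lambda>\<xi>. \<xi> $ i * \<rho> (\<xi> /\<^sub>R l)) x = l ^ 4 * sink (\<lambda>\<xi>. \<xi> $ i * \<rho> \<xi>) (l *\<^sub>R x)"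
  using assms
    integral_affine3[of l "\<lambda>\<xi>. \<rho> (\<xi> /\<^sub>R l) * cos (\<xi> \<bullet> x)" 0]
    integral_affine3[of l "\<lambda>\<xi>. \<rho> (\<xi> /\<^sub>R l) * sin (\<xi> \<bullet> x)" 0]
    integral_affine3[of l "\<lambda>\<xi>. \<xi> $ i * \<rho> (\<xi> /\<^sub>R l) * sin (\<xi> \<bullet> x)" 0]
  by (simp_all add: cosk_def sink_def mult.assoc power_numeral_reduce)

section \<open>The inversion factor of a fixed cutoff\<close>

locale cutoff =
  fixes chi :: "R3 \<Rightarrow> real"
  assumes cutoff: "LP_cutoff chi"
begin

lemma test_chi [simp, intro]: "test_function chi"
  using cutoff unfolding LP_cutoff_def test_function_def by blast

lemma chi_even [simp]: "chi (- \<xi>) = chi \<xi>"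
  using cutoff norm_minus_cancel[of \<xi>] unfolding LP_cutoff_def by blast

lemma chi_nonneg [simp]: "0 \<le> chi \<xi>"
  using cutoff unfolding LP_cutoff_def by blast

lemma chi_eq_1: "norm \<xi> \<le> 1 / 2 \<Longrightarrow> chi \<xi> = 1"
  using cutoff unfolding LP_cutoff_def by blast

lemma chi_0 [simp]: "chi 0 = 1"
  by (rule chi_eq_1) simp

lemma chi_eq_0: "norm \<xi> \<ge> 1 \<Longrightarrow> chi \<xi> = 0"
proof (rule ccontr)
  assume "norm \<xi> \<ge> 1" "chi \<xi> \<noteq> 0"
  then have "\<xi> \<in> support chi" by (auto simp: support_def intro: closure_subset[THEN subsetD])
  then have "\<xi> \<in> ball 0 1" using cutoff unfolding LP_cutoff_def by blast
  then show False using \<open>norm \<xi> \<ge> 1\<close> by simp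
qed

text \<open>The constant is in fact 1, but only \<open>mass \<noteq> 0\<close> is needed.\<close>

definition "mass = (LINT x|lborel. cosk chi x)"

lemma kernel_mass_chi: "kernel_mass chi = of_real mass"
proof -
  have "inverse_fourier (\<lambda>\<xi>. complex_of_real (chi \<xi>)) = (\<lambda>x. complex_of_real (cosk chi x))"
    using inverse_fourier_test_function[OF test_chi] trig_kernel_parity(1)[of chi]
    by (auto simp: complex_eq_iff)
  then show ?thesis by (simp add: kernel_mass_def mass_def)
qed

text \<open>The inversion formula evaluated at frequency 0. Symbols that vanish at the origin
  therefore have kernels of mean zero, the source of cancellation in the cross terms of the block
  sums.\<close>

lemma integral_cosk:
  assumes "test_function \<rho>"
  shows "(LINT x|lborel. cosk \<rho> x) = mass * \<rho> 0"
proof -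
  note int = integrable_trig_kernel[OF assms]
  have "Re (fourier_L1 (inverse_fourier (\<lambda>\<xi>. complex_of_real (\<rho> \<xi>))) 0) = mass * \<rho> 0"
    by (simp add: fourier_inverse_fourier[OF assms test_chi chi_0] kernel_mass_chi)
  moreover have "fourier_L1 (inverse_fourier (\<lambda>\<xi>. complex_of_real (\<rho> \<xi>))) 0 = (LINT x|lborel. inverse_fourier (\<lambda>\<xi>. complex_of_real (\<rho> \<xi>)) x)"
    using int(3) by (subst fourier_lborel(1)) auto
  moreover have "(LINT x|lborel. cosk \<rho> x) = (LINT x|lborel. Re (inverse_fourier (\<lambda>\<xi>. complex_of_real (\<rho> \<xi>)) x))"
    by (simp add: inverse_fourier_test_function[OF assms])
  ultimately show ?thesis using integral_Re[OF int(3)] by metis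
qed

text \<open>The multiplier \<rho> acts on the kernel of \<sigma>, whose transform is
  \<open>mass\<close> times \<sigma>. Every composition of two kernels thus costs one factor
  \<open>mass\<close>.\<close>

lemma trig_kernel_convolution:
  assumes \<rho>: "test_function \<rho>" and even: "\<And>\<xi>. \<rho> (- \<xi>) = \<rho> \<xi>" and \<sigma>: "test_function \<sigma>"
  shows "(LINT y|lborel. cosk \<rho> (x - y) * cosk \<sigma> y) = mass * cosk (\<lambda>\<xi>. \<rho> \<xi> * \<sigma> \<xi>) x"
    "(LINT y|lborel. cosk \<rho> (x - y) * sink \<sigma> y) = mass * sink (\<lambda>\<xi>. \<rho> \<xi> * \<sigma> \<xi>) x"
proof -
  let ?r = "\<lambda>\<xi>. complex_of_real (\<rho> \<xi>)" and ?s = "\<lambda>\<xi>. complex_of_real (\<sigma> \<xi>)"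
  have ir: "integrable lborel ?r" using test_function_integrable[OF \<rho>] by simp
  have t: "test_function (\<lambda>\<xi>. \<rho> \<xi> * \<sigma> \<xi>)" by (rule test_function_mult[OF \<rho> test_function_smooth[OF \<sigma>]])
  note int = integrable_trig_kernel[OF \<sigma>]
  have "(LINT y|lborel. inverse_fourier ?r (x - y) * inverse_fourier ?s y) = inverse_fourier (\<lambda>\<xi>. ?r \<xi> * fourier_L1 (inverse_fourier ?s) \<xi>) x"
    by (rule inverse_fourier_mult_L1[OF ir int(3), symmetric])
  also have "\<dots> = inverse_fourier (\<lambda>\<xi>. of_real mass * complex_of_real (\<rho> \<xi> * \<sigma> \<xi>)) x"
    by (simp add: fourier_inverse_fourier[OF \<sigma> test_chi chi_0] kernel_mass_chi mult_ac)
  also have "\<dots> = of_real mass * inverse_fourier (\<lambda>\<xi>. complex_of_real (\<rho> \<xi> * \<sigma> \<xi>)) x"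
    by (simp add: inverse_fourier_def mult.left_commute[of _ "complex_of_real mass"] del: of_real_mult)
  also have "\<dots> = of_real mass * Complex (cosk (\<lambda>\<xi>. \<rho> \<xi> * \<sigma> \<xi>) x) (sink (\<lambda>\<xi>. \<rho> \<xi> * \<sigma> \<xi>) x)"
    by (simp only: inverse_fourier_test_function[OF t])
  finally have eq: "(LINT y|lborel. inverse_fourier ?r (x - y) * inverse_fourier ?s y) = \<dots>" .
  have r: "inverse_fourier ?r (x - y) * inverse_fourier ?s y = Complex (cosk \<rho> (x - y) * cosk \<sigma> y) (cosk \<rho> (x - y) * sink \<sigma> y)" for y
    by (simp add: inverse_fourier_test_function[OF \<rho>] inverse_fourier_test_function[OF \<sigma>]
        trig_kernel_parity(1)[of \<rho>, OF even] complex_eq_iff)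
  have i: "integrable lborel (\<lambda>y. inverse_fourier ?r (x - y) * inverse_fourier ?s y)"
  proof -
    obtain C where C: "C \<ge> 0" "\<And>x. \<bar>cosk \<rho> x\<bar> \<le> C"
      using trig_kernel_decay[OF \<rho>, of 0] by auto
    have "norm (inverse_fourier ?r y) \<le> C" for y
      using C by (simp add: inverse_fourier_test_function[OF \<rho>] trig_kernel_parity(1)[of \<rho>, OF even] complex_norm)
    moreover have [measurable]: "inverse_fourier ?r \<in> borel_measurable borel"
      using integrable_trig_kernel(3)[OF \<rho>] by auto
    have "(\<lambda>y. inverse_fourier ?r (x - y)) \<in> borel_measurable lborel" by measurable
    ultimately show ?thesis
      by (intro integrable_mult_bounded(2)[OF int(3), where B=C])
  qed
  show "(LINT y|lborel. cosk \<rho> (x - y) * cosk \<sigma> y) = mass * cosk (\<lambda>\<xi>. \<rho> \<xi> * \<sigma> \<xi>) x"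
    "(LINT y|lborel. cosk \<rho> (x - y) * sink \<sigma> y) = mass * sink (\<lambda>\<xi>. \<rho> \<xi> * \<sigma> \<xi>) x"
    using integral_Re[OF i] integral_Im[OF i] eq by (simp_all add: r)
qed

text \<open>If \<open>mass\<close> vanished, the kernel of \<open>chi\<close> convolved with itself
  would vanish at 0. That kernel is even, so its square would have integral 0 and the kernel would
  vanish identically. But its value at 0 is a positive multiple of the integral of
  \<open>chi\<close>, a nonnegative continuous function equal to 1 at the origin.\<close>

lemma mass_nonzero: "mass \<noteq> 0"
proof
  assume "mass = 0"
  then have z: "(LINT y|lborel. cosk chi y * cosk chi y) = 0"
    using trig_kernel_convolution(1)[OF test_chi chi_even test_chi, of 0] by (simp add: trig_kernel_minus)
  have cont: "continuous_on UNIV (cosk chi)"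
    using smooth_trig_kernel(1)[OF test_chi] unfolding smooth_fun_def using C_k.simps(1) by blast
  obtain C where C: "C \<ge> 0" "\<And>x. \<bar>cosk chi x\<bar> \<le> C"
    using trig_kernel_decay[OF test_chi, of 0] by auto
  have i: "integrable lborel (\<lambda>y. cosk chi y * cosk chi y)"
    using integrable_trig_kernel[OF test_chi] C by (intro integrable_mult_bounded(1)[where B=C]) auto
  have "AE y in lborel. cosk chi y * cosk chi y = 0"
    using integral_nonneg_eq_0_iff_AE[OF i] z by simp
  then have ae: "AE y in lborel. cosk chi y = 0" by simp
  have "cosk chi 0 = 0" by (rule AE_zero_continuous[OF ae cont])
  then have "(LINT \<xi>|lborel. chi \<xi>) = 0" by (simp add: cosk_def)
  then have "AE \<xi> in lborel. chi \<xi> = 0"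
    using integral_nonneg_eq_0_iff_AE[OF test_function_integrable[OF test_chi]] by simp
  then have "chi 0 = 0" by (rule AE_zero_continuous) (rule test_function_continuous[OF test_chi])
  then show False by simp
qed

end

subsection \<open>The Fourier transform on L2\<close>

lemma norm_integral_le_nn_integral:
  fixes f :: "'a \<Rightarrow> 'b :: {banach, second_countable_topology}"
  shows "ennreal (norm (integral\<^sup>L M f)) \<le> (\<integral>\<^sup>+x. ennreal (norm (f x)) \<partial>M)"
  by (cases "integrable M f") (auto simp: integral_norm_bound_ennreal not_integrable_integral_eq)

lemma nn_integral_convolution:
  fixes k p :: "R3 \<Rightarrow> ennreal"
  assumes [measurable]: "k \<in> borel_measurable borel" "p \<in> borel_measurable borel"
  shows "(\<integral>\<^sup>+x. \<integral>\<^sup>+y. k (x - y) * p x \<partial>lborel \<partial>lborel) = (\<integral>\<^sup>+x. k x \<partial>lborel) * (\<integral>\<^sup>+x. p x \<partial>lborel)"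
    "(\<integral>\<^sup>+x. \<integral>\<^sup>+y. k (x - y) * p y \<partial>lborel \<partial>lborel) = (\<integral>\<^sup>+x. k x \<partial>lborel) * (\<integral>\<^sup>+x. p x \<partial>lborel)"
proof -
  note t = nn_integral_translate[OF \<open>k \<in> borel_measurable borel\<close>]
  show "(\<integral>\<^sup>+x. \<integral>\<^sup>+y. k (x - y) * p x \<partial>lborel \<partial>lborel) = (\<integral>\<^sup>+x. k x \<partial>lborel) * (\<integral>\<^sup>+x. p x \<partial>lborel)"
    by (simp add: nn_integral_multc nn_integral_cmult t)
  have "(\<integral>\<^sup>+x. \<integral>\<^sup>+y. k (x - y) * p y \<partial>lborel \<partial>lborel) = (\<integral>\<^sup>+y. \<integral>\<^sup>+x. k (x - y) * p y \<partial>lborel \<partial>lborel)"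
    by (rule lborel_pair.Fubini') (simp add: split_beta')
  also have "\<dots> = (\<integral>\<^sup>+x. k x \<partial>lborel) * (\<integral>\<^sup>+x. p x \<partial>lborel)"
    by (simp add: nn_integral_multc nn_integral_cmult t)
  finally show "(\<integral>\<^sup>+x. \<integral>\<^sup>+y. k (x - y) * p y \<partial>lborel \<partial>lborel) = (\<integral>\<^sup>+x. k x \<partial>lborel) * (\<integral>\<^sup>+x. p x \<partial>lborel)" .
qed

lemma test_function_dilation: "test_function \<rho> \<Longrightarrow> l > 0 \<Longrightarrow> test_function (\<lambda>\<xi>. \<rho> (\<xi> /\<^sub>R l))"
  by (rule test_function_scaleR) auto

text \<open>Invariance under dilation makes the constant in \<open>bessel\<close> independent of the
  scale of the cutoff.\<close>

lemma nn_integral_cosk_scale: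
  assumes "test_function \<rho>" "l > 0"
  shows "(\<integral>\<^sup>+x. ennreal \<bar>cosk (\<lambda>\<xi>. \<rho> (\<xi> /\<^sub>R l)) x\<bar> \<partial>lborel) = ennreal (LINT x|lborel. \<bar>cosk \<rho> x\<bar>)"
proof -
  note [measurable] = integrable_trig_kernel(4)[OF assms(1)]
  have "(\<integral>\<^sup>+x. ennreal \<bar>cosk (\<lambda>\<xi>. \<rho> (\<xi> /\<^sub>R l)) x\<bar> \<partial>lborel) = (\<integral>\<^sup>+x. ennreal (\<bar>l\<bar> ^ 3) * ennreal \<bar>cosk \<rho> (l *\<^sub>R x)\<bar> \<partial>lborel)"
    using assms(2) by (simp add: trig_kernel_scale abs_mult ennreal_mult)
  also have "\<dots> = ennreal (\<bar>l\<bar> ^ 3) * (\<integral>\<^sup>+x. ennreal \<bar>cosk \<rho> (0 + l *\<^sub>R x)\<bar> \<partial>lborel)"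
    by (simp add: nn_integral_cmult)
  also have "\<dots> = (\<integral>\<^sup>+x. ennreal \<bar>cosk \<rho> x\<bar> \<partial>lborel)"
    using assms(2) by (intro nn_integral_affine3[symmetric]) auto
  also have "\<dots> = ennreal (LINT x|lborel. \<bar>cosk \<rho> x\<bar>)"
    using integrable_trig_kernel(1)[OF assms(1)] by (intro nn_integral_eq_integral) auto
  finally show ?thesis .
qed

lemma integrable_truncation:
  fixes f :: "R3 \<Rightarrow> complex"
  assumes [measurable]: "f \<in> borel_measurable borel" and f2: "integrable lborel (\<lambda>x. (cmod (f x))\<^sup>2)"
  shows "integrable lborel (\<lambda>x. indicator (cball 0 R) x * f x)"
proof (rule Bochner_Integration.integrable_bound)
  have [measurable]: "cball 0 R \<in> sets (borel :: R3 measure)" by simp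
  show "integrable lborel (\<lambda>x::R3. indicator (cball 0 R) x + (cmod (f x))\<^sup>2)"
    by (intro Bochner_Integration.integrable_add f2 integrable_real_indicator)
      (auto simp: emeasure_lborel_cball_finite[unfolded infinity_ennreal_def])
  show "AE x in lborel. norm (indicator (cball 0 R) x * f x) \<le> norm (indicator (cball 0 R) x + (cmod (f x))\<^sup>2)"
  proof (rule AE_I2)
    fix x
    have "cmod (f x) \<le> 1 + (cmod (f x))\<^sup>2"
      using sum_squares_ge_zero[of "cmod (f x) - 1" 0] by (simp add: power2_eq_square algebra_simps) (smt (verit) norm_ge_zero)
    then show "norm (indicator (cball 0 R) x * f x) \<le> norm (indicator (cball 0 R) x + (cmod (f x))\<^sup>2)"
      by (simp add: norm_mult indicator_def)
  qed
  show "(\<lambda>x. indicator (cball 0 R) x * f x) \<in> borel_measurable lborel" by measurable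
qed

context cutoff
begin

text \<open>The power of 2 pi comes from the normalisation of \<open>inverse_fourier\<close>, the
  integral is the L1 norm of the cutoff kernel, and the leading 2 comes from bounding |f(x) f(y)| by
  the sum of the two squares.\<close>

definition "bessel_const = 2 * (2 * pi) ^ 3 * (LINT x|lborel. \<bar>cosk chi x\<bar>)"

text \<open>With the weight \<open>chi\<close> at scale l, the frequency integral converges
  absolutely and equals (2 pi)^3 times the quadratic form of the cutoff kernel in f. The L1 norm of
  the kernel bounds this form uniformly in l, and Fatou removes the weight as l tends to
  infinity.\<close>

lemma bessel:
  fixes f :: "R3 \<Rightarrow> complex"
  assumes f: "integrable lborel f"
  shows "(\<integral>\<^sup>+\<xi>. ennreal ((cmod (fourier_L1 f \<xi>))\<^sup>2) \<partial>lborel) \<le> ennreal bessel_const * (\<integral>\<^sup>+x. ennreal ((cmod (f x))\<^sup>2) \<partial>lborel)"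
proof -
  have [measurable]: "f \<in> borel_measurable borel" using f by auto
  note [measurable] = test_function_measurable[OF test_chi]
  let ?F = "fourier_L1 f" and ?p = "(2 * pi) ^ 3 :: real"
  let ?N = "\<integral>\<^sup>+x. ennreal ((cmod (f x))\<^sup>2) \<partial>lborel"
  have p0: "?p \<ge> 0" by simp
  have bound: "(\<integral>\<^sup>+\<xi>. ennreal (chi (\<xi> /\<^sub>R l) * (cmod (?F \<xi>))\<^sup>2) \<partial>lborel) \<le> ennreal bessel_const * ?N" if "l > 0" for l
  proof -
    let ?\<rho> = "\<lambda>\<xi>. chi (\<xi> /\<^sub>R l)"
    let ?r = "\<lambda>\<xi>. complex_of_real (?\<rho> \<xi>)"
    have t: "test_function ?\<rho>" using that by (rule test_function_dilation[OF test_chi])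
    note [measurable] = test_function_measurable[OF t] integrable_trig_kernel(4)[OF t]
    have ir: "integrable lborel ?r" using test_function_integrable[OF t] by simp
    let ?B = "LINT x|lborel. cmod (f x)"
    have irF: "integrable lborel (\<lambda>\<xi>. ?r \<xi> * ?F \<xi>)"
      by (rule integrable_mult_bounded(1)[OF ir, where B="?B"]) (auto intro: norm_fourier_L1_le f)
    have irFF: "integrable lborel (\<lambda>\<xi>. ?\<rho> \<xi> * (cmod (?F \<xi>))\<^sup>2)"
      by (rule integrable_mult_bounded(1)[OF test_function_integrable[OF t], where B="?B\<^sup>2"])
         (auto intro!: power_mono norm_fourier_L1_le f)
    have k: "inverse_fourier ?r x = complex_of_real (cosk ?\<rho> x)" for x
      using inverse_fourier_test_function[OF t] trig_kernel_parity(1)[of ?\<rho>] by (simp add: complex_eq_iff)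
    have "complex_of_real (LINT \<xi>|lborel. ?\<rho> \<xi> * (cmod (?F \<xi>))\<^sup>2) = (LINT \<xi>|lborel. (?r \<xi> * ?F \<xi>) * (LINT x|lborel. cnj (f x) * cis (\<xi> \<bullet> x)))"
      unfolding integral_complex_of_real[symmetric]
    proof (intro Bochner_Integration.integral_cong refl)
      fix \<xi>
      have "(LINT x|lborel. cnj (f x) * cis (\<xi> \<bullet> x)) = (LINT x|lborel. cnj (cis (- (\<xi> \<bullet> x)) * f x))"
        by (simp add: cis_cnj mult.commute)
      also have "\<dots> = cnj (?F \<xi>)"
        by (simp only: Bochner_Integration.integral_cnj fourier_lborel[OF \<open>f \<in> borel_measurable borel\<close>])
      finally show "complex_of_real (?\<rho> \<xi> * (cmod (?F \<xi>))\<^sup>2) = (?r \<xi> * ?F \<xi>) * (LINT x|lborel. cnj (f x) * cis (\<xi> \<bullet> x))"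
        by (simp add: mult.assoc complex_norm_square[symmetric] del: of_real_power) 
    qed
    also have "\<dots> = (LINT x|lborel. cnj (f x) * (LINT \<xi>|lborel. (?r \<xi> * ?F \<xi>) * cis (\<xi> \<bullet> x)))"
      using f by (intro integral_swap_bounded[OF irF, where B=1]) (auto simp: split_beta')
    also have "\<dots> = (LINT x|lborel. cnj (f x) * (of_real ?p * (LINT y|lborel. of_real (cosk ?\<rho> (x - y)) * f y)))"
    proof (intro Bochner_Integration.integral_cong refl arg_cong2[where f="(*)"])
      fix x
      have "(LINT y|lborel. of_real (cosk ?\<rho> (x - y)) * f y) = inverse_fourier (\<lambda>\<xi>. ?r \<xi> * ?F \<xi>) x"
        using inverse_fourier_mult_L1[OF ir f, of x] by (simp add: k)
      also have "\<dots> = (LINT \<xi>|lborel. (?r \<xi> * ?F \<xi>) * cis (\<xi> \<bullet> x)) / of_real ?p"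
        by (subst fourier_lborel(2)) (auto simp: mult_ac)
      finally show "(LINT \<xi>|lborel. (?r \<xi> * ?F \<xi>) * cis (\<xi> \<bullet> x)) = of_real ?p * (LINT y|lborel. of_real (cosk ?\<rho> (x - y)) * f y)"
        by simp
    qed
    finally have eq: "complex_of_real (LINT \<xi>|lborel. ?\<rho> \<xi> * (cmod (?F \<xi>))\<^sup>2) = \<dots>" .
    have "(\<integral>\<^sup>+\<xi>. ennreal (?\<rho> \<xi> * (cmod (?F \<xi>))\<^sup>2) \<partial>lborel) = ennreal (LINT \<xi>|lborel. ?\<rho> \<xi> * (cmod (?F \<xi>))\<^sup>2)"
      by (intro nn_integral_eq_integral irFF) auto
    also have "\<dots> = ennreal (norm (complex_of_real (LINT \<xi>|lborel. ?\<rho> \<xi> * (cmod (?F \<xi>))\<^sup>2)))"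
      by (subst norm_of_real, subst abs_of_nonneg) (auto intro!: integral_nonneg)
    also have "\<dots> \<le> (\<integral>\<^sup>+x. ennreal (norm (cnj (f x) * (of_real ?p * (LINT y|lborel. of_real (cosk ?\<rho> (x - y)) * f y)))) \<partial>lborel)"
      unfolding eq by (rule norm_integral_le_nn_integral)
    also have "\<dots> \<le> (\<integral>\<^sup>+x. ennreal ?p * (\<integral>\<^sup>+y. ennreal \<bar>cosk ?\<rho> (x - y)\<bar> * ennreal ((cmod (f x))\<^sup>2) + ennreal \<bar>cosk ?\<rho> (x - y)\<bar> * ennreal ((cmod (f y))\<^sup>2) \<partial>lborel) \<partial>lborel)"
    proof (rule nn_integral_mono)
      fix x
      let ?I = "LINT y|lborel. of_real (cosk ?\<rho> (x - y)) * f y"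
      have "norm (cnj (f x) * (of_real ?p * ?I)) = ?p * norm (cnj (f x) * ?I)"
        by (simp only: norm_mult norm_of_real abs_of_nonneg[OF p0] mult.left_commute[of "norm (cnj (f x))"])
      also have "cnj (f x) * ?I = (LINT y|lborel. cnj (f x) * (of_real (cosk ?\<rho> (x - y)) * f y))"
        by (rule integral_mult_right_zero[symmetric])
      finally have "ennreal (norm (cnj (f x) * (of_real ?p * ?I)))
         = ennreal ?p * ennreal (norm (LINT y|lborel. cnj (f x) * (of_real (cosk ?\<rho> (x - y)) * f y)))"
        by (simp only: ennreal_mult[OF p0 norm_ge_zero])
      also have "\<dots> \<le> ennreal ?p * (\<integral>\<^sup>+y. ennreal (norm (cnj (f x) * (of_real (cosk ?\<rho> (x - y)) * f y))) \<partial>lborel)"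
        by (intro mult_left_mono norm_integral_le_nn_integral) auto
      also have "\<dots> \<le> ennreal ?p * (\<integral>\<^sup>+y. ennreal \<bar>cosk ?\<rho> (x - y)\<bar> * ennreal ((cmod (f x))\<^sup>2) + ennreal \<bar>cosk ?\<rho> (x - y)\<bar> * ennreal ((cmod (f y))\<^sup>2) \<partial>lborel)"
      proof (intro mult_left_mono nn_integral_mono)
        fix y
        have "cmod (f x) * cmod (f y) \<le> (cmod (f x))\<^sup>2 + (cmod (f y))\<^sup>2"
          using sum_squares_bound[of "cmod (f x)" "cmod (f y)"] mult_nonneg_nonneg[OF norm_ge_zero norm_ge_zero, of "f x" "f y"]
          unfolding mult.assoc by linarith
        then have "\<bar>cosk ?\<rho> (x - y)\<bar> * (cmod (f x) * cmod (f y)) \<le> \<bar>cosk ?\<rho> (x - y)\<bar> * ((cmod (f x))\<^sup>2 + (cmod (f y))\<^sup>2)"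
          by (intro mult_left_mono) auto
        then show "ennreal (norm (cnj (f x) * (of_real (cosk ?\<rho> (x - y)) * f y))) \<le>
          ennreal \<bar>cosk ?\<rho> (x - y)\<bar> * ennreal ((cmod (f x))\<^sup>2) + ennreal \<bar>cosk ?\<rho> (x - y)\<bar> * ennreal ((cmod (f y))\<^sup>2)"
          by (simp add: norm_mult ennreal_mult[symmetric] ennreal_plus[symmetric] algebra_simps del: ennreal_plus)
      qed auto
      finally show "ennreal (norm (cnj (f x) * (of_real ?p * (LINT y|lborel. of_real (cosk ?\<rho> (x - y)) * f y)))) \<le> \<dots>" .
    qed
    also have "\<dots> = ennreal ?p * ((\<integral>\<^sup>+x. ennreal \<bar>cosk ?\<rho> x\<bar> \<partial>lborel) * ?N + (\<integral>\<^sup>+x. ennreal \<bar>cosk ?\<rho> x\<bar> \<partial>lborel) * ?N)"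
      using nn_integral_convolution[of "\<lambda>x. ennreal \<bar>cosk ?\<rho> x\<bar>" "\<lambda>x. ennreal ((cmod (f x))\<^sup>2)"]
      by (simp add: nn_integral_cmult nn_integral_add)
    also have "\<dots> = ennreal bessel_const * ?N"
    proof -
      have "ennreal p * (ennreal K * N + ennreal K * N) = ennreal (2 * p * K) * N"
        if "0 \<le> p" "0 \<le> K" for p K :: real and N :: ennreal
        using that by (simp add: ennreal_mult mult_2[symmetric] mult_ac)
      from this[OF p0] show ?thesis
        unfolding nn_integral_cosk_scale[OF test_chi that] bessel_const_def by simp
    qed
    finally show ?thesis .
  qed
  have "(\<integral>\<^sup>+\<xi>. ennreal ((cmod (?F \<xi>))\<^sup>2) \<partial>lborel) = (\<integral>\<^sup>+\<xi>. liminf (\<lambda>n. ennreal (chi (\<xi> /\<^sub>R real (Suc n)) * (cmod (?F \<xi>))\<^sup>2)) \<partial>lborel)"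
  proof (intro nn_integral_cong lim_imp_Liminf[symmetric])
    fix \<xi> :: R3
    have "(\<lambda>n. inverse (real (Suc n)) *\<^sub>R \<xi>) \<longlonglongrightarrow> 0 *\<^sub>R \<xi>"
      by (rule tendsto_scaleR[OF LIMSEQ_inverse_real_of_nat tendsto_const])
    then have "(\<lambda>n. chi (\<xi> /\<^sub>R real (Suc n))) \<longlonglongrightarrow> chi (0 *\<^sub>R \<xi>)"
      by (intro continuous_on_tendsto_compose[OF test_function_continuous[OF test_chi]]) auto
    then have "(\<lambda>n. chi (\<xi> /\<^sub>R real (Suc n)) * (cmod (?F \<xi>))\<^sup>2) \<longlonglongrightarrow> chi (0 *\<^sub>R \<xi>) * (cmod (?F \<xi>))\<^sup>2"
      by (intro tendsto_intros)
    then show "(\<lambda>n. ennreal (chi (\<xi> /\<^sub>R real (Suc n)) * (cmod (?F \<xi>))\<^sup>2)) \<longlonglongrightarrow> ennreal ((cmod (?F \<xi>))\<^sup>2)"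
      by (intro tendsto_ennrealI) simp
  qed auto
  also have "\<dots> \<le> liminf (\<lambda>n. \<integral>\<^sup>+\<xi>. ennreal (chi (\<xi> /\<^sub>R real (Suc n)) * (cmod (?F \<xi>))\<^sup>2) \<partial>lborel)"
    by (intro nn_integral_liminf) measurable
  also have "\<dots> \<le> liminf (\<lambda>n. ennreal bessel_const * ?N)"
    by (intro Liminf_mono always_eventually allI bound) simp
  also have "\<dots> = ennreal bessel_const * ?N" by (simp add: Liminf_const)
  finally show ?thesis .
qed


lemma fourier_L1_diff:
  fixes f g :: "R3 \<Rightarrow> complex"
  assumes "integrable lborel f" "integrable lborel g"
  shows "fourier_L1 (\<lambda>x. f x - g x) \<xi> = fourier_L1 f \<xi> - fourier_L1 g \<xi>"
proof -
  have [measurable]: "f \<in> borel_measurable borel" "g \<in> borel_measurable borel" using assms by auto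
  have "integrable lborel (\<lambda>x. cis (- (\<xi> \<bullet> x)) * f x)" "integrable lborel (\<lambda>x. cis (- (\<xi> \<bullet> x)) * g x)"
    using assms by (auto intro!: integrable_mult_bounded(2)[where B=1])
  then show ?thesis by (simp add: fourier_lborel right_diff_distrib)
qed

lemma weighted_square_bound:
  fixes a b c :: real
  assumes "a * b = 1" "0 \<le> b"
  shows "2 * c \<le> a + b * c\<^sup>2"
proof -
  have "0 \<le> b * (a - c)\<^sup>2" using assms by simp
  also have "\<dots> = (a * b) * a - 2 * (a * b) * c + b * c\<^sup>2"
    by (simp add: power2_eq_square algebra_simps)
  finally show ?thesis using assms by simp
qed

text \<open>Outside L1 the value of \<open>fourier\<close> is a choice, so a witness must exist
  before anything is known about it. By \<open>bessel\<close> the transforms of the truncations are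
  Cauchy in L2; a rapidly converging subsequence has an almost everywhere limit, and Fatou makes
  this the L2 limit of the whole family.\<close>

lemma fourier_L2_exists:
  fixes f :: "R3 \<Rightarrow> complex"
  assumes [measurable]: "f \<in> borel_measurable borel" and f2: "integrable lborel (\<lambda>x. (cmod (f x))\<^sup>2)"
  shows "\<exists>g. is_fourier_L2 f g"
proof -
  have [measurable]: "cball 0 R \<in> sets (borel :: R3 measure)" for R by simp
  let ?f = "\<lambda>R x. indicator (cball 0 R) x * f x"
  define F where "F R = fourier_L1 (?f R)" for R
  note it = integrable_truncation[OF assms]
  have [measurable]: "F R \<in> borel_measurable borel" for R unfolding F_def by measurable
  define T where "T R = (LINT x|lborel. indicator (- cball 0 R) x * (cmod (f x))\<^sup>2)" for R
  have iT: "integrable lborel (\<lambda>x. indicator (- cball 0 R) x * (cmod (f x))\<^sup>2)" for R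
    by (rule integrable_mult_bounded(2)[OF f2, where B=1]) (auto simp: indicator_def)
  have T0: "T R \<ge> 0" for R unfolding T_def by simp
  have Tanti: "T S \<le> T R" if "R \<le> S" for R S
    unfolding T_def using that by (intro integral_mono iT) (auto simp: indicator_def)
  have Tlim: "(T \<longlongrightarrow> 0) at_top"
  proof -
    have "((\<lambda>R. LINT x|lborel. indicator (- cball 0 R) x * (cmod (f x))\<^sup>2) \<longlongrightarrow> integral\<^sup>L lborel (\<lambda>x::R3. 0::real)) at_top"
    proof (rule integral_dominated_convergence_at_top[where w="\<lambda>x. (cmod (f x))\<^sup>2"])
      show "AE x in lborel. ((\<lambda>R. indicator (- cball 0 R) x * (cmod (f x))\<^sup>2) \<longlongrightarrow> 0) at_top"
      proof (rule AE_I2)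
        fix x :: R3
        have "\<forall>\<^sub>F R in at_top. indicator (- cball 0 R) x * (cmod (f x))\<^sup>2 = 0"
          using eventually_ge_at_top[of "norm x"] by eventually_elim auto
        then show "((\<lambda>R. indicator (- cball 0 R) x * (cmod (f x))\<^sup>2) \<longlongrightarrow> 0) at_top"
          by (rule tendsto_eventually)
      qed
      show "\<forall>\<^sub>F R in at_top. AE x in lborel. norm (indicator (- cball 0 R) x * (cmod (f x))\<^sup>2) \<le> (cmod (f x))\<^sup>2"
        by (intro always_eventually allI AE_I2) (auto simp: indicator_def)
    qed (use f2 in auto)
    then show ?thesis by (simp add: T_def[abs_def])
  qed
  let ?D = "\<lambda>a b. \<integral>\<^sup>+\<xi>. ennreal ((cmod (F a \<xi> - F b \<xi>))\<^sup>2) \<partial>lborel"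
  have D: "?D a b \<le> ennreal (bessel_const * T (min a b))" for a b
  proof -
    have b0: "bessel_const \<ge> 0" by (simp add: bessel_const_def)
    have "?D a b \<le> ennreal bessel_const * (\<integral>\<^sup>+x. ennreal ((cmod (?f a x - ?f b x))\<^sup>2) \<partial>lborel)"
      using bessel[of "\<lambda>x. ?f a x - ?f b x"] it by (simp add: fourier_L1_diff[OF it it] F_def)
    also have "\<dots> \<le> ennreal bessel_const * (\<integral>\<^sup>+x. ennreal (indicator (- cball 0 (min a b)) x * (cmod (f x))\<^sup>2) \<partial>lborel)"
      by (intro mult_left_mono nn_integral_mono ennreal_leI) (auto simp: indicator_def)
    also have "\<dots> = ennreal (bessel_const * T (min a b))"
      unfolding T_def by (subst nn_integral_eq_integral[OF iT]) (auto simp: ennreal_mult b0)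
    finally show ?thesis .
  qed
  \<comment> \<open>Tails of size 8^(-k) allow the squared increments to carry the weight 2^k and
    still have integrals of order 4^(-k).\<close>
  have "\<exists>R\<ge>real k. T R \<le> (1/8) ^ k" for k
  proof -
    have "\<forall>\<^sub>F R in at_top. T R < (1/8) ^ k" by (rule order_tendstoD(2)[OF Tlim]) simp
    from eventually_conj[OF this eventually_ge_at_top[of "real k"]]
    obtain R where "T R < (1/8) ^ k" "real k \<le> R" by (auto simp: eventually_at_top_linorder)
    then show ?thesis by (intro exI[of _ R]) simp
  qed
  then obtain R where R: "\<And>k. R k \<ge> real k" "\<And>k. T (R k) \<le> (1/8) ^ k" by metis
  let ?e = "\<lambda>k \<xi>. F (R (Suc k)) \<xi> - F (R k) \<xi>"
  have "(\<integral>\<^sup>+\<xi>. (\<Sum>k. ennreal (2 ^ k * (cmod (?e k \<xi>))\<^sup>2)) \<partial>lborel) = (\<Sum>k. ennreal (2 ^ k) * ?D (R (Suc k)) (R k))"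
    by (subst nn_integral_suminf) (auto simp: ennreal_mult nn_integral_cmult)
  also have "\<dots> \<le> (\<Sum>k. ennreal (bessel_const * (1/4) ^ k))"
  proof (intro suminf_le summableI)
    fix k
    have "T (min (R (Suc k)) (R k)) \<le> (1/8) ^ k"
      using R(2)[of k] R(2)[of "Suc k"] T0[of "R (Suc k)"] by (auto simp: min_def)
    then have "bessel_const * T (min (R (Suc k)) (R k)) \<le> bessel_const * (1/8) ^ k"
      by (intro mult_left_mono) (auto simp: bessel_const_def)
    then have "?D (R (Suc k)) (R k) \<le> ennreal (bessel_const * (1/8) ^ k)"
      by (intro order_trans[OF D] ennreal_leI)
    then have "ennreal (2 ^ k) * ?D (R (Suc k)) (R k) \<le> ennreal (2 ^ k) * ennreal (bessel_const * (1/8) ^ k)"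
      by (intro mult_left_mono) auto
    also have "\<dots> = ennreal (2 ^ k * (bessel_const * (1/8) ^ k))"
      by (rule ennreal_mult'[symmetric]) simp
    also have "2 ^ k * (bessel_const * (1/8) ^ k) = bessel_const * (1/4) ^ k"
    proof -
      have "(2::real) ^ k * (1/8) ^ k = (2 * (1/8)) ^ k" by (rule power_mult_distrib[symmetric])
      also have "2 * (1/8) = (1/4::real)" by simp
      finally show ?thesis by (metis mult.left_commute)
    qed
    finally show "ennreal (2 ^ k) * ?D (R (Suc k)) (R k) \<le> ennreal (bessel_const * (1/4) ^ k)" .
  qed
  also have "\<dots> < \<infinity>"
  proof (rule suminf_ennreal_less_top)
    show "summable (\<lambda>k. bessel_const * (1/4) ^ k)" by (intro summable_mult summable_geometric) simp
    show "0 \<le> bessel_const * (1/4) ^ k" for k by (intro mult_nonneg_nonneg) (auto simp: bessel_const_def)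
  qed
  finally have "AE \<xi> in lborel. (\<Sum>k. ennreal (2 ^ k * (cmod (?e k \<xi>))\<^sup>2)) \<noteq> \<infinity>"
    by (intro nn_integral_PInf_AE) auto
  then have conv: "AE \<xi> in lborel. convergent (\<lambda>k. F (R k) \<xi>)"
  proof eventually_elim
    case (elim \<xi>)
    then have s: "summable (\<lambda>k. 2 ^ k * (cmod (?e k \<xi>))\<^sup>2)"
      by (intro summable_suminf_not_top) auto
    have "summable (\<lambda>k. norm (?e k \<xi>))"
    proof (rule summable_comparison_test')
      show "summable (\<lambda>k. (1/2) ^ k + 2 ^ k * (cmod (?e k \<xi>))\<^sup>2)"
        by (intro summable_add s summable_geometric) simp
      fix k
      have "(1/2::real) ^ k * 2 ^ k = 1" by (simp flip: power_mult_distrib)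
      \<comment> \<open>The weight 2^k turns summability of squares into summability of first
        powers.\<close>
      then have "2 * cmod (?e k \<xi>) \<le> (1/2) ^ k + 2 ^ k * (cmod (?e k \<xi>))\<^sup>2"
        by (rule weighted_square_bound) simp
      then show "norm (norm (?e k \<xi>)) \<le> (1/2) ^ k + 2 ^ k * (cmod (?e k \<xi>))\<^sup>2"
        using norm_ge_zero[of "?e k \<xi>"] by (simp del: norm_ge_zero)
    qed
    then have "summable (\<lambda>k. ?e k \<xi>)" by (rule summable_norm_cancel)
    then have "convergent (\<lambda>n. \<Sum>k<n. ?e k \<xi>)" by (simp add: summable_iff_convergent)
    then have "convergent (\<lambda>n. F (R n) \<xi> - F (R 0) \<xi>)" using sum_lessThan_telescope[of "\<lambda>k. F (R k) \<xi>"] by simp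
    then show ?case using convergent_add[OF _ convergent_const[of "F (R 0) \<xi>"]] by force
  qed
  define g where "g \<xi> = lim (\<lambda>k. F (R k) \<xi>)" for \<xi>
  have [measurable]: "g \<in> borel_measurable borel"
    unfolding g_def[abs_def] by (rule borel_measurable_lim_metric) measurable
  have Dg: "(\<integral>\<^sup>+\<xi>. ennreal ((cmod (F a \<xi> - g \<xi>))\<^sup>2) \<partial>lborel) \<le> ennreal (bessel_const * T a)" for a
  proof -
    have "(\<integral>\<^sup>+\<xi>. ennreal ((cmod (F a \<xi> - g \<xi>))\<^sup>2) \<partial>lborel) =
      (\<integral>\<^sup>+\<xi>. liminf (\<lambda>k. ennreal ((cmod (F a \<xi> - F (R k) \<xi>))\<^sup>2)) \<partial>lborel)"
    proof (rule nn_integral_cong_AE, use conv in eventually_elim)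
      case (elim \<xi>)
      then have "(\<lambda>k. F (R k) \<xi>) \<longlonglongrightarrow> g \<xi>" by (simp add: g_def convergent_LIMSEQ_iff)
      then have "(\<lambda>k. ennreal ((cmod (F a \<xi> - F (R k) \<xi>))\<^sup>2)) \<longlonglongrightarrow> ennreal ((cmod (F a \<xi> - g \<xi>))\<^sup>2)"
        by (intro tendsto_intros tendsto_ennrealI)
      then show ?case by (intro lim_imp_Liminf[symmetric]) auto
    qed
    also have "\<dots> \<le> liminf (\<lambda>k. ?D a (R k))"
      by (intro nn_integral_liminf) measurable
    also have "\<dots> \<le> liminf (\<lambda>k. ennreal (bessel_const * T a))"
    proof (rule Liminf_mono)
      have "\<forall>\<^sub>F k in sequentially. real k \<ge> a"
        using filterlim_real_sequentially by (auto simp: filterlim_at_top)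
      then show "\<forall>\<^sub>F k in sequentially. ?D a (R k) \<le> ennreal (bessel_const * T a)"
      proof eventually_elim
        case (elim k)
        then have "min a (R k) = a" using R(1)[of k] by simp
        then show ?case using D[of a "R k"] by simp
      qed
    qed
    also have "\<dots> = ennreal (bessel_const * T a)" by (simp add: Liminf_const)
    finally show ?thesis .
  qed
  have "(\<integral>\<^sup>+\<xi>. ennreal ((cmod (g \<xi>))\<^sup>2) \<partial>lborel) \<le>
     (\<integral>\<^sup>+\<xi>. 2 * ennreal ((cmod (F 0 \<xi>))\<^sup>2) + 2 * ennreal ((cmod (F 0 \<xi> - g \<xi>))\<^sup>2) \<partial>lborel)"
  proof (rule nn_integral_mono)
    fix \<xi>
    have "cmod (g \<xi>) \<le> cmod (F 0 \<xi>) + cmod (F 0 \<xi> - g \<xi>)"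
      by (metis add_diff_cancel_left' diff_add_cancel norm_minus_commute norm_triangle_sub add.commute)
    then have "(cmod (g \<xi>))\<^sup>2 \<le> (cmod (F 0 \<xi>) + cmod (F 0 \<xi> - g \<xi>))\<^sup>2" by (intro power_mono) auto
    also have "\<dots> \<le> 2 * (cmod (F 0 \<xi>))\<^sup>2 + 2 * (cmod (F 0 \<xi> - g \<xi>))\<^sup>2"
      using sum_squares_bound[of "cmod (F 0 \<xi>)" "cmod (F 0 \<xi> - g \<xi>)"] by (simp add: power2_sum)
    finally have "ennreal ((cmod (g \<xi>))\<^sup>2) \<le> ennreal (2 * (cmod (F 0 \<xi>))\<^sup>2 + 2 * (cmod (F 0 \<xi> - g \<xi>))\<^sup>2)"
      by (rule ennreal_leI)
    then show "ennreal ((cmod (g \<xi>))\<^sup>2) \<le> 2 * ennreal ((cmod (F 0 \<xi>))\<^sup>2) + 2 * ennreal ((cmod (F 0 \<xi> - g \<xi>))\<^sup>2)"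
      by (simp add: ennreal_mult')
  qed
  also have "\<dots> = 2 * (\<integral>\<^sup>+\<xi>. ennreal ((cmod (F 0 \<xi>))\<^sup>2) \<partial>lborel) + 2 * (\<integral>\<^sup>+\<xi>. ennreal ((cmod (F 0 \<xi> - g \<xi>))\<^sup>2) \<partial>lborel)"
    by (simp add: nn_integral_add nn_integral_cmult)
  also have "\<dots> < \<infinity>"
  proof -
    have "(\<integral>\<^sup>+\<xi>. ennreal ((cmod (F 0 \<xi> - g \<xi>))\<^sup>2) \<partial>lborel) < \<infinity>"
      using Dg[of 0] by (rule order_le_less_trans) (simp add: ennreal_less_top)
    moreover have "(\<integral>\<^sup>+\<xi>. ennreal ((cmod (F 0 \<xi>))\<^sup>2) \<partial>lborel) < \<infinity>"
    proof -
      have "(\<integral>\<^sup>+\<xi>. ennreal ((cmod (F 0 \<xi>))\<^sup>2) \<partial>lborel) \<le> ennreal bessel_const * (\<integral>\<^sup>+x. ennreal ((cmod (?f 0 x))\<^sup>2) \<partial>lborel)"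
        unfolding F_def by (rule bessel[OF it])
      also have "\<dots> \<le> ennreal bessel_const * (\<integral>\<^sup>+x. ennreal ((cmod (f x))\<^sup>2) \<partial>lborel)"
        by (intro mult_left_mono nn_integral_mono ennreal_leI) (auto simp: indicator_def)
      also have "\<dots> < \<infinity>"
        by (subst nn_integral_eq_integral[OF f2]) (auto simp: ennreal_mult_less_top)
      finally show ?thesis .
    qed
    ultimately show ?thesis by (simp add: ennreal_mult_less_top)
  qed
  finally have "integrable lborel (\<lambda>\<xi>. (cmod (g \<xi>))\<^sup>2)" by (intro integrableI_nonneg) auto
  then have "L2 g"
    by (simp add: L2_def integral_lebesgue borel_measurable_lebesgueI)
  moreover have "((\<lambda>a. \<integral>\<^sup>+\<xi>. ennreal ((cmod (F a \<xi> - g \<xi>))\<^sup>2) \<partial>lborel) \<longlongrightarrow> 0) at_top"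
  proof (rule tendsto_sandwich[OF _ _ tendsto_const])
    show "((\<lambda>a. ennreal (bessel_const * T a)) \<longlongrightarrow> 0) at_top"
      using tendsto_ennrealI[OF tendsto_mult_right_zero[OF Tlim, of bessel_const]] by simp
  qed (use Dg in auto)
  ultimately show ?thesis
    unfolding is_fourier_L2_def F_def nn_integral_completion by auto
qed

lemma is_fourier_L2_fourier:
  fixes f :: "R3 \<Rightarrow> complex"
  assumes "f \<in> borel_measurable borel" "integrable lborel (\<lambda>x. (cmod (f x))\<^sup>2)" "\<not> integrable lborel f"
  shows "is_fourier_L2 f (fourier f)"
  using someI_ex[OF fourier_L2_exists[OF assms(1,2)]] assms by (simp add: fourier_def integral_lebesgue)

end

subsection \<open>Multipliers as convolutions\<close>

definition conv :: "(R3 \<Rightarrow> real) \<Rightarrow> (R3 \<Rightarrow> real) \<Rightarrow> R3 \<Rightarrow> real" where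
  "conv k f x = (LINT y|lborel. k (x - y) * f y)"

definition Lp :: "nat \<Rightarrow> (R3 \<Rightarrow> real) \<Rightarrow> bool" where
  "Lp n f \<longleftrightarrow> f \<in> borel_measurable borel \<and> integrable lborel (\<lambda>x. \<bar>f x\<bar> ^ n)"

lemma Lp_measurable [measurable_dest]: "Lp n f \<Longrightarrow> f \<in> borel_measurable borel"
  by (simp add: Lp_def)

lemma Lp_1: "Lp 1 f \<longleftrightarrow> integrable lborel f" "Lp (Suc 0) f \<longleftrightarrow> integrable lborel f"
  using integrable_abs_cancel[of lborel f] by (auto simp: Lp_def dest: borel_measurable_integrable)

lemma Lp_2: "Lp 2 f \<longleftrightarrow> f \<in> borel_measurable borel \<and> integrable lborel (\<lambda>x. (f x)\<^sup>2)"
  by (simp add: Lp_def)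

lemma measurable_conv [measurable]:
  assumes [measurable]: "k \<in> borel_measurable borel" "f \<in> borel_measurable borel"
  shows "conv k f \<in> borel_measurable borel"
proof -
  have "(\<lambda>x. LINT y|lborel. k (x - y) * f y) \<in> borel_measurable borel" by measurable
  then show ?thesis by (simp add: conv_def[abs_def])
qed

lemma abs_mult_le_squares: "\<bar>a * b\<bar> \<le> a\<^sup>2 + (b::real)\<^sup>2"
  using sum_squares_bound[of "\<bar>a\<bar>" "\<bar>b\<bar>"] mult_nonneg_nonneg[OF abs_ge_zero abs_ge_zero, of a b]
  unfolding abs_mult mult.assoc power2_abs by linarith

lemma Lp_trig_kernel:
  assumes "test_function \<rho>" "n \<noteq> 0"
  shows "Lp n (cosk \<rho>)" "Lp n (sink \<rho>)"
proof -
  obtain C where C: "C \<ge> 0" "\<And>x. \<bar>cosk \<rho> x\<bar> \<le> C" "\<And>x. \<bar>sink \<rho> x\<bar> \<le> C"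
    using trig_kernel_decay[OF assms(1), of 0] by auto
  note int = integrable_trig_kernel[OF assms(1)]
  have "Lp (Suc m) f" if i: "integrable lborel f" and f: "\<And>x. \<bar>f x\<bar> \<le> C" for f m
  proof -
    have [measurable]: "f \<in> borel_measurable borel" using i by auto
    have "integrable lborel (\<lambda>x. \<bar>f x\<bar> * \<bar>f x\<bar> ^ m)"
      using i by (intro integrable_mult_bounded(1)[where B="C ^ m"]) (auto simp: power_abs f intro!: power_mono)
    then show ?thesis by (simp add: Lp_def)
  qed
  then show "Lp n (cosk \<rho>)" "Lp n (sink \<rho>)"
    using int C assms(2) by (cases n; simp)+
qed

text \<open>The pointwise bound |ab| \<le> a^2 + b^2 yields estimates uniform in x, on which the
  boundedness of convolutions and the later Fubini arguments rest.\<close>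

lemma integrable_conv_L2:
  assumes k: "Lp 2 k" and f: "Lp 2 f"
  shows "integrable lborel (\<lambda>y. k (x - y) * f y)" "integrable lborel (\<lambda>y. \<bar>k (x - y)\<bar> * \<bar>f y\<bar>)"
    "\<bar>conv k f x\<bar> \<le> (LINT y|lborel. (k y)\<^sup>2) + (LINT y|lborel. (f y)\<^sup>2)"
    "(\<integral>\<^sup>+y. ennreal \<bar>k (x - y) * f y\<bar> \<partial>lborel) \<le> ennreal ((LINT y|lborel. (k y)\<^sup>2) + (LINT y|lborel. (f y)\<^sup>2))"
proof -
  note [measurable] = Lp_measurable[OF k] Lp_measurable[OF f]
  have k2: "integrable lborel (\<lambda>y. (k (x - y))\<^sup>2)"
    using k integrable_translate_iff(3)[of "\<lambda>y. (k y)\<^sup>2" x] by (simp add: Lp_2)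
  have f2: "integrable lborel (\<lambda>y. (f y)\<^sup>2)" using f by (simp add: Lp_2)
  have k2f2: "integrable lborel (\<lambda>y. (k (x - y))\<^sup>2 + (f y)\<^sup>2)" using k2 f2 by simp
  show i: "integrable lborel (\<lambda>y. k (x - y) * f y)"
    by (rule Bochner_Integration.integrable_bound[OF k2f2]) (use abs_mult_le_squares in \<open>auto intro!: AE_I2\<close>)
  from integrable_abs[OF i] show "integrable lborel (\<lambda>y. \<bar>k (x - y)\<bar> * \<bar>f y\<bar>)" by (simp add: abs_mult)
  have e: "(LINT y|lborel. (k (x - y))\<^sup>2 + (f y)\<^sup>2) = (LINT y|lborel. (k y)\<^sup>2) + (LINT y|lborel. (f y)\<^sup>2)"
    using k2 f2 integral_translate(3)[of "\<lambda>y. (k y)\<^sup>2" x] by simp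
  show "\<bar>conv k f x\<bar> \<le> (LINT y|lborel. (k y)\<^sup>2) + (LINT y|lborel. (f y)\<^sup>2)"
    unfolding conv_def e[symmetric] real_norm_def[symmetric]
    by (rule norm_integral_le[OF i k2f2]) (use abs_mult_le_squares in auto)
  have "(\<integral>\<^sup>+y. ennreal \<bar>k (x - y) * f y\<bar> \<partial>lborel) \<le> (\<integral>\<^sup>+y. ennreal ((k (x - y))\<^sup>2 + (f y)\<^sup>2) \<partial>lborel)"
    by (intro nn_integral_mono ennreal_leI abs_mult_le_squares)
  also have "\<dots> = ennreal ((LINT y|lborel. (k y)\<^sup>2) + (LINT y|lborel. (f y)\<^sup>2))"
    using e by (subst nn_integral_eq_integral[OF k2f2]) auto
  finally show "(\<integral>\<^sup>+y. ennreal \<bar>k (x - y) * f y\<bar> \<partial>lborel) \<le> \<dots>" .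
qed

text \<open>The flux applies multipliers to the products u_i u_j, which are in L1, and to the
  components u_j, which are in L2; both are treated at once.\<close>

definition L1_or_L2 :: "(R3 \<Rightarrow> real) \<Rightarrow> bool" where
  "L1_or_L2 f \<longleftrightarrow> Lp 1 f \<or> Lp 2 f"

text \<open>Fubini applies because the inner integral of |e| |v| is bounded uniformly in the outer
  variable and h is integrable.\<close>

lemma conv_assoc:
  assumes h: "Lp 1 h" and e: "Lp 1 e" "Lp 2 e" and v: "Lp 2 v"
  shows "conv h (conv e v) y = conv (conv h e) v y"
proof -
  note [measurable] = Lp_measurable[OF h] Lp_measurable[OF e(1)] Lp_measurable[OF v]
  define E where "E = (LINT y|lborel. (e y)\<^sup>2) + (LINT y|lborel. (v y)\<^sup>2)"
  have "conv h (conv e v) y = (LINT x|lborel. LINT z|lborel. h (y - x) * (e (x - z) * v z))"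
    by (simp add: conv_def)
  also have "\<dots> = (LINT z|lborel. LINT x|lborel. h (y - x) * (e (x - z) * v z))"
  proof (rule integral_swap)
    have "(\<integral>\<^sup>+x. \<integral>\<^sup>+z. ennreal (norm (h (y - x) * (e (x - z) * v z))) \<partial>lborel \<partial>lborel)
       = (\<integral>\<^sup>+x. ennreal \<bar>h (y - x)\<bar> * (\<integral>\<^sup>+z. ennreal \<bar>e (x - z) * v z\<bar> \<partial>lborel) \<partial>lborel)"
      by (simp add: abs_mult ennreal_mult nn_integral_cmult)
    also have "\<dots> \<le> (\<integral>\<^sup>+x. ennreal \<bar>h (y - x)\<bar> * ennreal E \<partial>lborel)"
      unfolding E_def by (intro nn_integral_mono mult_left_mono integrable_conv_L2(4) e v) auto
    also have "\<dots> = (\<integral>\<^sup>+x. ennreal \<bar>h x\<bar> \<partial>lborel) * ennreal E"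
      using nn_integral_translate(3)[of "\<lambda>x. ennreal \<bar>h x\<bar>" y] by (simp add: nn_integral_multc)
    also have "\<dots> < \<infinity>"
      using h by (subst nn_integral_eq_integral) (auto simp: Lp_1 ennreal_mult_less_top)
    finally show "(\<integral>\<^sup>+x. \<integral>\<^sup>+z. ennreal (norm (h (y - x) * (e (x - z) * v z))) \<partial>lborel \<partial>lborel) < \<infinity>" .
  qed measurable
  also have "\<dots> = conv (conv h e) v y"
    unfolding conv_def
  proof (intro Bochner_Integration.integral_cong refl)
    fix z
    have "(LINT x|lborel. h (y - x) * (e (x - z) * v z)) = (LINT x|lborel. h (y - x) * e (x - z)) * v z"
      unfolding mult.assoc[symmetric] by simp
    also have "(LINT x|lborel. h (y - x) * e (x - z)) = (LINT x|lborel. h (y - z - x) * e x)"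
      using integral_translate(1)[of "\<lambda>x. h (y - x) * e (x - z)" z] by (simp add: algebra_simps)
    finally show "(LINT x|lborel. h (y - x) * (e (x - z) * v z)) = (LINT x|lborel. h (y - z - x) * e x) * v z" .
  qed
  finally show ?thesis .
qed

text \<open>An even kernel is self-adjoint for the pairing of L1 with bounded functions. This moves
  the truncation off the product u_i u_j and onto the gradient factor.\<close>

lemma integral_conv_adjoint:
  assumes h: "Lp 1 h" and w: "Lp 1 w" and even: "\<And>x. h (- x) = h x"
    and [measurable]: "b \<in> borel_measurable borel" and b: "\<And>x. \<bar>b x\<bar> \<le> B"
  shows "(LINT x|lborel. conv h w x * b x) = (LINT y|lborel. w y * conv h b y)"
    "integrable lborel (\<lambda>x. conv h w x * b x)"
proof -
  note [measurable] = Lp_measurable[OF h] Lp_measurable[OF w]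
  have fin: "(\<integral>\<^sup>+x. \<integral>\<^sup>+y. ennreal (norm (h (x - y) * w y * b x)) \<partial>lborel \<partial>lborel) < \<infinity>"
  proof -
    have "(\<integral>\<^sup>+x. \<integral>\<^sup>+y. ennreal (norm (h (x - y) * w y * b x)) \<partial>lborel \<partial>lborel)
      \<le> (\<integral>\<^sup>+x. \<integral>\<^sup>+y. (ennreal \<bar>h (x - y)\<bar> * ennreal \<bar>w y\<bar>) * ennreal B \<partial>lborel \<partial>lborel)"
      using b by (intro nn_integral_mono) (auto simp: abs_mult ennreal_mult[symmetric] order_trans[OF abs_ge_zero b] intro!: ennreal_leI mult_left_mono)
    also have "\<dots> = ((\<integral>\<^sup>+x. ennreal \<bar>h x\<bar> \<partial>lborel) * (\<integral>\<^sup>+x. ennreal \<bar>w x\<bar> \<partial>lborel)) * ennreal B"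
      using nn_integral_convolution(2)[of "\<lambda>x. ennreal \<bar>h x\<bar>" "\<lambda>x. ennreal \<bar>w x\<bar>"]
      by (simp add: nn_integral_multc)
    also have "\<dots> < \<infinity>"
      using h w by (subst (1 2) nn_integral_eq_integral) (auto simp: Lp_1 ennreal_mult_less_top)
    finally show ?thesis .
  qed
  have m: "(\<lambda>(x, y). h (x - y) * w y * b x) \<in> borel_measurable (lborel \<Otimes>\<^sub>M lborel)" by measurable
  have "(LINT x|lborel. conv h w x * b x) = (LINT x|lborel. LINT y|lborel. h (x - y) * w y * b x)"
    by (simp add: conv_def)
  also have "\<dots> = (LINT y|lborel. LINT x|lborel. h (x - y) * w y * b x)"
    by (rule integral_swap[OF m fin])
  also have "\<dots> = (LINT y|lborel. w y * conv h b y)"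
  proof (intro Bochner_Integration.integral_cong refl)
    fix y
    have "(LINT x|lborel. h (x - y) * w y * b x) = (LINT x|lborel. w y * (h (y - x) * b x))"
      using even[of "x - y" for x] by (intro Bochner_Integration.integral_cong refl) simp
    then show "(LINT x|lborel. h (x - y) * w y * b x) = w y * conv h b y" by (simp add: conv_def)
  qed
  finally show "(LINT x|lborel. conv h w x * b x) = (LINT y|lborel. w y * conv h b y)" .
  have "integrable lborel (\<lambda>x. LINT y|lborel. h (x - y) * w y * b x)"
    using lborel_pair.integrable_fst'[OF integrable_pairI[OF m fin]] by simp
  then show "integrable lborel (\<lambda>x. conv h w x * b x)" by (simp add: conv_def)
qed

context cutoff
begin

lemma fourier_eq_fourier_L1: "integrable lborel f \<Longrightarrow> fourier f = fourier_L1 f"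
  using integral_lebesgue(2)[of f] by (auto simp: fourier_def)

lemma Lp_complex:
  assumes "L1_or_L2 f"
  shows "(\<lambda>x. complex_of_real (f x)) \<in> borel_measurable borel"
    "\<not> integrable lborel (\<lambda>x. complex_of_real (f x)) \<Longrightarrow> integrable lborel (\<lambda>x. (cmod (complex_of_real (f x)))\<^sup>2)"
  using assms unfolding L1_or_L2_def Lp_1 Lp_2 by auto

text \<open>For f in L1 the transform is bounded. Otherwise it is a chosen, merely Lebesgue
  measurable function, and the square integrability of both factors is used; hence the statement on
  \<open>lebesgue\<close>.\<close>

lemma integrable_mult_fourier:
  assumes \<rho>: "test_function \<rho>" and f: "L1_or_L2 f"
  shows "integrable lebesgue (\<lambda>\<xi>. complex_of_real (\<rho> \<xi>) * fourier (\<lambda>x. complex_of_real (f x)) \<xi>)"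
proof (cases "integrable lborel (\<lambda>x. complex_of_real (f x))")
  case True
  have [measurable]: "(\<lambda>x. complex_of_real (f x)) \<in> borel_measurable borel" by (rule Lp_complex[OF f])
  have "integrable lborel (\<lambda>\<xi>. complex_of_real (\<rho> \<xi>) * fourier_L1 (\<lambda>x. complex_of_real (f x)) \<xi>)"
    using test_function_integrable[OF \<rho>]
    by (intro integrable_mult_bounded(1)[OF _ _ norm_fourier_L1_le[OF True]]) auto
  then show ?thesis
    using integral_lebesgue(2)[of "\<lambda>\<xi>. complex_of_real (\<rho> \<xi>) * fourier_L1 (\<lambda>x. complex_of_real (f x)) \<xi>"]
    by (simp add: fourier_eq_fourier_L1[OF True] borel_measurable_integrable)
next
  case False
  let ?g = "fourier (\<lambda>x. complex_of_real (f x))"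
  have "L2 ?g" using is_fourier_L2_fourier[OF Lp_complex(1,2)[OF f] False] False by (simp add: is_fourier_L2_def)
  then have g: "?g \<in> borel_measurable lebesgue" "integrable lebesgue (\<lambda>\<xi>. (cmod (?g \<xi>))\<^sup>2)" by (auto simp: L2_def)
  note [measurable] = g(1) test_function_measurable[OF \<rho>]
  have [measurable]: "(\<lambda>\<xi>. complex_of_real (\<rho> \<xi>)) \<in> borel_measurable lebesgue"
    by (rule borel_measurable_lebesgueI) measurable
  have t2: "test_function (\<lambda>\<xi>. \<rho> \<xi> * \<rho> \<xi>)" by (rule test_function_mult[OF \<rho> test_function_smooth[OF \<rho>]])
  have "integrable lebesgue (\<lambda>\<xi>. (\<rho> \<xi>)\<^sup>2)"
    using test_function_integrable[OF t2] integral_lebesgue(2)[of "\<lambda>\<xi>. (\<rho> \<xi>)\<^sup>2"] by (simp add: power2_eq_square)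
  with g(2) have i: "integrable lebesgue (\<lambda>\<xi>. (\<rho> \<xi>)\<^sup>2 + (cmod (?g \<xi>))\<^sup>2)" by simp
  show ?thesis
  proof (rule Bochner_Integration.integrable_bound[OF i])
    show "AE \<xi> in lebesgue. norm (complex_of_real (\<rho> \<xi>) * ?g \<xi>) \<le> norm ((\<rho> \<xi>)\<^sup>2 + (cmod (?g \<xi>))\<^sup>2)"
      using abs_mult_le_squares[of "\<rho> \<xi>" "cmod (?g \<xi>)" for \<xi>] by (auto simp: norm_mult abs_mult)
  qed measurable
qed

text \<open>For f in L1 this is \<open>inverse_fourier_mult_L1\<close>. Otherwise f is truncated to
  balls: the convolutions converge at every x by domination, the frequency integrals converge
  because Cauchy-Schwarz bounds their differences by the L2 distance of the transforms, and the two
  limits agree.\<close>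

lemma inverse_fourier_mult_fourier:
  assumes \<rho>: "test_function \<rho>" and f: "L1_or_L2 f"
  shows "inverse_fourier (\<lambda>\<xi>. complex_of_real (\<rho> \<xi>) * fourier (\<lambda>x. complex_of_real (f x)) \<xi>) x =
    Complex (conv (cosk \<rho>) f x) (conv (sink \<rho>) f x)"
proof -
  let ?k = "inverse_fourier (\<lambda>\<xi>. complex_of_real (\<rho> \<xi>))"
  let ?f = "\<lambda>x. complex_of_real (f x)"
  let ?p = "complex_of_real ((2 * pi) ^ 3)"
  note [measurable] = test_function_measurable[OF \<rho>] Lp_complex(1)[OF f] integrable_trig_kernel(4,5)[OF \<rho>]
  have [measurable]: "cball 0 R \<in> sets (borel :: R3 measure)" for R by simp
  have [measurable]: "f \<in> borel_measurable borel" using f by (auto simp: L1_or_L2_def Lp_def)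
  have ir: "integrable lborel (\<lambda>\<xi>. complex_of_real (\<rho> \<xi>))" using test_function_integrable[OF \<rho>] by simp
  have keq: "?k = (\<lambda>x. complex_of_real (cosk \<rho> x) + \<i> * complex_of_real (sink \<rho> x))"
    using inverse_fourier_test_function[OF \<rho>] by (auto simp: complex_eq_iff)
  have ik: "integrable lborel (\<lambda>y. cosk \<rho> (x - y) * f y) \<and> integrable lborel (\<lambda>y. sink \<rho> (x - y) * f y)"
  proof (cases "Lp 2 f")
    case True
    then show ?thesis using Lp_trig_kernel[OF \<rho>, of 2] by (auto intro: integrable_conv_L2)
  next
    case False
    then have i: "integrable lborel f" using f Lp_1 by (auto simp: L1_or_L2_def)
    obtain C where C: "C \<ge> 0" "\<And>x. \<bar>cosk \<rho> x\<bar> \<le> C" "\<And>x. \<bar>sink \<rho> x\<bar> \<le> C"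
      using trig_kernel_decay[OF \<rho>, of 0] by auto
    show ?thesis using i C by (auto intro!: integrable_mult_bounded(2)[where B=C])
  qed
  have int: "integrable lborel (\<lambda>y. ?k (x - y) * ?f y)"
  proof -
    have "?k (x - y) * ?f y = complex_of_real (cosk \<rho> (x - y) * f y) + \<i> * complex_of_real (sink \<rho> (x - y) * f y)" for y
      unfolding keq by (simp add: algebra_simps)
    moreover have "integrable lborel (\<lambda>y. complex_of_real (cosk \<rho> (x - y) * f y))" "integrable lborel (\<lambda>y. complex_of_real (sink \<rho> (x - y) * f y))"
      using ik by (auto simp only: integrable_of_real)
    ultimately show ?thesis by (simp only: Bochner_Integration.integrable_add integrable_mult_right)
  qed
  have "(LINT y|lborel. ?k (x - y) * ?f y) = Complex (conv (cosk \<rho>) f x) (conv (sink \<rho>) f x)"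
    using integral_Re[OF int] integral_Im[OF int] by (simp add: conv_def keq complex_eq_iff)
  moreover have "inverse_fourier (\<lambda>\<xi>. complex_of_real (\<rho> \<xi>) * fourier ?f \<xi>) x = (LINT y|lborel. ?k (x - y) * ?f y)"
  proof (cases "integrable lborel ?f")
    case True
    then show ?thesis by (simp add: fourier_eq_fourier_L1 inverse_fourier_mult_L1[OF ir])
  next
    case False
    note f2 = Lp_complex(2)[OF f False]
    define g where "g = fourier ?f"
    let ?t = "\<lambda>n::nat. \<lambda>x. indicator (cball 0 (real n)) x * ?f x"
    let ?F = "\<lambda>n. fourier_L1 (?t n)"
    have isf: "is_fourier_L2 ?f g"
      unfolding g_def by (rule is_fourier_L2_fourier[OF Lp_complex(1)[OF f] f2 False])
    then have [measurable]: "g \<in> borel_measurable lebesgue" by (simp add: is_fourier_L2_def L2_def)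
    have [measurable]: "?F n \<in> borel_measurable lebesgue" for n
      by (rule borel_measurable_lebesgueI) measurable
    have [measurable]: "(\<lambda>\<xi>. complex_of_real (\<rho> \<xi>)) \<in> borel_measurable lebesgue" "(\<lambda>\<xi>. \<rho> \<xi>) \<in> borel_measurable lebesgue"
      by (rule borel_measurable_lebesgueI, measurable)+
    have lim: "(\<lambda>n. \<integral>\<^sup>+\<xi>. ennreal ((cmod (?F n \<xi> - g \<xi>))\<^sup>2) \<partial>lebesgue) \<longlonglongrightarrow> 0"
      using isf filterlim_compose[OF _ filterlim_real_sequentially] by (auto simp: is_fourier_L2_def)
    have it: "integrable lborel (?t n)" for n by (rule integrable_truncation[OF Lp_complex(1)[OF f] f2])
    define v where "v n = inverse_fourier (\<lambda>\<xi>. complex_of_real (\<rho> \<xi>) * ?F n \<xi>) x" for n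
    define v\<^sub>0 where "v\<^sub>0 = inverse_fourier (\<lambda>\<xi>. complex_of_real (\<rho> \<xi>) * g \<xi>) x"
    have "v \<longlonglongrightarrow> (LINT y|lborel. ?k (x - y) * ?f y)"
      unfolding v_def inverse_fourier_mult_L1[OF ir it]
    proof (rule integral_dominated_convergence[where w="\<lambda>y. norm (?k (x - y) * ?f y)"])
      show "AE y in lborel. (\<lambda>n. ?k (x - y) * ?t n y) \<longlonglongrightarrow> ?k (x - y) * ?f y"
      proof (rule AE_I2)
        fix y :: R3
        obtain N :: nat where N: "norm y \<le> real N" using real_arch_simple by blast
        have "\<forall>\<^sub>F n in sequentially. ?k (x - y) * ?t n y = ?k (x - y) * ?f y"
          using eventually_ge_at_top[of N]
        proof eventually_elim
          case (elim n)
          then have "norm y \<le> real n" using N by (meson of_nat_le_iff order_trans)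
          then show ?case by simp
        qed
        then show "(\<lambda>n. ?k (x - y) * ?t n y) \<longlonglongrightarrow> ?k (x - y) * ?f y" by (rule tendsto_eventually)
      qed
      show "integrable lborel (\<lambda>y. norm (?k (x - y) * ?f y))" by (rule integrable_norm[OF int])
      show "AE y in lborel. norm (?k (x - y) * ?t n y) \<le> norm (?k (x - y) * ?f y)" for n
        by (intro AE_I2) (auto simp: norm_mult indicator_def)
      show "(\<lambda>y. ?k (x - y) * ?f y) \<in> borel_measurable lborel" using int by auto
      show "(\<lambda>y. ?k (x - y) * ?t n y) \<in> borel_measurable lborel" for n by measurable
    qed
    moreover have "v \<longlonglongrightarrow> v\<^sub>0"
    proof -
      have iF: "integrable lebesgue (\<lambda>\<xi>. complex_of_real (\<rho> \<xi>) * ?F n \<xi>)" for n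
      proof -
        have "integrable lborel (\<lambda>\<xi>. complex_of_real (\<rho> \<xi>) * ?F n \<xi>)"
          by (intro integrable_mult_bounded(1)[OF ir _ norm_fourier_L1_le[OF it]]) measurable
        then show ?thesis using integral_lebesgue(2)[of "\<lambda>\<xi>. complex_of_real (\<rho> \<xi>) * ?F n \<xi>"]
          by (simp add: borel_measurable_integrable)
      qed
      have ig: "integrable lebesgue (\<lambda>\<xi>. complex_of_real (\<rho> \<xi>) * g \<xi>)"
        unfolding g_def by (rule integrable_mult_fourier[OF \<rho> f])
      have ic: "integrable lebesgue (\<lambda>\<xi>. cis (\<xi> \<bullet> x) * h \<xi>)" if "integrable lebesgue h" for h
        by (rule integrable_mult_bounded(2)[OF that, where B=1]) (auto intro: borel_measurable_lebesgueI)
      let ?A = "\<integral>\<^sup>+\<xi>. (ennreal \<bar>\<rho> \<xi>\<bar>)\<^sup>2 \<partial>lebesgue"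
      have A: "?A < \<infinity>"
      proof -
        have t2: "test_function (\<lambda>\<xi>. \<rho> \<xi> * \<rho> \<xi>)" by (rule test_function_mult[OF \<rho> test_function_smooth[OF \<rho>]])
        have "?A = (\<integral>\<^sup>+\<xi>. ennreal (\<rho> \<xi> * \<rho> \<xi>) \<partial>lborel)"
          by (simp add: nn_integral_completion ennreal_power power2_eq_square[symmetric])
        also have "\<dots> < \<infinity>" using test_function_integrable[OF t2] by (subst nn_integral_eq_integral) auto
        finally show ?thesis .
      qed
      have bd: "ennreal ((cmod ((v n - v\<^sub>0) * ?p))\<^sup>2) \<le> ?A * (\<integral>\<^sup>+\<xi>. ennreal ((cmod (?F n \<xi> - g \<xi>))\<^sup>2) \<partial>lebesgue)" for n
      proof -
        have "(v n - v\<^sub>0) * ?p = (LINT \<xi>|lebesgue. cis (\<xi> \<bullet> x) * (complex_of_real (\<rho> \<xi>) * ?F n \<xi>)) -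
           (LINT \<xi>|lebesgue. cis (\<xi> \<bullet> x) * (complex_of_real (\<rho> \<xi>) * g \<xi>))"
          unfolding v_def v\<^sub>0_def inverse_fourier_def by (simp add: diff_divide_distrib[symmetric])
        also have "\<dots> = (LINT \<xi>|lebesgue. cis (\<xi> \<bullet> x) * (complex_of_real (\<rho> \<xi>) * ?F n \<xi>) - cis (\<xi> \<bullet> x) * (complex_of_real (\<rho> \<xi>) * g \<xi>))"
          by (rule Bochner_Integration.integral_diff[symmetric]; intro ic iF ig)
        finally have eq: "(v n - v\<^sub>0) * ?p = \<dots>" .
        have "ennreal (cmod ((v n - v\<^sub>0) * ?p)) \<le> (\<integral>\<^sup>+\<xi>. ennreal (cmod (cis (\<xi> \<bullet> x) * (complex_of_real (\<rho> \<xi>) * ?F n \<xi>) - cis (\<xi> \<bullet> x) * (complex_of_real (\<rho> \<xi>) * g \<xi>))) \<partial>lebesgue)"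
          unfolding eq by (rule norm_integral_le_nn_integral)
        also have "\<dots> = (\<integral>\<^sup>+\<xi>. ennreal \<bar>\<rho> \<xi>\<bar> * ennreal (cmod (?F n \<xi> - g \<xi>)) \<partial>lebesgue)"
        proof (intro nn_integral_cong)
          fix \<xi>
          have "cis (\<xi> \<bullet> x) * (complex_of_real (\<rho> \<xi>) * ?F n \<xi>) - cis (\<xi> \<bullet> x) * (complex_of_real (\<rho> \<xi>) * g \<xi>) =
            cis (\<xi> \<bullet> x) * (complex_of_real (\<rho> \<xi>) * (?F n \<xi> - g \<xi>))" by (simp add: right_diff_distrib)
          then show "ennreal (cmod (cis (\<xi> \<bullet> x) * (complex_of_real (\<rho> \<xi>) * ?F n \<xi>) - cis (\<xi> \<bullet> x) * (complex_of_real (\<rho> \<xi>) * g \<xi>))) =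
             ennreal \<bar>\<rho> \<xi>\<bar> * ennreal (cmod (?F n \<xi> - g \<xi>))"
            by (simp add: norm_mult ennreal_mult)
        qed
        finally have "ennreal (cmod ((v n - v\<^sub>0) * ?p)) \<le> \<dots>" .
        then have "(ennreal (cmod ((v n - v\<^sub>0) * ?p)))\<^sup>2 \<le> (\<integral>\<^sup>+\<xi>. ennreal \<bar>\<rho> \<xi>\<bar> * ennreal (cmod (?F n \<xi> - g \<xi>)) \<partial>lebesgue)\<^sup>2"
          by (rule power_mono) simp
        also have "\<dots> \<le> ?A * (\<integral>\<^sup>+\<xi>. (ennreal (cmod (?F n \<xi> - g \<xi>)))\<^sup>2 \<partial>lebesgue)"
          by (rule Cauchy_Schwarz_nn_integral) measurable
        finally show ?thesis by (simp add: ennreal_power)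
      qed
      have "(\<lambda>n. ennreal ((cmod ((v n - v\<^sub>0) * ?p))\<^sup>2)) \<longlonglongrightarrow> 0"
      proof (rule tendsto_sandwich[OF _ _ tendsto_const])
        show "(\<lambda>n. ?A * (\<integral>\<^sup>+\<xi>. ennreal ((cmod (?F n \<xi> - g \<xi>))\<^sup>2) \<partial>lebesgue)) \<longlonglongrightarrow> 0"
          using ennreal_tendsto_cmult[OF A[unfolded infinity_ennreal_def] lim] by simp
      qed (use bd in auto)
      then have "(\<lambda>n. (cmod ((v n - v\<^sub>0) * ?p))\<^sup>2) \<longlonglongrightarrow> 0"
        by (subst (asm) ennreal_tendsto_0_iff) auto
      then have "(\<lambda>n. cmod ((v n - v\<^sub>0) * ?p)) \<longlonglongrightarrow> 0" by (simp add: power_tendsto_0_iff)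
      then have "(\<lambda>n. (v n - v\<^sub>0) * ?p) \<longlonglongrightarrow> 0" by (rule tendsto_norm_zero_cancel)
      then have "(\<lambda>n. ((v n - v\<^sub>0) * ?p) / ?p) \<longlonglongrightarrow> 0 / ?p" by (intro tendsto_divide tendsto_const) auto
      then have "(\<lambda>n. v n - v\<^sub>0) \<longlonglongrightarrow> 0" by (simp del: of_real_power of_real_mult)
      then show ?thesis by (simp add: LIM_zero_iff)
    qed
    ultimately show ?thesis using LIMSEQ_unique unfolding v\<^sub>0_def g_def by blast
  qed
  ultimately show ?thesis by simp
qed

end

subsection \<open>The flux as a trilinear form\<close>

lemma lam_pos [simp]: "0 < lam q" by (simp add: lam_def)

lemma lam_add: "lam (p + q) = lam p * lam q" by (simp add: lam_def powr_add)

lemma lam_simps [simp]: "lam 0 = 1" "lam 1 = 2" "lam (-1) = 1 / 2"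
  by (simp_all add: lam_def powr_minus_divide)

lemma lam_mono: "p \<le> q \<Longrightarrow> lam p \<le> lam q" by (simp add: lam_def)

text \<open>The i-th partial derivative of \<open>cosk \<rho>\<close>, written through its symbol so
  that decay, parity and scaling are inherited from \<open>sink\<close>.\<close>

definition grad_kernel :: "(R3 \<Rightarrow> real) \<Rightarrow> 3 \<Rightarrow> R3 \<Rightarrow> real" where
  "grad_kernel \<rho> i z = - sink (\<lambda>\<xi>. \<xi> $ i * \<rho> \<xi>) z"

lemma partial_cosk:
  assumes "test_function \<rho>"
  shows "partial i (cosk \<rho>) = grad_kernel \<rho> i"
  using partial_trig_kernel(3)[OF assms] by (auto simp: grad_kernel_def)

lemma Lp_uminus: "Lp n f \<Longrightarrow> Lp n (\<lambda>x. - f x)"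
  by (auto simp: Lp_def)

lemma Lp_grad_kernel: "test_function \<rho> \<Longrightarrow> n \<noteq> 0 \<Longrightarrow> Lp n (grad_kernel \<rho> i)"
  unfolding grad_kernel_def[abs_def] using Lp_trig_kernel(2)[OF test_function_coord] by (blast intro: Lp_uminus)

lemma grad_kernel_minus: "grad_kernel \<rho> i (- z) = - grad_kernel \<rho> i z"
  by (simp add: grad_kernel_def trig_kernel_minus)

lemma grad_kernel_scale:
  "l > 0 \<Longrightarrow> grad_kernel (\<lambda>\<xi>. \<rho> (\<xi> /\<^sub>R l)) i z = l ^ 4 * grad_kernel \<rho> i (l *\<^sub>R z)"
  by (simp add: grad_kernel_def trig_kernel_scale)

lemma grad_kernel_add:
  assumes "test_function \<rho>" "test_function \<sigma>"
  shows "grad_kernel (\<lambda>\<xi>. \<rho> \<xi> + \<sigma> \<xi>) i z = grad_kernel \<rho> i z + grad_kernel \<sigma> i z"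
  using test_function_trig_integrable(2)[OF test_function_coord[OF assms(1), of i], of z]
    test_function_trig_integrable(2)[OF test_function_coord[OF assms(2), of i], of z]
  by (simp add: grad_kernel_def sink_def distrib_left distrib_right add_divide_distrib)

text \<open>The trilinear form obtained by moving both frequency truncations onto one factor.\<close>

definition trilinear_flux :: "(R3 \<Rightarrow> real) \<Rightarrow> (R3 \<Rightarrow> R3) \<Rightarrow> real" where
  "trilinear_flux \<rho> u = (\<Sum>i\<in>UNIV. \<Sum>j\<in>UNIV. LINT y|lborel. u y $ i * u y $ j * conv (grad_kernel \<rho> i) (\<lambda>x. u x $ j) y)"

context
  fixes u :: "R3 \<Rightarrow> R3"
  assumes u_meas: "u \<in> borel_measurable borel" and u_L2: "integrable lborel (\<lambda>x. (norm (u x))\<^sup>2)"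
begin

lemma Lp_2_component: "Lp 2 (\<lambda>x. u x $ j)"
  unfolding Lp_2
proof
  show [measurable]: "(\<lambda>x. u x $ j) \<in> borel_measurable borel"
    by (rule measurable_compose[OF u_meas]) (simp add: borel_measurable_continuous_onI continuous_intros)
  have "(u x $ j)\<^sup>2 \<le> (norm (u x))\<^sup>2" for x
    using power_mono[OF component_le_norm_cart[of "u x" j] abs_ge_zero, of 2] by simp
  then show "integrable lborel (\<lambda>x. (u x $ j)\<^sup>2)"
    by (intro Bochner_Integration.integrable_bound[OF u_L2]) auto
qed

lemma Lp_1_products: "Lp 1 (\<lambda>x. u x $ i * u x $ j)"
  unfolding Lp_1
proof (rule Bochner_Integration.integrable_bound)
  show "integrable lborel (\<lambda>x. (u x $ i)\<^sup>2 + (u x $ j)\<^sup>2)"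
    using Lp_2_component unfolding Lp_2 by simp
  show "AE x in lborel. norm (u x $ i * u x $ j) \<le> norm ((u x $ i)\<^sup>2 + (u x $ j)\<^sup>2)"
    using abs_mult_le_squares by (auto intro!: AE_I2)
  show "(\<lambda>x. u x $ i * u x $ j) \<in> borel_measurable lborel"
    using Lp_2_component[of i] Lp_2_component[of j] by (auto simp: Lp_2)
qed

lemma trilinear_integrable:
  assumes "Lp 2 g"
  shows "integrable lborel (\<lambda>y. u y $ i * u y $ j * conv g (\<lambda>x. u x $ j) y)"
proof (rule integrable_mult_bounded(1))
  show "integrable lborel (\<lambda>y. u y $ i * u y $ j)" using Lp_1_products Lp_1 by simp
  show "conv g (\<lambda>x. u x $ j) \<in> borel_measurable lborel"
    using Lp_measurable[OF assms] Lp_measurable[OF Lp_2_component] by simp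
  show "norm (conv g (\<lambda>x. u x $ j) y) \<le> (LINT y|lborel. (g y)\<^sup>2) + (LINT y|lborel. (u y $ j)\<^sup>2)" for y
    using integrable_conv_L2(3)[OF assms Lp_2_component] by simp
qed

text \<open>Linearity in the symbol allows the two scales of the flux to be estimated
  separately.\<close>

lemma trilinear_flux_add:
  assumes \<rho>: "test_function \<rho>" and \<sigma>: "test_function \<sigma>"
  shows "trilinear_flux (\<lambda>\<xi>. \<rho> \<xi> + \<sigma> \<xi>) u = trilinear_flux \<rho> u + trilinear_flux \<sigma> u"
proof -
  have c: "conv (grad_kernel (\<lambda>\<xi>. \<rho> \<xi> + \<sigma> \<xi>) i) (\<lambda>x. u x $ j) y =
    conv (grad_kernel \<rho> i) (\<lambda>x. u x $ j) y + conv (grad_kernel \<sigma> i) (\<lambda>x. u x $ j) y" for i j y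
    using integrable_conv_L2(1)[OF Lp_grad_kernel[OF \<rho>] Lp_2_component] integrable_conv_L2(1)[OF Lp_grad_kernel[OF \<sigma>] Lp_2_component]
    by (simp add: conv_def grad_kernel_add[OF assms] distrib_right)
  show ?thesis
    unfolding trilinear_flux_def c distrib_left
    by (simp add: trilinear_integrable[OF Lp_grad_kernel[OF \<rho>]] trilinear_integrable[OF Lp_grad_kernel[OF \<sigma>]] sum.distrib)
qed

end

section \<open>Littlewood-Paley symbols as differences of dilated cutoffs\<close>

context cutoff
begin

text \<open>The total symbol of all blocks below \<open>Q\<close>. The value 0 at negative
  \<open>Q\<close> turns the block -1, whose symbol is \<open>chi\<close>, into
  \<open>low 0 - low (-1)\<close>, so that it telescopes like all the others.\<close>

definition low :: "int \<Rightarrow> R3 \<Rightarrow> real" where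
  "low Q \<xi> = (if 0 \<le> Q then chi (\<xi> /\<^sub>R lam Q) else 0)"

lemma low_dilation: "0 \<le> Q \<Longrightarrow> low Q = (\<lambda>\<xi>. chi (\<xi> /\<^sub>R lam Q))"
  by (auto simp: low_def)

lemma low_negative: "Q < 0 \<Longrightarrow> low Q = (\<lambda>\<xi>. 0)"
  by (auto simp: low_def)

lemma test_function_0: "test_function (\<lambda>\<xi>. 0)"
  using test_function_cmult[OF test_chi, of 0] by simp

lemma test_low [simp]: "test_function (low Q)"
  using test_function_dilation[OF test_chi, of "lam Q"] test_function_0
  by (cases "0 \<le> Q") (auto simp: low_dilation low_negative)

lemma low_even [simp]: "low Q (- \<xi>) = low Q \<xi>"
  by (simp add: low_def)

lemma LP_symbol_eq:
  assumes "- 1 \<le> q"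
  shows "LP_symbol chi q = (\<lambda>\<xi>. low (q + 1) \<xi> - low q \<xi>)"
proof
  fix \<xi> :: R3
  show "LP_symbol chi q \<xi> = low (q + 1) \<xi> - low q \<xi>"
  proof (cases "0 \<le> q")
    case True
    then show ?thesis
      by (simp add: LP_symbol_def LP_phi_def low_def lam_add mult.commute)
  next
    case False
    then have "q = -1" using assms by simp
    then show ?thesis by (simp add: LP_symbol_def low_def)
  qed
qed

lemma test_LP_symbol: "- 1 \<le> q \<Longrightarrow> test_function (LP_symbol chi q)"
  by (simp add: LP_symbol_eq test_function_diff)

lemma LP_symbol_even: "- 1 \<le> q \<Longrightarrow> LP_symbol chi q (- \<xi>) = LP_symbol chi q \<xi>"
  by (simp add: LP_symbol_eq)

text \<open>Where \<open>low P\<close> is nonzero, |\<xi>| < \<lambda>_P \<le> \<lambda>_Q / 2, and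
  there \<open>low Q\<close> is 1.\<close>

lemma low_mult_low:
  assumes "P < Q"
  shows "low P \<xi> * low Q \<xi> = low P \<xi>"
proof (cases "low P \<xi> = 0")
  case False
  then have P: "0 \<le> P" "chi (\<xi> /\<^sub>R lam P) \<noteq> 0" by (auto simp: low_def split: if_splits)
  then have "norm (\<xi> /\<^sub>R lam P) < 1" using chi_eq_0[of "\<xi> /\<^sub>R lam P"] by force
  then have "norm \<xi> < lam P" using lam_pos[of P] by (simp add: inverse_eq_divide pos_divide_less_eq)
  also have "lam P = lam (P + 1) / 2" by (simp add: lam_add)
  also have "\<dots> \<le> lam Q / 2" using assms by (intro divide_right_mono lam_mono) auto
  finally have "norm (\<xi> /\<^sub>R lam Q) \<le> 1 / 2" using lam_pos[of Q] by (simp add: inverse_eq_divide pos_divide_le_eq abs_of_pos)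
  then show ?thesis using P assms by (simp add: low_def chi_eq_1)
qed simp

definition band :: "int \<Rightarrow> int \<Rightarrow> R3 \<Rightarrow> real" where
  "band Q\<^sub>0 Q\<^sub>1 \<xi> = low (Q\<^sub>1 + 1) \<xi> - low Q\<^sub>0 \<xi>"

lemma test_band [simp]: "test_function (band Q\<^sub>0 Q\<^sub>1)"
  unfolding band_def[abs_def] by (simp add: test_function_diff)

lemma band_even [simp]: "band Q\<^sub>0 Q\<^sub>1 (- \<xi>) = band Q\<^sub>0 Q\<^sub>1 \<xi>"
  by (simp add: band_def)

lemma sum_LP_symbol:
  assumes "- 1 \<le> Q\<^sub>0" "Q\<^sub>0 \<le> Q\<^sub>1"
  shows "(\<Sum>q\<in>{Q\<^sub>0..Q\<^sub>1}. LP_symbol chi q \<xi>) = band Q\<^sub>0 Q\<^sub>1 \<xi>"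
  using assms(2)
proof (induction Q\<^sub>1 rule: int_ge_induct)
  case base
  then show ?case using assms by (simp add: LP_symbol_eq band_def)
next
  case (step i)
  have "{Q\<^sub>0..i + 1} = insert (i + 1) {Q\<^sub>0..i}" using step by auto
  then show ?case using step assms by (simp add: LP_symbol_eq band_def)
qed

text \<open>Each summand is integrable on the frequency side, so the finite sum passes inside and
  the symbols telescope. The gradient in the flux then acts on a single Fourier integral.\<close>

lemma LP_sum_eq_inverse_fourier:
  assumes "- 1 \<le> Q\<^sub>0" "Q\<^sub>0 \<le> Q\<^sub>1" and f: "L1_or_L2 f"
  shows "LP_sum chi Q\<^sub>0 Q\<^sub>1 (\<lambda>x. complex_of_real (f x)) =
    inverse_fourier (\<lambda>\<xi>. complex_of_real (band Q\<^sub>0 Q\<^sub>1 \<xi>) * fourier (\<lambda>x. complex_of_real (f x)) \<xi>)"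
proof
  fix x
  let ?f = "fourier (\<lambda>x. complex_of_real (f x))"
  have i: "integrable lebesgue (\<lambda>\<xi>. cis (\<xi> \<bullet> x) * (complex_of_real (LP_symbol chi q \<xi>) * ?f \<xi>))" if "q \<in> {Q\<^sub>0..Q\<^sub>1}" for q
    using that assms
    by (intro integrable_mult_bounded(2)[OF integrable_mult_fourier[OF test_LP_symbol f], where B=1])
      (auto intro: borel_measurable_lebesgueI)
  have "LP_sum chi Q\<^sub>0 Q\<^sub>1 (\<lambda>x. complex_of_real (f x)) x =
    (\<Sum>q\<in>{Q\<^sub>0..Q\<^sub>1}. LINT \<xi>|lebesgue. cis (\<xi> \<bullet> x) * (complex_of_real (LP_symbol chi q \<xi>) * ?f \<xi>)) / complex_of_real ((2 * pi) ^ 3)"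
    by (simp add: LP_sum_def LP_block_def inverse_fourier_def sum_divide_distrib)
  also have "(\<Sum>q\<in>{Q\<^sub>0..Q\<^sub>1}. LINT \<xi>|lebesgue. cis (\<xi> \<bullet> x) * (complex_of_real (LP_symbol chi q \<xi>) * ?f \<xi>)) =
    (LINT \<xi>|lebesgue. (\<Sum>q\<in>{Q\<^sub>0..Q\<^sub>1}. cis (\<xi> \<bullet> x) * (complex_of_real (LP_symbol chi q \<xi>) * ?f \<xi>)))"
    by (rule Bochner_Integration.integral_sum[symmetric]) (rule i)
  also have "\<dots> = (LINT \<xi>|lebesgue. cis (\<xi> \<bullet> x) * (complex_of_real (band Q\<^sub>0 Q\<^sub>1 \<xi>) * ?f \<xi>))"
    by (simp add: sum_LP_symbol[OF assms(1,2), symmetric] sum_distrib_left sum_distrib_right)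
  finally show "LP_sum chi Q\<^sub>0 Q\<^sub>1 (\<lambda>x. complex_of_real (f x)) x =
    inverse_fourier (\<lambda>\<xi>. complex_of_real (band Q\<^sub>0 Q\<^sub>1 \<xi>) * ?f \<xi>) x"
    by (simp add: inverse_fourier_def)
qed

lemma conv_0_left: "(\<And>x. k x = 0) \<Longrightarrow> conv k f y = 0"
  by (simp add: conv_def)

lemma LP_block_eq_conv:
  assumes "- 1 \<le> q" and f: "L1_or_L2 f"
  shows "LP_block chi q (\<lambda>x. complex_of_real (f x)) y = complex_of_real (conv (cosk (LP_symbol chi q)) f y)"
  using inverse_fourier_mult_fourier[OF test_LP_symbol[OF assms(1)] f, of y]
    trig_kernel_parity(1)[of "LP_symbol chi q"] assms(1)
  by (simp add: LP_block_def complex_eq_iff conv_0_left LP_symbol_even)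

lemma LP_sum_eq_conv:
  assumes "- 1 \<le> Q\<^sub>0" "Q\<^sub>0 \<le> Q\<^sub>1" and f: "L1_or_L2 f"
  shows "LP_sum chi Q\<^sub>0 Q\<^sub>1 (\<lambda>x. complex_of_real (f x)) y = complex_of_real (conv (cosk (band Q\<^sub>0 Q\<^sub>1)) f y)"
  using inverse_fourier_mult_fourier[OF test_band f, of Q\<^sub>0 Q\<^sub>1 y] trig_kernel_parity(1)[of "band Q\<^sub>0 Q\<^sub>1"]
  by (simp add: LP_sum_eq_inverse_fourier[OF assms] complex_eq_iff conv_0_left)

lemma partial_LP_sum_eq_conv:
  assumes "- 1 \<le> Q\<^sub>0" "Q\<^sub>0 \<le> Q\<^sub>1" and f: "L1_or_L2 f"
  shows "partial i (LP_sum chi Q\<^sub>0 Q\<^sub>1 (\<lambda>x. complex_of_real (f x))) y = complex_of_real (conv (grad_kernel (band Q\<^sub>0 Q\<^sub>1) i) f y)"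
proof -
  let ?f = "fourier (\<lambda>x. complex_of_real (f x))"
  obtain R where R: "R > 0" "\<And>x. R < norm x \<Longrightarrow> band Q\<^sub>0 Q\<^sub>1 x = 0" using test_functionD[OF test_band] by metis
  have "partial i (LP_sum chi Q\<^sub>0 Q\<^sub>1 (\<lambda>x. complex_of_real (f x))) y =
    \<i> * inverse_fourier (\<lambda>\<xi>. complex_of_real (\<xi> $ i) * (complex_of_real (band Q\<^sub>0 Q\<^sub>1 \<xi>) * ?f \<xi>)) y"
    unfolding LP_sum_eq_inverse_fourier[OF assms] using R
    by (intro has_derivative_inverse_fourier(2)[where R=R] integrable_mult_fourier[OF test_band f]) auto
  also have "\<dots> = \<i> * Complex (conv (cosk (\<lambda>\<xi>. \<xi> $ i * band Q\<^sub>0 Q\<^sub>1 \<xi>)) f y) (conv (sink (\<lambda>\<xi>. \<xi> $ i * band Q\<^sub>0 Q\<^sub>1 \<xi>)) f y)"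
    using inverse_fourier_mult_fourier[OF test_function_coord[OF test_band] f, of i Q\<^sub>0 Q\<^sub>1 y] by (simp add: mult.assoc)
  also have "\<dots> = complex_of_real (conv (grad_kernel (band Q\<^sub>0 Q\<^sub>1) i) f y)"
    using trig_kernel_parity(2)[of "band Q\<^sub>0 Q\<^sub>1" i] by (simp add: complex_eq_iff conv_0_left) (simp add: conv_def grad_kernel_def)
  finally show ?thesis .
qed

lemma conv_cosk_grad_kernel:
  assumes "test_function \<rho>" "\<And>\<xi>. \<rho> (- \<xi>) = \<rho> \<xi>"
  shows "conv (cosk \<rho>) (grad_kernel \<rho> i) x = mass * grad_kernel (\<lambda>\<xi>. \<rho> \<xi> * \<rho> \<xi>) i x"
proof -
  have "conv (cosk \<rho>) (grad_kernel \<rho> i) x = - (LINT y|lborel. cosk \<rho> (x - y) * sink (\<lambda>\<xi>. \<xi> $ i * \<rho> \<xi>) y)"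
    by (simp add: conv_def grad_kernel_def)
  then show ?thesis
    by (simp add: trig_kernel_convolution(2)[OF assms(1,2) test_function_coord[OF assms(1)]] grad_kernel_def mult.left_commute)
qed

text \<open>Self-adjointness puts both truncations on one velocity factor, so the symbol becomes the
  square of \<open>band\<close>; composing the two kernels leaves the factor
  \<open>mass\<close>.\<close>

lemma energy_flux_eq_trilinear_flux:
  fixes u :: "R3 \<Rightarrow> R3"
  assumes um: "u \<in> borel_measurable borel" and u2: "integrable lborel (\<lambda>x. (norm (u x))\<^sup>2)"
    and Q: "- 1 \<le> Q\<^sub>0" "Q\<^sub>0 < Q\<^sub>1"
  shows "energy_flux chi u Q\<^sub>0 Q\<^sub>1 = complex_of_real (mass * (trilinear_flux (\<lambda>\<xi>. low (Q\<^sub>1 + 1) \<xi> * low (Q\<^sub>1 + 1) \<xi>) u +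
    trilinear_flux (\<lambda>\<xi>. low Q\<^sub>0 \<xi> * low Q\<^sub>0 \<xi> - 2 * low Q\<^sub>0 \<xi>) u))"
proof -
  let ?M = "band Q\<^sub>0 Q\<^sub>1"
  let ?u = "\<lambda>j x. u x $ j"
  note L2 = Lp_2_component[OF um u2] and L1 = Lp_1_products[OF um u2]
  note [measurable] = Lp_measurable[OF L2] Lp_measurable[OF L1] Lp_measurable[OF Lp_trig_kernel(1)[OF test_band, of 1, simplified]]
    Lp_measurable[OF Lp_grad_kernel[OF test_band, of 1, simplified]]
  have L: "L1_or_L2 (?u j)" "L1_or_L2 (\<lambda>x. u x $ i * u x $ j)" for i j
    using L2 L1 by (auto simp: L1_or_L2_def)
  let ?I = "\<lambda>i j x. conv (cosk ?M) (\<lambda>x. u x $ i * u x $ j) x * conv (grad_kernel ?M i) (?u j) x"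
  have Q': "Q\<^sub>0 \<le> Q\<^sub>1" using Q by simp
  have c: "component u j = (\<lambda>x. complex_of_real (u x $ j))" for j by (auto simp: component_def)
  have flux: "energy_flux chi u Q\<^sub>0 Q\<^sub>1 = (LINT x|lebesgue. complex_of_real (\<Sum>i\<in>UNIV. \<Sum>j\<in>UNIV. ?I i j x))"
    unfolding energy_flux_def c of_real_mult[symmetric]
      LP_sum_eq_conv[OF Q(1) Q' L(2)] partial_LP_sum_eq_conv[OF Q(1) Q' L(1)] by simp
  have bdd: "\<bar>conv (grad_kernel ?M i) (?u j) x\<bar> \<le> (LINT y|lborel. (grad_kernel ?M i y)\<^sup>2) + (LINT y|lborel. (u y $ j)\<^sup>2)" for i j x
    by (intro integrable_conv_L2(3) Lp_grad_kernel L2) auto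
  note adj = integral_conv_adjoint[OF Lp_trig_kernel(1)[OF test_band] L1 trig_kernel_minus(1) _ bdd]
  have int: "integrable lborel (?I i j)" for i j by (rule adj(2)) auto
  have each: "(LINT x|lborel. ?I i j x) = mass * (LINT y|lborel. u y $ i * u y $ j * conv (grad_kernel (\<lambda>\<xi>. ?M \<xi> * ?M \<xi>) i) (?u j) y)" for i j
  proof -
    have "(LINT x|lborel. ?I i j x) = (LINT y|lborel. u y $ i * u y $ j * conv (cosk ?M) (conv (grad_kernel ?M i) (?u j)) y)"
      by (rule adj(1)) auto
    also have "\<dots> = (LINT y|lborel. mass * (u y $ i * u y $ j * conv (grad_kernel (\<lambda>\<xi>. ?M \<xi> * ?M \<xi>) i) (?u j) y))"
    proof (intro Bochner_Integration.integral_cong refl)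
      fix y
      have "conv (cosk ?M) (conv (grad_kernel ?M i) (?u j)) y = conv (conv (cosk ?M) (grad_kernel ?M i)) (?u j) y"
        by (intro conv_assoc Lp_trig_kernel(1) Lp_grad_kernel L2) auto
      also have "conv (cosk ?M) (grad_kernel ?M i) = (\<lambda>x. mass * grad_kernel (\<lambda>\<xi>. ?M \<xi> * ?M \<xi>) i x)"
        by (rule ext) (simp add: conv_cosk_grad_kernel)
      also have "conv \<dots> (?u j) y = mass * conv (grad_kernel (\<lambda>\<xi>. ?M \<xi> * ?M \<xi>) i) (?u j) y"
        by (simp add: conv_def mult.assoc)
      finally show "u y $ i * u y $ j * conv (cosk ?M) (conv (grad_kernel ?M i) (?u j)) y =
         mass * (u y $ i * u y $ j * conv (grad_kernel (\<lambda>\<xi>. ?M \<xi> * ?M \<xi>) i) (?u j) y)" by simp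
    qed
    finally show ?thesis by simp
  qed
  have "energy_flux chi u Q\<^sub>0 Q\<^sub>1 = complex_of_real (LINT x|lborel. (\<Sum>i\<in>UNIV. \<Sum>j\<in>UNIV. ?I i j x))"
  proof -
    have "(\<lambda>x. complex_of_real (\<Sum>i\<in>UNIV. \<Sum>j\<in>UNIV. ?I i j x)) \<in> borel_measurable borel" by measurable
    from integral_lebesgue(1)[OF this] show ?thesis unfolding flux by (simp only: integral_complex_of_real)
  qed
  also have "(LINT x|lborel. (\<Sum>i\<in>UNIV. \<Sum>j\<in>UNIV. ?I i j x)) = mass * trilinear_flux (\<lambda>\<xi>. ?M \<xi> * ?M \<xi>) u"
    by (simp add: int each trilinear_flux_def sum_distrib_left)
  \<comment> \<open>The upper cutoff is 1 on the support of the lower one, so the mixed term reduces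
    to \<open>- 2 * low Q\<^sub>0 \<xi>\<close> and no term involves both scales.\<close>
  also have "(\<lambda>\<xi>. ?M \<xi> * ?M \<xi>) = (\<lambda>\<xi>. low (Q\<^sub>1 + 1) \<xi> * low (Q\<^sub>1 + 1) \<xi> + (low Q\<^sub>0 \<xi> * low Q\<^sub>0 \<xi> - 2 * low Q\<^sub>0 \<xi>))"
    using low_mult_low[of Q\<^sub>0 "Q\<^sub>1 + 1"] Q by (auto simp: band_def algebra_simps)
  also have "trilinear_flux \<dots> u = trilinear_flux (\<lambda>\<xi>. low (Q\<^sub>1 + 1) \<xi> * low (Q\<^sub>1 + 1) \<xi>) u +
    trilinear_flux (\<lambda>\<xi>. low Q\<^sub>0 \<xi> * low Q\<^sub>0 \<xi> - 2 * low Q\<^sub>0 \<xi>) u"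
    by (intro trilinear_flux_add[OF um u2] test_function_diff test_function_mult test_function_cmult test_function_smooth test_low)
  finally show ?thesis .
qed

end

subsection \<open>Functions in L3\<close>

text \<open>The L3 norm as a real number. It defaults to 0 when the cube is not integrable, so it is
  meaningful only together with \<open>Lp 3\<close>.\<close>

definition n3 :: "(R3 \<Rightarrow> real) \<Rightarrow> real" where
  "n3 f = root 3 (LINT x|lborel. \<bar>f x\<bar> ^ 3)"

lemma n3_nonneg [simp]: "0 \<le> n3 f"
  by (simp add: n3_def)

lemma n3_power: "n3 f ^ 3 = (LINT x|lborel. \<bar>f x\<bar> ^ 3)"
  by (simp add: n3_def)

lemma n3_leI: "(LINT x|lborel. \<bar>f x\<bar> ^ 3) \<le> c ^ 3 \<Longrightarrow> 0 \<le> c \<Longrightarrow> n3 f \<le> c"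
  unfolding n3_power[symmetric] by (rule power_le_imp_le_base[of _ 2]) (auto simp: numeral_3_eq_3)

lemma n3_leI_nn:
  assumes [measurable]: "f \<in> borel_measurable borel"
    and "(\<integral>\<^sup>+x. ennreal (\<bar>f x\<bar> ^ 3) \<partial>lborel) \<le> ennreal (c ^ 3)" "0 \<le> c"
  shows "Lp 3 f" "n3 f \<le> c"
proof -
  have i: "integrable lborel (\<lambda>x. \<bar>f x\<bar> ^ 3)"
    using assms(2) by (intro integrableI_nonneg) (auto intro: order_le_less_trans ennreal_less_top)
  then show "Lp 3 f" by (simp add: Lp_def)
  have "ennreal (LINT x|lborel. \<bar>f x\<bar> ^ 3) \<le> ennreal (c ^ 3)"
    using assms(2) by (subst (asm) nn_integral_eq_integral[OF i]) auto
  then show "n3 f \<le> c" using assms(3) by (intro n3_leI) (auto simp: ennreal_le_iff)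
qed

lemma Lp_nn_integral: "Lp 3 f \<Longrightarrow> (\<integral>\<^sup>+x. ennreal (\<bar>f x\<bar> ^ 3) \<partial>lborel) = ennreal (n3 f ^ 3)"
  unfolding n3_power by (subst nn_integral_eq_integral) (auto simp: Lp_def)

lemma n3_uminus [simp]: "n3 (\<lambda>x. - f x) = n3 f"
  by (simp add: n3_def)

lemma n3_cmult: "n3 (\<lambda>x. c * f x) = \<bar>c\<bar> * n3 f"
  by (simp add: n3_def abs_mult power_mult_distrib real_root_mult odd_real_root_power_cancel)

lemma Lp_cmult: "Lp n f \<Longrightarrow> Lp n (\<lambda>x. c * f x)"
  by (auto simp: Lp_def abs_mult power_mult_distrib)

lemma Lp_translate: "Lp n f \<Longrightarrow> Lp n (\<lambda>x. f (x - z))" "Lp n f \<Longrightarrow> Lp n (\<lambda>x. f (x + z))"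
  using integrable_translate_iff(1)[of "\<lambda>x. \<bar>f x\<bar> ^ n" z] integrable_translate_iff(2)[of "\<lambda>x. \<bar>f x\<bar> ^ n" z]
  by (auto simp: Lp_def)

lemma n3_translate: "n3 (\<lambda>x. f (x - z)) = n3 f" "n3 (\<lambda>x. f (x + z)) = n3 f"
  using integral_translate(1)[of "\<lambda>x. \<bar>f x\<bar> ^ 3" z] integral_translate(2)[of "\<lambda>x. \<bar>f x\<bar> ^ 3" z]
  by (auto simp: n3_def)

lemma am_gm3:
  fixes a b c :: real
  assumes "0 \<le> a" "0 \<le> b" "0 \<le> c"
  shows "3 * (a * b * c) \<le> a ^ 3 + b ^ 3 + c ^ 3"
proof -
  have "0 \<le> (a + b + c) * ((a - b)\<^sup>2 + (b - c)\<^sup>2 + (c - a)\<^sup>2)"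
    using assms by (intro mult_nonneg_nonneg) auto
  also have "\<dots> = 2 * (a ^ 3 + b ^ 3 + c ^ 3 - 3 * (a * b * c))"
    by (simp add: power2_eq_square power3_eq_cube algebra_simps)
  finally show ?thesis by simp
qed

text \<open>Each factor is divided by its norm, and the arithmetic-geometric mean inequality is
  applied pointwise.\<close>

lemma hoelder3:
  assumes f: "Lp 3 f" and g: "Lp 3 g" and h: "Lp 3 h"
  shows "integrable lborel (\<lambda>x. \<bar>f x\<bar> * \<bar>g x\<bar> * \<bar>h x\<bar>)"
    "(LINT x|lborel. \<bar>f x\<bar> * \<bar>g x\<bar> * \<bar>h x\<bar>) \<le> n3 f * n3 g * n3 h"
proof -
  note [measurable] = Lp_measurable[OF f] Lp_measurable[OF g] Lp_measurable[OF h]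
  have i3: "integrable lborel (\<lambda>x. \<bar>f x\<bar> ^ 3)" "integrable lborel (\<lambda>x. \<bar>g x\<bar> ^ 3)" "integrable lborel (\<lambda>x. \<bar>h x\<bar> ^ 3)"
    using f g h by (auto simp: Lp_def)
  show i: "integrable lborel (\<lambda>x. \<bar>f x\<bar> * \<bar>g x\<bar> * \<bar>h x\<bar>)"
  proof (rule Bochner_Integration.integrable_bound)
    show "integrable lborel (\<lambda>x. \<bar>f x\<bar> ^ 3 + \<bar>g x\<bar> ^ 3 + \<bar>h x\<bar> ^ 3)" using i3 by simp
    have "\<bar>f x\<bar> * \<bar>g x\<bar> * \<bar>h x\<bar> \<le> \<bar>f x\<bar> ^ 3 + \<bar>g x\<bar> ^ 3 + \<bar>h x\<bar> ^ 3" for x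
    proof -
      have "0 \<le> \<bar>f x\<bar> * \<bar>g x\<bar> * \<bar>h x\<bar>" by simp
      then show ?thesis using am_gm3[OF abs_ge_zero abs_ge_zero abs_ge_zero, of "f x" "g x" "h x"] by linarith
    qed
    then show "AE x in lborel. norm (\<bar>f x\<bar> * \<bar>g x\<bar> * \<bar>h x\<bar>) \<le> norm (\<bar>f x\<bar> ^ 3 + \<bar>g x\<bar> ^ 3 + \<bar>h x\<bar> ^ 3)"
      by (auto simp: abs_mult)
  qed measurable
  let ?I = "LINT x|lborel. \<bar>f x\<bar> * \<bar>g x\<bar> * \<bar>h x\<bar>"
  \<comment> \<open>The summand e keeps the divisors positive even when a norm vanishes; it is sent
    to 0 at the end.\<close>
  have "?I \<le> (n3 f + e) * (n3 g + e) * (n3 h + e)" if "e > 0" for e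
  proof -
    define A where "A = n3 f + e"
    define B where "B = n3 g + e"
    define C where "C = n3 h + e"
    have pos: "A > 0" "B > 0" "C > 0" using that by (auto simp: A_def B_def C_def add_nonneg_pos)
    have eq: "?I = A * B * C * (LINT x|lborel. \<bar>f x\<bar> * \<bar>g x\<bar> * \<bar>h x\<bar> / (A * B * C))" using pos by simp
    have "(LINT x|lborel. \<bar>f x\<bar> * \<bar>g x\<bar> * \<bar>h x\<bar> / (A * B * C)) \<le>
       (LINT x|lborel. (1 / (3 * A ^ 3)) * \<bar>f x\<bar> ^ 3 + (1 / (3 * B ^ 3)) * \<bar>g x\<bar> ^ 3 + (1 / (3 * C ^ 3)) * \<bar>h x\<bar> ^ 3)"
    proof (rule integral_mono)
      show "\<bar>f x\<bar> * \<bar>g x\<bar> * \<bar>h x\<bar> / (A * B * C) \<le> (1 / (3 * A ^ 3)) * \<bar>f x\<bar> ^ 3 + (1 / (3 * B ^ 3)) * \<bar>g x\<bar> ^ 3 + (1 / (3 * C ^ 3)) * \<bar>h x\<bar> ^ 3" for x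
        using am_gm3[of "\<bar>f x\<bar> / A" "\<bar>g x\<bar> / B" "\<bar>h x\<bar> / C"] pos by (simp add: power_divide)
    qed (use i i3 in auto)
    also have "\<dots> = (1 / (3 * A ^ 3)) * n3 f ^ 3 + (1 / (3 * B ^ 3)) * n3 g ^ 3 + (1 / (3 * C ^ 3)) * n3 h ^ 3"
      using i3 by (simp add: n3_power)
    also have "\<dots> \<le> (1 / (3 * A ^ 3)) * A ^ 3 + (1 / (3 * B ^ 3)) * B ^ 3 + (1 / (3 * C ^ 3)) * C ^ 3"
      using pos that by (intro add_mono mult_left_mono power_mono) (auto simp: A_def B_def C_def)
    also have "\<dots> = 1" using pos by simp
    finally have "A * B * C * (LINT x|lborel. \<bar>f x\<bar> * \<bar>g x\<bar> * \<bar>h x\<bar> / (A * B * C)) \<le> A * B * C * 1"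
      using pos by (intro mult_left_mono) auto
    then show ?thesis unfolding eq by (simp add: A_def B_def C_def)
  qed
  then have "\<forall>\<^sub>F e in at_right 0. ?I \<le> (n3 f + e) * (n3 g + e) * (n3 h + e)"
    using eventually_at_right_less[of "0::real"] by (auto elim: eventually_mono)
  moreover have "((\<lambda>e. (n3 f + e) * (n3 g + e) * (n3 h + e)) \<longlongrightarrow> (n3 f + 0) * (n3 g + 0) * (n3 h + 0)) (at_right 0)"
    by (intro tendsto_intros)
  ultimately show "?I \<le> n3 f * n3 g * n3 h"
    using tendsto_lowerbound[of "\<lambda>e. (n3 f + e) * (n3 g + e) * (n3 h + e)" "n3 f * n3 g * n3 h" "at_right 0" ?I] by simp
qed

lemma cube_add_le: "\<bar>a + b :: real\<bar> ^ 3 \<le> 4 * (\<bar>a\<bar> ^ 3 + \<bar>b\<bar> ^ 3)"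
proof -
  have *: "(x + y) ^ 3 \<le> 4 * (x ^ 3 + y ^ 3)" if "0 \<le> x" "0 \<le> y" for x y :: real
  proof -
    have "0 \<le> 3 * (x + y) * (x - y)\<^sup>2" using that by simp
    also have "\<dots> = 4 * (x ^ 3 + y ^ 3) - (x + y) ^ 3"
      by (simp add: power2_eq_square power3_eq_cube algebra_simps)
    finally show ?thesis by simp
  qed
  have "\<bar>a + b\<bar> ^ 3 \<le> (\<bar>a\<bar> + \<bar>b\<bar>) ^ 3" by (intro power_mono) auto
  also have "\<dots> \<le> 4 * (\<bar>a\<bar> ^ 3 + \<bar>b\<bar> ^ 3)" by (rule *) auto
  finally show ?thesis .
qed

lemma Lp_3_add:
  assumes "Lp 3 f" "Lp 3 g"
  shows "Lp 3 (\<lambda>x. f x + g x)"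
proof -
  note [measurable] = assms[THEN Lp_measurable]
  have "integrable lborel (\<lambda>x. \<bar>f x + g x\<bar> ^ 3)"
  proof (rule Bochner_Integration.integrable_bound)
    show "integrable lborel (\<lambda>x. 4 * (\<bar>f x\<bar> ^ 3 + \<bar>g x\<bar> ^ 3))" using assms by (simp add: Lp_def)
    show "AE x in lborel. norm (\<bar>f x + g x\<bar> ^ 3) \<le> norm (4 * (\<bar>f x\<bar> ^ 3 + \<bar>g x\<bar> ^ 3))"
      using cube_add_le[of "f x" "g x" for x] by (auto simp: abs_mult)
  qed measurable
  then show ?thesis using assms by (simp add: Lp_def)
qed

text \<open>One factor of |f + g|^3 is split by the triangle inequality, Hoelder is applied to both
  parts, and the remaining square of the norm is divided out.\<close>

lemma minkowski3:
  assumes f: "Lp 3 f" and g: "Lp 3 g"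
  shows "n3 (\<lambda>x. f x + g x) \<le> n3 f + n3 g"
proof -
  let ?s = "\<lambda>x. f x + g x"
  have s: "Lp 3 ?s" by (rule Lp_3_add[OF f g])
  note h1 = hoelder3[OF f s s] and h2 = hoelder3[OF g s s]
  have "n3 ?s ^ 3 = (LINT x|lborel. \<bar>?s x\<bar> ^ 3)" by (rule n3_power)
  also have "\<dots> \<le> (LINT x|lborel. \<bar>f x\<bar> * \<bar>?s x\<bar> * \<bar>?s x\<bar> + \<bar>g x\<bar> * \<bar>?s x\<bar> * \<bar>?s x\<bar>)"
  proof (rule integral_mono)
    show "\<bar>?s x\<bar> ^ 3 \<le> \<bar>f x\<bar> * \<bar>?s x\<bar> * \<bar>?s x\<bar> + \<bar>g x\<bar> * \<bar>?s x\<bar> * \<bar>?s x\<bar>" for x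
    proof -
      have "\<bar>?s x\<bar> ^ 3 = \<bar>?s x\<bar> * (\<bar>?s x\<bar> * \<bar>?s x\<bar>)" by (simp only: power3_eq_cube mult.assoc)
      also have "\<dots> \<le> (\<bar>f x\<bar> + \<bar>g x\<bar>) * (\<bar>?s x\<bar> * \<bar>?s x\<bar>)"
        by (intro mult_right_mono abs_triangle_ineq) auto
      finally show ?thesis by (simp only: distrib_right mult.assoc)
    qed
  qed (use s h1 h2 in \<open>auto simp: Lp_def\<close>)
  also have "\<dots> \<le> (n3 f + n3 g) * n3 ?s * n3 ?s"
    using h1 h2 by (simp add: distrib_right)
  finally have *: "n3 ?s ^ 3 \<le> (n3 f + n3 g) * n3 ?s * n3 ?s" .
  show ?thesis
  proof (cases "n3 ?s = 0")
    case True
    then show ?thesis by simp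
  next
    case False
    then have "n3 ?s > 0" by (simp add: less_le)
    with * show ?thesis by (simp add: power3_eq_cube)
  qed
qed

text \<open>Jensen's inequality for the weight |k(x - y)|, followed by Tonelli. Integrability is
  required at every x, so that each value of \<open>conv k f\<close> is a genuine integral.\<close>

lemma young3:
  assumes k: "Lp 1 k" and f: "Lp 3 f" and int: "\<And>x. integrable lborel (\<lambda>y. k (x - y) * f y)"
    and K: "(LINT y|lborel. \<bar>k y\<bar>) \<le> K"
  shows "Lp 3 (conv k f)" "n3 (conv k f) \<le> K * n3 f"
proof -
  note [measurable] = Lp_measurable[OF k] Lp_measurable[OF f]
  have ik: "integrable lborel (\<lambda>y. \<bar>k y\<bar>)" using k Lp_1 by auto
  \<comment> \<open>A bound K' > K is a positive divisor even for the zero kernel; K' is sent to K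
    at the end.\<close>
  have bound: "Lp 3 (conv k f) \<and> n3 (conv k f) \<le> K' * n3 f" if K': "K < K'" for K'
  proof -
    have "0 \<le> (LINT y|lborel. \<bar>k y\<bar>)" by simp
    then have "K \<ge> 0" using K by linarith
    then have pos: "K' > 0" using K' by simp
    have pt: "ennreal (\<bar>conv k f x\<bar> ^ 3) \<le> ennreal (K'\<^sup>2) * (\<integral>\<^sup>+y. ennreal \<bar>k (x - y)\<bar> * ennreal (\<bar>f y\<bar> ^ 3) \<partial>lborel)" for x
    proof (cases "(\<integral>\<^sup>+y. ennreal \<bar>k (x - y)\<bar> * ennreal (\<bar>f y\<bar> ^ 3) \<partial>lborel) = \<infinity>")
      case True
      then show ?thesis using pos by (simp add: ennreal_mult_eq_top_iff)
    next
      case False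
      have i3: "integrable lborel (\<lambda>y. \<bar>k (x - y)\<bar> * \<bar>f y\<bar> ^ 3)"
        using False by (intro integrableI_nonneg) (auto simp: ennreal_mult top.not_eq_extremum)
      have i1: "integrable lborel (\<lambda>y. \<bar>k (x - y)\<bar> * \<bar>f y\<bar>)"
        using integrable_abs[OF int[of x]] by (simp add: abs_mult)
      have i0: "integrable lborel (\<lambda>y. \<bar>k (x - y)\<bar>)" and e0: "(LINT y|lborel. \<bar>k (x - y)\<bar>) \<le> K"
        using ik K integrable_translate_iff(3)[of "\<lambda>y. \<bar>k y\<bar>" x] integral_translate(3)[of "\<lambda>y. \<bar>k y\<bar>" x] by auto
      define A where "A = (LINT y|lborel. \<bar>k (x - y)\<bar> * \<bar>f y\<bar>)"
      have A0: "A \<ge> 0" by (simp add: A_def)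
      \<comment> \<open>Jensen through a supporting line: t^3 lies above its tangent at s, and s is
        the weighted mean with the total weight replaced by K'.\<close>
      define s where "s = A / K'"
      have s0: "s \<ge> 0" using A0 pos by (simp add: s_def)
      have tangent: "3 * s\<^sup>2 * t - 2 * s ^ 3 \<le> t ^ 3" if "t \<ge> 0" for t
      proof -
        have "0 \<le> (t + 2 * s) * (t - s)\<^sup>2" using that s0 by simp
        also have "\<dots> = t ^ 3 - (3 * s\<^sup>2 * t - 2 * s ^ 3)"
          by (simp add: power2_eq_square power3_eq_cube algebra_simps)
        finally show ?thesis by simp
      qed
      have "A ^ 3 / K'\<^sup>2 = 3 * s\<^sup>2 * A - 2 * s ^ 3 * K'"
        using pos by (simp add: s_def field_simps power2_eq_square power3_eq_cube)
      also have "\<dots> \<le> 3 * s\<^sup>2 * A - 2 * s ^ 3 * (LINT y|lborel. \<bar>k (x - y)\<bar>)"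
        using s0 e0 K' by (intro diff_left_mono mult_left_mono) auto
      also have "\<dots> = (LINT y|lborel. 3 * s\<^sup>2 * (\<bar>k (x - y)\<bar> * \<bar>f y\<bar>) - 2 * s ^ 3 * \<bar>k (x - y)\<bar>)"
        using i1 i0 by (simp add: A_def)
      also have "\<dots> \<le> (LINT y|lborel. \<bar>k (x - y)\<bar> * \<bar>f y\<bar> ^ 3)"
      proof (rule integral_mono)
        show "3 * s\<^sup>2 * (\<bar>k (x - y)\<bar> * \<bar>f y\<bar>) - 2 * s ^ 3 * \<bar>k (x - y)\<bar> \<le> \<bar>k (x - y)\<bar> * \<bar>f y\<bar> ^ 3" for y
          using mult_left_mono[OF tangent[of "\<bar>f y\<bar>"], of "\<bar>k (x - y)\<bar>"] by (simp add: algebra_simps)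
      qed (use i3 i1 i0 in auto)
      finally have "A ^ 3 \<le> K'\<^sup>2 * (LINT y|lborel. \<bar>k (x - y)\<bar> * \<bar>f y\<bar> ^ 3)"
        using pos by (simp add: field_simps)
      moreover have "\<bar>conv k f x\<bar> \<le> A"
        unfolding conv_def A_def using integral_abs_bound[of lborel "\<lambda>y. k (x - y) * f y"] by (simp add: abs_mult)
      then have "\<bar>conv k f x\<bar> ^ 3 \<le> A ^ 3" by (intro power_mono) auto
      ultimately have "ennreal (\<bar>conv k f x\<bar> ^ 3) \<le> ennreal (K'\<^sup>2 * (LINT y|lborel. \<bar>k (x - y)\<bar> * \<bar>f y\<bar> ^ 3))"
        by (intro ennreal_leI) simp
      also have "\<dots> = ennreal (K'\<^sup>2) * (\<integral>\<^sup>+y. ennreal (\<bar>k (x - y)\<bar> * \<bar>f y\<bar> ^ 3) \<partial>lborel)"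
        by (subst nn_integral_eq_integral[OF i3]) (auto simp: ennreal_mult)
      finally show ?thesis by (simp add: ennreal_mult)
    qed
    have "(\<integral>\<^sup>+x. ennreal (\<bar>conv k f x\<bar> ^ 3) \<partial>lborel) \<le>
      (\<integral>\<^sup>+x. ennreal (K'\<^sup>2) * (\<integral>\<^sup>+y. ennreal \<bar>k (x - y)\<bar> * ennreal (\<bar>f y\<bar> ^ 3) \<partial>lborel) \<partial>lborel)"
      by (intro nn_integral_mono pt)
    also have "\<dots> = ennreal (K'\<^sup>2) * ((\<integral>\<^sup>+y. ennreal \<bar>k y\<bar> \<partial>lborel) * (\<integral>\<^sup>+y. ennreal (\<bar>f y\<bar> ^ 3) \<partial>lborel))"
      using nn_integral_convolution(2)[of "\<lambda>y. ennreal \<bar>k y\<bar>" "\<lambda>y. ennreal (\<bar>f y\<bar> ^ 3)"] by (simp add: nn_integral_cmult)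
    also have "\<dots> \<le> ennreal (K'\<^sup>2) * (ennreal K' * ennreal (n3 f ^ 3))"
      unfolding Lp_nn_integral[OF f] using K K' ik
      by (intro mult_left_mono mult_right_mono) (auto simp: nn_integral_eq_integral intro!: ennreal_leI)
    also have "\<dots> = ennreal ((K' * n3 f) ^ 3)"
      using pos by (simp add: ennreal_mult[symmetric] power_mult_distrib power2_eq_square power3_eq_cube mult.assoc)
    finally show ?thesis using pos n3_leI_nn[of "conv k f" "K' * n3 f"] by simp
  qed
  from bound[of "K + 1"] show "Lp 3 (conv k f)" by simp
  have "\<forall>\<^sub>F K' in at_right K. n3 (conv k f) \<le> K' * n3 f"
    using eventually_at_right_less[of K] by (rule eventually_mono) (use bound in auto)
  moreover have "((\<lambda>K'. K' * n3 f) \<longlongrightarrow> K * n3 f) (at_right K)" by (intro tendsto_intros)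
  ultimately show "n3 (conv k f) \<le> K * n3 f"
    using tendsto_lowerbound[of "\<lambda>K'. K' * n3 f" "K * n3 f" "at_right K"] by simp
qed

section \<open>Increments and their commutation with convolution\<close>

definition diff :: "R3 \<Rightarrow> (R3 \<Rightarrow> real) \<Rightarrow> R3 \<Rightarrow> real" where
  "diff z f x = f (x - z) - f x"

lemma Lp_3_diff: "Lp 3 f \<Longrightarrow> Lp 3 (diff z f)" "Lp 3 f \<Longrightarrow> n3 (diff z f) \<le> 2 * n3 f"
  using Lp_3_add[OF Lp_translate(1)[of 3 f z] Lp_uminus[of 3 f]] minkowski3[OF Lp_translate(1)[of 3 f z] Lp_uminus[of 3 f]]
  by (simp_all add: diff_def[abs_def] n3_translate)

lemma Lp_1_diff:
  assumes "Lp 1 f"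
  shows "Lp 1 (diff z f)"
  using assms Lp_translate(1)[OF assms, of z] unfolding Lp_1 by (simp add: diff_def[abs_def])

lemma Lp_2_diff:
  assumes "Lp 2 f"
  shows "Lp 2 (diff z f)"
proof -
  note [measurable] = Lp_measurable[OF assms]
  have "integrable lborel (\<lambda>x. (diff z f x)\<^sup>2)"
  proof (rule Bochner_Integration.integrable_bound)
    show "integrable lborel (\<lambda>x. 2 * ((f (x - z))\<^sup>2 + (f x)\<^sup>2))"
      using assms Lp_translate(1)[OF assms, of z] by (simp add: Lp_2)
    show "AE x in lborel. norm ((diff z f x)\<^sup>2) \<le> norm (2 * ((f (x - z))\<^sup>2 + (f x)\<^sup>2))"
    proof (rule AE_I2)
      fix x
      have "(f (x - z) - f x)\<^sup>2 \<le> 2 * ((f (x - z))\<^sup>2 + (f x)\<^sup>2)"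
        using zero_le_power2[of "f (x - z) + f x"] by (simp add: power2_sum power2_diff)
      then show "norm ((diff z f x)\<^sup>2) \<le> norm (2 * ((f (x - z))\<^sup>2 + (f x)\<^sup>2))" by (simp add: diff_def)
    qed
    show "(\<lambda>x. (diff z f x)\<^sup>2) \<in> borel_measurable lborel" unfolding diff_def by measurable
  qed
  moreover have "diff z f \<in> borel_measurable borel" unfolding diff_def[abs_def] by measurable
  ultimately show ?thesis by (simp add: Lp_2)
qed

lemma diff_conv:
  assumes "\<And>x. integrable lborel (\<lambda>y. k (x - y) * f y)"
  shows "diff z (conv k f) x = conv (diff z k) f x" "diff z (conv k f) x = conv k (diff z f) x"
proof -
  have e: "k (x - z - y) = k (x - y - z)" for y by (simp add: algebra_simps)
  show "diff z (conv k f) x = conv (diff z k) f x"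
    using assms[of x] assms[of "x - z"] by (simp add: diff_def conv_def left_diff_distrib e)
  have s: "x - z - y = x - (y + z)" for y by (simp add: algebra_simps)
  have "(LINT y|lborel. k (x - z - y) * f y) = (LINT y|lborel. k (x - y) * f (y - z))"
    using integral_translate(1)[of "\<lambda>y. k (x - y) * f (y - z)" z] by (simp add: s)
  moreover have "integrable lborel (\<lambda>y. k (x - y) * f (y - z))"
    using assms[of "x - z"] integrable_translate_iff(1)[of "\<lambda>y. k (x - y) * f (y - z)" z] by (simp add: s)
  ultimately show "diff z (conv k f) x = conv k (diff z f) x"
    using assms[of x] by (simp add: diff_def conv_def right_diff_distrib)
qed

subsection \<open>Summing the blocks in L3\<close>

lemma integrable_weighted_decay:
  fixes f :: "R3 \<Rightarrow> real"
  assumes [measurable]: "f \<in> borel_measurable borel" and C: "\<And>x. \<bar>f x\<bar> \<le> C / (1 + norm x) ^ (n + 5)"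
  shows "integrable lborel (\<lambda>x. \<bar>f x\<bar> * (1 + norm x) ^ n)"
proof (rule Bochner_Integration.integrable_bound)
  show "integrable lborel (\<lambda>x::R3. C * (1 / (1 + norm x) ^ 5))"
    using integrable_mult_right[OF integrable_decay[of 5], of C] by simp
  show "AE x in lborel. norm (\<bar>f x\<bar> * (1 + norm x) ^ n) \<le> norm (C * (1 / (1 + norm x) ^ 5))"
  proof (rule AE_I2)
    fix x :: R3
    have pos: "1 + norm x > 0" by (simp add: add_pos_nonneg)
    have "\<bar>f x\<bar> * (1 + norm x) ^ n \<le> C / (1 + norm x) ^ (n + 5) * (1 + norm x) ^ n"
      using pos by (intro mult_right_mono C) auto
    also have "\<dots> = C * (1 / (1 + norm x) ^ 5)" using pos by (simp add: power_add)
    finally have "\<bar>f x\<bar> * (1 + norm x) ^ n \<le> C * (1 / (1 + norm x) ^ 5)" .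
    moreover have "0 \<le> \<bar>f x\<bar> * (1 + norm x) ^ n" using pos by simp
    ultimately show "norm (\<bar>f x\<bar> * (1 + norm x) ^ n) \<le> norm (C * (1 / (1 + norm x) ^ 5))"
      unfolding real_norm_def by linarith
  qed
qed measurable

lemma integrable_trig_kernel_weighted:
  assumes "test_function \<rho>"
  shows "integrable lborel (\<lambda>x. \<bar>cosk \<rho> x\<bar> * (1 + norm x) ^ n)" "integrable lborel (\<lambda>x. \<bar>sink \<rho> x\<bar> * (1 + norm x) ^ n)"
proof -
  obtain C where "\<And>x. \<bar>cosk \<rho> x\<bar> \<le> C / (1 + norm x) ^ (n + 5)" "\<And>x. \<bar>sink \<rho> x\<bar> \<le> C / (1 + norm x) ^ (n + 5)"
    using trig_kernel_decay[OF assms] by metis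
  then show "integrable lborel (\<lambda>x. \<bar>cosk \<rho> x\<bar> * (1 + norm x) ^ n)" "integrable lborel (\<lambda>x. \<bar>sink \<rho> x\<bar> * (1 + norm x) ^ n)"
    using integrable_trig_kernel(4,5)[OF assms] by (auto intro: integrable_weighted_decay)
qed

text \<open>For |z| \<le> 1 the mean value theorem meets a gradient that decays like the inverse
  fifth power; for larger z the triangle inequality gives a constant.\<close>

lemma kernel_modulus:
  assumes "test_function \<rho>"
  shows "\<exists>C>0. \<forall>z. (LINT x|lborel. \<bar>diff z (cosk \<rho>) x\<bar>) \<le> C * min 1 (norm z)"
proof -
  have "\<exists>B. \<forall>i. B i \<ge> 0 \<and> (\<forall>x. \<bar>grad_kernel \<rho> i x\<bar> \<le> B i / (1 + norm x) ^ 5)"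
  proof (rule choice, rule allI)
    fix i
    show "\<exists>B. B \<ge> 0 \<and> (\<forall>x. \<bar>grad_kernel \<rho> i x\<bar> \<le> B / (1 + norm x) ^ 5)"
      using trig_kernel_decay[OF test_function_coord[OF assms, of i], of 5] by (auto simp: grad_kernel_def)
  qed
  then obtain B where B: "\<And>i. B i \<ge> 0" "\<And>i x. \<bar>grad_kernel \<rho> i x\<bar> \<le> B i / (1 + norm x) ^ 5" by blast
  \<comment> \<open>32 is 2^5: moving by at most 1 changes the weight 1 + |x| by at most a factor 2,
    and the weight enters with exponent 5.\<close>
  define S where "S = 32 * (\<Sum>i\<in>UNIV. B i)"
  have S0: "S \<ge> 0" unfolding S_def using B by (auto intro: sum_nonneg)
  let ?w = "\<lambda>x::R3. 1 / (1 + norm x) ^ 5"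
  have iw: "integrable lborel ?w" by (rule integrable_decay) simp
  have L1: "Lp 1 (cosk \<rho>)" using Lp_trig_kernel(1)[OF assms, of 1] by simp
  have id: "integrable lborel (\<lambda>x. \<bar>diff z (cosk \<rho>) x\<bar>)" for z using Lp_1_diff[OF L1] Lp_1 by auto
  have small: "\<bar>diff z (cosk \<rho>) x\<bar> \<le> norm z * (S * ?w x)" if "norm z \<le> 1" for z x
  proof -
    have der: "((\<lambda>s. cosk \<rho> (x + s *\<^sub>R (- z))) has_real_derivative (\<Sum>i\<in>UNIV. (- z) $ i * partial i (cosk \<rho>) (x + s *\<^sub>R (- z)))) (at s)" for s
      by (rule has_real_derivative_line[OF partial_trig_kernel(1)[OF assms]])
    obtain s where s: "0 < s" "s < 1" and
      eq: "cosk \<rho> (x + 1 *\<^sub>R (- z)) - cosk \<rho> (x + 0 *\<^sub>R (- z)) = (1 - 0) * (\<Sum>i\<in>UNIV. (- z) $ i * partial i (cosk \<rho>) (x + s *\<^sub>R (- z)))"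
      using MVT2[OF zero_less_one der] by blast
    let ?y = "x + s *\<^sub>R (- z)"
    have "norm x \<le> norm ?y + norm (s *\<^sub>R z)"
      using norm_triangle_ineq[of ?y "s *\<^sub>R z"] by simp
    moreover have "norm (s *\<^sub>R z) \<le> 1" using s that by (simp add: mult_le_one)
    moreover have "1 + a \<le> 2 * (1 + b)" if "a \<le> b + c" "c \<le> 1" "0 \<le> b" for a b c :: real
      using that by simp
    ultimately have "1 + norm x \<le> 2 * (1 + norm ?y)" using norm_ge_zero by blast
    then have "(1 + norm x) ^ 5 \<le> (2 * (1 + norm ?y)) ^ 5" by (intro power_mono) auto
    moreover have "1 / b ^ 5 \<le> 32 * (1 / a ^ 5)" if "a ^ 5 \<le> (2 * b) ^ 5" "0 < a" "0 < b" for a b :: real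
      using that by (simp add: power_mult_distrib field_simps)
    ultimately have y: "1 / (1 + norm ?y) ^ 5 \<le> 32 * ?w x"
      by (simp only: add_pos_nonneg zero_less_one norm_ge_zero)
    have "\<bar>diff z (cosk \<rho>) x\<bar> = \<bar>\<Sum>i\<in>UNIV. (- z) $ i * grad_kernel \<rho> i ?y\<bar>"
      using eq by (simp add: diff_def partial_cosk[OF assms])
    also have "\<dots> \<le> (\<Sum>i\<in>UNIV. norm z * (B i * (32 * ?w x)))"
    proof (rule order_trans[OF sum_abs sum_mono])
      fix i
      have "\<bar>grad_kernel \<rho> i ?y\<bar> \<le> B i * (1 / (1 + norm ?y) ^ 5)" using B(2)[of i ?y] by simp
      also have "\<dots> \<le> B i * (32 * ?w x)" using B(1) y by (intro mult_left_mono) auto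
      finally have "\<bar>grad_kernel \<rho> i ?y\<bar> \<le> B i * (32 * ?w x)" .
      moreover have "\<bar>(- z) $ i\<bar> \<le> norm z" using component_le_norm_cart[of z i] by simp
      ultimately show "\<bar>(- z) $ i * grad_kernel \<rho> i ?y\<bar> \<le> norm z * (B i * (32 * ?w x))"
        unfolding abs_mult by (intro mult_mono) auto
    qed
    also have "\<dots> = norm z * (S * ?w x)" by (simp add: S_def sum_distrib_left sum_distrib_right mult_ac)
    finally show ?thesis .
  qed
  define I where "I = (LINT x|lborel. \<bar>cosk \<rho> x\<bar>)"
  define W where "W = (LINT x|lborel. ?w x)"
  have I0: "I \<ge> 0" and W0: "W \<ge> 0" unfolding I_def W_def by auto
  let ?C = "S * W + 2 * I + 1"
  show ?thesis
  proof (intro exI[of _ ?C] conjI allI)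
    show "?C > 0" using S0 W0 I0 by (simp add: add_nonneg_pos)
    fix z :: R3
    show "(LINT x|lborel. \<bar>diff z (cosk \<rho>) x\<bar>) \<le> ?C * min 1 (norm z)"
    proof (cases "norm z \<le> 1")
      case True
      have "(LINT x|lborel. \<bar>diff z (cosk \<rho>) x\<bar>) \<le> (LINT x|lborel. norm z * (S * ?w x))"
        by (intro integral_mono id small[OF True] integrable_mult_right iw)
      also have "\<dots> = norm z * (S * W)" unfolding W_def by (simp only: integral_mult_right_zero)
      also have "\<dots> = S * W * norm z" by (simp only: mult_ac)
      also have "\<dots> \<le> ?C * norm z" using I0 by (intro mult_right_mono) auto
      finally show ?thesis using True by (simp add: min_def)
    next
      case False
      have ik: "integrable lborel (\<lambda>x. \<bar>cosk \<rho> x\<bar>)" using L1 Lp_1 by auto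
      have "(LINT x|lborel. \<bar>diff z (cosk \<rho>) x\<bar>) \<le> (LINT x|lborel. \<bar>cosk \<rho> (x - z)\<bar> + \<bar>cosk \<rho> x\<bar>)"
        using ik integrable_translate_iff(2)[of "\<lambda>x. \<bar>cosk \<rho> x\<bar>" z]
        by (intro integral_mono id) (auto simp: diff_def)
      also have "\<dots> = 2 * I"
        using ik integrable_translate_iff(2)[of "\<lambda>x. \<bar>cosk \<rho> x\<bar>" z] integral_translate(2)[of "\<lambda>x. \<bar>cosk \<rho> x\<bar>" z]
        by (simp add: I_def)
      also have "\<dots> \<le> ?C" using S0 W0 by simp
      finally show ?thesis using False by (simp add: min_def)
    qed
  qed
qed

lemma integral_diff_cosk_dilation:
  assumes "l > 0"
  shows "(LINT x|lborel. \<bar>diff z (cosk (\<lambda>\<xi>. \<rho> (\<xi> /\<^sub>R l))) x\<bar>) = (LINT x|lborel. \<bar>diff (l *\<^sub>R z) (cosk \<rho>) x\<bar>)"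
proof -
  have "\<bar>diff z (cosk (\<lambda>\<xi>. \<rho> (\<xi> /\<^sub>R l))) x\<bar> = l ^ 3 * \<bar>diff (l *\<^sub>R z) (cosk \<rho>) (0 + l *\<^sub>R x)\<bar>" for x
  proof -
    have "diff z (cosk (\<lambda>\<xi>. \<rho> (\<xi> /\<^sub>R l))) x = l ^ 3 * diff (l *\<^sub>R z) (cosk \<rho>) (0 + l *\<^sub>R x)"
      using assms by (simp add: diff_def trig_kernel_scale right_diff_distrib scaleR_diff_right)
    then show ?thesis using assms by (simp add: abs_mult)
  qed
  then show ?thesis
    using assms integral_affine3[of l "\<lambda>x. \<bar>diff (l *\<^sub>R z) (cosk \<rho>) x\<bar>" 0] by simp
qed

text \<open>The factor 1/l is the derivative gained when a function of frequency l is tested against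
  a Lipschitz one.\<close>

lemma first_moment_cosk_dilation:
  assumes "test_function \<rho>" "l > 0"
  shows "(LINT x|lborel. \<bar>cosk (\<lambda>\<xi>. \<rho> (\<xi> /\<^sub>R l)) x\<bar> * norm x) = (LINT x|lborel. \<bar>cosk \<rho> x\<bar> * norm x) / l"
proof -
  have "(LINT x|lborel. \<bar>cosk (\<lambda>\<xi>. \<rho> (\<xi> /\<^sub>R l)) x\<bar> * norm x) =
    (LINT x|lborel. (l ^ 3 / l) * (\<bar>cosk \<rho> (0 + l *\<^sub>R x)\<bar> * norm (0 + l *\<^sub>R x)))"
    using assms(2) by (intro Bochner_Integration.integral_cong) (auto simp: trig_kernel_scale abs_mult)
  also have "\<dots> = (l ^ 3 / l) * (LINT x|lborel. \<bar>cosk \<rho> (0 + l *\<^sub>R x)\<bar> * norm (0 + l *\<^sub>R x))" by (rule integral_mult_right_zero)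
  also have "\<dots> = (LINT x|lborel. \<bar>cosk \<rho> x\<bar> * norm x) / l"
    using assms integral_affine3[of l "\<lambda>x. \<bar>cosk \<rho> x\<bar> * norm x" 0] by (simp only:) simp
  finally show ?thesis .
qed

lemma integrable_first_moment: 
  assumes "test_function \<rho>"
  shows "integrable lborel (\<lambda>x. \<bar>cosk \<rho> x\<bar> * norm x)"
proof (rule Bochner_Integration.integrable_bound[OF integrable_trig_kernel_weighted(1)[OF assms, of 1]])
  show "(\<lambda>x. \<bar>cosk \<rho> x\<bar> * norm x) \<in> borel_measurable lborel"
    using integrable_trig_kernel(4)[OF assms] by measurable
qed (auto intro!: AE_I2 mult_left_mono simp: abs_mult)

text \<open>Taylor's formula for |t|^3 with second-order remainder. The linear term keeps its sign,
  because it is small only after integration.\<close>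

lemma cube_expansion_le: "\<bar>t + f\<bar> ^ 3 \<le> \<bar>t\<bar> ^ 3 + 3 * (\<bar>t\<bar> * t * f) + 3 * (\<bar>t\<bar> * f\<^sup>2) + \<bar>f :: real\<bar> ^ 3"
proof -
  have *: "\<bar>t + f\<bar> ^ 3 \<le> \<bar>t\<bar> ^ 3 + 3 * (\<bar>t\<bar> * t * f) + 3 * (\<bar>t\<bar> * f\<^sup>2) + \<bar>f\<bar> ^ 3" if t: "0 \<le> t" for t f :: real
  proof (cases "0 \<le> t + f")
    case True
    have "(t + f) ^ 3 = t ^ 3 + 3 * (t * t * f) + 3 * (t * f\<^sup>2) + f ^ 3"
      by (simp add: power2_eq_square power3_eq_cube algebra_simps)
    moreover have "f ^ 3 \<le> \<bar>f\<bar> ^ 3" by (simp flip: power_abs)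
    ultimately show ?thesis using t True by simp
  next
    case False
    define g where "g = - f"
    have g: "g > t" "g \<ge> 0" using False t by (auto simp: g_def)
    \<comment> \<open>This is exactly the difference of the two sides when t + f is
      negative.\<close>
    have "0 \<le> 6 * (t * (g * (g - t))) + 2 * t ^ 3" using g t by (intro add_nonneg_nonneg) auto
    also have "\<dots> = t ^ 3 + 3 * (t * t * f) + 3 * (t * f\<^sup>2) + g ^ 3 - (g - t) ^ 3"
      by (simp add: g_def power2_eq_square power3_eq_cube algebra_simps)
    finally have "(g - t) ^ 3 \<le> t ^ 3 + 3 * (t * t * f) + 3 * (t * f\<^sup>2) + g ^ 3" by simp
    moreover have "\<bar>t + f\<bar> = g - t" "\<bar>t\<bar> = t" "\<bar>f\<bar> = g" using g t by (auto simp: g_def)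
    ultimately show ?thesis by (simp only:)
  qed
  show ?thesis
  proof (cases "0 \<le> t")
    case False
    have "\<bar>- t + - f\<bar> = \<bar>t + f\<bar>" by (metis abs_minus_cancel minus_add_distrib)
    then show ?thesis using *[of "- t" "- f"] False by simp
  qed (rule *)
qed

text \<open>A mean value bound for t |t|, whose derivative 2|t| is split between the two endpoints;
  both resulting terms fit the three-factor Hoelder inequality.\<close>

lemma abs_square_diff_le: "\<bar>\<bar>a\<bar> * a - \<bar>b\<bar> * b\<bar> \<le> \<bar>a - b\<bar> * \<bar>a\<bar> + \<bar>a - b\<bar> * \<bar>b :: real\<bar>"
proof -
  consider "0 \<le> a" "0 \<le> b" | "a \<le> 0" "b \<le> 0" | "0 \<le> a" "b \<le> 0" | "a \<le> 0" "0 \<le> b" by linarith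
  then show ?thesis
  proof cases
    case 1
    then have "\<bar>a\<bar> * a - \<bar>b\<bar> * b = (a - b) * (a + b)" by (simp add: square_diff_square_factored mult.commute)
    then have "\<bar>\<bar>a\<bar> * a - \<bar>b\<bar> * b\<bar> = \<bar>a - b\<bar> * \<bar>a + b\<bar>" by (simp add: abs_mult)
    moreover have "\<bar>a + b\<bar> = \<bar>a\<bar> + \<bar>b\<bar>" using 1 by simp
    ultimately show ?thesis by (simp only: distrib_left)
  next
    case 2
    then have "\<bar>a\<bar> * a - \<bar>b\<bar> * b = - ((a - b) * (a + b))" by (simp add: algebra_simps)
    then have "\<bar>\<bar>a\<bar> * a - \<bar>b\<bar> * b\<bar> = \<bar>a - b\<bar> * \<bar>a + b\<bar>" by (simp add: abs_mult)
    moreover have "\<bar>a + b\<bar> = \<bar>a\<bar> + \<bar>b\<bar>" using 2 by simp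
    ultimately show ?thesis by (simp only: distrib_left)
  next
    case 3
    have "\<bar>a\<bar> * a - \<bar>b\<bar> * b = a * a + b * b" using 3 by simp
    also have "\<dots> \<le> (a - b) * a + (a - b) * (- b)" using 3 mult_nonneg_nonpos[of a b] by (simp add: algebra_simps)
    finally show ?thesis using 3 by (simp add: abs_of_nonneg abs_of_nonpos)
  next
    case 4
    have "\<bar>a\<bar> * a - \<bar>b\<bar> * b = - (a * a + b * b)" using 4 by simp
    moreover have "a * a + b * b \<le> (b - a) * (- a) + (b - a) * b" using 4 mult_nonpos_nonneg[of a b] by (simp add: algebra_simps)
    ultimately show ?thesis using 4 by (simp add: abs_of_nonneg abs_of_nonpos abs_minus_commute)
  qed
qed

text \<open>Hoelder bounds the inner integral uniformly in the shift w and k is integrable, so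
  Fubini applies. A convolution becomes an average over translates, from which both the cross terms
  and the increment formula for the flux start.\<close>

lemma trilinear_swap:
  assumes a: "Lp 3 a" and b: "Lp 3 b" and f: "Lp 3 f" and k: "Lp 1 k"
  shows "(LINT x|lborel. a x * b x * conv k f x) = (LINT w|lborel. k w * (LINT x|lborel. a x * b x * f (x - w)))"
    "integrable lborel (\<lambda>w. k w * (LINT x|lborel. a x * b x * f (x - w)))"
    "\<And>w. integrable lborel (\<lambda>x. a x * b x * f (x - w))"
proof -
  note [measurable] = Lp_measurable[OF a] Lp_measurable[OF b] Lp_measurable[OF f] Lp_measurable[OF k]
  let ?H = "\<lambda>x. a x * b x"
  have m: "(\<lambda>(x, w). ?H x * (k w * f (x - w))) \<in> borel_measurable (lborel \<Otimes>\<^sub>M lborel)" by measurable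
  have fin: "(\<integral>\<^sup>+x. \<integral>\<^sup>+w. ennreal (norm (?H x * (k w * f (x - w)))) \<partial>lborel \<partial>lborel) < \<infinity>"
  proof -
    have "(\<integral>\<^sup>+x. \<integral>\<^sup>+w. ennreal (norm (?H x * (k w * f (x - w)))) \<partial>lborel \<partial>lborel)
      = (\<integral>\<^sup>+w. \<integral>\<^sup>+x. ennreal (norm (?H x * (k w * f (x - w)))) \<partial>lborel \<partial>lborel)"
      by (rule lborel_pair.Fubini') (simp add: split_beta')
    also have "\<dots> \<le> (\<integral>\<^sup>+w. ennreal \<bar>k w\<bar> * ennreal (n3 a * n3 b * n3 f) \<partial>lborel)"
    proof (rule nn_integral_mono)
      fix w
      note h = hoelder3[OF a b Lp_translate(1)[OF f, of w]]
      have "(\<integral>\<^sup>+x. ennreal (norm (?H x * (k w * f (x - w)))) \<partial>lborel) = (\<integral>\<^sup>+x. ennreal \<bar>k w\<bar> * ennreal (\<bar>a x\<bar> * \<bar>b x\<bar> * \<bar>f (x - w)\<bar>) \<partial>lborel)"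
      proof (intro nn_integral_cong)
        fix x
        have "norm (?H x * (k w * f (x - w))) = \<bar>k w\<bar> * (\<bar>a x\<bar> * \<bar>b x\<bar> * \<bar>f (x - w)\<bar>)"
          by (simp only: real_norm_def abs_mult abs_idempotent mult_ac)
        then show "ennreal (norm (?H x * (k w * f (x - w)))) = ennreal \<bar>k w\<bar> * ennreal (\<bar>a x\<bar> * \<bar>b x\<bar> * \<bar>f (x - w)\<bar>)"
          by (simp only: ennreal_mult[OF abs_ge_zero mult_nonneg_nonneg[OF mult_nonneg_nonneg]] abs_ge_zero)
      qed
      also have "\<dots> = ennreal \<bar>k w\<bar> * ennreal (LINT x|lborel. \<bar>a x\<bar> * \<bar>b x\<bar> * \<bar>f (x - w)\<bar>)"
        by (subst nn_integral_cmult, measurable, subst nn_integral_eq_integral[OF h(1)]) auto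
      also have "\<dots> \<le> ennreal \<bar>k w\<bar> * ennreal (n3 a * n3 b * n3 f)"
        using h(2) by (intro mult_left_mono ennreal_leI) (auto simp: n3_translate)
      finally show "(\<integral>\<^sup>+x. ennreal (norm (?H x * (k w * f (x - w)))) \<partial>lborel) \<le> \<dots>" .
    qed
    also have "\<dots> = (\<integral>\<^sup>+w. ennreal \<bar>k w\<bar> \<partial>lborel) * ennreal (n3 a * n3 b * n3 f)"
      by (rule nn_integral_multc) measurable
    also have "\<dots> < \<infinity>"
      using k by (subst nn_integral_eq_integral) (auto simp: Lp_1 ennreal_mult_less_top)
    finally show ?thesis .
  qed
  have "(LINT x|lborel. ?H x * conv k f x) = (LINT x|lborel. LINT w|lborel. ?H x * (k w * f (x - w)))"
  proof (intro Bochner_Integration.integral_cong refl)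
    fix x
    have "conv k f x = (LINT w|lborel. k w * f (x - w))"
      unfolding conv_def using integral_translate(3)[of "\<lambda>w. k w * f (x - w)" x] by simp
    then show "?H x * conv k f x = (LINT w|lborel. ?H x * (k w * f (x - w)))"
      by (simp only: integral_mult_right_zero)
  qed
  also have "\<dots> = (LINT w|lborel. LINT x|lborel. ?H x * (k w * f (x - w)))"
    by (rule integral_swap[OF m fin])
  also have "\<dots> = (LINT w|lborel. k w * (LINT x|lborel. ?H x * f (x - w)))"
    by (simp only: integral_mult_right_zero mult.left_commute[of "?H _"])
  finally show "(LINT x|lborel. ?H x * conv k f x) = \<dots>" .
  have "integrable lborel (\<lambda>w. LINT x|lborel. ?H x * (k w * f (x - w)))"
    using lborel_pair.integrable_snd[OF integrable_pairI[OF m fin]] by simp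
  then show "integrable lborel (\<lambda>w. k w * (LINT x|lborel. ?H x * f (x - w)))"
    by (simp only: integral_mult_right_zero mult.left_commute[of "?H _"])
  show "integrable lborel (\<lambda>x. ?H x * f (x - w))" for w
  proof (rule integrable_abs_cancel)
    show "integrable lborel (\<lambda>x. \<bar>?H x * f (x - w)\<bar>)"
      using hoelder3(1)[OF a b Lp_translate(1)[OF f, of w]] by (simp add: abs_mult)
  qed measurable
qed

lemma Lp_abs: "Lp n f \<Longrightarrow> Lp n (\<lambda>x. \<bar>f x\<bar>)"
  by (auto simp: Lp_def)

text \<open>The frequency-localised factor f is tested against the Lipschitz function
  |T| T of T; the vanishing mean of the reproducing kernel gains one derivative.\<close>

lemma cross_term_bound:
  assumes T: "Lp 3 T" and f: "Lp 3 f"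
    and k: "Lp 1 k" "(LINT y|lborel. k y) = 0" "integrable lborel (\<lambda>y. \<bar>k y\<bar> * norm y)"
    and rep: "\<And>x. f x = c * conv k f x"
    and D: "\<And>w. n3 (diff w T) \<le> D * norm w"
  shows "\<bar>LINT x|lborel. \<bar>T x\<bar> * T x * f x\<bar> \<le> \<bar>c\<bar> * (2 * D * n3 T * n3 f) * (LINT y|lborel. \<bar>k y\<bar> * norm y)"
proof -
  note [measurable] = Lp_measurable[OF T] Lp_measurable[OF f] Lp_measurable[OF k(1)]
  let ?H = "\<lambda>x. \<bar>T x\<bar> * T x"
  have iH: "integrable lborel (\<lambda>x. ?H (x + w) * f x)" for w
  proof -
    have "integrable lborel (\<lambda>x. \<bar>?H (x + w) * f x\<bar>)"
      using hoelder3(1)[OF Lp_translate(2)[OF T, of w] Lp_translate(2)[OF T, of w] f] by (simp add: abs_mult)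
    then show ?thesis by (rule integrable_abs_cancel) measurable
  qed
  \<comment> \<open>By translation invariance the shift can sit on T, whose increments are small,
    instead of on f.\<close>
  define G where "G w = (LINT x|lborel. ?H (x + w) * f x)" for w
  have G: "G w = (LINT x|lborel. ?H x * f (x - w))" for w
    unfolding G_def using integral_translate(1)[of "\<lambda>x. ?H x * f (x - w)" w] by simp
  have "(LINT x|lborel. ?H x * f x) = c * (LINT x|lborel. ?H x * conv k f x)"
    by (subst rep) (simp only: mult.left_commute[of _ c] integral_mult_right_zero)
  also have "(LINT x|lborel. ?H x * conv k f x) = (LINT w|lborel. k w * G w)"
    unfolding G by (rule trilinear_swap(1)[OF Lp_abs[OF T] T f k(1)])
  \<comment> \<open>Subtracting \<open>G 0\<close> changes nothing, as k has mean zero.\<close>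
  also have "\<dots> = (LINT w|lborel. k w * (G w - G 0))"
  proof -
    have "integrable lborel (\<lambda>w. k w * G w)" unfolding G by (rule trilinear_swap(2)[OF Lp_abs[OF T] T f k(1)])
    then show ?thesis using k(1,2) by (simp add: right_diff_distrib Lp_1)
  qed
  finally have eq: "(LINT x|lborel. ?H x * f x) = c * (LINT w|lborel. k w * (G w - G 0))" .
  have GG: "\<bar>G w - G 0\<bar> \<le> 2 * D * n3 T * n3 f * norm w" for w
  proof -
    let ?d = "\<lambda>x. T (x + w) - T x"
    have d: "?d = diff (- w) T" by (auto simp: diff_def)
    have Ld: "Lp 3 ?d" and nd: "n3 ?d \<le> D * norm w" unfolding d using Lp_3_diff[OF T] D[of "- w"] by auto
    note h1 = hoelder3[OF Ld Lp_translate(2)[OF T, of w] f] and h2 = hoelder3[OF Ld T f]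
    have "\<bar>G w - G 0\<bar> = \<bar>LINT x|lborel. ?H (x + w) * f x - ?H x * f x\<bar>"
      unfolding G_def using iH[of w] iH[of 0] by simp
    also have "\<dots> \<le> (LINT x|lborel. \<bar>?d x\<bar> * \<bar>T (x + w)\<bar> * \<bar>f x\<bar> + \<bar>?d x\<bar> * \<bar>T x\<bar> * \<bar>f x\<bar>)"
    proof -
      have "norm (LINT x|lborel. ?H (x + w) * f x - ?H x * f x) \<le>
        (LINT x|lborel. \<bar>?d x\<bar> * \<bar>T (x + w)\<bar> * \<bar>f x\<bar> + \<bar>?d x\<bar> * \<bar>T x\<bar> * \<bar>f x\<bar>)"
      proof (rule norm_integral_le)
        show "norm (?H (x + w) * f x - ?H x * f x) \<le> \<bar>?d x\<bar> * \<bar>T (x + w)\<bar> * \<bar>f x\<bar> + \<bar>?d x\<bar> * \<bar>T x\<bar> * \<bar>f x\<bar>" for x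
          using mult_right_mono[OF abs_square_diff_le[of "T (x + w)" "T x"] abs_ge_zero[of "f x"]]
          by (simp only: real_norm_def abs_mult left_diff_distrib[symmetric] distrib_right)
      qed (use iH[of w] iH[of 0] h1 h2 in auto)
      then show ?thesis by (simp only: real_norm_def)
    qed
    also have "\<dots> \<le> n3 ?d * n3 T * n3 f + n3 ?d * n3 T * n3 f"
      using add_mono[OF h1(2) h2(2)] by (simp only: Bochner_Integration.integral_add[OF h1(1) h2(1)] n3_translate)
    also have "\<dots> = 2 * n3 ?d * (n3 T * n3 f)" by simp
    also have "\<dots> \<le> 2 * (D * norm w) * (n3 T * n3 f)" using nd by (intro mult_right_mono mult_left_mono) auto
    finally show ?thesis by (simp add: mult_ac)
  qed
  have [measurable]: "G \<in> borel_measurable borel" unfolding G_def[abs_def] by measurable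
  let ?E = "2 * D * n3 T * n3 f"
  have le: "norm (k w * (G w - G 0)) \<le> ?E * (\<bar>k w\<bar> * norm w)" for w
    using mult_left_mono[OF GG[of w], of "\<bar>k w\<bar>"] by (simp add: abs_mult mult_ac)
  have "integrable lborel (\<lambda>w. k w * (G w - G 0))"
  proof (rule Bochner_Integration.integrable_bound[OF integrable_mult_right[OF k(3), of ?E]])
    show "AE w in lborel. norm (k w * (G w - G 0)) \<le> norm (?E * (\<bar>k w\<bar> * norm w))"
      by (intro AE_I2 order_trans[OF le]) (simp only: real_norm_def abs_ge_self)
  qed measurable
  from norm_integral_le[OF this integrable_mult_right[OF k(3), of ?E] le]
  have "\<bar>LINT w|lborel. k w * (G w - G 0)\<bar> \<le> ?E * (LINT y|lborel. \<bar>k y\<bar> * norm y)" by simp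
  then show ?thesis unfolding eq abs_mult by (simp add: mult.assoc mult_left_mono)
qed

lemma lam_nonzero [simp]: "lam q \<noteq> 0"
  by (simp add: lam_def)

text \<open>The sum over k < n of 2^(k - n) a_k. Times \<lambda>_(n - 1) it is the sum of the
  \<lambda>_(k - 1) a_k, which bounds, up to a constant, the L3 Lipschitz constant of the sum of the
  first n blocks.\<close>

primrec dyadic_average :: "(nat \<Rightarrow> real) \<Rightarrow> nat \<Rightarrow> real" where
  "dyadic_average a 0 = 0"
| "dyadic_average a (Suc n) = (dyadic_average a n + a n) / 2"

text \<open>The surplus on the left pays for the next average, by convexity of the square; it is
  what closes the induction.\<close>

lemma sum_dyadic_average_squares:
  "(\<Sum>k<n. (dyadic_average a k)\<^sup>2) + 2 * (dyadic_average a n)\<^sup>2 \<le> (\<Sum>k<n. (a k)\<^sup>2)"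
proof (induction n)
  case (Suc n)
  have "0 \<le> (dyadic_average a n - a n)\<^sup>2" by simp
  then have "2 * ((dyadic_average a n + a n) / 2)\<^sup>2 \<le> (dyadic_average a n)\<^sup>2 + (a n)\<^sup>2"
    by (simp add: power2_sum power2_diff power_divide)
  then show ?case using Suc by simp
qed simp

text \<open>A bootstrap. Let A be the l2 norm of a. If all earlier t_l are at most B A, the summed
  recursion bounds t_n^3 by (B (C + 3) + 1) A^3, where the products of a with its averages are
  controlled by \<open>sum_dyadic_average_squares\<close>.\<close>

lemma cubic_recursion_bound:
  fixes t a :: "nat \<Rightarrow> real"
  assumes t0: "t 0 = 0" and t: "\<And>n. 0 \<le> t n" and a: "\<And>n. 0 \<le> a n" and C: "0 \<le> C"
    and step: "\<And>n. n < N \<Longrightarrow> t (Suc n) ^ 3 \<le> t n ^ 3 + C * (t n * (a n * dyadic_average a n)) + 3 * (t n * (a n)\<^sup>2) + a n ^ 3"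
  shows "t N \<le> (C + 4) * sqrt (\<Sum>k<N. (a k)\<^sup>2)"
proof -
  define A where "A = sqrt (\<Sum>k<N. (a k)\<^sup>2)"
  \<comment> \<open>Chosen so that B (C + 3) + 1 \<le> B^2 \<le> B^3, which returns the assumed
    bound.\<close>
  define B where "B = C + 4"
  have A0: "A \<ge> 0" unfolding A_def by (simp add: sum_nonneg)
  have A2: "A\<^sup>2 = (\<Sum>k<N. (a k)\<^sup>2)" unfolding A_def by (simp add: sum_nonneg)
  have B4: "B \<ge> 4" using C by (simp add: B_def)
  have avg0: "0 \<le> dyadic_average a k" for k by (induction k) (auto simp: a)
  have aA: "a k \<le> A" if "k < N" for k
  proof (rule power2_le_imp_le[OF _ A0])
    show "(a k)\<^sup>2 \<le> A\<^sup>2" unfolding A2 using that by (intro member_le_sum) auto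
  qed
  have "t n \<le> B * A" if "n \<le> N" for n
    using that
  proof (induction n rule: less_induct)
    case (less n)
    have tl: "t l \<le> B * A" if "l < n" for l using less that by auto
    have "t m ^ 3 \<le> (\<Sum>l<m. C * (t l * (a l * dyadic_average a l)) + 3 * (t l * (a l)\<^sup>2) + a l ^ 3)" if "m \<le> N" for m
      using that
    proof (induction m)
      case (Suc m)
      then show ?case using step[of m] by simp
    qed (simp add: t0)
    from this[OF less.prems]
    have "t n ^ 3 \<le> (\<Sum>l<n. C * (t l * (a l * dyadic_average a l)) + 3 * (t l * (a l)\<^sup>2) + a l ^ 3)" .
    also have "\<dots> \<le> (\<Sum>l<n. C * (B * A * (((a l)\<^sup>2 + (dyadic_average a l)\<^sup>2) / 2)) + 3 * (B * A * (a l)\<^sup>2) + A * (a l)\<^sup>2)"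
    proof (rule sum_mono)
      fix l assume "l \<in> {..<n}"
      then have l: "l < n" "l < N" using less.prems by auto
      have "a l * dyadic_average a l \<le> ((a l)\<^sup>2 + (dyadic_average a l)\<^sup>2) / 2"
        using sum_squares_bound[of "a l" "dyadic_average a l"] by simp
      then have "t l * (a l * dyadic_average a l) \<le> B * A * (((a l)\<^sup>2 + (dyadic_average a l)\<^sup>2) / 2)"
        using tl[OF l(1)] t a avg0 A0 B4 by (intro mult_mono) auto
      moreover have "t l * (a l)\<^sup>2 \<le> B * A * (a l)\<^sup>2" using tl[OF l(1)] by (intro mult_right_mono) auto
      moreover have "a l ^ 3 \<le> A * (a l)\<^sup>2"
        using mult_right_mono[OF aA[OF l(2)], of "(a l)\<^sup>2"] by (simp add: power3_eq_cube power2_eq_square mult.assoc)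
      ultimately show "C * (t l * (a l * dyadic_average a l)) + 3 * (t l * (a l)\<^sup>2) + a l ^ 3 \<le>
        C * (B * A * (((a l)\<^sup>2 + (dyadic_average a l)\<^sup>2) / 2)) + 3 * (B * A * (a l)\<^sup>2) + A * (a l)\<^sup>2"
        using C by (intro add_mono mult_left_mono) auto
    qed
    also have "\<dots> = C * B * A / 2 * ((\<Sum>l<n. (a l)\<^sup>2) + (\<Sum>l<n. (dyadic_average a l)\<^sup>2)) + (3 * B * A + A) * (\<Sum>l<n. (a l)\<^sup>2)"
      by (simp add: sum.distrib sum_distrib_left[symmetric] sum_divide_distrib[symmetric] algebra_simps)
    also have "\<dots> \<le> C * B * A / 2 * (A\<^sup>2 + A\<^sup>2) + (3 * B * A + A) * A\<^sup>2"
    proof -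
      have "(\<Sum>l<n. (a l)\<^sup>2) \<le> A\<^sup>2" unfolding A2 using less.prems by (intro sum_mono2) auto
      moreover have "(\<Sum>l<n. (dyadic_average a l)\<^sup>2) \<le> (\<Sum>l<n. (a l)\<^sup>2)"
        using sum_dyadic_average_squares[of a n] zero_le_power2[of "dyadic_average a n"] by linarith
      ultimately show ?thesis using C B4 A0 by (intro add_mono mult_left_mono) auto
    qed
    also have "\<dots> = (B * (C + 3) + 1) * A ^ 3"
      by (simp add: power2_eq_square power3_eq_cube algebra_simps)
    also have "\<dots> \<le> B ^ 3 * A ^ 3"
    proof (rule mult_right_mono)
      have "B * (C + 3) + 1 \<le> B * B" using B4 by (simp add: B_def algebra_simps)
      also have "\<dots> \<le> B * B * B" using B4 by (intro mult_le_cancel_left1[THEN iffD2]) auto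
      finally show "B * (C + 3) + 1 \<le> B ^ 3" by (simp add: power3_eq_cube)
    qed (use A0 in auto)
    finally have "t n ^ 3 \<le> (B * A) ^ 3" by (simp add: power_mult_distrib)
    then show ?case using power_le_imp_le_base[of "t n" 2 "B * A"] A0 B4 by (simp add: numeral_3_eq_3)
  qed
  then show ?thesis unfolding A_def B_def by simp
qed

section \<open>Reproducing kernels and partial sums of the blocks\<close>

context cutoff
begin

definition block :: "int \<Rightarrow> (R3 \<Rightarrow> real) \<Rightarrow> R3 \<Rightarrow> real" where
  "block q v = conv (cosk (LP_symbol chi q)) v"

text \<open>Equal to 1 on the annulus 1/2 \<le> |\<eta>| \<le> 2. For q \<ge> 0 the rescaled block
  lives there, and vanishing at the origin gives a kernel of mean zero; the block -1 contains
  frequency 0 and gets a plain cutoff. Only two profiles occur, so constants are uniform in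
  q.\<close>

definition fat_base :: "int \<Rightarrow> R3 \<Rightarrow> real" where
  "fat_base q \<eta> = chi (\<eta> /\<^sub>R 4) - (if 0 \<le> q then chi (2 *\<^sub>R \<eta>) else 0)"

definition fat :: "int \<Rightarrow> R3 \<Rightarrow> real" where
  "fat q \<xi> = fat_base q (\<xi> /\<^sub>R lam q)"

lemma test_fat_base: "test_function (fat_base q)"
proof -
  have "test_function (\<lambda>\<eta>. chi (\<eta> /\<^sub>R 4))" by (rule test_function_dilation) auto
  moreover have "test_function (\<lambda>\<eta>. chi (2 *\<^sub>R \<eta>))" by (rule test_function_scaleR) auto
  ultimately show ?thesis
    unfolding fat_base_def[abs_def] using test_function_diff test_function_0 by (cases "0 \<le> q") auto
qed

lemma test_fat: "test_function (fat q)"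
  unfolding fat_def[abs_def] by (rule test_function_dilation[OF test_fat_base]) simp

lemma fat_even: "fat q (- \<xi>) = fat q \<xi>"
  by (simp add: fat_def fat_base_def)

lemma fat_mult_symbol:
  assumes "- 1 \<le> q"
  shows "fat q \<xi> * LP_symbol chi q \<xi> = LP_symbol chi q \<xi>"
proof (cases "0 \<le> q")
  case True
  define \<eta> where "\<eta> = \<xi> /\<^sub>R lam q"
  have s: "LP_symbol chi q \<xi> = chi (\<eta> /\<^sub>R 2) - chi \<eta>" using True by (simp add: LP_symbol_def LP_phi_def \<eta>_def)
  \<comment> \<open>Inside the small ball and outside the large one the two cutoffs agree, so the
    block symbol is 0; in between the fattened symbol is 1.\<close>
  consider "norm \<eta> \<le> 1 / 2" | "2 \<le> norm \<eta>" | "1 / 2 \<le> norm \<eta>" "norm \<eta> \<le> 2" by linarith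
  then show ?thesis
  proof cases
    case 1
    then have "chi \<eta> = 1" "chi (\<eta> /\<^sub>R 2) = 1" by (auto intro!: chi_eq_1)
    then show ?thesis by (simp add: s)
  next
    case 2
    then have "chi \<eta> = 0" "chi (\<eta> /\<^sub>R 2) = 0" by (auto intro!: chi_eq_0)
    then show ?thesis by (simp add: s)
  next
    case 3
    then have "chi (\<eta> /\<^sub>R 4) = 1" "chi (2 *\<^sub>R \<eta>) = 0" by (auto intro!: chi_eq_0 chi_eq_1)
    then have "fat q \<xi> = 1" using True by (simp add: fat_def fat_base_def \<eta>_def[symmetric])
    then show ?thesis by simp
  qed
next
  case False
  then have q: "q = -1" using assms by simp
  have s: "LP_symbol chi q \<xi> = chi \<xi>" by (simp add: LP_symbol_def q)
  have f: "fat q \<xi> = chi (\<xi> /\<^sub>R 2)" by (simp add: fat_def fat_base_def q)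
  show ?thesis
  proof (cases "norm \<xi> \<le> 1")
    case True
    then have "chi (\<xi> /\<^sub>R 2) = 1" by (auto intro!: chi_eq_1)
    then show ?thesis by (simp add: f)
  next
    case False
    then have "chi \<xi> = 0" by (auto intro!: chi_eq_0)
    then show ?thesis by (simp add: s)
  qed
qed

lemma fat_0: "0 \<le> q \<Longrightarrow> fat q 0 = 0"
  by (simp add: fat_def fat_base_def)

lemma block_measurable: "Lp 2 v \<Longrightarrow> - 1 \<le> q \<Longrightarrow> block q v \<in> borel_measurable borel"
  using Lp_measurable[OF Lp_trig_kernel(1)[OF test_LP_symbol, of q 1]] Lp_measurable[of 2 v]
  unfolding block_def by simp

lemma block_bounded:
  assumes "Lp 2 v" "- 1 \<le> q"
  shows "\<bar>block q v x\<bar> \<le> (LINT y|lborel. (cosk (LP_symbol chi q) y)\<^sup>2) + (LINT y|lborel. (v y)\<^sup>2)"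
  unfolding block_def by (intro integrable_conv_L2(3) Lp_trig_kernel(1) test_LP_symbol assms) auto

text \<open>Blocks of L2 functions are bounded, so these convolutions converge at every point, as
  \<open>young3\<close> demands.\<close>

lemma integrable_conv_block:
  assumes "Lp 2 v" "- 1 \<le> q" "Lp 1 k"
  shows "integrable lborel (\<lambda>y. k (x - y) * block q v y)"
  using assms(3) block_measurable[OF assms(1,2)] block_bounded[OF assms(1,2)]
    integrable_translate_iff(3)[of k x]
  by (intro integrable_mult_bounded(1)[OF _ _, where B="(LINT y|lborel. (cosk (LP_symbol chi q) y)\<^sup>2) + (LINT y|lborel. (v y)\<^sup>2)"])
     (auto simp: Lp_1)

text \<open>Convolving with the kernel of \<open>fat q\<close> multiplies the block symbol by a
  function that is 1 on its support; the quotient by \<open>mass\<close> undoes the cost of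
  composing kernels.\<close>

lemma block_reproduce:
  assumes "Lp 2 v" "- 1 \<le> q"
  shows "block q v x = (1 / mass) * conv (cosk (fat q)) (block q v) x"
proof -
  note t = test_LP_symbol[OF assms(2)]
  have "conv (cosk (fat q)) (block q v) x = conv (conv (cosk (fat q)) (cosk (LP_symbol chi q))) v x"
    unfolding block_def by (intro conv_assoc Lp_trig_kernel(1) test_fat t assms) auto
  also have "conv (cosk (fat q)) (cosk (LP_symbol chi q)) = (\<lambda>x. mass * cosk (LP_symbol chi q) x)"
  proof -
    have e: "(\<lambda>\<xi>. fat q \<xi> * LP_symbol chi q \<xi>) = LP_symbol chi q"
      by (rule ext, rule fat_mult_symbol[OF assms(2)])
    show ?thesis by (rule ext) (simp only: conv_def trig_kernel_convolution(1)[OF test_fat fat_even t] e)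
  qed
  also have "conv \<dots> v x = mass * block q v x" by (simp add: conv_def block_def mult.assoc)
  finally show ?thesis using mass_nonzero by simp
qed

text \<open>The increment is moved from the block onto its reproducing kernel, whose L1 modulus of
  continuity is known from the two profiles by dilation; \<open>young3\<close> then returns to the
  block.\<close>

lemma block_diff:
  "\<exists>C>0. \<forall>v q z. Lp 2 v \<longrightarrow> - 1 \<le> q \<longrightarrow> Lp 3 (block q v) \<longrightarrow>
    n3 (diff z (block q v)) \<le> C * min 1 (lam q * norm z) * n3 (block q v)"
proof -
  obtain C1 where C1: "C1 > 0" "\<And>z. (LINT x|lborel. \<bar>diff z (cosk (fat_base 0)) x\<bar>) \<le> C1 * min 1 (norm z)"
    using kernel_modulus[OF test_fat_base] by blast
  obtain C2 where C2: "C2 > 0" "\<And>z. (LINT x|lborel. \<bar>diff z (cosk (fat_base (-1))) x\<bar>) \<le> C2 * min 1 (norm z)"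
    using kernel_modulus[OF test_fat_base] by blast
  let ?C = "max C1 C2"
  have base: "fat_base q = fat_base 0 \<or> fat_base q = fat_base (-1)" for q
    by (cases "0 \<le> q") (auto simp: fat_base_def)
  have k: "(LINT x|lborel. \<bar>diff z (cosk (fat q)) x\<bar>) \<le> ?C * min 1 (lam q * norm z)" for q z
  proof -
    have "(LINT x|lborel. \<bar>diff z (cosk (fat q)) x\<bar>) = (LINT x|lborel. \<bar>diff (lam q *\<^sub>R z) (cosk (fat_base q)) x\<bar>)"
      unfolding fat_def[abs_def] by (rule integral_diff_cosk_dilation) simp
    also have "\<dots> \<le> ?C * min 1 (norm (lam q *\<^sub>R z))"
      using base[of q] C1(2)[of "lam q *\<^sub>R z"] C2(2)[of "lam q *\<^sub>R z"]
        mult_right_mono[of C1 ?C "min 1 (norm (lam q *\<^sub>R z))"] mult_right_mono[of C2 ?C "min 1 (norm (lam q *\<^sub>R z))"]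
      by auto
    finally show ?thesis using lam_pos[of q] by (simp add: abs_of_pos)
  qed
  show ?thesis
  proof (intro exI[of _ "?C / \<bar>mass\<bar>"] conjI allI impI)
    show "?C / \<bar>mass\<bar> > 0" using C1 mass_nonzero by (simp add: less_max_iff_disj)
    fix v q z
    assume v: "Lp 2 v" and q: "- 1 \<le> q" and b: "Lp 3 (block q v)"
    have L1: "Lp 1 (cosk (fat q))" by (intro Lp_trig_kernel(1) test_fat) simp
    have "diff z (block q v) = (\<lambda>x. (1 / mass) * conv (diff z (cosk (fat q))) (block q v) x)"
    proof
      fix x
      have "diff z (block q v) x = (1 / mass) * diff z (conv (cosk (fat q)) (block q v)) x"
        unfolding diff_def using block_reproduce[OF v q, of x] block_reproduce[OF v q, of "x - z"]
        by (simp add: right_diff_distrib[symmetric] diff_divide_distrib)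
      then show "diff z (block q v) x = (1 / mass) * conv (diff z (cosk (fat q))) (block q v) x"
        using diff_conv(1)[OF integrable_conv_block[OF v q L1]] by simp
    qed
    then have "n3 (diff z (block q v)) = \<bar>1 / mass\<bar> * n3 (conv (diff z (cosk (fat q))) (block q v))"
      by (simp only: n3_cmult)
    also have "\<dots> \<le> \<bar>1 / mass\<bar> * (?C * min 1 (lam q * norm z) * n3 (block q v))"
      by (intro mult_left_mono young3(2) k b Lp_1_diff L1 integrable_conv_block v q) auto
    finally show "n3 (diff z (block q v)) \<le> ?C / \<bar>mass\<bar> * min 1 (lam q * norm z) * n3 (block q v)"
      by (simp add: abs_divide)
  qed
qed

text \<open>Because \<open>|t|^3\<close> is 2-smooth and the blocks are almost orthogonal to powers of lower partial
  sums, no Littlewood--Paley square function is needed. The shift in \<open>int k - 1\<close> appears because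
  blocks are numbered from \<open>-1\<close>.\<close>

lemma partial_sum_L3:
  "\<exists>B>0. \<forall>v N. Lp 2 v \<longrightarrow> (\<forall>k<N. Lp 3 (block (int k - 1) v)) \<longrightarrow>
    Lp 3 (\<lambda>x. \<Sum>k<N. block (int k - 1) v x) \<and>
    n3 (\<lambda>x. \<Sum>k<N. block (int k - 1) v x) \<le> B * sqrt (\<Sum>k<N. (n3 (block (int k - 1) v))\<^sup>2)"
proof -
  obtain C where C: "C > 0" and Cd: "\<And>v q z. Lp 2 v \<Longrightarrow> - 1 \<le> q \<Longrightarrow> Lp 3 (block q v) \<Longrightarrow>
    n3 (diff z (block q v)) \<le> C * min 1 (lam q * norm z) * n3 (block q v)"
    using block_diff by blast
  define M where "M = (LINT x|lborel. \<bar>cosk (fat_base 0) x\<bar> * norm x)"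
  have M0: "M \<ge> 0" unfolding M_def by simp
  \<comment> \<open>The 3 is the coefficient of the linear term in \<open>cube_expansion_le\<close>,
    the rest is the constant of the cross term.\<close>
  define K where "K = 3 * (\<bar>1 / mass\<bar> * (2 * C * M))"
  have K0: "K \<ge> 0" unfolding K_def using C M0 by auto
  show ?thesis
  proof (intro exI[of _ "K + 4"] conjI allI impI)
    show "K + 4 > 0" using K0 by simp
    fix v N
    assume v: "Lp 2 v" and b: "\<forall>k<N. Lp 3 (block (int k - 1) v)"
    define f where "f k = block (int k - 1) v" for k :: nat
    define T where "T n x = (\<Sum>k<n. f k x)" for n :: nat and x
    define a where "a k = (if k < N then n3 (f k) else 0)" for k
    have f3: "Lp 3 (f k)" if "k < N" for k using b that by (simp add: f_def)
    have TS: "T (Suc n) = (\<lambda>x. T n x + f n x)" for n by (auto simp: T_def)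
    have T3: "Lp 3 (T n)" if "n \<le> N" for n
      using that
    proof (induction n)
      case 0
      then show ?case by (simp add: T_def[abs_def] Lp_def)
    next
      case (Suc n)
      then show ?case unfolding TS by (intro Lp_3_add f3) auto
    qed
    \<comment> \<open>Each step doubles the frequency, which is compensated by the halving in
      \<open>dyadic_average\<close>.\<close>
    have dT: "n3 (diff w (T n)) \<le> C * lam (int n - 1) * dyadic_average a n * norm w" if "n \<le> N" for n w
      using that
    proof (induction n)
      case 0
      then show ?case by (simp add: T_def diff_def[abs_def] n3_def)
    next
      case (Suc n)
      have nN: "n < N" using Suc.prems by simp
      have "diff w (T (Suc n)) = (\<lambda>x. diff w (T n) x + diff w (f n) x)" by (auto simp: TS diff_def)
      then have "n3 (diff w (T (Suc n))) \<le> n3 (diff w (T n)) + n3 (diff w (f n))"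
        using minkowski3[OF Lp_3_diff(1)[OF T3] Lp_3_diff(1)[OF f3[OF nN]]] nN by simp
      also have "n3 (diff w (f n)) \<le> C * (lam (int n - 1) * norm w) * a n"
      proof -
        have "n3 (diff w (f n)) \<le> C * min 1 (lam (int n - 1) * norm w) * a n"
          using Cd[OF v, of "int n - 1" w] f3[OF nN] nN by (simp add: f_def a_def)
        also have "\<dots> \<le> C * (lam (int n - 1) * norm w) * a n"
          using C by (intro mult_right_mono mult_left_mono) (auto simp: a_def)
        finally show ?thesis .
      qed
      also have "n3 (diff w (T n)) \<le> C * lam (int n - 1) * dyadic_average a n * norm w" using Suc by simp
      finally have "n3 (diff w (T (Suc n))) \<le> C * lam (int n - 1) * (dyadic_average a n + a n) * norm w"
        by (simp add: algebra_simps)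
      moreover have "lam (int (Suc n) - 1) = lam (int n - 1) * 2"
        using lam_add[of "int n - 1" 1] by simp
      ultimately show ?case by simp
    qed
    have cross: "\<bar>LINT x|lborel. \<bar>T n x\<bar> * T n x * f n x\<bar> \<le> \<bar>1 / mass\<bar> * (2 * C * M) * (n3 (T n) * (a n * dyadic_average a n))" if n: "n < N" for n
    \<comment> \<open>The kernel reproducing the block -1 lacks mean zero, but this block is added
      to the empty sum, where the cross term is 0. From n = 1 on the index \<open>int n - 1\<close>
      is nonnegative and the cancellation is available.\<close>
    proof (cases "n = 0")
      case True
      then show ?thesis by (simp add: T_def)
    next
      case False
      then have q: "0 \<le> int n - 1" by simp
      have base: "fat_base (int n - 1) = fat_base 0" using q by (auto simp: fat_base_def)
      let ?l = "lam (int n - 1)"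
      \<comment> \<open>The 1/\<lambda> in this moment cancels the \<lambda> in the Lipschitz bound
        for the partial sum and leaves a constant free of n.\<close>
      have m: "(LINT y|lborel. \<bar>cosk (fat (int n - 1)) y\<bar> * norm y) = M / ?l"
        unfolding fat_def[abs_def] M_def base by (rule first_moment_cosk_dilation[OF test_fat_base]) simp
      have "\<bar>LINT x|lborel. \<bar>T n x\<bar> * T n x * f n x\<bar> \<le>
        \<bar>1 / mass\<bar> * (2 * (C * ?l * dyadic_average a n) * n3 (T n) * n3 (f n)) * (LINT y|lborel. \<bar>cosk (fat (int n - 1)) y\<bar> * norm y)"
      proof (rule cross_term_bound)
        show "Lp 3 (T n)" "Lp 3 (f n)" using n T3 f3 by auto
        show "Lp 1 (cosk (fat (int n - 1)))" by (intro Lp_trig_kernel(1) test_fat) simp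
        show "(LINT y|lborel. cosk (fat (int n - 1)) y) = 0"
          using integral_cosk[OF test_fat] fat_0[OF q] by simp
        show "integrable lborel (\<lambda>y. \<bar>cosk (fat (int n - 1)) y\<bar> * norm y)" by (rule integrable_first_moment[OF test_fat])
        show "f n x = (1 / mass) * conv (cosk (fat (int n - 1))) (f n) x" for x
          unfolding f_def by (rule block_reproduce[OF v]) simp
        show "n3 (diff w (T n)) \<le> C * ?l * dyadic_average a n * norm w" for w using dT n by simp
      qed
      also have "\<dots> = \<bar>1 / mass\<bar> * (2 * C * M) * (n3 (T n) * (a n * dyadic_average a n))"
        unfolding m using n by (simp add: a_def)
      finally show ?thesis .
    qed
    have "n3 (T N) \<le> (K + 4) * sqrt (\<Sum>k<N. (a k)\<^sup>2)"
    proof (rule cubic_recursion_bound[where t="\<lambda>n. n3 (T n)"])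
      show "n3 (T 0) = 0" by (simp add: T_def[abs_def] n3_def)
      show "0 \<le> a n" for n by (simp add: a_def)
      fix n assume n: "n < N"
      have L: "Lp 3 (T n)" "Lp 3 (f n)" using n T3 f3 by auto
      note [measurable] = Lp_measurable[OF L(1)] Lp_measurable[OF L(2)]
      note h = hoelder3[OF L(1) L(2) L(2)]
      have h1: "integrable lborel (\<lambda>x. \<bar>T n x\<bar> * (f n x)\<^sup>2)" "(LINT x|lborel. \<bar>T n x\<bar> * (f n x)\<^sup>2) \<le> n3 (T n) * n3 (f n) * n3 (f n)"
        using h by (simp_all add: power2_eq_square mult.assoc)
      have h2: "integrable lborel (\<lambda>x. \<bar>T n x\<bar> * T n x * f n x)"
      proof (rule integrable_abs_cancel)
        show "integrable lborel (\<lambda>x. \<bar>\<bar>T n x\<bar> * T n x * f n x\<bar>)"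
          using hoelder3(1)[OF L(1) L(1) L(2)] by (simp add: abs_mult)
      qed measurable
      have i3: "integrable lborel (\<lambda>x. \<bar>T n x\<bar> ^ 3)" "integrable lborel (\<lambda>x. \<bar>f n x\<bar> ^ 3)" "integrable lborel (\<lambda>x. \<bar>T n x + f n x\<bar> ^ 3)"
        using L Lp_3_add[OF L] by (auto simp: Lp_def)
      have "n3 (T (Suc n)) ^ 3 = (LINT x|lborel. \<bar>T n x + f n x\<bar> ^ 3)" by (simp add: n3_power TS)
      also have "\<dots> \<le> (LINT x|lborel. \<bar>T n x\<bar> ^ 3 + 3 * (\<bar>T n x\<bar> * T n x * f n x) + 3 * (\<bar>T n x\<bar> * (f n x)\<^sup>2) + \<bar>f n x\<bar> ^ 3)"
        by (rule integral_mono[OF _ _ cube_expansion_le]) (use i3 h1 h2 in auto)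
      also have "\<dots> = n3 (T n) ^ 3 + 3 * (LINT x|lborel. \<bar>T n x\<bar> * T n x * f n x) + 3 * (LINT x|lborel. \<bar>T n x\<bar> * (f n x)\<^sup>2) + n3 (f n) ^ 3"
        using i3 h1(1) h2 by (simp add: n3_power)
      also have "\<dots> \<le> n3 (T n) ^ 3 + K * (n3 (T n) * (a n * dyadic_average a n)) + 3 * (n3 (T n) * (a n)\<^sup>2) + a n ^ 3"
      proof (intro add_mono)
        show "3 * (LINT x|lborel. \<bar>T n x\<bar> * T n x * f n x) \<le> K * (n3 (T n) * (a n * dyadic_average a n))"
          using cross[OF n] unfolding K_def mult.assoc[of 3] by (intro mult_left_mono) auto
        show "3 * (LINT x|lborel. \<bar>T n x\<bar> * (f n x)\<^sup>2) \<le> 3 * (n3 (T n) * (a n)\<^sup>2)"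
          using h1(2) n by (simp add: a_def power2_eq_square mult.assoc)
      qed (use n in \<open>auto simp: a_def\<close>)
      finally show "n3 (T (Suc n)) ^ 3 \<le> n3 (T n) ^ 3 + K * (n3 (T n) * (a n * dyadic_average a n)) + 3 * (n3 (T n) * (a n)\<^sup>2) + a n ^ 3" .
    qed (use K0 in auto)
    moreover have "(\<Sum>k<N. (a k)\<^sup>2) = (\<Sum>k<N. (n3 (block (int k - 1) v))\<^sup>2)" by (simp add: a_def f_def)
    moreover have "T N = (\<lambda>x. \<Sum>k<N. block (int k - 1) v x)" by (auto simp: T_def f_def)
    ultimately show "n3 (\<lambda>x. \<Sum>k<N. block (int k - 1) v x) \<le> (K + 4) * sqrt (\<Sum>k<N. (n3 (block (int k - 1) v))\<^sup>2)"
      "Lp 3 (\<lambda>x. \<Sum>k<N. block (int k - 1) v x)"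
      using T3[of N] by simp_all
  qed
qed

end

subsection \<open>Approximation in L2\<close>

text \<open>The approximants come with \<open>measurable_on\<close>, which converges off a
  negligible set; as the exceptional set is Borel, this becomes a statement about
  \<open>lborel\<close>.\<close>

lemma continuous_ae_approximation:
  fixes v :: "R3 \<Rightarrow> real"
  assumes "v \<in> borel_measurable borel"
  obtains g where "\<And>n::nat. continuous_on UNIV (g n)" "AE x in lborel. (\<lambda>n. g n x) \<longlonglongrightarrow> v x"
proof -
  have "v measurable_on UNIV"
    using assms by (simp add: measurable_on_iff_borel_measurable borel_measurable_lebesgueI lebesgue_on_UNIV_eq)
  then obtain N g where N: "negligible N" and g: "\<And>n. continuous_on UNIV (g n)" "\<And>x. x \<notin> N \<Longrightarrow> (\<lambda>n. g n x) \<longlonglongrightarrow> v x"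
    unfolding measurable_on_def by auto
  have [measurable]: "g n \<in> borel_measurable borel" for n by (rule borel_measurable_continuous_onI[OF g(1)])
  note [measurable] = assms
  have "{x. \<not> (\<lambda>n. g n x) \<longlonglongrightarrow> v x} \<subseteq> N" using g(2) by blast
  then have "negligible {x. \<not> (\<lambda>n. g n x) \<longlonglongrightarrow> v x}" by (rule negligible_subset[OF N])
  moreover have "{x. \<not> (\<lambda>n. g n x) \<longlonglongrightarrow> v x} \<in> sets borel" by measurable
  ultimately have "{x. \<not> (\<lambda>n. g n x) \<longlonglongrightarrow> v x} \<in> null_sets lborel"
    by (simp add: negligible_iff_null_sets null_sets_def emeasure_completion)
  then have "AE x in lborel. (\<lambda>n. g n x) \<longlonglongrightarrow> v x" by (rule AE_I') auto
  then show ?thesis using g(1) that by blast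
qed

abbreviation sq2 :: "(R3 \<Rightarrow> real) \<Rightarrow> real" where
  "sq2 f \<equiv> LINT x|lborel. (f x)\<^sup>2"

lemma Lp_2_add:
  assumes f: "Lp 2 f" and g: "Lp 2 g"
  shows "Lp 2 (\<lambda>x. f x + g x)" "sq2 (\<lambda>x. f x + g x) \<le> 2 * sq2 f + 2 * sq2 g"
proof -
  note [measurable] = Lp_measurable[OF f] Lp_measurable[OF g]
  have le: "(f x + g x)\<^sup>2 \<le> 2 * (f x)\<^sup>2 + 2 * (g x)\<^sup>2" for x
    using zero_le_power2[of "f x - g x"] by (simp add: power2_sum power2_diff)
  have i: "integrable lborel (\<lambda>x. 2 * (f x)\<^sup>2 + 2 * (g x)\<^sup>2)" using f g by (simp add: Lp_2)
  have i2: "integrable lborel (\<lambda>x. (f x + g x)\<^sup>2)"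
    by (rule Bochner_Integration.integrable_bound[OF i]) (use le in \<open>auto intro!: AE_I2\<close>)
  then show "Lp 2 (\<lambda>x. f x + g x)" by (simp add: Lp_2)
  have "sq2 (\<lambda>x. f x + g x) \<le> (LINT x|lborel. 2 * (f x)\<^sup>2 + 2 * (g x)\<^sup>2)"
    by (rule integral_mono[OF i2 i le])
  then show "sq2 (\<lambda>x. f x + g x) \<le> 2 * sq2 f + 2 * sq2 g" using f g by (simp add: Lp_2)
qed

lemma Lp_2_minus:
  assumes "Lp 2 f" "Lp 2 g"
  shows "Lp 2 (\<lambda>x. f x - g x)" "sq2 (\<lambda>x. f x - g x) \<le> 2 * sq2 f + 2 * sq2 g"
  using Lp_2_add[OF assms(1) Lp_uminus[OF assms(2)]] by simp_all

lemma sq2_diff_le: "Lp 2 f \<Longrightarrow> sq2 (diff z f) \<le> 4 * sq2 f"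
  using Lp_2_minus(2)[OF Lp_translate(1)[of 2 f z], of f] integral_translate(2)[of "\<lambda>x. (f x)\<^sup>2" z]
  by (simp add: diff_def[abs_def])

text \<open>Values are clipped by \<open>cl\<close> and space is cut by \<open>b\<close>. Clipping
  the continuous approximants as well keeps all integrands dominated, so almost everywhere
  convergence becomes L2 convergence.\<close>

lemma continuous_compact_L2_dense:
  assumes v: "Lp 2 v" and e: "e > 0"
  obtains g R B where "continuous_on UNIV g" "\<And>x. R < norm x \<Longrightarrow> g x = 0" "\<And>x. \<bar>g x\<bar> \<le> B" "R > 0" "Lp 2 g" "sq2 (\<lambda>x. v x - g x) < e"
proof -
  note [measurable] = Lp_measurable[OF v]
  define cl where "cl R t = max (- R) (min R t)" for R t :: real
  define b where "b R x = max 0 (min 1 (R + 1 - norm x))" for R :: real and x :: R3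
  have b: "0 \<le> b R x" "b R x \<le> 1" "norm x \<le> R \<Longrightarrow> b R x = 1" "R + 1 < norm x \<Longrightarrow> b R x = 0" for R x
    by (auto simp: b_def)
  have bc: "continuous_on UNIV (b R)" for R unfolding b_def by (intro continuous_intros)
  have [measurable]: "b R \<in> borel_measurable borel" for R by (rule borel_measurable_continuous_onI[OF bc])
  have [measurable]: "cl R \<in> borel_measurable borel" for R unfolding cl_def by measurable
  have cl: "\<bar>cl R t\<bar> \<le> R" "\<bar>cl R t\<bar> \<le> \<bar>t\<bar>" if "R \<ge> 0" for R t using that by (auto simp: cl_def max_def min_def)
  have v2: "integrable lborel (\<lambda>x. (v x)\<^sup>2)" using v by (simp add: Lp_2)
  have abs1: "\<bar>v x - cl R (v x) * b R x\<bar> \<le> 2 * \<bar>v x\<bar>" if "R \<ge> 0" for R x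
  proof -
    have "\<bar>cl R (v x) * b R x\<bar> \<le> \<bar>v x\<bar> * 1"
      unfolding abs_mult using cl(2)[OF that, of "v x"] b[where R=R and x=x] by (intro mult_mono) auto
    then show ?thesis by linarith
  qed
  have "(\<lambda>n. sq2 (\<lambda>x. v x - cl (real n) (v x) * b (real n) x)) \<longlonglongrightarrow> integral\<^sup>L lborel (\<lambda>x::R3. 0)"
  proof (rule integral_dominated_convergence[where w="\<lambda>x. 4 * (v x)\<^sup>2"])
    show "AE x in lborel. (\<lambda>n. (v x - cl (real n) (v x) * b (real n) x)\<^sup>2) \<longlonglongrightarrow> 0"
    proof (rule AE_I2)
      fix x
      obtain N :: nat where N: "\<bar>v x\<bar> + norm x \<le> real N" using real_arch_simple by blast
      have "\<forall>\<^sub>F n in sequentially. (v x - cl (real n) (v x) * b (real n) x)\<^sup>2 = 0"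
        using eventually_ge_at_top[of N]
      proof eventually_elim
        case (elim n)
        then have "\<bar>v x\<bar> + norm x \<le> real n" using N by (meson of_nat_le_iff order_trans)
        then have "\<bar>v x\<bar> \<le> real n" "norm x \<le> real n" using norm_ge_zero[of x] abs_ge_zero[of "v x"] by linarith+
        then have "cl (real n) (v x) = v x" "b (real n) x = 1"
          by (auto simp: cl_def max_def min_def abs_le_iff intro!: b(3))
        then show ?case by simp
      qed
      then show "(\<lambda>n. (v x - cl (real n) (v x) * b (real n) x)\<^sup>2) \<longlonglongrightarrow> 0" by (rule tendsto_eventually)
    qed
    show "AE x in lborel. norm ((v x - cl (real n) (v x) * b (real n) x)\<^sup>2) \<le> 4 * (v x)\<^sup>2" for n
    proof (rule AE_I2)
      fix x
      have "\<bar>v x - cl (real n) (v x) * b (real n) x\<bar>\<^sup>2 \<le> (2 * \<bar>v x\<bar>)\<^sup>2" by (intro power_mono abs1) auto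
      then show "norm ((v x - cl (real n) (v x) * b (real n) x)\<^sup>2) \<le> 4 * (v x)\<^sup>2" by (simp add: power_mult_distrib)
    qed
  qed (use v2 in auto)
  \<comment> \<open>Two errors below e / 4, each multiplied by the 2 from squaring a sum, stay below
    e.\<close>
  then have "\<forall>\<^sub>F n in sequentially. sq2 (\<lambda>x. v x - cl (real n) (v x) * b (real n) x) < e / 4"
    using e by (intro order_tendstoD(2)) auto
  then obtain n where n: "sq2 (\<lambda>x. v x - cl (real n) (v x) * b (real n) x) < e / 4"
    by (auto simp: eventually_sequentially)
  define R where "R = real n"
  have R0: "R \<ge> 0" by (simp add: R_def)
  let ?w = "\<lambda>x. cl R (v x) * b R x"
  obtain g where g: "\<And>n::nat. continuous_on UNIV (g n)" "AE x in lborel. (\<lambda>n. g n x) \<longlonglongrightarrow> v x"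
    using continuous_ae_approximation[OF Lp_measurable[OF v]] by blast
  have clc: "continuous_on UNIV (cl R)" unfolding cl_def by (intro continuous_intros)
  let ?h = "\<lambda>m x. cl R (g m x) * b R x"
  have hc: "continuous_on UNIV (?h m)" for m
    by (intro continuous_on_mult bc continuous_on_compose2[OF clc g(1)]) auto
  have [measurable]: "?h m \<in> borel_measurable borel" for m by (rule borel_measurable_continuous_onI[OF hc])
  have hb: "\<bar>?h m x\<bar> \<le> R * indicator (cball 0 (R + 1)) x" for m x
    using cl(1)[OF R0, of "g m x"] b[where R=R and x=x] mult_mono[of "\<bar>cl R (g m x)\<bar>" R "b R x" 1]
    by (cases "norm x \<le> R + 1") (auto simp: abs_mult R0)
  have wb: "\<bar>?w x\<bar> \<le> R * indicator (cball 0 (R + 1)) x" for x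
    using cl(1)[OF R0, of "v x"] b[where R=R and x=x] mult_mono[of "\<bar>cl R (v x)\<bar>" R "b R x" 1]
    by (cases "norm x \<le> R + 1") (auto simp: abs_mult R0)
  have ii: "integrable lborel (\<lambda>x::R3. c * indicator (cball 0 (R + 1)) x)" for c :: real
    by (intro integrable_mult_right integrable_real_indicator)
      (auto simp: emeasure_lborel_cball_finite[unfolded infinity_ennreal_def])
  have "(\<lambda>m. sq2 (\<lambda>x. ?w x - ?h m x)) \<longlonglongrightarrow> integral\<^sup>L lborel (\<lambda>x::R3. 0)"
  proof (rule integral_dominated_convergence[where w="\<lambda>x. (2 * R)\<^sup>2 * indicator (cball 0 (R + 1)) x"])
    show "AE x in lborel. (\<lambda>m. (?w x - ?h m x)\<^sup>2) \<longlonglongrightarrow> 0"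
      using g(2)
    proof eventually_elim
      case (elim x)
      then have "(\<lambda>m. cl R (g m x)) \<longlonglongrightarrow> cl R (v x)"
        by (intro continuous_on_tendsto_compose[OF clc]) auto
      then have "(\<lambda>m. (?w x - ?h m x)\<^sup>2) \<longlonglongrightarrow> (?w x - ?w x)\<^sup>2" by (intro tendsto_intros)
      then show ?case by simp
    qed
    show "AE x in lborel. norm ((?w x - ?h m x)\<^sup>2) \<le> (2 * R)\<^sup>2 * indicator (cball 0 (R + 1)) x" for m
    proof (rule AE_I2)
      fix x
      have "\<bar>?w x - ?h m x\<bar> \<le> 2 * R * indicator (cball 0 (R + 1)) x" using hb[of m x] wb[of x] by linarith
      then have "\<bar>?w x - ?h m x\<bar>\<^sup>2 \<le> (2 * R * indicator (cball 0 (R + 1)) x)\<^sup>2" by (intro power_mono) auto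
      also have "(2 * R * indicator (cball 0 (R + 1)) x)\<^sup>2 = (2 * R)\<^sup>2 * indicator (cball 0 (R + 1)) x"
        by (cases "x \<in> cball 0 (R + 1)") auto
      finally show "norm ((?w x - ?h m x)\<^sup>2) \<le> (2 * R)\<^sup>2 * indicator (cball 0 (R + 1)) x"
        by (simp only: real_norm_def abs_power2 power2_abs)
    qed
  qed (use ii in auto)
  then have "\<forall>\<^sub>F m in sequentially. sq2 (\<lambda>x. ?w x - ?h m x) < e / 4"
    using e by (intro order_tendstoD(2)) auto
  then obtain m where m: "sq2 (\<lambda>x. ?w x - ?h m x) < e / 4" by (auto simp: eventually_sequentially)
  have Lbd: "Lp 2 f" if [measurable]: "f \<in> borel_measurable borel" and "\<And>x. \<bar>f x\<bar> \<le> R * indicator (cball 0 (R + 1)) x" for f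
  proof -
    have "integrable lborel (\<lambda>x. (f x)\<^sup>2)"
    proof (rule Bochner_Integration.integrable_bound[OF ii[of "R\<^sup>2"]])
      show "AE x in lborel. norm ((f x)\<^sup>2) \<le> norm (R\<^sup>2 * indicator (cball 0 (R + 1)) x)"
      proof (rule AE_I2)
        fix x
        show "norm ((f x)\<^sup>2) \<le> norm (R\<^sup>2 * indicator (cball 0 (R + 1)) x)"
          using power_mono[OF that(2)[of x] abs_ge_zero, of 2] by (cases "x \<in> cball 0 (R + 1)") auto
      qed
    qed measurable
    then show ?thesis by (simp add: Lp_2)
  qed
  have Lw: "Lp 2 ?w" by (rule Lbd[OF _ wb]) measurable
  have Lh: "Lp 2 (?h m)" by (rule Lbd[OF _ hb]) measurable
  have "sq2 (\<lambda>x. (v x - ?w x) + (?w x - ?h m x)) \<le> 2 * sq2 (\<lambda>x. v x - ?w x) + 2 * sq2 (\<lambda>x. ?w x - ?h m x)"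
    by (rule Lp_2_add(2)[OF Lp_2_minus(1)[OF v Lw] Lp_2_minus(1)[OF Lw Lh]])
  also have "\<dots> < e" using n m by (simp add: R_def)
  finally have "sq2 (\<lambda>x. v x - ?h m x) < e" by simp
  moreover have "?h m x = 0" if "R + 1 < norm x" for x using b(4)[OF that] by simp
  moreover have "\<bar>?h m x\<bar> \<le> R" for x using hb[of m x] R0 by (cases "x \<in> cball 0 (R + 1)") auto
  ultimately show ?thesis using that[of "?h m" "R + 1" R] hc Lh R0 by simp
qed

text \<open>For a continuous function of compact support dominated convergence applies; the
  increment of the remainder costs at most 4 times its square norm, whatever the shift.\<close>

lemma L2_translation_continuous:
  assumes v: "Lp 2 v" and z: "z \<longlonglongrightarrow> 0"
  shows "(\<lambda>n. sq2 (diff (z n) v)) \<longlonglongrightarrow> 0"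
proof (rule order_tendstoI)
  fix e :: real assume "e < 0"
  then show "\<forall>\<^sub>F n in sequentially. e < sq2 (diff (z n) v)"
    by (intro always_eventually allI) (auto intro: less_le_trans)
next
  fix e :: real assume e: "0 < e"
  \<comment> \<open>The remainder contributes at most 2 * 4 * e / 16 and g at most 2 * e / 4,
    together e.\<close>
  obtain g R B where g: "continuous_on UNIV g" "\<And>x. R < norm x \<Longrightarrow> g x = 0" "\<And>x. \<bar>g x\<bar> \<le> B" "R > 0"
    "Lp 2 g" "sq2 (\<lambda>x. v x - g x) < e / 16"
    by (rule continuous_compact_L2_dense[OF v, of "e / 16"]) (use e in auto)
  have [measurable]: "g \<in> borel_measurable borel" by (rule borel_measurable_continuous_onI[OF g(1)])
  have "\<forall>\<^sub>F n in sequentially. norm (z n) < 1"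
    using order_tendstoD(2)[OF tendsto_norm[OF z], of 1] by simp
  then obtain N where N: "\<And>n. n \<ge> N \<Longrightarrow> norm (z n) < 1" by (auto simp: eventually_sequentially)
  have "(\<lambda>n. sq2 (diff (z (n + N)) g)) \<longlonglongrightarrow> integral\<^sup>L lborel (\<lambda>x::R3. 0)"
  proof (rule integral_dominated_convergence[where w="\<lambda>x. (2 * B)\<^sup>2 * indicator (cball 0 (R + 1)) x"])
    show "integrable lborel (\<lambda>x::R3. (2 * B)\<^sup>2 * indicator (cball 0 (R + 1)) x)"
      by (intro integrable_mult_right integrable_real_indicator)
        (auto simp: emeasure_lborel_cball_finite[unfolded infinity_ennreal_def])
    show "AE x in lborel. (\<lambda>n. (diff (z (n + N)) g x)\<^sup>2) \<longlonglongrightarrow> 0"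
    proof (rule AE_I2)
      fix x
      have "(\<lambda>n. x - z (n + N)) \<longlonglongrightarrow> x - 0" by (intro tendsto_intros LIMSEQ_ignore_initial_segment z)
      then have "(\<lambda>n. g (x - z (n + N))) \<longlonglongrightarrow> g (x - 0)"
        by (intro continuous_on_tendsto_compose[OF g(1)]) auto
      then have "(\<lambda>n. (g (x - z (n + N)) - g x)\<^sup>2) \<longlonglongrightarrow> (g (x - 0) - g x)\<^sup>2" by (intro tendsto_intros)
      then show "(\<lambda>n. (diff (z (n + N)) g x)\<^sup>2) \<longlonglongrightarrow> 0" by (simp add: diff_def)
    qed
    show "AE x in lborel. norm ((diff (z (n + N)) g x)\<^sup>2) \<le> (2 * B)\<^sup>2 * indicator (cball 0 (R + 1)) x" for n
    proof (rule AE_I2)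
      fix x :: R3
      let ?z = "z (n + N)"
      have zn: "norm ?z < 1" by (rule N) simp
      show "norm ((diff ?z g x)\<^sup>2) \<le> (2 * B)\<^sup>2 * indicator (cball 0 (R + 1)) x"
      proof (cases "norm x \<le> R + 1")
        case True
        have "\<bar>diff ?z g x\<bar> \<le> 2 * B" unfolding diff_def using g(3)[of x] g(3)[of "x - ?z"] by linarith
        then have "\<bar>diff ?z g x\<bar>\<^sup>2 \<le> (2 * B)\<^sup>2" by (intro power_mono) auto
        then show ?thesis using True by simp
      next
        case False
        have "norm x \<le> norm (x - ?z) + norm ?z" using norm_triangle_ineq[of "x - ?z" ?z] by simp
        then have "R < norm (x - ?z)" using False zn by linarith
        then show ?thesis using g(2) False by (simp add: diff_def)
      qed
    qed
  qed (auto simp: diff_def)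
  then have "(\<lambda>n. sq2 (diff (z (n + N)) g)) \<longlonglongrightarrow> 0" by simp
  then have "(\<lambda>n. sq2 (diff (z n) g)) \<longlonglongrightarrow> 0" by (rule LIMSEQ_offset)
  then have "\<forall>\<^sub>F n in sequentially. sq2 (diff (z n) g) < e / 4" using e by (intro order_tendstoD(2)) auto
  then show "\<forall>\<^sub>F n in sequentially. sq2 (diff (z n) v) < e"
  proof eventually_elim
    case (elim n)
    have L: "Lp 2 (\<lambda>x. v x - g x)" by (rule Lp_2_minus(1)[OF v g(5)])
    have "diff (z n) v = (\<lambda>x. diff (z n) (\<lambda>x. v x - g x) x + diff (z n) g x)" by (auto simp: diff_def)
    then have "sq2 (diff (z n) v) \<le> 2 * sq2 (diff (z n) (\<lambda>x. v x - g x)) + 2 * sq2 (diff (z n) g)"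
      using Lp_2_add(2)[OF Lp_2_diff[OF L] Lp_2_diff[OF g(5)], of "z n" "z n"] by simp
    also have "\<dots> < e" using elim g(6) sq2_diff_le[OF L, of "z n"] by linarith
    finally show ?case .
  qed
qed

text \<open>The error is an average, with weight k, of the increments of v by y / l. These tend to 0
  by \<open>L2_translation_continuous\<close> and are dominated by a multiple of |k|. The kernel is
  not normalised, so its integral appears in the limit.\<close>

lemma approximate_identity_L2:
  assumes k: "Lp 1 k" "Lp 2 k" and v: "Lp 2 v" and l: "\<And>n. l n > 0" "(\<lambda>n. inverse (l n)) \<longlonglongrightarrow> 0"
  shows "(\<lambda>n. \<integral>\<^sup>+x. ennreal ((conv (\<lambda>y. l n ^ 3 * k (l n *\<^sub>R y)) v x - (LINT y|lborel. k y) * v x)\<^sup>2) \<partial>lborel) \<longlonglongrightarrow> 0"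
proof -
  note [measurable] = Lp_measurable[OF k(1)] Lp_measurable[OF v]
  have ik: "integrable lborel k" using k(1) Lp_1 by simp
  define K where "K = (LINT y|lborel. \<bar>k y\<bar>)"
  have K0: "K \<ge> 0" by (simp add: K_def)
  let ?d = "\<lambda>n y. diff (inverse (l n) *\<^sub>R y) v"
  have iv: "integrable lborel (\<lambda>y. k y * v (x - inverse (l n) *\<^sub>R y))"
    and cv: "conv (\<lambda>y. l n ^ 3 * k (l n *\<^sub>R y)) v x = (LINT y|lborel. k y * v (x - inverse (l n) *\<^sub>R y))" for x n
  proof -
    have ln: "l n > 0" by (rule l)
    have k2: "Lp 2 (\<lambda>y. l n ^ 3 * k (l n *\<^sub>R y))"
    proof (rule Lp_cmult)
      show "Lp 2 (\<lambda>y. k (l n *\<^sub>R y))"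
        using k(2) ln integrable_affine3_iff[of "l n" "\<lambda>y. (k y)\<^sup>2" 0] by (simp add: Lp_2)
    qed
    have e: "(\<lambda>y. l n ^ 3 * k (l n *\<^sub>R (x - y)) * v y) = (\<lambda>y. l n ^ 3 * (k (- l n *\<^sub>R y + l n *\<^sub>R x) * v (x - inverse (l n) *\<^sub>R (- l n *\<^sub>R y + l n *\<^sub>R x))))"
      using ln by (auto simp: scaleR_diff_right scaleR_add_right mult.assoc)
    have i1: "integrable lborel (\<lambda>y. l n ^ 3 * k (l n *\<^sub>R (x - y)) * v y)" by (rule integrable_conv_L2(1)[OF k2 v])
    show "integrable lborel (\<lambda>y. k y * v (x - inverse (l n) *\<^sub>R y))"
      using i1 ln unfolding e
      using integrable_affine3_iff[of "- l n" "\<lambda>y. k y * v (x - inverse (l n) *\<^sub>R y)" "l n *\<^sub>R x"]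
      by (simp add: add.commute)
    show "conv (\<lambda>y. l n ^ 3 * k (l n *\<^sub>R y)) v x = (LINT y|lborel. k y * v (x - inverse (l n) *\<^sub>R y))"
      unfolding conv_def e
      using ln integral_affine3[of "- l n" "\<lambda>y. k y * v (x - inverse (l n) *\<^sub>R y)" "l n *\<^sub>R x"]
      by (simp add: add.commute)
  qed
  have d: "conv (\<lambda>y. l n ^ 3 * k (l n *\<^sub>R y)) v x - (LINT y|lborel. k y) * v x = (LINT y|lborel. k y * ?d n y x)" for n x
    using iv[of x n] ik by (simp add: cv diff_def right_diff_distrib)
  have id: "integrable lborel (\<lambda>y. k y * ?d n y x)" for n x
    using iv[of x n] ik by (simp add: diff_def right_diff_distrib)
  have bound: "(\<integral>\<^sup>+x. ennreal ((conv (\<lambda>y. l n ^ 3 * k (l n *\<^sub>R y)) v x - (LINT y|lborel. k y) * v x)\<^sup>2) \<partial>lborel) \<le>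
    ennreal (K * (LINT y|lborel. \<bar>k y\<bar> * sq2 (?d n y)))" for n
  proof -
    have [measurable]: "(\<lambda>(x, y). ?d n y x) \<in> borel_measurable (lborel \<Otimes>\<^sub>M lborel)" "(\<lambda>(y, x). ?d n y x) \<in> borel_measurable (lborel \<Otimes>\<^sub>M lborel)"
      unfolding diff_def by measurable
    have "(\<integral>\<^sup>+x. ennreal ((conv (\<lambda>y. l n ^ 3 * k (l n *\<^sub>R y)) v x - (LINT y|lborel. k y) * v x)\<^sup>2) \<partial>lborel) \<le>
      (\<integral>\<^sup>+x. ennreal K * (\<integral>\<^sup>+y. ennreal (\<bar>k y\<bar> * (?d n y x)\<^sup>2) \<partial>lborel) \<partial>lborel)"
    proof (rule nn_integral_mono)
      fix x
      have "(ennreal \<bar>LINT y|lborel. k y * ?d n y x\<bar>)\<^sup>2 \<le> (\<integral>\<^sup>+y. ennreal (norm (k y * ?d n y x)) \<partial>lborel)\<^sup>2"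
        using norm_integral_le_nn_integral[of lborel "\<lambda>y. k y * ?d n y x"] by (intro power_mono) auto
      \<comment> \<open>Cauchy-Schwarz for the measure |k| dy, obtained by splitting |k| into two
        square roots.\<close>
      also have "(\<integral>\<^sup>+y. ennreal (norm (k y * ?d n y x)) \<partial>lborel) = (\<integral>\<^sup>+y. ennreal (sqrt \<bar>k y\<bar>) * ennreal (sqrt \<bar>k y\<bar> * \<bar>?d n y x\<bar>) \<partial>lborel)"
        by (intro nn_integral_cong) (simp add: ennreal_mult[symmetric] abs_mult mult.assoc[symmetric])
      also have "\<dots>\<^sup>2 \<le> (\<integral>\<^sup>+y. (ennreal (sqrt \<bar>k y\<bar>))\<^sup>2 \<partial>lborel) * (\<integral>\<^sup>+y. (ennreal (sqrt \<bar>k y\<bar> * \<bar>?d n y x\<bar>))\<^sup>2 \<partial>lborel)"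
        by (rule Cauchy_Schwarz_nn_integral) measurable
      also have "(\<integral>\<^sup>+y. (ennreal (sqrt \<bar>k y\<bar>))\<^sup>2 \<partial>lborel) = ennreal K"
        using ik by (simp add: ennreal_power K_def nn_integral_eq_integral)
      also have "(\<integral>\<^sup>+y. (ennreal (sqrt \<bar>k y\<bar> * \<bar>?d n y x\<bar>))\<^sup>2 \<partial>lborel) = (\<integral>\<^sup>+y. ennreal (\<bar>k y\<bar> * (?d n y x)\<^sup>2) \<partial>lborel)"
        by (intro nn_integral_cong) (simp add: ennreal_power power_mult_distrib)
      finally show "ennreal ((conv (\<lambda>y. l n ^ 3 * k (l n *\<^sub>R y)) v x - (LINT y|lborel. k y) * v x)\<^sup>2) \<le> ennreal K * (\<integral>\<^sup>+y. ennreal (\<bar>k y\<bar> * (?d n y x)\<^sup>2) \<partial>lborel)"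
        unfolding d by (simp add: ennreal_power)
    qed
    also have "\<dots> = ennreal K * (\<integral>\<^sup>+x. \<integral>\<^sup>+y. ennreal (\<bar>k y\<bar> * (?d n y x)\<^sup>2) \<partial>lborel \<partial>lborel)"
      by (rule nn_integral_cmult) measurable
    also have "(\<integral>\<^sup>+x. \<integral>\<^sup>+y. ennreal (\<bar>k y\<bar> * (?d n y x)\<^sup>2) \<partial>lborel \<partial>lborel) = (\<integral>\<^sup>+y. \<integral>\<^sup>+x. ennreal (\<bar>k y\<bar> * (?d n y x)\<^sup>2) \<partial>lborel \<partial>lborel)"
      by (rule lborel_pair.Fubini') (simp add: split_beta')
    also have "\<dots> = (\<integral>\<^sup>+y. ennreal (\<bar>k y\<bar> * sq2 (?d n y)) \<partial>lborel)"
    proof (intro nn_integral_cong)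
      fix y
      have "Lp 2 (?d n y)" by (rule Lp_2_diff[OF v])
      then have "integrable lborel (\<lambda>x. \<bar>k y\<bar> * (?d n y x)\<^sup>2)" by (simp add: Lp_2)
      from nn_integral_eq_integral[OF this] show "(\<integral>\<^sup>+x. ennreal (\<bar>k y\<bar> * (?d n y x)\<^sup>2) \<partial>lborel) = ennreal (\<bar>k y\<bar> * sq2 (?d n y))"
        by simp
    qed
    also have "\<dots> = ennreal (LINT y|lborel. \<bar>k y\<bar> * sq2 (?d n y))"
    proof (rule nn_integral_eq_integral)
      have [measurable]: "(\<lambda>y. sq2 (?d n y)) \<in> borel_measurable lborel" by measurable
      show "integrable lborel (\<lambda>y. \<bar>k y\<bar> * sq2 (?d n y))"
        using ik sq2_diff_le[OF v] by (intro integrable_mult_bounded(1)[where B="4 * sq2 v"]) auto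
    qed auto
    finally show ?thesis by (simp add: ennreal_mult K0)
  qed
  have "(\<lambda>n. LINT y|lborel. \<bar>k y\<bar> * sq2 (?d n y)) \<longlonglongrightarrow> integral\<^sup>L lborel (\<lambda>y::R3. 0)"
  proof (rule integral_dominated_convergence[where w="\<lambda>y. \<bar>k y\<bar> * (4 * sq2 v)"])
    show "integrable lborel (\<lambda>y. \<bar>k y\<bar> * (4 * sq2 v))" using ik by simp
    show "AE y in lborel. (\<lambda>n. \<bar>k y\<bar> * sq2 (?d n y)) \<longlonglongrightarrow> 0"
    proof (rule AE_I2)
      fix y :: R3
      have "(\<lambda>n. inverse (l n) *\<^sub>R y) \<longlonglongrightarrow> 0 *\<^sub>R y" by (rule tendsto_scaleR[OF l(2) tendsto_const])
      then have "(\<lambda>n. sq2 (?d n y)) \<longlonglongrightarrow> 0" by (intro L2_translation_continuous[OF v]) simp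
      then show "(\<lambda>n. \<bar>k y\<bar> * sq2 (?d n y)) \<longlonglongrightarrow> 0" by (rule tendsto_mult_right_zero)
    qed
    show "AE y in lborel. norm (\<bar>k y\<bar> * sq2 (?d n y)) \<le> \<bar>k y\<bar> * (4 * sq2 v)" for n
      using sq2_diff_le[OF v] by (intro AE_I2) (simp add: abs_mult mult_left_mono)
    show "(\<lambda>y. \<bar>k y\<bar> * sq2 (?d n y)) \<in> borel_measurable lborel" for n
      unfolding diff_def by measurable
  qed measurable
  then have "(\<lambda>n. K * (LINT y|lborel. \<bar>k y\<bar> * sq2 (?d n y))) \<longlonglongrightarrow> 0"
    by (intro tendsto_mult_right_zero) simp
  from tendsto_ennrealI[OF this] have "(\<lambda>n. ennreal (K * (LINT y|lborel. \<bar>k y\<bar> * sq2 (?d n y)))) \<longlonglongrightarrow> 0" by simp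
  from tendsto_sandwich[OF _ _ tendsto_const this] show ?thesis using bound by simp
qed

subsection \<open>Increments in L3\<close>

lemma cosk_add:
  assumes "test_function \<rho>" "test_function \<sigma>"
  shows "cosk (\<lambda>\<xi>. \<rho> \<xi> + \<sigma> \<xi>) x = cosk \<rho> x + cosk \<sigma> x"
  using test_function_trig_integrable(1)[OF assms(1), of x] test_function_trig_integrable(1)[OF assms(2), of x]
  by (simp add: cosk_def distrib_right add_divide_distrib)

text \<open>Origin of the kernel: its branch at nonpositive arguments is the saturated regime of the
  minimum, its branch at positive arguments the Lipschitz regime, once the weight \<lambda>_q^(2/3)
  of d_q^2 is separated off.\<close>

lemma K_kernel_identity:
  "(min 1 (lam q / lam Q))\<^sup>2 = lam Q powr (- (2 / 3)) * (K_kernel (Q - q) * lam q powr (2 / 3))"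
proof (cases "Q \<le> q")
  case True
  then have "lam Q \<le> lam q" by (rule lam_mono)
  then have "min 1 (lam q / lam Q) = 1" by (simp add: min_def divide_le_eq)
  moreover have "K_kernel (Q - q) = 2 powr (real_of_int (Q - q) * (2 / 3))"
    using True by (simp add: K_kernel_def lam_def powr_powr)
  then have "lam Q powr (- (2 / 3)) * (K_kernel (Q - q) * lam q powr (2 / 3)) = 2 powr (real_of_int Q * (- (2 / 3)) + (real_of_int (Q - q) * (2 / 3) + real_of_int q * (2 / 3)))"
    by (simp only: lam_def powr_powr powr_add)
  moreover have "real_of_int Q * (- (2 / 3)) + (real_of_int (Q - q) * (2 / 3) + real_of_int q * (2 / 3)) = 0"
    by (simp add: field_simps)
  ultimately show ?thesis by simp
next
  case False
  then have "lam q \<le> lam Q" by (intro lam_mono) simp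
  then have "(min 1 (lam q / lam Q))\<^sup>2 = (lam q / lam Q)\<^sup>2" by (simp add: min_def divide_le_eq)
  also have "\<dots> = 2 powr (2 * (real_of_int q - real_of_int Q))"
    by (simp add: lam_def powr_diff[symmetric] powr_power)
  also have "2 * (real_of_int q - real_of_int Q) = real_of_int Q * (- (2 / 3)) + (real_of_int (Q - q) * (- (4 / 3)) + real_of_int q * (2 / 3))"
    by (simp add: field_simps)
  also have "2 powr \<dots> = lam Q powr (- (2 / 3)) * (K_kernel (Q - q) * lam q powr (2 / 3))"
  proof -
    have "K_kernel (Q - q) = 2 powr (real_of_int (Q - q) * (- (4 / 3)))"
      using False by (simp add: K_kernel_def lam_def powr_powr)
    then show ?thesis by (simp only: lam_def powr_powr powr_add)
  qed
  finally show ?thesis .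
qed

text \<open>Compares a shift of length r with one of length 1/l. The price 1 + l r for leaving that
  scale is later absorbed by the decay of the gradient kernel.\<close>

lemma min_scale_le:
  fixes a l r :: real
  assumes "a > 0" "l > 0" "r \<ge> 0"
  shows "min 1 (a * r) \<le> (1 + l * r) * min 1 (a / l)"
proof (cases "a \<le> l")
  case True
  have "min 1 (a * r) \<le> a * r" by simp
  also have "\<dots> \<le> (1 + l * r) * (a / l)" using assms by (simp add: field_simps)
  finally have "min 1 (a * r) \<le> (1 + l * r) * (a / l)" .
  moreover have "min 1 (a / l) = a / l" using True assms by (simp add: min_def)
  ultimately show ?thesis by (simp only:)
next
  case False
  then have "min 1 (a / l) = 1" using assms by (simp add: min_def)
  moreover have "min 1 (a * r) \<le> 1" "0 \<le> l * r" using assms by auto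
  ultimately show ?thesis by simp
qed

section \<open>From partial sums of blocks to increments of the function\<close>

context cutoff
begin

definition partial_sum :: "nat \<Rightarrow> (R3 \<Rightarrow> real) \<Rightarrow> R3 \<Rightarrow> real" where
  "partial_sum N v x = (\<Sum>k<N. block (int k - 1) v x)"

lemma partial_sum_eq_conv:
  assumes v: "Lp 2 v"
  shows "partial_sum N v x = conv (cosk (low (int N - 1))) v x"
proof (induction N)
  case 0
  then show ?case by (simp add: partial_sum_def low_negative cosk_def conv_def)
next
  case (Suc N)
  have q: "- 1 \<le> int N - 1" by simp
  have "conv (cosk (low (int N - 1))) v x + block (int N - 1) v x =
    conv (\<lambda>y. cosk (low (int N - 1)) y + cosk (LP_symbol chi (int N - 1)) y) v x"
    unfolding block_def conv_def
    using integrable_conv_L2(1)[OF Lp_trig_kernel(1)[OF test_low] v] integrable_conv_L2(1)[OF Lp_trig_kernel(1)[OF test_LP_symbol[OF q]] v]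
    by (simp add: distrib_right)
  also have "(\<lambda>y. cosk (low (int N - 1)) y + cosk (LP_symbol chi (int N - 1)) y) = cosk (\<lambda>\<xi>. low (int N - 1) \<xi> + LP_symbol chi (int N - 1) \<xi>)"
    using cosk_add[OF test_low test_LP_symbol[OF q]] by auto
  also have "(\<lambda>\<xi>. low (int N - 1) \<xi> + LP_symbol chi (int N - 1) \<xi>) = low (int (Suc N) - 1)"
    using LP_symbol_eq[OF q] by auto
  finally show ?case using Suc by (simp add: partial_sum_def)
qed

text \<open>The sum of the first n + 1 blocks has symbol \<open>low n\<close>, which is
  \<open>chi\<close> at scale \<lambda>_n, so its kernel is a dilated approximate identity of
  integral \<open>mass\<close>.\<close>

lemma partial_sum_tendsto_L2:
  assumes v: "Lp 2 v"
  shows "(\<lambda>n. \<integral>\<^sup>+x. ennreal ((partial_sum (Suc n) v x - mass * v x)\<^sup>2) \<partial>lborel) \<longlonglongrightarrow> 0"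
proof -
  have lim: "(\<lambda>n. inverse (lam (int n))) \<longlonglongrightarrow> 0"
  proof -
    have "inverse (lam (int n)) = (1 / 2) ^ n" for n
      by (simp add: lam_def powr_realpow power_divide inverse_eq_divide)
    then show ?thesis by (simp add: LIMSEQ_realpow_zero)
  qed
  have "partial_sum (Suc n) v x = conv (\<lambda>y. lam (int n) ^ 3 * cosk chi (lam (int n) *\<^sub>R y)) v x" for n x
  proof -
    have "cosk (\<lambda>\<xi>. chi (\<xi> /\<^sub>R lam (int n))) = (\<lambda>y. lam (int n) ^ 3 * cosk chi (lam (int n) *\<^sub>R y))"
      by (rule ext, rule trig_kernel_scale(1)) simp
    then show ?thesis by (simp add: partial_sum_eq_conv[OF v] low_dilation)
  qed
  then show ?thesis
    using approximate_identity_L2[OF Lp_trig_kernel(1)[OF test_chi] Lp_trig_kernel(1)[OF test_chi] v lam_pos lim]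
    by (simp add: mass_def)
qed

text \<open>L2 convergence yields almost everywhere convergence along a subsequence, and Fatou
  transfers the uniform L3 bound to \<open>mass\<close> times v.\<close>

lemma n3_le_of_partial_sums:
  assumes v: "Lp 2 v" and p: "\<And>N. Lp 3 (partial_sum N v)" "\<And>N. n3 (partial_sum N v) \<le> b"
  shows "Lp 3 v" "n3 v \<le> b / \<bar>mass\<bar>"
proof -
  note [measurable] = Lp_measurable[OF v] Lp_measurable[OF p(1)]
  have b0: "b \<ge> 0" using p(2)[of 0] n3_nonneg order_trans by blast
  define u where "u n x = (partial_sum (Suc n) v x - mass * v x)\<^sup>2" for n x
  have [measurable]: "u n \<in> borel_measurable borel" for n unfolding u_def[abs_def] by measurable
  have fin: "\<forall>\<^sub>F n in sequentially. (\<integral>\<^sup>+x. ennreal (u n x) \<partial>lborel) < 1"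
    using partial_sum_tendsto_L2[OF v] unfolding u_def by (intro order_tendstoD(2)) auto
  \<comment> \<open>The shift by \<open>M\<close> discards the initial terms, whose integrals are
    not known to be finite.\<close>
  then obtain M where M: "\<And>n. n \<ge> M \<Longrightarrow> (\<integral>\<^sup>+x. ennreal (u n x) \<partial>lborel) < 1" by (auto simp: eventually_sequentially)
  have iu: "integrable lborel (u (n + M))" for n
    by (rule integrableI_nonneg) (use M[of "n + M"] in \<open>auto simp: u_def intro: less_trans ennreal_one_less_top\<close>)
  have "(\<lambda>n. \<integral>\<^sup>+x. ennreal (u (n + M) x) \<partial>lborel) \<longlonglongrightarrow> 0"
    using partial_sum_tendsto_L2[OF v] unfolding u_def by (rule LIMSEQ_ignore_initial_segment)
  moreover have "(\<integral>\<^sup>+x. ennreal (u (n + M) x) \<partial>lborel) = ennreal (LINT x|lborel. norm (u (n + M) x))" for n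
  proof -
    have "(\<integral>\<^sup>+x. ennreal (u (n + M) x) \<partial>lborel) = ennreal (LINT x|lborel. u (n + M) x)"
      by (rule nn_integral_eq_integral[OF iu]) (simp add: u_def)
    moreover have "norm (u (n + M) x) = u (n + M) x" for x by (simp add: u_def)
    ultimately show ?thesis by (simp only:)
  qed
  ultimately have "(\<lambda>n. LINT x|lborel. norm (u (n + M) x)) \<longlonglongrightarrow> 0"
    by (simp add: ennreal_tendsto_0_iff)
  from tendsto_L1_AE_subseq[OF iu this] obtain r where
    r: "strict_mono (r :: nat \<Rightarrow> nat)" "AE x in lborel. (\<lambda>n. u (r n + M) x) \<longlonglongrightarrow> 0" by blast
  have "(\<integral>\<^sup>+x. ennreal (\<bar>mass * v x\<bar> ^ 3) \<partial>lborel) =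
    (\<integral>\<^sup>+x. liminf (\<lambda>n. ennreal (\<bar>partial_sum (Suc (r n + M)) v x\<bar> ^ 3)) \<partial>lborel)"
  proof (rule nn_integral_cong_AE, use r(2) in eventually_elim)
    case (elim x)
    then have "(\<lambda>n. partial_sum (Suc (r n + M)) v x - mass * v x) \<longlonglongrightarrow> 0"
      by (simp add: u_def power_tendsto_0_iff)
    then have "(\<lambda>n. partial_sum (Suc (r n + M)) v x) \<longlonglongrightarrow> mass * v x" by (simp add: LIM_zero_iff)
    then have "(\<lambda>n. ennreal (\<bar>partial_sum (Suc (r n + M)) v x\<bar> ^ 3)) \<longlonglongrightarrow> ennreal (\<bar>mass * v x\<bar> ^ 3)"
      by (intro tendsto_ennrealI tendsto_intros)
    then show ?case by (intro lim_imp_Liminf[symmetric]) auto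
  qed
  also have "\<dots> \<le> liminf (\<lambda>n. \<integral>\<^sup>+x. ennreal (\<bar>partial_sum (Suc (r n + M)) v x\<bar> ^ 3) \<partial>lborel)"
    by (intro nn_integral_liminf) measurable
  also have "\<dots> \<le> liminf (\<lambda>n::nat. ennreal (b ^ 3))"
    by (intro Liminf_mono always_eventually allI) (auto simp: Lp_nn_integral[OF p(1)] intro!: ennreal_leI power_mono p(2))
  also have "\<dots> = ennreal (b ^ 3)" by (simp add: Liminf_const)
  finally have le: "(\<integral>\<^sup>+x. ennreal (\<bar>mass * v x\<bar> ^ 3) \<partial>lborel) \<le> ennreal (b ^ 3)" .
  note m = n3_leI_nn[OF _ le b0]
  have "Lp 3 (\<lambda>x. (1 / mass) * (mass * v x))" by (intro Lp_cmult m(1)) measurable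
  then show "Lp 3 v" using mass_nonzero by simp
  have "n3 (\<lambda>x. mass * v x) \<le> b" by (rule m(2)) measurable
  then show "n3 v \<le> b / \<bar>mass\<bar>" using mass_nonzero by (simp add: n3_cmult field_simps)
qed

lemma block_diff_commute:
  assumes "Lp 2 v" "- 1 \<le> q"
  shows "block q (diff z v) = diff z (block q v)"
  unfolding block_def
  using diff_conv(2)[OF integrable_conv_L2(1)[OF Lp_trig_kernel(1)[OF test_LP_symbol[OF assms(2)]] assms(1)], of z] by auto

text \<open>The block estimate is applied to the increment of v. Its blocks are increments of blocks
  of v, smaller by (1 + \<lambda>_Q |z|) min(1, \<lambda>_q / \<lambda>_Q) up to a constant, and
  \<open>K_kernel_identity\<close> turns the sum of their squares into \<kappa>.\<close>

lemma shift_estimate: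
  "\<exists>B>0. \<forall>v Q \<kappa>. Lp 2 v \<longrightarrow> 0 \<le> \<kappa> \<longrightarrow> (\<forall>q\<ge>-1. Lp 3 (block q v)) \<longrightarrow>
    (\<forall>N::nat. (\<Sum>k<N. K_kernel (Q - (int k - 1)) * (lam (int k - 1) powr (2 / 3) * (n3 (block (int k - 1) v))\<^sup>2)) \<le> \<kappa>) \<longrightarrow>
    Lp 3 v \<and> (\<forall>z. n3 (diff z v) \<le> B * (1 + lam Q * norm z) * lam Q powr (- (1 / 3)) * sqrt \<kappa>)"
proof -
  obtain B where B: "B > 0" and Bp: "\<And>v N. Lp 2 v \<Longrightarrow> (\<And>k. k < N \<Longrightarrow> Lp 3 (block (int k - 1) v)) \<Longrightarrow>
    Lp 3 (partial_sum N v) \<and> n3 (partial_sum N v) \<le> B * sqrt (\<Sum>k<N. (n3 (block (int k - 1) v))\<^sup>2)"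
    using partial_sum_L3 unfolding partial_sum_def[abs_def] by blast
  obtain C where C: "C > 0" and Cd: "\<And>v q z. Lp 2 v \<Longrightarrow> - 1 \<le> q \<Longrightarrow> Lp 3 (block q v) \<Longrightarrow>
    n3 (diff z (block q v)) \<le> C * min 1 (lam q * norm z) * n3 (block q v)"
    using block_diff by blast
  show ?thesis
  proof (intro exI[of _ "B * C / \<bar>mass\<bar>"] conjI allI impI)
    show "B * C / \<bar>mass\<bar> > 0" using B C mass_nonzero by simp
    fix v Q and \<kappa> :: real
    assume v: "Lp 2 v" and k0: "0 \<le> \<kappa>" and b: "\<forall>q\<ge>-1. Lp 3 (block q v)"
      and sum: "\<forall>N::nat. (\<Sum>k<N. K_kernel (Q - (int k - 1)) * (lam (int k - 1) powr (2 / 3) * (n3 (block (int k - 1) v))\<^sup>2)) \<le> \<kappa>"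
    define w where "w k = min 1 (lam (int k - 1) / lam Q)" for k :: nat
    define a where "a k = n3 (block (int k - 1) v)" for k :: nat
    have b3: "Lp 3 (block (int k - 1) v)" for k :: nat using b by simp
    have w0: "0 \<le> w k" for k by (simp add: w_def less_imp_le)
    have wsum: "(\<Sum>k<N. (w k * a k)\<^sup>2) \<le> lam Q powr (- (2 / 3)) * \<kappa>" for N
    proof -
      have "(\<Sum>k<N. (w k * a k)\<^sup>2) = lam Q powr (- (2 / 3)) * (\<Sum>k<N. K_kernel (Q - (int k - 1)) * (lam (int k - 1) powr (2 / 3) * (a k)\<^sup>2))"
        unfolding power_mult_distrib w_def K_kernel_identity by (simp add: sum_distrib_left mult.assoc)
      also have "\<dots> \<le> lam Q powr (- (2 / 3)) * \<kappa>"
        using sum by (intro mult_left_mono) (auto simp: a_def)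
      finally show ?thesis .
    qed
    have rt: "sqrt (lam Q powr (- (2 / 3)) * \<kappa>) = lam Q powr (- (1 / 3)) * sqrt \<kappa>"
      by (simp add: real_sqrt_mult powr_half_sqrt[symmetric] powr_powr)
    show "Lp 3 v"
    proof (rule n3_le_of_partial_sums(1)[OF v])
      show "Lp 3 (partial_sum N v)" for N using Bp[OF v b3] by blast
      \<comment> \<open>A qualitative bound: every weight is at least that of the block -1, so the
        unweighted squares are bounded too. Its dependence on Q is harmless, as it serves only to
        show that v is in L3.\<close>
      show "n3 (partial_sum N v) \<le> B * (1 / w 0 * sqrt (lam Q powr (- (2 / 3)) * \<kappa>))" for N
      proof -
        have wp: "w 0 > 0" by (simp add: w_def)
        have wk: "w 0 \<le> w k" for k
          unfolding w_def by (intro min.mono divide_right_mono lam_mono) (auto simp: less_imp_le)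
        have "(\<Sum>k<N. (a k)\<^sup>2) \<le> (\<Sum>k<N. (1 / w 0)\<^sup>2 * (w k * a k)\<^sup>2)"
        proof (rule sum_mono)
          fix k
          have "a k \<le> 1 / w 0 * (w k * a k)"
            using wp wk[of k] mult_right_mono[OF wk[of k], of "a k"] by (simp add: field_simps a_def)
          then have "(a k)\<^sup>2 \<le> (1 / w 0 * (w k * a k))\<^sup>2" by (intro power_mono) (auto simp: a_def)
          then show "(a k)\<^sup>2 \<le> (1 / w 0)\<^sup>2 * (w k * a k)\<^sup>2" by (simp only: power_mult_distrib)
        qed
        also have "\<dots> \<le> (1 / w 0)\<^sup>2 * (lam Q powr (- (2 / 3)) * \<kappa>)"
          unfolding sum_distrib_left[symmetric] by (intro mult_left_mono wsum) auto
        finally have "sqrt (\<Sum>k<N. (a k)\<^sup>2) \<le> sqrt ((1 / w 0)\<^sup>2 * (lam Q powr (- (2 / 3)) * \<kappa>))" by (rule real_sqrt_le_mono)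
        also have "\<dots> = 1 / w 0 * sqrt (lam Q powr (- (2 / 3)) * \<kappa>)" using wp by (simp add: real_sqrt_mult real_sqrt_divide)
        finally have "sqrt (\<Sum>k<N. (a k)\<^sup>2) \<le> 1 / w 0 * sqrt (lam Q powr (- (2 / 3)) * \<kappa>)" .
        then have "B * sqrt (\<Sum>k<N. (a k)\<^sup>2) \<le> B * (1 / w 0 * sqrt (lam Q powr (- (2 / 3)) * \<kappa>))"
          using B by (intro mult_left_mono) auto
        then show ?thesis using Bp[OF v b3, of N] unfolding a_def by linarith
      qed
    qed
    show "n3 (diff z v) \<le> B * C / \<bar>mass\<bar> * (1 + lam Q * norm z) * lam Q powr (- (1 / 3)) * sqrt \<kappa>" for z
    proof -
      let ?L = "1 + lam Q * norm z"
      have L0: "?L \<ge> 0" by (simp add: less_imp_le)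
      have dv: "Lp 2 (diff z v)" by (rule Lp_2_diff[OF v])
      have comm: "block (int k - 1) (diff z v) = diff z (block (int k - 1) v)" for k :: nat
        by (rule block_diff_commute[OF v]) simp
      have b3': "Lp 3 (block (int k - 1) (diff z v))" for k :: nat
        unfolding comm by (rule Lp_3_diff(1)[OF b3])
      have "n3 (diff z v) \<le> (B * (C * ?L * (lam Q powr (- (1 / 3)) * sqrt \<kappa>))) / \<bar>mass\<bar>"
      proof (rule n3_le_of_partial_sums(2)[OF dv])
        show "Lp 3 (partial_sum N (diff z v))" for N using Bp[OF dv b3'] by blast
        show "n3 (partial_sum N (diff z v)) \<le> B * (C * ?L * (lam Q powr (- (1 / 3)) * sqrt \<kappa>))" for N
        proof -
          have "(\<Sum>k<N. (n3 (block (int k - 1) (diff z v)))\<^sup>2) \<le> (\<Sum>k<N. (C * ?L)\<^sup>2 * (w k * a k)\<^sup>2)"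
          proof (rule sum_mono)
            fix k
            have "n3 (block (int k - 1) (diff z v)) \<le> C * min 1 (lam (int k - 1) * norm z) * a k"
              unfolding comm a_def by (rule Cd[OF v _ b3]) simp
            also have "\<dots> \<le> C * (?L * w k) * a k"
              unfolding w_def using C by (intro mult_right_mono mult_left_mono min_scale_le) (auto simp: a_def)
            finally have "n3 (block (int k - 1) (diff z v)) \<le> (C * ?L) * (w k * a k)" by (simp only: mult.assoc)
            then have "(n3 (block (int k - 1) (diff z v)))\<^sup>2 \<le> ((C * ?L) * (w k * a k))\<^sup>2" by (intro power_mono) auto
            then show "(n3 (block (int k - 1) (diff z v)))\<^sup>2 \<le> (C * ?L)\<^sup>2 * (w k * a k)\<^sup>2" by (simp only: power_mult_distrib)
          qed
          also have "\<dots> \<le> (C * ?L)\<^sup>2 * (lam Q powr (- (2 / 3)) * \<kappa>)"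
            unfolding sum_distrib_left[symmetric] by (intro mult_left_mono wsum) auto
          finally have "sqrt (\<Sum>k<N. (n3 (block (int k - 1) (diff z v)))\<^sup>2) \<le> sqrt ((C * ?L)\<^sup>2 * (lam Q powr (- (2 / 3)) * \<kappa>))"
            by (rule real_sqrt_le_mono)
          also have "\<dots> = \<bar>C * ?L\<bar> * (lam Q powr (- (1 / 3)) * sqrt \<kappa>)"
            by (simp only: real_sqrt_mult[of "(C * ?L)\<^sup>2"] real_sqrt_abs rt)
          also have "\<bar>C * ?L\<bar> = C * ?L" using C L0 by (intro abs_of_nonneg) simp
          finally have "B * sqrt (\<Sum>k<N. (n3 (block (int k - 1) (diff z v)))\<^sup>2) \<le> B * (C * ?L * (lam Q powr (- (1 / 3)) * sqrt \<kappa>))"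
            using B by (intro mult_left_mono) auto
          then show ?thesis using Bp[OF dv b3', of N] by linarith
        qed
      qed
      then show ?thesis by (simp add: mult_ac)
    qed
  qed
qed

end

subsection \<open>The flux in terms of increments\<close>

lemma partial_test_function_dilation:
  assumes "test_function \<rho>" "l > 0"
  shows "partial i (\<lambda>x. \<rho> (x /\<^sub>R l)) y = partial i \<rho> (y /\<^sub>R l) / l"
  using partial_affine(2)[OF test_function_differentiable[OF assms(1)], where a="inverse l" and b=0 and x=y and i=i]
  by (simp add: divide_inverse mult.commute)

context cutoff
begin

text \<open>The kernel is smooth but need not have compact support, so it is multiplied by a dilated
  cutoff before the weak equation is tested. The term with the derivative on the cutoff carries 1/r,
  and dominated convergence leaves only the gradient kernel.\<close>

lemma divergence_free_conv:
  fixes u :: "R3 \<Rightarrow> R3"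
  assumes um: "u \<in> borel_measurable borel" and u2: "integrable lborel (\<lambda>x. (norm (u x))\<^sup>2)"
    and div: "divergence_free u" and \<rho>: "test_function \<rho>"
  shows "(\<Sum>i\<in>UNIV. conv (grad_kernel \<rho> i) (\<lambda>y. u y $ i) x) = 0"
proof -
  note L2 = Lp_2_component[OF um u2]
  note [measurable] = Lp_measurable[OF L2] Lp_measurable[OF Lp_trig_kernel(1)[OF \<rho>, of 1, simplified]]
    Lp_measurable[OF Lp_grad_kernel[OF \<rho>, of 1, simplified]] test_function_measurable[OF test_chi]
    test_function_measurable[OF test_function_partial[OF test_chi]]
  obtain B where B: "B > 0" "\<And>x. \<bar>chi x\<bar> \<le> B" using test_function_bounded[OF test_chi] by metis
  have "\<exists>B'. \<forall>i. B' i > 0 \<and> (\<forall>x. \<bar>partial i chi x\<bar> \<le> B' i)"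
    by (intro choice allI) (metis test_function_bounded[OF test_function_partial[OF test_chi]])
  then obtain B' where B': "\<And>i. B' i > 0" "\<And>i x. \<bar>partial i chi x\<bar> \<le> B' i" by blast
  define r where "r n = real (Suc n)" for n
  have r1: "r n \<ge> 1" for n by (simp add: r_def)
  have r0: "r n > 0" for n by (simp add: r_def)
  have rlim: "(\<lambda>n. inverse (r n)) \<longlonglongrightarrow> 0" unfolding r_def by (rule LIMSEQ_inverse_real_of_nat)
  define \<psi> where "\<psi> n y = chi (y /\<^sub>R r n) * cosk \<rho> (x - y)" for n y
  define s where "s n y = (\<Sum>i\<in>UNIV. u y $ i * (partial i chi (y /\<^sub>R r n) / r n * cosk \<rho> (x - y) - chi (y /\<^sub>R r n) * grad_kernel \<rho> i (x - y)))" for n y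
  have sm: "smooth_fun (\<lambda>y. cosk \<rho> (x - y))"
    using C_k_affine[of _ "cosk \<rho>" "-1" x] smooth_trig_kernel(1)[OF \<rho>] by (simp add: smooth_fun_def)
  have td: "test_function (\<lambda>y. chi (y /\<^sub>R r n))" for n by (rule test_function_dilation[OF test_chi r0])
  have t\<psi>: "test_function (\<psi> n)" for n
    unfolding \<psi>_def[abs_def] by (rule test_function_mult[OF td sm])
  have pk: "partial i (\<lambda>y. cosk \<rho> (x - y)) y = - grad_kernel \<rho> i (x - y)" "(\<lambda>y. cosk \<rho> (x - y)) differentiable (at y)" for i y
    using partial_affine[OF partial_trig_kernel(1)[OF \<rho>], where a="-1" and b=x and x=y] by (simp_all add: partial_cosk[OF \<rho>])
  have p\<psi>: "partial i (\<psi> n) y = partial i chi (y /\<^sub>R r n) / r n * cosk \<rho> (x - y) - chi (y /\<^sub>R r n) * grad_kernel \<rho> i (x - y)" for i n y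
    unfolding \<psi>_def[abs_def]
    by (subst partial_mult[OF test_function_differentiable[OF td] pk(2)])
       (simp add: pk partial_test_function_dilation[OF test_chi r0])
  have zero: "(LINT y|lborel. s n y) = 0" for n
  proof -
    have "(LINT y|lebesgue. (\<Sum>i\<in>UNIV. u y $ i * partial i (\<psi> n) y)) = 0"
      using div t\<psi>[of n] unfolding divergence_free_def by blast
    then have "(LINT y|lebesgue. s n y) = 0" by (simp only: s_def p\<psi>)
    moreover have "s n \<in> borel_measurable borel" unfolding s_def[abs_def] by measurable
    ultimately show ?thesis by (simp add: integral_lebesgue)
  qed
  let ?c = "\<lambda>i y. \<bar>cosk \<rho> (x - y)\<bar> * \<bar>u y $ i\<bar>" and ?g = "\<lambda>i y. \<bar>grad_kernel \<rho> i (x - y)\<bar> * \<bar>u y $ i\<bar>"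
  have "(\<lambda>n. LINT y|lborel. s n y) \<longlonglongrightarrow> (LINT y|lborel. - (\<Sum>i\<in>UNIV. grad_kernel \<rho> i (x - y) * u y $ i))"
  proof (rule integral_dominated_convergence[where w="\<lambda>y. \<Sum>i\<in>UNIV. B' i * ?c i y + B * ?g i y"])
    have "integrable lborel (?c i)" "integrable lborel (?g i)" for i
      using integrable_conv_L2(2)[OF Lp_trig_kernel(1)[OF \<rho>] L2] integrable_conv_L2(2)[OF Lp_grad_kernel[OF \<rho>] L2] by auto
    then show "integrable lborel (\<lambda>y. \<Sum>i\<in>UNIV. B' i * ?c i y + B * ?g i y)" by simp
    show "AE y in lborel. (\<lambda>n. s n y) \<longlonglongrightarrow> - (\<Sum>i\<in>UNIV. grad_kernel \<rho> i (x - y) * u y $ i)"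
    proof (rule AE_I2)
      fix y :: R3
      have y: "(\<lambda>n. y /\<^sub>R r n) \<longlonglongrightarrow> 0"
        using tendsto_scaleR[OF rlim tendsto_const[of y]] by simp
      have "(\<lambda>n. chi (y /\<^sub>R r n)) \<longlonglongrightarrow> chi 0"
        by (intro continuous_on_tendsto_compose[OF test_function_continuous[OF test_chi] y]) auto
      then have c: "(\<lambda>n. chi (y /\<^sub>R r n)) \<longlonglongrightarrow> 1" by simp
      have p: "(\<lambda>n. partial i chi (y /\<^sub>R r n) / r n) \<longlonglongrightarrow> 0" for i
      proof -
        have "(\<lambda>n. partial i chi (y /\<^sub>R r n)) \<longlonglongrightarrow> partial i chi 0"
          by (intro continuous_on_tendsto_compose[OF test_function_continuous[OF test_function_partial[OF test_chi]] y]) auto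
        from tendsto_mult[OF this rlim] show ?thesis by (simp add: divide_inverse)
      qed
      have "(\<lambda>n. s n y) \<longlonglongrightarrow> (\<Sum>i\<in>UNIV. u y $ i * (0 * cosk \<rho> (x - y) - 1 * grad_kernel \<rho> i (x - y)))"
        unfolding s_def by (intro tendsto_intros p c)
      then show "(\<lambda>n. s n y) \<longlonglongrightarrow> - (\<Sum>i\<in>UNIV. grad_kernel \<rho> i (x - y) * u y $ i)"
        by (simp add: sum_negf mult.commute)
    qed
    show "AE y in lborel. norm (s n y) \<le> (\<Sum>i\<in>UNIV. B' i * ?c i y + B * ?g i y)" for n
    proof (rule AE_I2)
      fix y
      show "norm (s n y) \<le> (\<Sum>i\<in>UNIV. B' i * ?c i y + B * ?g i y)"
        unfolding s_def real_norm_def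
      proof (rule order_trans[OF sum_abs sum_mono])
        fix i
        have "\<bar>partial i chi (y /\<^sub>R r n) / r n\<bar> \<le> B' i / 1"
          unfolding abs_divide using B' r1[of n] by (intro frac_le) (auto simp: less_imp_le)
        then have 1: "\<bar>partial i chi (y /\<^sub>R r n) / r n * cosk \<rho> (x - y)\<bar> \<le> B' i * \<bar>cosk \<rho> (x - y)\<bar>"
          unfolding abs_mult by (intro mult_right_mono) auto
        have 2: "\<bar>chi (y /\<^sub>R r n) * grad_kernel \<rho> i (x - y)\<bar> \<le> B * \<bar>grad_kernel \<rho> i (x - y)\<bar>"
          unfolding abs_mult by (intro mult_right_mono B) auto
        have "\<bar>partial i chi (y /\<^sub>R r n) / r n * cosk \<rho> (x - y) - chi (y /\<^sub>R r n) * grad_kernel \<rho> i (x - y)\<bar>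
          \<le> B' i * \<bar>cosk \<rho> (x - y)\<bar> + B * \<bar>grad_kernel \<rho> i (x - y)\<bar>" using 1 2 by linarith
        from mult_left_mono[OF this, of "\<bar>u y $ i\<bar>"]
        show "\<bar>u y $ i * (partial i chi (y /\<^sub>R r n) / r n * cosk \<rho> (x - y) - chi (y /\<^sub>R r n) * grad_kernel \<rho> i (x - y))\<bar> \<le> B' i * ?c i y + B * ?g i y"
          unfolding abs_mult[of "u y $ i"] by (simp only: distrib_left mult_ac)
      qed
    qed
    show "s n \<in> borel_measurable lborel" for n unfolding s_def[abs_def] by measurable
  qed measurable
  then have "(LINT y|lborel. - (\<Sum>i\<in>UNIV. grad_kernel \<rho> i (x - y) * u y $ i)) = 0"
    by (simp add: zero LIMSEQ_const_iff)
  then show ?thesis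
    using integrable_conv_L2(1)[OF Lp_grad_kernel[OF \<rho>] L2]
    by (simp add: conv_def)
qed

text \<open>The Duchon--Robert form of the flux: when the increments are expanded, the pure cubes cancel by
  translation invariance, and the terms \<open>|u(x)|\<^sup>2 u(x - z)\<close> and \<open>|u(x - z)|\<^sup>2 u(x)\<close> drop out by incompressibility.\<close>

lemma trilinear_flux_increments:
  fixes u :: "R3 \<Rightarrow> R3"
  assumes um: "u \<in> borel_measurable borel" and u2: "integrable lborel (\<lambda>x. (norm (u x))\<^sup>2)"
    and div: "divergence_free u" and \<rho>: "test_function \<rho>" and u3: "\<And>j. Lp 3 (\<lambda>x. u x $ j)"
  shows "4 * trilinear_flux \<rho> u = (\<Sum>i\<in>UNIV. \<Sum>j\<in>UNIV. LINT z|lborel. grad_kernel \<rho> i z *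
      (LINT x|lborel. (diff z (\<lambda>x. u x $ j) x)\<^sup>2 * diff z (\<lambda>x. u x $ i) x))"
proof -
  let ?g = "grad_kernel \<rho>"
  define E where "E a b c z = (LINT x|lborel. u x $ a * u x $ b * u (x - z) $ c)" for a b c z
  note L1 = Lp_grad_kernel[OF \<rho> one_neq_zero]
  have iE: "integrable lborel (\<lambda>x. u x $ a * u x $ b * u (x - z) $ c)" for a b c z
    by (rule trilinear_swap(3)[OF u3 u3 u3 L1])
  have igE: "integrable lborel (\<lambda>z. ?g i z * E a b c z)" for i a b c
    unfolding E_def by (rule trilinear_swap(2)[OF u3 u3 u3 L1])
  have sE: "(LINT z|lborel. ?g i z * E a b c z) = (LINT x|lborel. u x $ a * u x $ b * conv (?g i) (\<lambda>x. u x $ c) x)" for i a b c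
    unfolding E_def by (rule trilinear_swap(1)[OF u3 u3 u3 L1, symmetric])
  have igE': "integrable lborel (\<lambda>z. ?g i z * E a b c (- z))" for i a b c
    using igE[of i a b c] integrable_translate_iff(4)[of "\<lambda>z. ?g i z * E a b c z"] by (simp add: grad_kernel_minus)
  \<comment> \<open>The kernel is odd, so reflected integrals change sign; this doubles the
    coefficients 1 and 2 of the expansion to 2 and 4.\<close>
  have sE': "(LINT z|lborel. ?g i z * E a b c (- z)) = - (LINT z|lborel. ?g i z * E a b c z)" for i a b c
    using integral_translate(4)[of "\<lambda>z. ?g i z * E a b c z"] by (simp add: grad_kernel_minus)
  have mirror: "(LINT x|lborel. u (x - z) $ a * u (x - z) $ b * u x $ c) = E a b c (- z)"
    "integrable lborel (\<lambda>x. u (x - z) $ a * u (x - z) $ b * u x $ c)" for a b c z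
    using integral_translate(2)[of "\<lambda>x. u x $ a * u x $ b * u (x + z) $ c" z]
      integrable_translate_iff(2)[of "\<lambda>x. u x $ a * u x $ b * u (x + z) $ c" z] iE[of a b "- z" c]
    by (simp_all add: E_def)
  have inc: "(LINT x|lborel. (diff z (\<lambda>x. u x $ j) x)\<^sup>2 * diff z (\<lambda>x. u x $ i) x) =
     E j j i z - E j j i (- z) + 2 * E i j j z - 2 * E i j j (- z)" for i j z
  proof -
    let ?t1 = "\<lambda>x. u (x - z) $ j * u (x - z) $ j * u (x - z) $ i" and ?t2 = "\<lambda>x. u x $ j * u x $ j * u x $ i"
    let ?t3 = "\<lambda>x. u x $ j * u x $ j * u (x - z) $ i" and ?t4 = "\<lambda>x. u (x - z) $ j * u (x - z) $ j * u x $ i"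
    let ?t5 = "\<lambda>x. u x $ i * u x $ j * u (x - z) $ j" and ?t6 = "\<lambda>x. u (x - z) $ i * u (x - z) $ j * u x $ j"
    have i2: "integrable lborel ?t2" using iE[of j j 0 i] by simp
    then have i1: "integrable lborel ?t1" and e1: "(LINT x|lborel. ?t1 x) = (LINT x|lborel. ?t2 x)"
      using integrable_translate_iff(2)[of ?t2 z] integral_translate(2)[of ?t2 z] by auto
    have "(LINT x|lborel. (diff z (\<lambda>x. u x $ j) x)\<^sup>2 * diff z (\<lambda>x. u x $ i) x) =
      (LINT x|lborel. ((((?t1 x - ?t2 x) + ?t3 x) - ?t4 x) + 2 * ?t5 x) - 2 * ?t6 x)"
      by (intro Bochner_Integration.integral_cong refl) (simp add: diff_def power2_eq_square algebra_simps)
    also have "\<dots> = E j j i z - E j j i (- z) + 2 * E i j j z - 2 * E i j j (- z)"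
      using i1 i2 e1 iE[of j j z i] iE[of i j z j] mirror[of z j j i] mirror[of z i j j] by (simp add: E_def[symmetric])
    finally show ?thesis .
  qed
  have "(LINT z|lborel. ?g i z * (LINT x|lborel. (diff z (\<lambda>x. u x $ j) x)\<^sup>2 * diff z (\<lambda>x. u x $ i) x)) =
    2 * (LINT x|lborel. u x $ j * u x $ j * conv (?g i) (\<lambda>x. u x $ i) x) +
    4 * (LINT x|lborel. u x $ i * u x $ j * conv (?g i) (\<lambda>x. u x $ j) x)" for i j
  proof -
    have "(LINT z|lborel. ?g i z * (LINT x|lborel. (diff z (\<lambda>x. u x $ j) x)\<^sup>2 * diff z (\<lambda>x. u x $ i) x)) =
      (LINT z|lborel. ((?g i z * E j j i z - ?g i z * E j j i (- z)) + 2 * (?g i z * E i j j z)) - 2 * (?g i z * E i j j (- z)))"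
      unfolding inc by (intro Bochner_Integration.integral_cong refl) (simp add: algebra_simps)
    also have "\<dots> = 2 * (LINT z|lborel. ?g i z * E j j i z) + 4 * (LINT z|lborel. ?g i z * E i j j z)"
      using igE igE' by (simp add: sE')
    finally show ?thesis by (simp add: sE)
  qed
  then have "(\<Sum>i\<in>UNIV. \<Sum>j\<in>UNIV. LINT z|lborel. ?g i z * (LINT x|lborel. (diff z (\<lambda>x. u x $ j) x)\<^sup>2 * diff z (\<lambda>x. u x $ i) x)) =
    2 * (\<Sum>i\<in>UNIV. \<Sum>j\<in>UNIV. LINT x|lborel. u x $ j * u x $ j * conv (?g i) (\<lambda>x. u x $ i) x) + 4 * trilinear_flux \<rho> u"
    by (simp add: trilinear_flux_def sum.distrib sum_distrib_left)
  also have "(\<Sum>i\<in>UNIV. \<Sum>j\<in>UNIV. LINT x|lborel. u x $ j * u x $ j * conv (?g i) (\<lambda>x. u x $ i) x) =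
    (\<Sum>j\<in>UNIV. \<Sum>i\<in>UNIV. LINT x|lborel. u x $ j * u x $ j * conv (?g i) (\<lambda>x. u x $ i) x)"
    by (rule sum.swap)
  also have "\<dots> = (\<Sum>j\<in>UNIV. LINT x|lborel. (\<Sum>i\<in>UNIV. u x $ j * u x $ j * conv (?g i) (\<lambda>x. u x $ i) x))"
  proof (intro sum.cong refl Bochner_Integration.integral_sum[symmetric])
    fix i j :: 3
    let ?B = "(LINT y|lborel. (?g i y)\<^sup>2) + (LINT y|lborel. (u y $ i)\<^sup>2)"
    show "integrable lborel (\<lambda>x. u x $ j * u x $ j * conv (?g i) (\<lambda>x. u x $ i) x)"
    proof (rule integrable_mult_bounded(1)[where B="?B"])
      show "integrable lborel (\<lambda>x. u x $ j * u x $ j)" using Lp_1_products[OF um u2] Lp_1 by simp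
      show "conv (?g i) (\<lambda>x. u x $ i) \<in> borel_measurable lborel"
        using Lp_measurable[OF L1] Lp_measurable[OF u3] by simp
      show "norm (conv (?g i) (\<lambda>x. u x $ i) x) \<le> ?B" for x
        using integrable_conv_L2(3)[OF Lp_grad_kernel[OF \<rho>] Lp_2_component[OF um u2]] by simp
    qed
  qed
  also have "\<dots> = 0"
    by (simp only: sum_distrib_left[symmetric] divergence_free_conv[OF um u2 div \<rho>]) simp
  finally show ?thesis by simp
qed

lemma integrable_grad_kernel_weighted:
  assumes "test_function \<rho>"
  shows "integrable lborel (\<lambda>z. \<bar>grad_kernel \<rho> i z\<bar> * (1 + norm z) ^ n)"
  using integrable_trig_kernel_weighted(2)[OF test_function_coord[OF assms]] by (simp add: grad_kernel_def)

text \<open>Hoelder bounds the inner integral by (D (1 + l |z|))^3, a polynomial weight that the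
  decay of the gradient kernel absorbs. The power of l is 4 from scaling this kernel minus 3 from
  the change of variables.\<close>

lemma trilinear_flux_bound:
  assumes \<rho>: "test_function \<rho>"
  shows "\<exists>C>0. \<forall>u l D. u \<in> borel_measurable borel \<longrightarrow> integrable lborel (\<lambda>x. (norm (u x))\<^sup>2) \<longrightarrow> divergence_free u \<longrightarrow>
    (\<forall>j. Lp 3 (\<lambda>x. u x $ j)) \<longrightarrow> 0 < l \<longrightarrow> (\<forall>j z. n3 (diff z (\<lambda>x. u x $ j)) \<le> D * (1 + l * norm z)) \<longrightarrow>
    \<bar>trilinear_flux (\<lambda>\<xi>. \<rho> (\<xi> /\<^sub>R l)) u\<bar> \<le> C * (l * D ^ 3)"
proof -
  define W where "W i = (LINT z|lborel. \<bar>grad_kernel \<rho> i z\<bar> * (1 + norm z) ^ 3)" for i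
  have W0: "W i \<ge> 0" for i unfolding W_def by simp
  let ?C = "(\<Sum>i\<in>UNIV. \<Sum>j\<in>(UNIV :: 3 set). W i) + 1"
  show ?thesis
  proof (intro exI[of _ ?C] conjI allI impI)
    show "?C > 0" using W0 by (intro add_nonneg_pos sum_nonneg) auto
    fix u :: "R3 \<Rightarrow> R3" and l D :: real
    assume um: "u \<in> borel_measurable borel" and u2: "integrable lborel (\<lambda>x. (norm (u x))\<^sup>2)" and div: "divergence_free u"
      and u3: "\<forall>j. Lp 3 (\<lambda>x. u x $ j)" and l: "0 < l" and D: "\<forall>j z. n3 (diff z (\<lambda>x. u x $ j)) \<le> D * (1 + l * norm z)"
    have "n3 (diff 0 (\<lambda>x. u x $ 1)) \<le> D" using D[THEN spec, THEN spec, of 0 1] by simp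
    then have D0: "D \<ge> 0" using n3_nonneg order_trans by blast
    let ?\<rho> = "\<lambda>\<xi>. \<rho> (\<xi> /\<^sub>R l)"
    have t: "test_function ?\<rho>" by (rule test_function_dilation[OF \<rho> l])
    note [measurable] = Lp_measurable[OF Lp_grad_kernel[OF t, of 1, simplified]] Lp_measurable[OF u3[rule_format]]
    let ?I = "\<lambda>i j z. LINT x|lborel. (diff z (\<lambda>x. u x $ j) x)\<^sup>2 * diff z (\<lambda>x. u x $ i) x"
    have I: "\<bar>?I i j z\<bar> \<le> (D * (1 + l * norm z)) ^ 3" for i j z
    proof -
      let ?a = "diff z (\<lambda>x. u x $ j)" and ?b = "diff z (\<lambda>x. u x $ i)"
      note L = Lp_3_diff(1)[OF u3[rule_format]]
      have "\<bar>?I i j z\<bar> \<le> (LINT x|lborel. \<bar>(?a x)\<^sup>2 * ?b x\<bar>)" by (rule integral_abs_bound)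
      also have "\<dots> = (LINT x|lborel. \<bar>?a x\<bar> * \<bar>?a x\<bar> * \<bar>?b x\<bar>)" by (simp add: abs_mult power2_eq_square)
      also have "\<dots> \<le> n3 ?a * n3 ?a * n3 ?b" by (rule hoelder3(2)[OF L L L])
      also have "\<dots> \<le> (D * (1 + l * norm z)) * (D * (1 + l * norm z)) * (D * (1 + l * norm z))"
        using D D0 l by (intro mult_mono mult_nonneg_nonneg) auto
      finally show ?thesis by (simp add: power3_eq_cube)
    qed
    have g: "\<bar>grad_kernel ?\<rho> i z\<bar> * (D * (1 + l * norm z)) ^ 3 = (D ^ 3 * l ^ 4) * (\<bar>grad_kernel \<rho> i (0 + l *\<^sub>R z)\<bar> * (1 + norm (0 + l *\<^sub>R z)) ^ 3)" for i z
      using l by (simp add: grad_kernel_scale abs_mult power_mult_distrib)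
    have iw: "integrable lborel (\<lambda>z. \<bar>grad_kernel ?\<rho> i z\<bar> * (D * (1 + l * norm z)) ^ 3)" for i
      unfolding g using integrable_affine3[OF integrable_grad_kernel_weighted[OF \<rho>, of i 3], of l 0] l
      by (intro integrable_mult_right) auto
    have ew: "(LINT z|lborel. \<bar>grad_kernel ?\<rho> i z\<bar> * (D * (1 + l * norm z)) ^ 3) = l * D ^ 3 * W i" for i
    proof -
      have "W i = l ^ 3 * (LINT z|lborel. \<bar>grad_kernel \<rho> i (0 + l *\<^sub>R z)\<bar> * (1 + norm (0 + l *\<^sub>R z)) ^ 3)"
        unfolding W_def using l integral_affine3[of l "\<lambda>z. \<bar>grad_kernel \<rho> i z\<bar> * (1 + norm z) ^ 3" 0] by simp
      moreover have "l ^ 4 = l * l ^ 3" by (simp add: power_numeral_reduce)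
      ultimately show ?thesis unfolding g integral_mult_right_zero by (simp only: mult_ac)
    qed
    have term_le: "\<bar>LINT z|lborel. grad_kernel ?\<rho> i z * ?I i j z\<bar> \<le> l * D ^ 3 * W i" for i j
    proof -
      have le: "norm (grad_kernel ?\<rho> i z * ?I i j z) \<le> \<bar>grad_kernel ?\<rho> i z\<bar> * (D * (1 + l * norm z)) ^ 3" for z
        unfolding real_norm_def abs_mult by (intro mult_left_mono I) auto
      have "integrable lborel (\<lambda>z. grad_kernel ?\<rho> i z * ?I i j z)"
      proof (rule Bochner_Integration.integrable_bound[OF iw])
        show "AE z in lborel. norm (grad_kernel ?\<rho> i z * ?I i j z) \<le> norm (\<bar>grad_kernel ?\<rho> i z\<bar> * (D * (1 + l * norm z)) ^ 3)"
          by (intro AE_I2 order_trans[OF le]) (simp only: real_norm_def abs_ge_self)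
        show "(\<lambda>z. grad_kernel ?\<rho> i z * ?I i j z) \<in> borel_measurable lborel"
          unfolding diff_def by measurable
      qed
      from norm_integral_le[OF this iw le] show ?thesis by (simp only: ew real_norm_def)
    qed
    have "4 * \<bar>trilinear_flux ?\<rho> u\<bar> = \<bar>\<Sum>i\<in>UNIV. \<Sum>j\<in>UNIV. LINT z|lborel. grad_kernel ?\<rho> i z * ?I i j z\<bar>"
      using trilinear_flux_increments[OF um u2 div t u3[rule_format]] by (simp add: abs_mult[symmetric])
    also have "\<dots> \<le> (\<Sum>i\<in>UNIV. \<Sum>j\<in>(UNIV :: 3 set). l * D ^ 3 * W i)"
      by (intro order_trans[OF sum_abs sum_mono] term_le)
    also have "\<dots> = (\<Sum>i\<in>UNIV. \<Sum>j\<in>(UNIV :: 3 set). W i) * (l * D ^ 3)"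
      by (simp add: sum_distrib_left sum_distrib_right mult_ac)
    also have "\<dots> \<le> ?C * (l * D ^ 3)" using l D0 by (intro mult_right_mono) auto
    finally show "\<bar>trilinear_flux ?\<rho> u\<bar> \<le> ?C * (l * D ^ 3)" using abs_ge_zero[of "trilinear_flux ?\<rho> u"] by linarith
  qed
qed

end

subsection \<open>The estimate\<close>

text \<open>The flux estimates are proved for Borel fields; a field that is only Lebesgue measurable
  is first altered on a null set.\<close>

lemma borel_modification:
  fixes u :: "R3 \<Rightarrow> R3"
  assumes "u \<in> borel_measurable lebesgue"
  obtains u' where "u' \<in> borel_measurable borel" "AE x in lebesgue. u x = u' x"
proof -
  have "\<exists>g \<in> borel_measurable lborel. AE x in lborel. u x $ j = g x" for j
    using measurable_compose[OF assms, of "\<lambda>v. v $ j" borel]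
    by (intro completion_ex_borel_measurable_real) (auto intro!: borel_measurable_continuous_onI continuous_intros)
  then obtain g where g: "\<And>j. g j \<in> borel_measurable lborel" "\<And>j. AE x in lborel. u x $ j = g j x" by metis
  have "(\<lambda>x. \<chi> j. g j x) \<in> borel_measurable borel"
  proof (subst borel_measurable_euclidean_space, rule ballI)
    fix b :: R3 assume "b \<in> Basis"
    then obtain i where "b = axis i 1" by (auto simp: Basis_vec_def)
    then show "(\<lambda>x. (\<chi> j. g j x) \<bullet> b) \<in> borel_measurable borel" using g(1)[of i] by (simp add: inner_axis)
  qed
  moreover have "AE x in lborel. \<forall>j. u x $ j = g j x" using g(2) by (simp add: AE_all_countable)
  then have "AE x in lborel. u x = (\<chi> j. g j x)" by eventually_elim (simp add: vec_eq_iff)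
  then have "AE x in lebesgue. u x = (\<chi> j. g j x)" by (rule AE_completion)
  ultimately show ?thesis using that by blast
qed

text \<open>Equality holds at every point: outside L1 both transforms are chosen by the same
  predicate, because \<open>is_fourier_L2\<close> sees the function only through integrals.\<close>

lemma fourier_cong_AE:
  assumes f: "f \<in> borel_measurable lebesgue" and g: "g \<in> borel_measurable lebesgue" and ae: "AE x in lebesgue. f x = g x"
  shows "fourier f = fourier g"
proof -
  have L1: "fourier_L1 (\<lambda>x. h x * f x) = fourier_L1 (\<lambda>x. h x * g x)" if h: "h \<in> borel_measurable lebesgue" for h
  proof
    fix \<xi>
    have [measurable]: "(\<lambda>x::R3. cis (- (\<xi> \<bullet> x))) \<in> borel_measurable lebesgue"
      by (rule borel_measurable_lebesgueI) measurable
    note [measurable] = f g h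
    show "fourier_L1 (\<lambda>x. h x * f x) \<xi> = fourier_L1 (\<lambda>x. h x * g x) \<xi>"
      unfolding fourier_L1_def by (rule integral_cong_AE) (use ae in auto)
  qed
  have "integrable lebesgue f \<longleftrightarrow> integrable lebesgue g" by (rule integrable_cong_AE[OF f g ae])
  moreover have "fourier_L1 f = fourier_L1 g" using L1[of "\<lambda>_. 1"] by simp
  moreover have "(\<lambda>x::R3. indicator (cball 0 R) x :: complex) \<in> borel_measurable lebesgue" for R :: real
    by (rule borel_measurable_lebesgueI) (simp add: borel_measurable_indicator)
  then have "is_fourier_L2 f = is_fourier_L2 g"
    unfolding is_fourier_L2_def[abs_def] using L1 by simp
  ultimately show ?thesis by (simp add: fourier_def)
qed

lemma energy_flux_cong_AE:
  assumes u: "u \<in> borel_measurable lebesgue" and v: "v \<in> borel_measurable lebesgue" and ae: "AE x in lebesgue. u x = v x"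
  shows "energy_flux chi u Q\<^sub>0 Q\<^sub>1 = energy_flux chi v Q\<^sub>0 Q\<^sub>1" "K_conv_d2 chi u Q = K_conv_d2 chi v Q"
proof -
  have m: "component w j \<in> borel_measurable lebesgue" if "w \<in> borel_measurable lebesgue" for w j
    using measurable_compose[OF that, of "\<lambda>v. complex_of_real (v $ j)" borel]
    by (simp add: component_def[abs_def] borel_measurable_continuous_onI continuous_intros)
  have 1: "fourier (component u j) = fourier (component v j)" for j
    by (rule fourier_cong_AE[OF m[OF u] m[OF v]]) (use ae in eventually_elim, simp add: component_def)
  have 2: "fourier (\<lambda>y. component u i y * component u j y) = fourier (\<lambda>y. component v i y * component v j y)" for i j
    by (rule fourier_cong_AE[OF borel_measurable_times[OF m[OF u] m[OF u]] borel_measurable_times[OF m[OF v] m[OF v]]])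
      (use ae in eventually_elim, simp add: component_def)
  have B: "LP_block chi q f = LP_block chi q g" if "fourier f = fourier g" for q f g
    using that by (simp add: LP_block_def[abs_def])
  have S: "LP_sum chi Q\<^sub>0 Q\<^sub>1 f = LP_sum chi Q\<^sub>0 Q\<^sub>1 g" if "fourier f = fourier g" for f g
    using B[OF that] by (simp add: LP_sum_def[abs_def])
  show "energy_flux chi u Q\<^sub>0 Q\<^sub>1 = energy_flux chi v Q\<^sub>0 Q\<^sub>1"
    by (simp only: energy_flux_def S[OF 1] S[OF 2])
  have "LP_block_vec chi q u = LP_block_vec chi q v" for q
    by (simp add: LP_block_vec_def[abs_def] B[OF 1])
  then show "K_conv_d2 chi u Q = K_conv_d2 chi v Q" by (simp add: K_conv_d2_def d_coeff_def)
qed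

lemma ennreal_powr_less_top: "ennreal_powr I a < \<infinity> \<Longrightarrow> I < \<infinity>"
  by (auto simp: ennreal_powr_def less_top[symmetric] split: if_splits)

lemma K_kernel_pos: "0 < K_kernel q"
  by (simp add: K_kernel_def)

section \<open>From the coefficients d_q to the flux\<close>

context cutoff
begin

text \<open>A component is dominated by the vector; finiteness allows the extended-real powers in
  \<open>Lp_norm\<close> to be computed as real ones.\<close>

lemma d_coeff_bound:
  fixes u :: "R3 \<Rightarrow> R3"
  assumes um: "u \<in> borel_measurable borel" and u2: "integrable lborel (\<lambda>x. (norm (u x))\<^sup>2)"
    and q: "- 1 \<le> q" and fin: "d_coeff chi u q < \<infinity>"
  shows "Lp 3 (block q (\<lambda>x. u x $ j))"
    "ennreal (lam q powr (2 / 3) * (n3 (block q (\<lambda>x. u x $ j)))\<^sup>2) \<le> (d_coeff chi u q)\<^sup>2"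
proof -
  let ?I = "\<integral>\<^sup>+x. ennreal (norm (LP_block_vec chi q u x) powr 3) \<partial>lebesgue"
  let ?b = "block q (\<lambda>x. u x $ j)"
  note v = Lp_2_component[OF um u2]
  have L: "L1_or_L2 (\<lambda>x. u x $ j)" for j using v by (simp add: L1_or_L2_def)
  have "LP_block_vec chi q u x $ j = complex_of_real (?b x)" for x
    using LP_block_eq_conv[OF q L, of j x] by (simp add: LP_block_vec_def component_def[abs_def] block_def)
  then have le: "\<bar>?b x\<bar> ^ 3 \<le> norm (LP_block_vec chi q u x) powr 3" for x
    using component_le_norm_cart power_mono[OF Finite_Cartesian_Product.norm_nth_le[of "LP_block_vec chi q u x" j] norm_ge_zero, of 3]
    by (simp add: powr_numeral)
  have "Lp_norm 3 (LP_block_vec chi q u) < \<infinity>"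
    using fin by (auto simp: d_coeff_def ennreal_mult_less_top less_top[symmetric] ennreal_mult_eq_top_iff)
  then have Ifin: "?I < \<infinity>" unfolding Lp_norm_def by (rule ennreal_powr_less_top)
  define I where "I = enn2real ?I"
  have I: "?I = ennreal I" using Ifin by (simp add: I_def)
  have I0: "I \<ge> 0" by (simp add: I_def)
  have N: "Lp_norm 3 (LP_block_vec chi q u) = ennreal (I powr (1 / 3))"
    unfolding Lp_norm_def ennreal_powr_def using Ifin by (simp add: I_def less_top)
  have cube: "(I powr (1 / 3)) ^ 3 = I" using I0 by (simp add: powr_numeral[symmetric] powr_powr del: powr_numeral)
  have "(\<integral>\<^sup>+x. ennreal (\<bar>?b x\<bar> ^ 3) \<partial>lborel) \<le> (\<integral>\<^sup>+x. ennreal (norm (LP_block_vec chi q u x) powr 3) \<partial>lborel)"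
    by (intro nn_integral_mono ennreal_leI le)
  also have "\<dots> = ennreal ((I powr (1 / 3)) ^ 3)" using I by (simp add: nn_integral_completion cube)
  finally have bound: "(\<integral>\<^sup>+x. ennreal (\<bar>?b x\<bar> ^ 3) \<partial>lborel) \<le> ennreal ((I powr (1 / 3)) ^ 3)" .
  note n = n3_leI_nn[OF block_measurable[OF v q] bound]
  show "Lp 3 ?b" by (rule n(1)) simp
  have "(n3 ?b)\<^sup>2 \<le> (I powr (1 / 3))\<^sup>2" by (intro power_mono n(2)) auto
  then have "lam q powr (2 / 3) * (n3 ?b)\<^sup>2 \<le> (lam q powr (1 / 3) * I powr (1 / 3))\<^sup>2"
    by (simp add: power_mult_distrib powr_power mult_left_mono)
  then have "ennreal (lam q powr (2 / 3) * (n3 ?b)\<^sup>2) \<le> ennreal ((lam q powr (1 / 3) * I powr (1 / 3))\<^sup>2)" by (rule ennreal_leI)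
  also have "\<dots> = (d_coeff chi u q)\<^sup>2"
    unfolding d_coeff_def N by (simp add: ennreal_mult[symmetric] ennreal_power)
  finally show "ennreal (lam q powr (2 / 3) * (n3 ?b)\<^sup>2) \<le> (d_coeff chi u q)\<^sup>2" .
qed

text \<open>All terms are nonnegative, so finite partial sums stay below \<kappa>; positivity of
  \<open>K_kernel\<close> makes every single \<open>d_coeff\<close> finite.\<close>

lemma K_conv_d2_bound:
  fixes u :: "R3 \<Rightarrow> R3"
  assumes um: "u \<in> borel_measurable borel" and u2: "integrable lborel (\<lambda>x. (norm (u x))\<^sup>2)"
    and fin: "K_conv_d2 chi u Q = ennreal \<kappa>" "0 \<le> \<kappa>"
  shows "- 1 \<le> q \<Longrightarrow> Lp 3 (block q (\<lambda>x. u x $ j))"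
    "(\<Sum>k<N. K_kernel (Q - (int k - 1)) * (lam (int k - 1) powr (2 / 3) * (n3 (block (int k - 1) (\<lambda>x. u x $ j)))\<^sup>2)) \<le> \<kappa>"
proof -
  let ?t = "\<lambda>q. ennreal (K_kernel (Q - q)) * (d_coeff chi u q)\<^sup>2"
  have S: "sum ?t F \<le> ennreal \<kappa>" if "finite F" "F \<subseteq> {-1..}" for F
    unfolding fin(1)[symmetric] K_conv_d2_def using that
    by (subst nonneg_infsum_complete) (auto intro!: SUP_upper)
  have dfin: "d_coeff chi u q < \<infinity>" if "- 1 \<le> q" for q
  proof -
    have "?t q < \<infinity>" using S[of "{q}"] that by (auto intro: order_le_less_trans ennreal_less_top)
    then show ?thesis using K_kernel_pos[of "Q - q"]
      by (cases "d_coeff chi u q = \<infinity>") (auto simp: ennreal_mult_eq_top_iff less_top power2_eq_square)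
  qed
  note d = d_coeff_bound[OF um u2 _ dfin]
  show "- 1 \<le> q \<Longrightarrow> Lp 3 (block q (\<lambda>x. u x $ j))" by (rule d(1))
  let ?a = "\<lambda>q. lam q powr (2 / 3) * (n3 (block q (\<lambda>x. u x $ j)))\<^sup>2"
  have "ennreal (\<Sum>k<N. K_kernel (Q - (int k - 1)) * ?a (int k - 1)) = (\<Sum>k<N. ennreal (K_kernel (Q - (int k - 1))) * ennreal (?a (int k - 1)))"
    by (simp add: sum_ennreal[symmetric] ennreal_mult less_imp_le[OF K_kernel_pos] del: sum_ennreal)
  also have "\<dots> \<le> (\<Sum>k<N. ?t (int k - 1))"
    by (intro sum_mono mult_left_mono d(2)) auto
  also have "\<dots> = sum ?t ((\<lambda>k. int k - 1) ` {..<N})"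
    by (subst sum.reindex) (auto simp: inj_on_def)
  also have "\<dots> \<le> ennreal \<kappa>" by (rule S) auto
  finally show "(\<Sum>k<N. K_kernel (Q - (int k - 1)) * ?a (int k - 1)) \<le> \<kappa>"
    using fin(2) by (simp add: ennreal_le_iff)
qed

text \<open>The parameter c separates the scale of the symbol from that of the increments: the upper
  cutoff of the flux lives at 2 \<lambda>_Q, the lower one at \<lambda>_Q. Each of the three
  increments brings \<lambda>_Q^(-1/3), which cancels the factor \<lambda>_Q of the kernel.\<close>

lemma trilinear_flux_K_bound:
  assumes \<rho>: "test_function \<rho>" and c: "c > 0"
  shows "\<exists>C>0. \<forall>u Q \<kappa>. u \<in> borel_measurable borel \<longrightarrow> integrable lborel (\<lambda>x. (norm (u x))\<^sup>2) \<longrightarrow> divergence_free u \<longrightarrow>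
    K_conv_d2 chi u Q = ennreal \<kappa> \<longrightarrow> 0 \<le> \<kappa> \<longrightarrow>
    \<bar>trilinear_flux (\<lambda>\<xi>. \<rho> (\<xi> /\<^sub>R (c * lam Q))) u\<bar> \<le> C * \<kappa> powr (3 / 2)"
proof -
  obtain B where B: "B > 0" and Bs: "\<And>v Q \<kappa>. Lp 2 v \<Longrightarrow> 0 \<le> \<kappa> \<Longrightarrow> (\<And>q. -1 \<le> q \<Longrightarrow> Lp 3 (block q v)) \<Longrightarrow>
    (\<And>N::nat. (\<Sum>k<N. K_kernel (Q - (int k - 1)) * (lam (int k - 1) powr (2 / 3) * (n3 (block (int k - 1) v))\<^sup>2)) \<le> \<kappa>) \<Longrightarrow>
    Lp 3 v \<and> (\<forall>z. n3 (diff z v) \<le> B * (1 + lam Q * norm z) * lam Q powr (- (1 / 3)) * sqrt \<kappa>)"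
    using shift_estimate by blast
  obtain C where C: "C > 0" and Cb: "\<And>u l D. u \<in> borel_measurable borel \<Longrightarrow> integrable lborel (\<lambda>x. (norm (u x))\<^sup>2) \<Longrightarrow> divergence_free u \<Longrightarrow>
    (\<And>j. Lp 3 (\<lambda>x. u x $ j)) \<Longrightarrow> 0 < l \<Longrightarrow> (\<And>j z. n3 (diff z (\<lambda>x. u x $ j)) \<le> D * (1 + l * norm z)) \<Longrightarrow>
    \<bar>trilinear_flux (\<lambda>\<xi>. \<rho> (\<xi> /\<^sub>R l)) u\<bar> \<le> C * (l * D ^ 3)"
    using trilinear_flux_bound[OF \<rho>] by blast
  \<comment> \<open>Large enough that 1 + \<lambda>_Q |z| \<le> m (1 + c \<lambda>_Q |z|) for every
    z.\<close>
  define m where "m = max 1 (1 / c)"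
  have m: "m \<ge> 1" "m * c \<ge> 1" unfolding m_def using c by (auto simp: max_def field_simps)
  show ?thesis
  proof (intro exI[of _ "C * c * (B * m) ^ 3"] conjI allI impI)
    show "C * c * (B * m) ^ 3 > 0" using C c B m by simp
    fix u :: "R3 \<Rightarrow> R3" and Q :: int and \<kappa> :: real
    assume um: "u \<in> borel_measurable borel" and u2: "integrable lborel (\<lambda>x. (norm (u x))\<^sup>2)" and div: "divergence_free u"
      and K: "K_conv_d2 chi u Q = ennreal \<kappa>" "0 \<le> \<kappa>"
    note s = Bs[OF Lp_2_component[OF um u2] K(2) K_conv_d2_bound[OF um u2 K]]
    let ?D = "B * m * (lam Q powr (- (1 / 3)) * sqrt \<kappa>)"
    have "\<bar>trilinear_flux (\<lambda>\<xi>. \<rho> (\<xi> /\<^sub>R (c * lam Q))) u\<bar> \<le> C * (c * lam Q * ?D ^ 3)"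
    proof (rule Cb[OF um u2 div])
      show "Lp 3 (\<lambda>x. u x $ j)" for j using s by blast
      show "0 < c * lam Q" using c by simp
      fix j :: 3 and z :: R3
      have "1 + lam Q * norm z \<le> m * (1 + c * lam Q * norm z)"
      proof -
        have "1 * (lam Q * norm z) \<le> (m * c) * (lam Q * norm z)"
          using m by (intro mult_right_mono mult_nonneg_nonneg less_imp_le[OF lam_pos]) auto
        moreover have "m * (1 + c * lam Q * norm z) = m + (m * c) * (lam Q * norm z)"
          by (simp add: algebra_simps)
        ultimately show ?thesis using m(1) by linarith
      qed
      then have "B * (1 + lam Q * norm z) * (lam Q powr (- (1 / 3)) * sqrt \<kappa>) \<le> B * (m * (1 + c * lam Q * norm z)) * (lam Q powr (- (1 / 3)) * sqrt \<kappa>)"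
        using B K(2) by (intro mult_right_mono mult_left_mono) auto
      moreover have "n3 (diff z (\<lambda>x. u x $ j)) \<le> B * (1 + lam Q * norm z) * (lam Q powr (- (1 / 3)) * sqrt \<kappa>)"
        using s[of j] by (simp add: mult.assoc)
      ultimately show "n3 (diff z (\<lambda>x. u x $ j)) \<le> ?D * (1 + c * lam Q * norm z)" by (simp only: mult_ac)
    qed
    also have "\<dots> = C * c * (B * m) ^ 3 * ((lam Q * (lam Q powr (- (1 / 3))) ^ 3) * (sqrt \<kappa>) ^ 3)"
      by (simp only: power_mult_distrib mult_ac)
    also have "(lam Q powr (- (1 / 3))) ^ 3 = 1 / lam Q"
    proof -
      have "(lam Q powr (- (1 / 3))) ^ 3 = (lam Q powr (- (1 / 3))) powr 3" by (rule powr_numeral[symmetric]) simp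
      also have "\<dots> = lam Q powr (- 1)" unfolding powr_powr by simp
      also have "\<dots> = 1 / lam Q" by (simp add: powr_minus_divide abs_of_pos)
      finally show ?thesis .
    qed
    also have "(sqrt \<kappa>) ^ 3 = \<kappa> powr (3 / 2)"
    proof -
      have "(sqrt \<kappa>) ^ 3 = (\<kappa> powr (1 / 2)) powr 3"
        using K(2) by (subst powr_numeral) (auto simp: powr_half_sqrt)
      also have "\<dots> = \<kappa> powr (3 / 2)" unfolding powr_powr by simp
      finally show ?thesis .
    qed
    finally show "\<bar>trilinear_flux (\<lambda>\<xi>. \<rho> (\<xi> /\<^sub>R (c * lam Q))) u\<bar> \<le> C * c * (B * m) ^ 3 * \<kappa> powr (3 / 2)" by simp
  qed
qed

lemma trilinear_flux_zero: "trilinear_flux (\<lambda>\<xi>. 0) u = 0"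
  by (simp add: trilinear_flux_def grad_kernel_def sink_def conv_def)

lemma energy_flux_bound:
  "\<exists>C>0. \<forall>u Q\<^sub>0 Q\<^sub>1. u \<in> borel_measurable borel \<longrightarrow> integrable lborel (\<lambda>x. (norm (u x))\<^sup>2) \<longrightarrow> divergence_free u \<longrightarrow>
    -1 \<le> Q\<^sub>0 \<longrightarrow> Q\<^sub>0 < Q\<^sub>1 \<longrightarrow> ennreal (cmod (energy_flux chi u Q\<^sub>0 Q\<^sub>1))
      \<le> ennreal C * ennreal_powr (K_conv_d2 chi u Q\<^sub>0) (3 / 2) + ennreal C * ennreal_powr (K_conv_d2 chi u Q\<^sub>1) (3 / 2)"
proof -
  let ?r1 = "\<lambda>\<xi>. chi \<xi> * chi \<xi>" and ?r0 = "\<lambda>\<xi>. chi \<xi> * chi \<xi> - 2 * chi \<xi>"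
  have t: "test_function ?r1" "test_function ?r0"
    by (intro test_function_diff test_function_mult test_function_cmult test_function_smooth test_chi)+
  obtain C1 where C1: "C1 > 0" and b1: "\<And>u Q \<kappa>. u \<in> borel_measurable borel \<Longrightarrow> integrable lborel (\<lambda>x. (norm (u x))\<^sup>2) \<Longrightarrow> divergence_free u \<Longrightarrow>
    K_conv_d2 chi u Q = ennreal \<kappa> \<Longrightarrow> 0 \<le> \<kappa> \<Longrightarrow> \<bar>trilinear_flux (\<lambda>\<xi>. ?r1 (\<xi> /\<^sub>R (2 * lam Q))) u\<bar> \<le> C1 * \<kappa> powr (3 / 2)"
    using trilinear_flux_K_bound[OF t(1), of 2] by auto
  obtain C0 where C0: "C0 > 0" and b0: "\<And>u Q \<kappa>. u \<in> borel_measurable borel \<Longrightarrow> integrable lborel (\<lambda>x. (norm (u x))\<^sup>2) \<Longrightarrow> divergence_free u \<Longrightarrow>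
    K_conv_d2 chi u Q = ennreal \<kappa> \<Longrightarrow> 0 \<le> \<kappa> \<Longrightarrow> \<bar>trilinear_flux (\<lambda>\<xi>. ?r0 (\<xi> /\<^sub>R (1 * lam Q))) u\<bar> \<le> C0 * \<kappa> powr (3 / 2)"
    using trilinear_flux_K_bound[OF t(2), of 1] by auto
  define C where "C = \<bar>mass\<bar> * max C0 C1"
  have C: "C > 0" unfolding C_def using mass_nonzero C0 by (simp add: less_max_iff_disj)
  show ?thesis
  proof (intro exI[of _ C] conjI allI impI C)
    fix u :: "R3 \<Rightarrow> R3" and Q\<^sub>0 Q\<^sub>1 :: int
    assume um: "u \<in> borel_measurable borel" and u2: "integrable lborel (\<lambda>x. (norm (u x))\<^sup>2)" and div: "divergence_free u"
      and Q: "-1 \<le> Q\<^sub>0" "Q\<^sub>0 < Q\<^sub>1"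
    show "ennreal (cmod (energy_flux chi u Q\<^sub>0 Q\<^sub>1))
      \<le> ennreal C * ennreal_powr (K_conv_d2 chi u Q\<^sub>0) (3 / 2) + ennreal C * ennreal_powr (K_conv_d2 chi u Q\<^sub>1) (3 / 2)"
    proof (cases "K_conv_d2 chi u Q\<^sub>0 = \<infinity> \<or> K_conv_d2 chi u Q\<^sub>1 = \<infinity>")
      case True
      then show ?thesis using C by (auto simp: ennreal_powr_def ennreal_mult_top)
    next
      case False
      define k0 where "k0 = enn2real (K_conv_d2 chi u Q\<^sub>0)"
      define k1 where "k1 = enn2real (K_conv_d2 chi u Q\<^sub>1)"
      have k: "K_conv_d2 chi u Q\<^sub>0 = ennreal k0" "0 \<le> k0" "K_conv_d2 chi u Q\<^sub>1 = ennreal k1" "0 \<le> k1"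
        using False by (auto simp: k0_def k1_def less_top)
      have l1: "(\<lambda>\<xi>. low (Q\<^sub>1 + 1) \<xi> * low (Q\<^sub>1 + 1) \<xi>) = (\<lambda>\<xi>. ?r1 (\<xi> /\<^sub>R (2 * lam Q\<^sub>1)))"
        using Q by (auto simp: low_def lam_add mult.commute)
      have 1: "\<bar>trilinear_flux (\<lambda>\<xi>. low (Q\<^sub>1 + 1) \<xi> * low (Q\<^sub>1 + 1) \<xi>) u\<bar> \<le> C1 * k1 powr (3 / 2)"
        unfolding l1 by (rule b1[OF um u2 div k(3,4)])
      \<comment> \<open>For \<open>Q\<^sub>0 = -1\<close> the lower cutoff is 0, and only the upper
        scale contributes.\<close>
      have 0: "\<bar>trilinear_flux (\<lambda>\<xi>. low Q\<^sub>0 \<xi> * low Q\<^sub>0 \<xi> - 2 * low Q\<^sub>0 \<xi>) u\<bar> \<le> C0 * k0 powr (3 / 2)"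
      proof (cases "0 \<le> Q\<^sub>0")
        case True
        then have l0: "(\<lambda>\<xi>. low Q\<^sub>0 \<xi> * low Q\<^sub>0 \<xi> - 2 * low Q\<^sub>0 \<xi>) = (\<lambda>\<xi>. ?r0 (\<xi> /\<^sub>R (1 * lam Q\<^sub>0)))"
          by (auto simp: low_def)
        show ?thesis unfolding l0 by (rule b0[OF um u2 div k(1,2)])
      next
        case False
        then show ?thesis using C0 by (simp add: low_negative trilinear_flux_zero)
      qed
      have "cmod (energy_flux chi u Q\<^sub>0 Q\<^sub>1) \<le> \<bar>mass\<bar> * (C1 * k1 powr (3 / 2) + C0 * k0 powr (3 / 2))"
        unfolding energy_flux_eq_trilinear_flux[OF um u2 Q] norm_of_real abs_mult
        by (intro mult_left_mono order_trans[OF abs_triangle_ineq] add_mono 0 1) auto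
      also have "\<dots> \<le> \<bar>mass\<bar> * (max C0 C1 * k1 powr (3 / 2) + max C0 C1 * k0 powr (3 / 2))"
        by (intro mult_left_mono add_mono mult_right_mono) auto
      also have "\<dots> = C * k0 powr (3 / 2) + C * k1 powr (3 / 2)" by (simp add: C_def algebra_simps)
      finally have "ennreal (cmod (energy_flux chi u Q\<^sub>0 Q\<^sub>1)) \<le> ennreal (C * k0 powr (3 / 2) + C * k1 powr (3 / 2))" by (rule ennreal_leI)
      also have "\<dots> = ennreal C * ennreal (k0 powr (3 / 2)) + ennreal C * ennreal (k1 powr (3 / 2))"
        using C by (simp add: ennreal_mult ennreal_plus)
      finally show ?thesis using k by (simp add: ennreal_powr_def)
    qed
  qed
qed

end

theorem theorem3p4:
  fixes chi :: "real ^ 3 \<Rightarrow> real"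
  assumes "LP_cutoff chi"
  shows "\<exists>C::real. C \<ge> 0 \<and>
    (\<forall>(u :: real ^ 3 \<Rightarrow> real ^ 3) (Q0::int) (Q1::int).
       L2 u \<and> divergence_free u \<and> -1 \<le> Q0 \<and> Q0 < Q1 \<longrightarrow>
       ennreal (cmod (energy_flux chi u Q0 Q1))
         \<le> ennreal C * ennreal_powr (K_conv_d2 chi u Q0) (3 / 2)
           + ennreal C * ennreal_powr (K_conv_d2 chi u Q1) (3 / 2))"
proof -
  interpret cutoff chi by standard (rule assms)
  obtain C where C: "C > 0" and bound: "\<And>u Q\<^sub>0 Q\<^sub>1. u \<in> borel_measurable borel \<Longrightarrow> integrable lborel (\<lambda>x. (norm (u x))\<^sup>2) \<Longrightarrow>
    divergence_free u \<Longrightarrow> -1 \<le> Q\<^sub>0 \<Longrightarrow> Q\<^sub>0 < Q\<^sub>1 \<Longrightarrow> ennreal (cmod (energy_flux chi u Q\<^sub>0 Q\<^sub>1))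
      \<le> ennreal C * ennreal_powr (K_conv_d2 chi u Q\<^sub>0) (3 / 2) + ennreal C * ennreal_powr (K_conv_d2 chi u Q\<^sub>1) (3 / 2)"
    using energy_flux_bound by blast
  show ?thesis
  proof (intro exI[of _ C] conjI allI impI, use C in simp, elim conjE)
    fix u :: "R3 \<Rightarrow> R3" and Q0 Q1 :: int
    assume u: "L2 u" and div: "divergence_free u" and Q: "-1 \<le> Q0" "Q0 < Q1"
    have um: "u \<in> borel_measurable lebesgue" and u2: "integrable lebesgue (\<lambda>x. (norm (u x))\<^sup>2)" using u by (auto simp: L2_def)
    \<comment> \<open>Flux, divergence condition and both values of the convolution are insensitive
      to null sets, so a Borel representative v takes the place of u.\<close>
    obtain v where v: "v \<in> borel_measurable borel" and ae: "AE x in lebesgue. u x = v x"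
      by (rule borel_modification[OF um])
    note vl = borel_measurable_lebesgueI[OF v]
    have "integrable lebesgue (\<lambda>x. (norm (v x))\<^sup>2)"
      using u2 by (rule integrable_cong_AE_imp) (use vl ae in \<open>auto elim: AE_mp\<close>)
    then have v2: "integrable lborel (\<lambda>x. (norm (v x))\<^sup>2)"
      using v by (simp add: integral_lebesgue)
    have vdiv: "divergence_free v"
      unfolding divergence_free_def
    proof (intro allI impI)
      fix \<psi> assume t: "test_function \<psi>"
      have [measurable]: "(\<lambda>x. w x $ i * partial i \<psi> x) \<in> borel_measurable lebesgue" if "w \<in> borel_measurable lebesgue" for w i
      proof (rule borel_measurable_times)
        show "(\<lambda>x. w x $ i) \<in> borel_measurable lebesgue"
          using measurable_compose[OF that, of "\<lambda>v. v $ i" borel]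
          by (simp add: borel_measurable_continuous_onI continuous_intros)
        show "partial i \<psi> \<in> borel_measurable lebesgue"
          by (intro borel_measurable_lebesgueI test_function_measurable test_function_partial t)
      qed
      have "(LINT x|lebesgue. (\<Sum>i\<in>UNIV. v x $ i * partial i \<psi> x)) = (LINT x|lebesgue. (\<Sum>i\<in>UNIV. u x $ i * partial i \<psi> x))"
        using um vl ae by (intro integral_cong_AE borel_measurable_sum) (auto elim: AE_mp)
      then show "(LINT x|lebesgue. (\<Sum>i\<in>UNIV. v x $ i * partial i \<psi> x)) = 0"
        using div t by (simp add: divergence_free_def)
    qed
    show "ennreal (cmod (energy_flux chi u Q0 Q1))
         \<le> ennreal C * ennreal_powr (K_conv_d2 chi u Q0) (3 / 2)
           + ennreal C * ennreal_powr (K_conv_d2 chi u Q1) (3 / 2)"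
      unfolding energy_flux_cong_AE[OF um vl ae] by (rule bound[OF v v2 vdiv Q])
  qed
qed

end
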